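(* Consider the linear regression model $Y=X\beta+\epsilon$ of the context, where the error process $(\epsilon_i)_{i\in\mathbb{Z}}$ is strictly stationary, centered, square integrable, independent of the design, with $\mathcal{F}_{-\infty}$ trivial and $\epsilon_0$ $\mathcal{F}_\infty$-measurable. Assume Hannan's condition $$\sum_{i\in\mathbb{Z}}\|P_0(\epsilon_i)\|_{\mathbb{L}^2}<+\infty .$$ Assume that the design satisfies, almost surely: (i) for all $j\in\{1,\dots,p\}$, $\lim_{n\to\infty}d_j(n)=\infty$; (ii) for all $j\in\{1,\dots,p\}$, $\lim_{n\to\infty}\frac{\sup_{1\le i\le n}|x_{i,j}|}{d_j(n)}=0$; (iii) for all $j,l\in\{1,\dots,p\}$ and all integers $k\ge 0$, the limit $\rho_{j,l}(k)=\lim_{n\to\infty}\sum_{m=1}^{n-k}\frac{x_{m,j}x_{m+k,l}}{d_j(n)d_l(n)}$ exists; (iv) the matrix $R(0)=[\rho_{j,l}(0)]_{1\le j,l\le p}$ is positive definite. Assume also that $C=F^{-1}GF^{-1}$ is almost surely positive definite. Let $(h_n)$ be a sequence of positive reals such that $h_n\to\infty$, $h_n/n\to0$, and $$h_n\,\mathbb{E}\left(|\epsilon_0|^2\left(1\wedge\frac{h_n}{n}|\epsilon_0|^2\right)\right)\xrightarrow[n\to\infty]{}0 ,$$ and let $C_n=[c_{n,(j,l)}]_{1\le j,l\le p}$ be the estimator defined in the context (built with the bandwidth $h_n$ and a kernel $K$ as there). Let $j\in\{1,\dots,p\}$ and $$T_{j,n}=\frac{d_j(n)\hat\beta_j}{\sqrt{c_{n,(j,j)}}}.$$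 If $\beta_j=0$ (the null hypothesis $H_0$), then the distribution of $T_{j,n}$ converges to the standard normal distribution $\mathcal{N}(0,1)$ as $n\to\infty$.
   Context: Model. All random variables live on a probability space $(\Omega,\mathcal{F},\mathbb{P})$. Fix $p\ge1$. The design is a (random or deterministic) array $(x_{i,j})_{i\ge1,\,1\le j\le p}$ of real numbers; for each $n$, $X$ is the $n\times p$ matrix $[x_{i,j}]_{1\le i\le n,1\le j\le p}$. One observes $Y=X\beta+\epsilon\in\mathbb{R}^n$ with $\beta\in\mathbb{R}^p$ an unknown deterministic vector and $\epsilon=(\epsilon_1,\dots,\epsilon_n)^t$. The process $(\epsilon_i)_{i\in\mathbb{Z}}$ is independent of the design. The superscript $t$ denotes transpose. Errors. $\epsilon_i=\epsilon_0\circ\mathbb{T}^i$ for all $i\in\mathbb{Z}$, where $\mathbb{T}:\Omega\to\Omega$ is a bijective bimeasurable transformation preserving $\mathbb{P}$; $\mathbb{E}(\epsilon_0)=0$, $\mathbb{E}(\epsilon_0^2)<\infty$. $\mathcal{F}_0\subseteq\mathcal{F}$ is a sub-$\sigma$-algebra with $\mathcal{F}_0\subseteq\mathbb{T}^{-1}(\mathcal{F}_0)$, $\mathcal{F}_i=\mathbb{T}^{-i}(\mathcal{F}_0)$, $\mathcal{F}_{-\infty}=\bigcap_{i\in\mathbb{Z}}\mathcal{F}_i$, $\mathcal{F}_\infty=\sigma(\bigcup_{i\in\mathbb{Z}}\mathcal{F}_i)$. For $Z\in\mathbb{L}^2(\Omega)$, $P_j(Z)=\mathbb{E}(Z|\mathcal{F}_j)-\mathbb{E}(Z|\mathcal{F}_{j-1})$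 and $\|Z\|_{\mathbb{L}^2}=(\mathbb{E}(Z^2))^{1/2}$. The autocovariance is $\gamma(k)=\mathbb{E}(\epsilon_0\epsilon_k)$ (absolutely summable under Hannan's condition) and the spectral density is $f(\lambda)=\frac1{2\pi}\sum_{k\in\mathbb{Z}}\gamma(k)e^{ik\lambda}$, $\lambda\in[-\pi,\pi]$. Design quantities. $d_j(n)=\left(\sum_{i=1}^nx_{i,j}^2\right)^{1/2}$ and $D(n)=\mathrm{diag}(d_1(n),\dots,d_p(n))$. For $k\ge0$, $R(k)=[\rho_{j,l}(k)]_{1\le j,l\le p}$, and $F_X$ is the associated spectral measure, i.e. the Hermitian nonnegative-definite $p\times p$ matrix-valued measure on $[-\pi,\pi]$ such that $R(k)=\int_{-\pi}^{\pi}e^{ik\lambda}F_X(d\lambda)$ for all $k\ge 0$. Set $$F=\frac1{2\pi}\int_{-\pi}^{\pi}F_X(d\lambda),\qquad G=\frac1{2\pi}\int_{-\pi}^{\pi}f(\lambda)\,F_X(d\lambda).$$ Estimator. $\hat\beta=(X^tX)^{-1}X^tY$ is the least square estimator (under the positive definiteness of $R(0)$, $X^tX$ is a.s. invertible for $n$ large). The residuals are $\hat\epsilon_j=Y_j-(x_j)^t\hat\beta$, where $(x_j)^t$ is the $j$-th row of $X$, and $\hat\gamma_k^*=\frac1n\sum_{j=1}^{n-|k|}\hat\epsilon_j\hat\epsilon_{j+|k|}$ for $0\le|k|\le n-1$. The kernel $K:\mathbb{R}\to\mathbb{R}$ is nonnegative, symmetric, with $K(0)=1$, has compact support, and its Fourier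 transform is integrable. Set $$\widehat\Gamma^*_{n,h_n}=\left[K\left(\frac{j-l}{h_n}\right)\hat\gamma^*_{j-l}\right]_{1\le j,l\le n},\qquad C_n=D(n)(X^tX)^{-1}X^t\,\widehat\Gamma^*_{n,h_n}\,X(X^tX)^{-1}D(n).$$ $T_{j,n}$ is defined by the formula on the event $c_{n,(j,j)}>0$, with an arbitrary measurable definition elsewhere.
   Formalization: The kernel K is additionally assumed continuous; without this the claim fails, e.g. for the triangle kernel set to 0 at all nonzero rationals with rational bandwidths h_n, where C_n tends to γ(0)R(0)^{-1}. *)

theory Defs
  imports "HOL-Probability.Probability"
begin

section \<open>Stationary errors\<close>

definition invertible_mpt :: "'a measure \<Rightarrow> ('a \<Rightarrow> 'a) \<Rightarrow> bool" where
  "invertible_mpt M T \<longleftrightarrow>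
     bij_betw T (space M) (space M) \<and> T \<in> measurable M M \<and>
     inv_into (space M) T \<in> measurable M M \<and> distr M M T = M"

definition int_iterate :: "'a measure \<Rightarrow> ('a \<Rightarrow> 'a) \<Rightarrow> int \<Rightarrow> 'a \<Rightarrow> 'a" where
  "int_iterate M T i =
     (if 0 \<le> i then T ^^ nat i else inv_into (space M) T ^^ nat (- i))"

text \<open>The \<open>\<sigma>\<close>-algebra \<open>T\<^sup>-\<^sup>i F0\<close> of preimages of members of \<open>F0\<close> under the \<open>i\<close>-th iterate.
  Only spaces and measurable sets of \<open>F0\<close> and of the filtration matter.\<close>

definition filtr :: "'a measure \<Rightarrow> ('a \<Rightarrow> 'a) \<Rightarrow> 'a measure \<Rightarrow> int \<Rightarrow> 'a measure" where
  "filtr M T F0 i = vimage_algebra (space M) (int_iterate M T i) F0"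

definition filtr_past :: "'a measure \<Rightarrow> ('a \<Rightarrow> 'a) \<Rightarrow> 'a measure \<Rightarrow> 'a set set" where
  "filtr_past M T F0 = (\<Inter>i. sets (filtr M T F0 i))"

definition filtr_all :: "'a measure \<Rightarrow> ('a \<Rightarrow> 'a) \<Rightarrow> 'a measure \<Rightarrow> 'a measure" where
  "filtr_all M T F0 = sigma (space M) (\<Union>i. sets (filtr M T F0 i))"

definition proj_incr ::
  "'a measure \<Rightarrow> ('a \<Rightarrow> 'a) \<Rightarrow> 'a measure \<Rightarrow> int \<Rightarrow> ('a \<Rightarrow> real) \<Rightarrow> 'a \<Rightarrow> real" where
  "proj_incr M T F0 j Z \<omega> =
     real_cond_exp M (filtr M T F0 j) Z \<omega> - real_cond_exp M (filtr M T F0 (j - 1)) Z \<omega>"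

definition norm_L2 :: "'a measure \<Rightarrow> ('a \<Rightarrow> real) \<Rightarrow> real" where
  "norm_L2 M Z = sqrt (\<integral>\<omega>. (Z \<omega>)\<^sup>2 \<partial>M)"

definition autocov :: "'a measure \<Rightarrow> (int \<Rightarrow> 'a \<Rightarrow> real) \<Rightarrow> int \<Rightarrow> real" where
  "autocov M \<epsilon> k = (\<integral>\<omega>. \<epsilon> 0 \<omega> * \<epsilon> k \<omega> \<partial>M)"

text \<open>The values are real, but are kept in \<^typ>\<open>complex\<close> because they are integrated against
  complex measures below.\<close>

definition spectral_density :: "(int \<Rightarrow> real) \<Rightarrow> real \<Rightarrow> complex" where
  "spectral_density \<gamma> l =
     complex_of_real (1 / (2 * pi)) *
     (\<Sum>\<^sub>\<infinity>k\<in>UNIV. complex_of_real (\<gamma> k) * exp (\<i> * of_int k * complex_of_real l))"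


section \<open>Matrices and matrix-valued measures\<close>

definition pos_def :: "real^'p^'p \<Rightarrow> bool" where
  "pos_def A \<longleftrightarrow> transpose A = A \<and> (\<forall>v. v \<noteq> 0 \<longrightarrow> 0 < v \<bullet> (A *v v))"

definition hermitian :: "complex^'p^'p \<Rightarrow> bool" where
  "hermitian A \<longleftrightarrow> (\<forall>a b. A $ a $ b = cnj (A $ b $ a))"

definition herm_form :: "complex^'p^'p \<Rightarrow> complex^'p \<Rightarrow> complex" where
  "herm_form A v = (\<Sum>a\<in>UNIV. \<Sum>b\<in>UNIV. cnj (v $ a) * A $ a $ b * v $ b)"

definition herm_nonneg_def :: "complex^'p^'p \<Rightarrow> bool" where
  "herm_nonneg_def A \<longleftrightarrow> hermitian A \<and> (\<forall>v. 0 \<le> Re (herm_form A v))"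

definition herm_pos_def :: "complex^'p^'p \<Rightarrow> bool" where
  "herm_pos_def A \<longleftrightarrow> hermitian A \<and> (\<forall>v. v \<noteq> 0 \<longrightarrow> 0 < Re (herm_form A v))"

text \<open>Integration against a complex measure \<open>\<nu>\<close>, given as a set function on the measurable
  sets of \<open>S\<close>: the real and the imaginary part are signed measures, and each of these is
  integrated through its Jordan decomposition.\<close>

definition upper_variation :: "'a measure \<Rightarrow> ('a set \<Rightarrow> real) \<Rightarrow> 'a measure" where
  "upper_variation S \<nu> =
     measure_of (space S) (sets S) (\<lambda>A. SUP B\<in>{B \<in> sets S. B \<subseteq> A}. ennreal (\<nu> B))"

definition signed_integral :: "'a measure \<Rightarrow> ('a set \<Rightarrow> real) \<Rightarrow> ('a \<Rightarrow> complex) \<Rightarrow> complex" where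
  "signed_integral S \<nu> g =
     integral\<^sup>L (upper_variation S \<nu>) g - integral\<^sup>L (upper_variation S (\<lambda>A. - \<nu> A)) g"

lemma upper_variation_measure:
  assumes "finite_measure N" "sets N = sets S"
  shows "upper_variation S (measure N) = N"
proof (rule measure_eqI)
  interpret finite_measure N by fact
  have sp: "space S = space N" using assms(2) by (metis sets_eq_imp_space_eq)
  have eq: "(SUP B\<in>{B \<in> sets S. B \<subseteq> A}. ennreal (measure N B)) = emeasure N A"
    if "A \<in> sets N" for A
    unfolding emeasure_eq_measure[symmetric]
    by (rule antisym) (use that assms(2) in \<open>auto intro!: SUP_least SUP_upper emeasure_mono\<close>)
  show "sets (upper_variation S (measure N)) = sets N"
    by (simp add: upper_variation_def assms(2))
  have "upper_variation S (measure N) = measure_of (space N) (sets N) (emeasure N)"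
    unfolding upper_variation_def sp assms(2)[symmetric]
    by (rule measure_of_eq[OF sets.space_closed]) (simp add: eq[unfolded assms(2)[symmetric]] assms(2)[symmetric] sets.sigma_sets_eq)
  then show "emeasure (upper_variation S (measure N)) A = emeasure N A" for A
    by (simp add: measure_of_of_measure)
qed

lemma upper_variation_uminus_measure:
  "upper_variation S (\<lambda>A. - measure N A) = null_measure S"
proof -
  have z: "(SUP B\<in>{B \<in> sets S. B \<subseteq> A}. ennreal (- measure N B)) = 0" for A
    by (auto simp: SUP_eq_iff ennreal_neg intro!: antisym SUP_least)
  show ?thesis unfolding upper_variation_def z by (simp add: null_measure_def)
qed

lemma signed_integral_measure:
  assumes "finite_measure N" "sets N = sets S"
  shows "signed_integral S (measure N) g = integral\<^sup>L N g"
  by (simp add: signed_integral_def upper_variation_measure[OF assms] upper_variation_uminus_measure)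

definition complex_integral ::
  "'a measure \<Rightarrow> ('a set \<Rightarrow> complex) \<Rightarrow> ('a \<Rightarrow> complex) \<Rightarrow> complex" where
  "complex_integral S \<nu> g =
     signed_integral S (\<lambda>A. Re (\<nu> A)) g + \<i> * signed_integral S (\<lambda>A. Im (\<nu> A)) g"

definition matrix_integral ::
  "'a measure \<Rightarrow> ('a set \<Rightarrow> complex^'p^'p) \<Rightarrow> ('a \<Rightarrow> complex) \<Rightarrow> complex^'p^'p" where
  "matrix_integral S F g = (\<chi> a b. complex_integral S (\<lambda>A. F A $ a $ b) g)"

definition herm_matrix_measure :: "'a measure \<Rightarrow> ('a set \<Rightarrow> complex^'p^'p) \<Rightarrow> bool" where
  "herm_matrix_measure S F \<longleftrightarrow>
     (\<forall>A\<in>sets S. herm_nonneg_def (F A)) \<and>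
     (\<forall>A :: nat \<Rightarrow> 'a set. range A \<subseteq> sets S \<longrightarrow> disjoint_family A \<longrightarrow>
        (\<lambda>i. F (A i)) sums F (\<Union>i. A i))"

abbreviation freq :: "real measure" where
  "freq \<equiv> restrict_space borel {- pi..pi}"

text \<open>This determines \<open>F\<close> only up to the splitting of mass between the endpoints \<open>-\<pi>\<close> and
  \<open>\<pi>\<close>, which does not affect integrals of \<open>2\<pi>\<close>-periodic functions.\<close>

definition is_spectral_measure ::
  "(nat \<Rightarrow> real^'p^'p) \<Rightarrow> (real set \<Rightarrow> complex^'p^'p) \<Rightarrow> bool" where
  "is_spectral_measure R F \<longleftrightarrow>
     herm_matrix_measure freq F \<and>
     (\<forall>k a b. complex_of_real (R k $ a $ b) =
        matrix_integral freq F (\<lambda>l. exp (\<i> * of_nat k * complex_of_real l)) $ a $ b)"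

definition spectral_F :: "(real set \<Rightarrow> complex^'p^'p) \<Rightarrow> complex^'p^'p" where
  "spectral_F F = (1 / (2 * pi)) *\<^sub>R matrix_integral freq F (\<lambda>_. 1)"

definition spectral_G :: "(real \<Rightarrow> complex) \<Rightarrow> (real set \<Rightarrow> complex^'p^'p) \<Rightarrow> complex^'p^'p" where
  "spectral_G f F = (1 / (2 * pi)) *\<^sub>R matrix_integral freq F f"

definition asymp_cov :: "(real \<Rightarrow> complex) \<Rightarrow> (real set \<Rightarrow> complex^'p^'p) \<Rightarrow> complex^'p^'p" where
  "asymp_cov f F = matrix_inv (spectral_F F) ** spectral_G f F ** matrix_inv (spectral_F F)"


section \<open>Design and least square estimator\<close>

text \<open>A realisation of the design is the sequence of its rows \<open>x 1, x 2, \<dots>\<close>, so that the entry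
  in row \<open>i\<close> and column \<open>j\<close> is \<open>x i $ j\<close>; the value \<open>x 0\<close> is never used. The matrix \<open>X\<close> made of
  the first \<open>n\<close> rows only enters through products written as sums over \<open>1..n\<close>.\<close>

definition col_norm :: "(nat \<Rightarrow> real^'p) \<Rightarrow> 'p \<Rightarrow> nat \<Rightarrow> real" where
  "col_norm x j n = sqrt (\<Sum>i=1..n. (x i $ j)\<^sup>2)"

definition col_norm_mat :: "(nat \<Rightarrow> real^'p) \<Rightarrow> nat \<Rightarrow> real^'p^'p" where
  "col_norm_mat x n = (\<chi> a b. if a = b then col_norm x a n else 0)"

definition cross_corr :: "(nat \<Rightarrow> real^'p) \<Rightarrow> nat \<Rightarrow> 'p \<Rightarrow> 'p \<Rightarrow> nat \<Rightarrow> real" where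
  "cross_corr x k j l n =
     (\<Sum>m=1..n - k. x m $ j * x (m + k) $ l / (col_norm x j n * col_norm x l n))"

definition limit_corr :: "(nat \<Rightarrow> real^'p) \<Rightarrow> nat \<Rightarrow> real^'p^'p" where
  "limit_corr x k = (\<chi> j l. lim (cross_corr x k j l))"

text \<open>\<open>X\<^sup>t X\<close>. In the estimators below \<open>matrix_inv\<close> has a fixed unspecified value where \<open>X\<^sup>t X\<close>
  is singular.\<close>

definition gram :: "(nat \<Rightarrow> real^'p) \<Rightarrow> nat \<Rightarrow> real^'p^'p" where
  "gram x n = (\<chi> a b. \<Sum>i=1..n. x i $ a * x i $ b)"

definition response :: "(nat \<Rightarrow> real^'p) \<Rightarrow> real^'p \<Rightarrow> (int \<Rightarrow> real) \<Rightarrow> nat \<Rightarrow> real" where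
  "response x \<beta> e i = x i \<bullet> \<beta> + e (int i)"

definition lse :: "(nat \<Rightarrow> real^'p) \<Rightarrow> (nat \<Rightarrow> real) \<Rightarrow> nat \<Rightarrow> real^'p" where
  "lse x y n = matrix_inv (gram x n) *v (\<chi> a. \<Sum>i=1..n. x i $ a * y i)"

definition residual :: "(nat \<Rightarrow> real^'p) \<Rightarrow> (nat \<Rightarrow> real) \<Rightarrow> nat \<Rightarrow> nat \<Rightarrow> real" where
  "residual x y n i = y i - x i \<bullet> lse x y n"

definition residual_autocov :: "(nat \<Rightarrow> real^'p) \<Rightarrow> (nat \<Rightarrow> real) \<Rightarrow> nat \<Rightarrow> int \<Rightarrow> real" where
  "residual_autocov x y n k =
     (1 / real n) * (\<Sum>i=1..n - nat \<bar>k\<bar>. residual x y n i * residual x y n (i + nat \<bar>k\<bar>))"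

definition tapered_cov ::
  "(real \<Rightarrow> real) \<Rightarrow> real \<Rightarrow> (nat \<Rightarrow> real^'p) \<Rightarrow> (nat \<Rightarrow> real) \<Rightarrow> nat \<Rightarrow> nat \<Rightarrow> nat \<Rightarrow> real" where
  "tapered_cov K h x y n i m =
     K ((real i - real m) / h) * residual_autocov x y n (int i - int m)"

definition cov_estimator ::
  "(real \<Rightarrow> real) \<Rightarrow> real \<Rightarrow> (nat \<Rightarrow> real^'p) \<Rightarrow> (nat \<Rightarrow> real) \<Rightarrow> nat \<Rightarrow> real^'p^'p" where
  "cov_estimator K h x y n =
     col_norm_mat x n ** matrix_inv (gram x n) **
     (\<chi> a b. \<Sum>i=1..n. \<Sum>m=1..n. x i $ a * tapered_cov K h x y n i m * x m $ b) **
     matrix_inv (gram x n) ** col_norm_mat x n"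


section \<open>Kernels\<close>

definition fourier_transform :: "(real \<Rightarrow> real) \<Rightarrow> real \<Rightarrow> complex" where
  "fourier_transform K u = (\<integral>t. complex_of_real (K t) * exp (- \<i> * complex_of_real (u * t)) \<partial>lborel)"

text \<open>Integrability of the Fourier transform yields the inversion formula for \<open>K\<close> only almost
  everywhere, while the estimator evaluates \<open>K\<close> at countably many points; continuity makes
  the inversion formula hold everywhere.\<close>

definition admissible_kernel :: "(real \<Rightarrow> real) \<Rightarrow> bool" where
  "admissible_kernel K \<longleftrightarrow>
     continuous_on UNIV K \<and> (\<forall>u. 0 \<le> K u) \<and> (\<forall>u. K (- u) = K u) \<and> K 0 = 1 \<and>
     compact (closure {u. K u \<noteq> 0}) \<and> integrable lborel (fourier_transform K)"

end

theory Submission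
  imports Defs
begin

text \<open>By independence and Fubini the design may be frozen at a typical realisation. With \<open>z\<close> the column
  \<open>j\<close> of \<open>X(X\<^sup>tX)\<^sup>-\<^sup>1D(n)\<close>, the numerator of the studentized statistic is \<open>S = \<Sum>\<^sub>i z\<^sub>i\<epsilon>\<^sub>i\<close>, and its squared
  denominator is the quadratic form of the residuals with Toeplitz coefficients \<open>K(k/h) \<rho>(k)\<close>, where
  \<open>\<rho>(k) = \<Sum>\<^sub>s z\<^sub>sz\<^sub>s\<^sub>+\<^sub>k\<close>.

  Hannan's condition gives \<open>\<parallel>\<Sum>a\<^sub>i\<epsilon>\<^sub>i\<parallel> \<le> (\<Sum>\<^sub>k \<parallel>P\<^sub>0\<epsilon>\<^sub>k\<parallel>) \<parallel>a\<parallel>\<close> in \<open>L\<^sup>2\<close>, so that \<open>\<epsilon>\<close> may be replaced by a finite sum of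
  shifts of bounded martingale differences. For these, McLeish's argument gives the central limit
  theorem for \<open>S\<close>. The kernel is a cosine transform \<open>K(u) = \<integral> \<kappa>(t) cos(ut) dt\<close> with \<open>\<kappa>\<close> integrable, which
  bounds the quadratic form in \<open>L\<^sup>1\<close> by the product of the two Hannan constants, uniformly in \<open>h\<close>; hence
  only bounded martingale differences matter there as well, and for them the variance of the form is
  \<open>O(h/n)\<close>. Passing to residuals costs \<open>O(\<surd>(h/n))\<close>. The limit of both the variance of \<open>S\<close> and the
  quadratic form is the diagonal entry \<open>(F\<^sup>-\<^sup>1GF\<^sup>-\<^sup>1)\<^sub>j\<^sub>j > 0\<close>.\<close>

section \<open>Square integrable functions\<close>

text \<open>The noise has only second moments, so the quadratic form need not have a variance, and
  bounded martingale differences can only be reached through an L^1 estimate. Bounding the taper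
  matrix by its band width would cost a factor h there. The cosine representation avoids this: at
  each frequency the form is a sum of products of two linear forms, and for those the linear Hannan
  bound is available. The band width is used only after truncation and in the passage to residuals,
  where it enters divided by n.

  The weights have bounded energy and a vanishing maximum because they arise from the columns of X,
  divided by their norms, through the inverse of the normalised Gram matrix, and this inverse
  converges to that of R(0).

  Freezing the design requires one measurable function of the pair (design, noise), defined for all
  arguments. The statistic is therefore replaced by a total one, with the Gram inverse given by
  Cramer's formula and the value 0 where the variance estimate is not positive. The two can differ
  only on an event of vanishing probability, since for a fixed design the variance estimate has a
  positive limit in L^1.\<close>

definition sqint :: "'a measure \<Rightarrow> ('a \<Rightarrow> real) \<Rightarrow> bool" where
  "sqint M f \<longleftrightarrow> f \<in> borel_measurable M \<and> integrable M (\<lambda>x. (f x)\<^sup>2)"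

lemma sqint_measurable [measurable_dest]: "sqint M f \<Longrightarrow> f \<in> borel_measurable M"
  by (simp add: sqint_def)

lemma sqint_square_integrable: "sqint M f \<Longrightarrow> integrable M (\<lambda>x. (f x)\<^sup>2)"
  by (simp add: sqint_def)

lemma sqint_mult_integrable:
  assumes "sqint M f" "sqint M g"
  shows "integrable M (\<lambda>x. f x * g x)"
proof (rule Bochner_Integration.integrable_bound)
  show "integrable M (\<lambda>x. (f x)\<^sup>2 + (g x)\<^sup>2)" using assms by (simp add: sqint_def)
  show "(\<lambda>x. f x * g x) \<in> borel_measurable M" using assms by (auto simp: sqint_def)
  have "\<bar>a * b\<bar> \<le> a\<^sup>2 + b\<^sup>2" for a b :: real
  proof -
    have "2 * \<bar>a\<bar> * \<bar>b\<bar> \<le> \<bar>a\<bar>\<^sup>2 + \<bar>b\<bar>\<^sup>2" by (rule sum_squares_bound)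
    moreover have "0 \<le> \<bar>a\<bar> * \<bar>b\<bar>" by simp
    ultimately show ?thesis unfolding abs_mult power2_abs by linarith
  qed
  then show "AE x in M. norm (f x * g x) \<le> norm ((f x)\<^sup>2 + (g x)\<^sup>2)" by auto
qed

lemma sqint_cmult: "sqint M f \<Longrightarrow> sqint M (\<lambda>x. c * f x)"
  by (auto simp: sqint_def power_mult_distrib)

lemma sqint_add:
  assumes "sqint M f" "sqint M g" shows "sqint M (\<lambda>x. f x + g x)"
  using assms sqint_mult_integrable[OF assms] by (auto simp: sqint_def power2_sum mult.assoc)

lemma sqint_diff:
  assumes "sqint M f" "sqint M g" shows "sqint M (\<lambda>x. f x - g x)"
  using sqint_add[OF assms(1) sqint_cmult[OF assms(2), of "-1"]] by simp

lemma sqint_sum: "(\<And>i. i \<in> I \<Longrightarrow> sqint M (f i)) \<Longrightarrow> sqint M (\<lambda>x. \<Sum>i\<in>I. f i x)"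
proof (induction I rule: infinite_finite_induct)
  case (insert x F)
  then show ?case using sqint_add[of M "f x" "\<lambda>\<omega>. \<Sum>i\<in>F. f i \<omega>"] by simp
qed (auto simp: sqint_def)

lemma sqint_AE_cong:
  assumes "sqint M f" "AE x in M. f x = g x" "g \<in> borel_measurable M" shows "sqint M g"
  unfolding sqint_def
proof
  show "integrable M (\<lambda>x. (g x)\<^sup>2)"
    by (rule Bochner_Integration.integrable_cong_AE_imp[of _ "\<lambda>x. (f x)\<^sup>2"]) (use assms in \<open>auto simp: sqint_def\<close>)
qed fact

lemma norm_L2_nonneg [simp]: "0 \<le> norm_L2 M f"
  by (simp add: norm_L2_def)

lemma norm_L2_sq: "(norm_L2 M f)\<^sup>2 = (\<integral>x. (f x)\<^sup>2 \<partial>M)"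
  by (simp add: norm_L2_def)

lemma norm_L2_AE_cong:
  assumes "AE x in M. f x = g x" "f \<in> borel_measurable M" "g \<in> borel_measurable M"
  shows "norm_L2 M f = norm_L2 M g"
  unfolding norm_L2_def
  by (intro arg_cong[where f=sqrt] integral_cong_AE) (use assms in auto)

lemma norm_L2_cmult: "norm_L2 M (\<lambda>x. c * f x) = \<bar>c\<bar> * norm_L2 M f"
  by (simp add: norm_L2_def power_mult_distrib real_sqrt_mult)

lemma norm_L2_uminus: "norm_L2 M (\<lambda>x. - f x) = norm_L2 M f"
  by (simp add: norm_L2_def)

lemma norm_L2_minus_commute: "norm_L2 M (\<lambda>x. f x - g x) = norm_L2 M (\<lambda>x. g x - f x)"
  by (simp add: norm_L2_def power2_commute)

text \<open>Cauchy-Schwarz. The inequality for nonnegative integrals is transported to the Bochner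
  integral; square integrability of both functions makes every quantity finite.\<close>

lemma integral_abs_mult_le_norm_L2:
  assumes "sqint M f" "sqint M g"
  shows "(\<integral>x. \<bar>f x * g x\<bar> \<partial>M) \<le> norm_L2 M f * norm_L2 M g"
proof -
  have m[measurable]: "f \<in> borel_measurable M" "g \<in> borel_measurable M"
    using assms by (auto simp: sqint_def)
  have "(\<integral>\<^sup>+x. ennreal \<bar>f x\<bar> * ennreal \<bar>g x\<bar> \<partial>M)\<^sup>2
      \<le> (\<integral>\<^sup>+x. ennreal \<bar>f x\<bar> ^ 2 \<partial>M) * (\<integral>\<^sup>+x. ennreal \<bar>g x\<bar> ^ 2 \<partial>M)"
    by (rule Cauchy_Schwarz_nn_integral) measurable
  also have "(\<integral>\<^sup>+x. ennreal \<bar>f x\<bar> ^ 2 \<partial>M) = ennreal (\<integral>x. (f x)\<^sup>2 \<partial>M)"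
    using assms(1) by (subst nn_integral_eq_integral[symmetric]) (auto simp: sqint_def ennreal_power)
  also have "(\<integral>\<^sup>+x. ennreal \<bar>g x\<bar> ^ 2 \<partial>M) = ennreal (\<integral>x. (g x)\<^sup>2 \<partial>M)"
    using assms(2) by (subst nn_integral_eq_integral[symmetric]) (auto simp: sqint_def ennreal_power)
  also have "(\<integral>\<^sup>+x. ennreal \<bar>f x\<bar> * ennreal \<bar>g x\<bar> \<partial>M) = ennreal (\<integral>x. \<bar>f x * g x\<bar> \<partial>M)"
    using integrable_abs[OF sqint_mult_integrable[OF assms]]
    by (subst nn_integral_eq_integral[symmetric]) (auto simp: abs_mult ennreal_mult)
  finally have "(\<integral>x. \<bar>f x * g x\<bar> \<partial>M)\<^sup>2 \<le> (\<integral>x. (f x)\<^sup>2 \<partial>M) * (\<integral>x. (g x)\<^sup>2 \<partial>M)"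
    by (simp add: ennreal_power ennreal_mult[symmetric])
  then have "sqrt ((\<integral>x. \<bar>f x * g x\<bar> \<partial>M)\<^sup>2) \<le> sqrt ((\<integral>x. (f x)\<^sup>2 \<partial>M) * (\<integral>x. (g x)\<^sup>2 \<partial>M))"
    by (rule real_sqrt_le_mono)
  then show ?thesis by (simp add: norm_L2_def real_sqrt_mult)
qed

lemma integral_mult_le_norm_L2:
  assumes "sqint M f" "sqint M g"
  shows "\<bar>\<integral>x. f x * g x \<partial>M\<bar> \<le> norm_L2 M f * norm_L2 M g"
  using integral_abs_mult_le_norm_L2[OF assms] integral_abs_bound[of M "\<lambda>x. f x * g x"] by linarith

lemma norm_L2_triangle:
  assumes "sqint M f" "sqint M g"
  shows "norm_L2 M (\<lambda>x. f x + g x) \<le> norm_L2 M f + norm_L2 M g"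
proof (rule power2_le_imp_le)
  have "(norm_L2 M (\<lambda>x. f x + g x))\<^sup>2 = (\<integral>x. (f x)\<^sup>2 + (g x)\<^sup>2 + 2 * (f x * g x) \<partial>M)"
    by (simp add: norm_L2_sq power2_sum mult.assoc)
  also have "\<dots> = (norm_L2 M f)\<^sup>2 + (norm_L2 M g)\<^sup>2 + 2 * (\<integral>x. f x * g x \<partial>M)"
    using assms sqint_mult_integrable[OF assms] by (simp add: norm_L2_sq sqint_def)
  also have "\<dots> \<le> (norm_L2 M f + norm_L2 M g)\<^sup>2"
    using integral_mult_le_norm_L2[OF assms] by (simp add: power2_sum)
  finally show "(norm_L2 M (\<lambda>x. f x + g x))\<^sup>2 \<le> (norm_L2 M f + norm_L2 M g)\<^sup>2" .
qed simp

lemma norm_L2_triangle_diff: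
  assumes "sqint M f" "sqint M g"
  shows "norm_L2 M (\<lambda>x. f x - g x) \<le> norm_L2 M f + norm_L2 M g"
  using norm_L2_triangle[OF assms(1) sqint_cmult[OF assms(2), of "-1"]] by (simp add: norm_L2_uminus)

lemma norm_L2_triangle_sub:
  assumes "sqint M f" "sqint M g"
  shows "norm_L2 M f \<le> norm_L2 M g + norm_L2 M (\<lambda>x. f x - g x)"
  using norm_L2_triangle[OF assms(2) sqint_diff[OF assms]] by simp

lemma norm_L2_dist_triangle:
  assumes "sqint M f" "sqint M g" "sqint M h"
  shows "norm_L2 M (\<lambda>x. f x - h x) \<le> norm_L2 M (\<lambda>x. f x - g x) + norm_L2 M (\<lambda>x. g x - h x)"
  using norm_L2_triangle[OF sqint_diff[OF assms(1,2)] sqint_diff[OF assms(2,3)]] by simp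

lemma norm_L2_sum:
  assumes "\<And>i. i \<in> I \<Longrightarrow> sqint M (f i)"
  shows "norm_L2 M (\<lambda>x. \<Sum>i\<in>I. f i x) \<le> (\<Sum>i\<in>I. norm_L2 M (f i))"
  using assms
proof (induction I rule: infinite_finite_induct)
  case (insert i F)
  have "norm_L2 M (\<lambda>x. \<Sum>i\<in>insert i F. f i x) \<le> norm_L2 M (f i) + norm_L2 M (\<lambda>x. \<Sum>i\<in>F. f i x)"
    using insert norm_L2_triangle[of M "f i" "\<lambda>x. \<Sum>i\<in>F. f i x"] sqint_sum[of F M f] by simp
  then show ?case using insert by fastforce
qed (auto simp: norm_L2_def)

section \<open>Square integrability over a probability space\<close>

context prob_space
begin

lemma sqint_const [simp]: "sqint M (\<lambda>_. c)"
  by (simp add: sqint_def)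

lemma sqint_integrable: "sqint M f \<Longrightarrow> integrable M f"
  by (auto simp: sqint_def intro: square_integrable_imp_integrable)

lemma sqint_bounded:
  assumes "f \<in> borel_measurable M" "\<And>x. x \<in> space M \<Longrightarrow> \<bar>f x\<bar> \<le> B"
  shows "sqint M f"
  unfolding sqint_def
proof
  have "(f x)\<^sup>2 \<le> B\<^sup>2" if "x \<in> space M" for x
    using power_mono[OF assms(2)[OF that], of 2] by simp
  then show "integrable M (\<lambda>x. (f x)\<^sup>2)"
    by (intro integrable_const_bound[of _ "B\<^sup>2"]) (use assms in auto)
qed fact

text \<open>Cauchy-Schwarz against the constant 1, whose norm is 1 because the total mass is
  one.\<close>

lemma integral_abs_le_norm_L2:
  assumes "sqint M f" shows "(\<integral>x. \<bar>f x\<bar> \<partial>M) \<le> norm_L2 M f"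
  using integral_abs_mult_le_norm_L2[OF assms sqint_const[of 1]] by (simp add: norm_L2_def prob_space)

lemma sqint_mult_bounded:
  assumes "sqint M f" "g \<in> borel_measurable M" "\<And>x. x \<in> space M \<Longrightarrow> \<bar>g x\<bar> \<le> B"
  shows "sqint M (\<lambda>x. f x * g x)"
  unfolding sqint_def
proof
  show "(\<lambda>x. f x * g x) \<in> borel_measurable M" using assms by (auto simp: sqint_def)
  show "integrable M (\<lambda>x. (f x * g x)\<^sup>2)"
  proof (rule Bochner_Integration.integrable_bound[of _ "\<lambda>x. B\<^sup>2 * (f x)\<^sup>2"])
    have "\<bar>g x\<bar>\<^sup>2 \<le> B\<^sup>2" if "x \<in> space M" for x using assms(3)[OF that] by (intro power_mono) auto
    then show "AE x in M. norm ((f x * g x)\<^sup>2) \<le> norm (B\<^sup>2 * (f x)\<^sup>2)"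
      by (auto intro!: AE_I2 mult_left_mono simp: power_mult_distrib mult.commute[of "B\<^sup>2"])
  qed (use assms in \<open>auto simp: sqint_def\<close>)
qed

text \<open>Dominated convergence for \<open>f\<^sup>2 1\<^bsub>|f|>A\<^esub>\<close>.\<close>

lemma sqint_truncation:
  assumes f: "sqint M f" and "\<delta> > 0"
  obtains A where "A \<ge> (0::real)" "norm_L2 M (\<lambda>x. f x - (if \<bar>f x\<bar> \<le> A then f x else 0)) < \<delta>"
proof -
  have [measurable]: "f \<in> borel_measurable M" using f by (simp add: sqint_def)
  let ?g = "\<lambda>n x. f x - (if \<bar>f x\<bar> \<le> real n then f x else 0)"
  have "(\<lambda>n. \<integral>x. (?g n x)\<^sup>2 \<partial>M) \<longlonglongrightarrow> (\<integral>x. 0 \<partial>M)"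
  proof (rule integral_dominated_convergence[where w="\<lambda>x. (f x)\<^sup>2"])
    have "(\<lambda>n. (?g n x)\<^sup>2) \<longlonglongrightarrow> 0" for x
    proof (rule tendsto_eventually)
      show "\<forall>\<^sub>F n in sequentially. (?g n x)\<^sup>2 = 0"
        using eventually_ge_at_top[of "nat \<lceil>\<bar>f x\<bar>\<rceil>"] by eventually_elim (auto simp: nat_le_iff ceiling_le_iff)
    qed
    then show "AE x in M. (\<lambda>n. (?g n x)\<^sup>2) \<longlonglongrightarrow> 0" by simp
  qed (use f in \<open>auto simp: sqint_def\<close>)
  then have "(\<lambda>n. norm_L2 M (?g n)) \<longlonglongrightarrow> 0"
    unfolding norm_L2_def using tendsto_real_sqrt by fastforce
  then have "\<forall>\<^sub>F n in sequentially. norm_L2 M (?g n) < \<delta>" using \<open>\<delta> > 0\<close> by (rule order_tendstoD)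
  then obtain n where "norm_L2 M (?g n) < \<delta>" by (auto simp: eventually_sequentially)
  then show ?thesis using that[of "real n"] by simp
qed

end

section \<open>Stationary filtrations\<close>

locale stationary_filtration = prob_space M for M :: "'a measure" +
  fixes T :: "'a \<Rightarrow> 'a" and F0 :: "'a measure"
  assumes mpt: "invertible_mpt M T"
    and subalg_F0: "subalgebra M F0"
    and F0_incl: "sets F0 \<subseteq> sets (vimage_algebra (space M) T F0)"
    and past_trivial: "A \<in> filtr_past M T F0 \<Longrightarrow> measure M A = 0 \<or> measure M A = 1"
begin

abbreviation "It \<equiv> int_iterate M T"
abbreviation "F \<equiv> filtr M T F0"
abbreviation "CE i \<equiv> real_cond_exp M (F i)"

section \<open>Integer iterates of the transformation\<close>

lemma T_props:
  shows T_bij: "bij_betw T (space M) (space M)" and T_meas [measurable]: "T \<in> measurable M M"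
    and T_inv_meas [measurable]: "inv_into (space M) T \<in> measurable M M" and T_distr: "distr M M T = M"
  using mpt by (auto simp: invertible_mpt_def)

lemma it_0 [simp]: "It 0 \<omega> = \<omega>"
  by (simp add: int_iterate_def)

lemma it_measurable [measurable]: "It i \<in> measurable M M"
proof -
  have "(f ^^ n) \<in> measurable M M" if [measurable]: "f \<in> measurable M M" for f and n :: nat
  proof (induction n)
    case (Suc n)
    then show ?case using measurable_comp[of "f ^^ n" M M f M] that by simp
  qed simp
  then show ?thesis by (simp add: int_iterate_def)
qed

lemma it_space: "\<omega> \<in> space M \<Longrightarrow> It i \<omega> \<in> space M"
  by (rule measurable_space[OF it_measurable])

lemma T_inv: "\<omega> \<in> space M \<Longrightarrow> T (inv_into (space M) T \<omega>) = \<omega>"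
    "\<omega> \<in> space M \<Longrightarrow> inv_into (space M) T (T \<omega>) = \<omega>"
  using T_bij by (auto simp: bij_betw_def f_inv_into_f inv_into_f_f)

text \<open>The two branches of \<open>int_iterate\<close> interact only for negative exponents,
  where T has to cancel one inverse step. This cancellation is valid on \<open>space M\<close>
  alone, which explains the hypothesis on \<omega>.\<close>

lemma it_Suc:
  assumes "\<omega> \<in> space M" shows "It (a + 1) \<omega> = T (It a \<omega>)"
proof (cases "a \<ge> 0")
  case True
  then have "nat (a + 1) = Suc (nat a)" by simp
  with True show ?thesis by (simp add: int_iterate_def)
next
  case False
  define k where "k = nat (- a - 1)"
  have k: "a = - int k - 1" using False by (simp add: k_def)
  have "(inv_into (space M) T ^^ k) \<omega> \<in> space M"
    using it_space[OF assms, of "- int k"] by (cases "k = 0") (auto simp: int_iterate_def assms)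
  moreover have "nat (- a) = Suc k" using k by simp
  moreover have "It (a + 1) \<omega> = (inv_into (space M) T ^^ k) \<omega>" using k by (cases "k = 0") (auto simp: int_iterate_def)
  ultimately show ?thesis using False by (simp add: int_iterate_def T_inv)
qed

lemma it_pred:
  assumes "\<omega> \<in> space M" shows "It (a - 1) \<omega> = inv_into (space M) T (It a \<omega>)"
  using it_Suc[OF assms, of "a - 1"] T_inv(2)[OF it_space[OF assms]] by simp

lemma it_add:
  assumes "\<omega> \<in> space M" shows "It a (It b \<omega>) = It (a + b) \<omega>"
proof (induction a rule: int_induct[where k=0])
  case (step1 i)
  then show ?case using it_Suc[OF it_space[OF assms], of i] it_Suc[OF assms, of "i + b"] by (simp add: algebra_simps)
next
  case (step2 i)
  then show ?case using it_pred[OF it_space[OF assms], of i] it_pred[OF assms, of "i + b"] by (simp add: algebra_simps)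
qed simp

text \<open>Invariance under the inverse map follows by pushing M forward along T and then along the
  inverse: the composition is the identity on \<open>space M\<close>, and the first step does not
  change M.\<close>

lemma it_distr: "distr M M (It i) = M"
proof (induction i rule: int_induct[where k=0])
  case base
  then show ?case by (simp add: distr_id2 cong: distr_cong)
next
  case (step1 i)
  have "distr M M (It (i + 1)) = distr M M (\<lambda>\<omega>. T (It i \<omega>))"
    by (rule distr_cong) (auto simp: it_Suc)
  also have "\<dots> = distr (distr M M (It i)) M T" by (subst distr_distr) (auto simp: comp_def)
  finally show ?case using step1 T_distr by simp
next
  case (step2 i)
  have "M = distr M M (\<lambda>\<omega>. inv_into (space M) T (T \<omega>))"
    by (subst distr_cong[where N=M and g="\<lambda>x. x" and L=M]) (auto simp: T_inv distr_id2)
  also have "\<dots> = distr (distr M M T) M (inv_into (space M) T)" by (subst distr_distr) (auto simp: comp_def)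
  finally have S: "distr M M (inv_into (space M) T) = M" using T_distr by simp
  have "distr M M (It (i - 1)) = distr M M (\<lambda>\<omega>. inv_into (space M) T (It i \<omega>))"
    by (rule distr_cong) (auto simp: it_pred)
  also have "\<dots> = distr (distr M M (It i)) M (inv_into (space M) T)" by (subst distr_distr) (auto simp: comp_def)
  finally show ?case using step2 S by simp
qed

lemma integral_it:
  fixes f :: "'a \<Rightarrow> real"
  assumes "f \<in> borel_measurable M" shows "(\<integral>\<omega>. f (It i \<omega>) \<partial>M) = (\<integral>\<omega>. f \<omega> \<partial>M)"
  using integral_distr[OF it_measurable assms, of i] it_distr by simp

lemma integrable_it:
  fixes f :: "'a \<Rightarrow> real"
  assumes "integrable M f" shows "integrable M (\<lambda>\<omega>. f (It i \<omega>))"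
  using integrable_distr[OF it_measurable, of i f] it_distr[of i] assms by simp

lemma sqint_it: "sqint M f \<Longrightarrow> sqint M (\<lambda>\<omega>. f (It i \<omega>))"
  using integrable_it[of "\<lambda>\<omega>. (f \<omega>)\<^sup>2" i] by (auto simp: sqint_def)

lemma norm_L2_it: "f \<in> borel_measurable M \<Longrightarrow> norm_L2 M (\<lambda>\<omega>. f (It i \<omega>)) = norm_L2 M f"
  using integral_it[of "\<lambda>\<omega>. (f \<omega>)\<^sup>2" i] by (auto simp: norm_L2_def)

section \<open>The shifted sigma-algebras\<close>

lemma space_F [simp]: "space (F i) = space M"
  by (simp add: filtr_def)

lemma it_space_F0: "It i \<in> space M \<rightarrow> space F0"
  using it_space subalg_F0 by (auto simp: subalgebra_def)

lemma sets_F: "sets (F i) = {It i -` A \<inter> space M | A. A \<in> sets F0}"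
  unfolding filtr_def using it_space_F0 by (rule sets_vimage_algebra2)

lemma subalg_F: "subalgebra M (F i)"
  using subalg_F0 measurable_sets[OF it_measurable, of _ i]
  by (auto simp: subalgebra_def sets_F)

lemma sigma_finite_F: "sigma_finite_subalgebra M (F i)"
  by (rule finite_measure_subalgebra_is_sigma_finite) (simp add: finite_measure_subalgebra_def finite_measure_axioms finite_measure_subalgebra_axioms_def subalg_F)

text \<open>One step suffices: a set of \<open>F0\<close> is the T-preimage of another set of
  \<open>F0\<close>, and pulling this back along \<open>It j\<close> raises the exponent by
  one.\<close>

lemma F_mono: assumes "i \<le> j" shows "sets (F i) \<subseteq> sets (F j)"
  using assms
proof (induction j rule: int_ge_induct)
  case (step j)
  have "sets (F j) \<subseteq> sets (F (j + 1))"
  proof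
    fix B assume "B \<in> sets (F j)"
    then obtain A where A: "A \<in> sets F0" "B = It j -` A \<inter> space M" by (auto simp: sets_F)
    have "T \<in> space M \<rightarrow> space F0" using measurable_space[OF T_meas] subalg_F0 by (simp add: subalgebra_def)
    then have "A \<in> {T -` A' \<inter> space M | A'. A' \<in> sets F0}"
      using subsetD[OF F0_incl A(1)] by (simp only: sets_vimage_algebra2)
    then obtain A' where A': "A' \<in> sets F0" "A = T -` A' \<inter> space M" by blast
    have "B = It (j + 1) -` A' \<inter> space M" unfolding A(2) A'(2) by (auto simp: it_Suc it_space)
    with A'(1) show "B \<in> sets (F (j + 1))" by (auto simp: sets_F)
  qed
  with step show ?case by blast
qed simp

lemma measurable_F_mono: "f \<in> borel_measurable (F i) \<Longrightarrow> i \<le> j \<Longrightarrow> f \<in> borel_measurable (F j)"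
  using F_mono[of i j] by (auto simp: measurable_def)

lemma measurable_F_M: "f \<in> borel_measurable (F i) \<Longrightarrow> f \<in> borel_measurable M"
  using measurable_from_subalg[OF subalg_F] .

text \<open>Composition with \<open>It a\<close> moves information from time b to time b + a. All
  adaptedness statements about shifted innovations come from here.\<close>

lemma it_measurable_F: "It a \<in> measurable (F (b + a)) (F b)"
proof -
  have "It (b + a) \<in> measurable (F (b + a)) F0"
    unfolding filtr_def by (rule measurable_vimage_algebra1) (rule it_space_F0)
  then have "(\<lambda>x. It b (It a x)) \<in> measurable (F (b + a)) F0"
    by (subst measurable_cong[where g="It (b + a)"]) (auto simp: it_add)
  then show ?thesis
    unfolding filtr_def[of M T F0 b] by (intro measurable_vimage_algebra2) (auto simp: it_space)
qed

lemma measurable_F_it: "f \<in> borel_measurable (F b) \<Longrightarrow> (\<lambda>\<omega>. f (It a \<omega>)) \<in> borel_measurable (F (b + a))"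
  using measurable_compose[OF it_measurable_F] .

section \<open>Conditional expectation as an orthogonal projection\<close>

lemma CE_measurable: "CE i g \<in> borel_measurable (F i)"
  by simp

lemma CE_sqint:
  assumes "sqint M g" shows "sqint M (CE i g)"
proof -
  interpret C: sigma_finite_subalgebra M "F i" by (rule sigma_finite_F)
  have "integrable M (\<lambda>x. (CE i g x)\<^sup>2)"
    by (rule C.integrable_convex_cond_exp[where I=UNIV])
       (use sqint_integrable[OF assms] assms convex_power2 in \<open>auto simp: sqint_def\<close>)
  then show ?thesis by (simp add: sqint_def)
qed

text \<open>The projection property: \<open>g\<close> minus its conditional expectation is
  orthogonal to every square integrable function known at time i. Most of the L^2 arguments about
  conditional expectations use it in this form instead of integrals over sets.\<close>

lemma CE_inner:
  assumes "sqint M g" "sqint M Y" "Y \<in> borel_measurable (F i)"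
  shows "(\<integral>\<omega>. Y \<omega> * CE i g \<omega> \<partial>M) = (\<integral>\<omega>. Y \<omega> * g \<omega> \<partial>M)"
proof -
  interpret C: sigma_finite_subalgebra M "F i" by (rule sigma_finite_F)
  show ?thesis using C.real_cond_exp_intg(2)[OF sqint_mult_integrable[OF assms(2,1)] assms(3)] assms(1)
    by (simp add: sqint_def)
qed

text \<open>The squared norm of the projection equals its inner product with \<open>g\<close>;
  Cauchy-Schwarz and division by the norm, if it is not zero, give the contraction.\<close>

lemma CE_norm_le:
  assumes "sqint M g" shows "norm_L2 M (CE i g) \<le> norm_L2 M g"
proof -
  have "(norm_L2 M (CE i g))\<^sup>2 = (\<integral>\<omega>. CE i g \<omega> * g \<omega> \<partial>M)"
    using CE_inner[OF assms CE_sqint[OF assms] CE_measurable, of i] unfolding norm_L2_sq by (simp add: power2_eq_square)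
  also have "\<dots> \<le> norm_L2 M (CE i g) * norm_L2 M g"
    using integral_mult_le_norm_L2[OF CE_sqint[OF assms] assms, of i] by linarith
  finally have *: "norm_L2 M (CE i g) * norm_L2 M (CE i g) \<le> norm_L2 M (CE i g) * norm_L2 M g"
    unfolding power2_eq_square[of "norm_L2 M (CE i g)"] .
  show ?thesis
  proof (cases "norm_L2 M (CE i g) = 0")
    case False
    then have "0 < norm_L2 M (CE i g)" by (simp add: less_le)
    then show ?thesis using * by (rule mult_left_le_imp_le[rotated])
  qed simp
qed

text \<open>Pythagoras: the cross term between \<open>g\<close> minus its projection and the
  projection minus \<open>Y\<close> vanishes by \<open>CE_inner\<close>.\<close>

lemma CE_best_approx:
  assumes "sqint M g" "sqint M Y" "Y \<in> borel_measurable (F i)"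
  shows "norm_L2 M (\<lambda>\<omega>. g \<omega> - CE i g \<omega>) \<le> norm_L2 M (\<lambda>\<omega>. g \<omega> - Y \<omega>)"
proof (rule power2_le_imp_le)
  let ?c = "CE i g"
  note c = CE_sqint[OF assms(1), of i]
  have m: "(\<lambda>\<omega>. ?c \<omega> - Y \<omega>) \<in> borel_measurable (F i)" using assms(3) by simp
  have 0: "(\<integral>\<omega>. (?c \<omega> - Y \<omega>) * ?c \<omega> \<partial>M) = (\<integral>\<omega>. (?c \<omega> - Y \<omega>) * g \<omega> \<partial>M)"
    by (rule CE_inner[OF assms(1) sqint_diff[OF c assms(2)] m])
  have "(\<integral>\<omega>. (g \<omega> - Y \<omega>)\<^sup>2 \<partial>M) = (\<integral>\<omega>. (g \<omega> - ?c \<omega>)\<^sup>2 + (?c \<omega> - Y \<omega>)\<^sup>2 + 2 * ((?c \<omega> - Y \<omega>) * g \<omega> - (?c \<omega> - Y \<omega>) * ?c \<omega>) \<partial>M)"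
    by (rule arg_cong[where f="integral\<^sup>L M"]) (auto simp: fun_eq_iff power2_eq_square algebra_simps)
  also have "\<dots> = (\<integral>\<omega>. (g \<omega> - ?c \<omega>)\<^sup>2 \<partial>M) + (\<integral>\<omega>. (?c \<omega> - Y \<omega>)\<^sup>2 \<partial>M)"
    using 0 sqint_diff[OF assms(1) c] sqint_diff[OF c assms(2)] sqint_mult_integrable[OF sqint_diff[OF c assms(2)] assms(1)]
      sqint_mult_integrable[OF sqint_diff[OF c assms(2)] c] by (simp add: sqint_def)
  finally show "(norm_L2 M (\<lambda>\<omega>. g \<omega> - CE i g \<omega>))\<^sup>2 \<le> (norm_L2 M (\<lambda>\<omega>. g \<omega> - Y \<omega>))\<^sup>2"
    by (simp add: norm_L2_sq)
qed simp

text \<open>The shift preserves M and carries the sets of \<open>F b\<close> to those of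
  \<open>F (b + a)\<close>, so the shifted conditional expectation has the integrals over
  \<open>F (b + a)\<close> that characterise the left-hand side.\<close>

lemma CE_shift:
  assumes g: "integrable M g"
  shows "AE \<omega> in M. CE (b + a) (\<lambda>\<omega>. g (It a \<omega>)) \<omega> = CE b g (It a \<omega>)"
proof -
  interpret C: sigma_finite_subalgebra M "F (b + a)" by (rule sigma_finite_F)
  interpret Cb: sigma_finite_subalgebra M "F b" by (rule sigma_finite_F)
  have ib: "integrable M (CE b g)" by (rule Cb.real_cond_exp_int(1)[OF g])
  show ?thesis
  proof (rule C.real_cond_exp_charact)
    fix A assume A: "A \<in> sets (F (b + a))"
    \<comment> \<open>The set A carried back to time b. Its indicator, composed with the shift, is
      that of A, which turns an integral over A into one over \<open>A'\<close>.\<close>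
    define A' where "A' = It (- a) -` A \<inter> space (F b)"
    have "It (- a) \<in> measurable (F b) (F (b + a))" using it_measurable_F[of "- a" "b + a"] by simp
    then have A': "A' \<in> sets (F b)" unfolding A'_def using A by (rule measurable_sets)
    have A'M: "A' \<in> sets M" using A' subalg_F by (auto simp: subalgebra_def)
    have ind: "indicator A \<omega> = (indicator A' (It a \<omega>) :: real)" if "\<omega> \<in> space M" for \<omega>
      using that it_space[OF that] by (auto simp: A'_def indicator_def it_add)
    have *: "(\<integral>\<omega>\<in>A. f (It a \<omega>) \<partial>M) = (\<integral>\<omega>\<in>A'. f \<omega> \<partial>M)" if [measurable]: "f \<in> borel_measurable M" for f :: "'a \<Rightarrow> real"
    proof -
      have "(\<integral>\<omega>\<in>A. f (It a \<omega>) \<partial>M) = (\<integral>\<omega>. indicator A' (It a \<omega>) * f (It a \<omega>) \<partial>M)"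
        unfolding set_lebesgue_integral_def by (rule Bochner_Integration.integral_cong) (auto simp: ind)
      also have "\<dots> = (\<integral>\<omega>. indicator A' \<omega> * f \<omega> \<partial>M)"
        by (rule integral_it) (use A'M in measurable)
      finally show ?thesis by (simp add: set_lebesgue_integral_def)
    qed
    show "(\<integral>\<omega>\<in>A. g (It a \<omega>) \<partial>M) = (\<integral>\<omega>\<in>A. CE b g (It a \<omega>) \<partial>M)"
      using *[of g] *[of "CE b g"] Cb.real_cond_exp_intA[OF g A'] g by simp
  next
    show "integrable M (\<lambda>\<omega>. g (It a \<omega>))" by (rule integrable_it[OF g])
    show "integrable M (\<lambda>\<omega>. CE b g (It a \<omega>))" by (rule integrable_it[OF ib])
    show "(\<lambda>\<omega>. CE b g (It a \<omega>)) \<in> borel_measurable (F (b + a))" by (rule measurable_F_it) simp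
  qed
qed

end

section \<open>The remote past and the far future\<close>

context stationary_filtration
begin

text \<open>Past triviality is used for the almost sure limit \<open>Z\<close> of a subsequence of \<open>E(g|F\<^sub>-\<^sub>n)\<close>: a version
  of \<open>Z\<close> is measurable for every \<open>F\<^sub>-\<^sub>N\<close>, so \<open>{Z > 0}\<close> and \<open>{Z < 0}\<close> have probability 0 or 1.\<close>

lemma CE_past_tendsto_0:
  assumes g: "sqint M g" and g0: "(\<integral>\<omega>. g \<omega> \<partial>M) = 0"
  shows "(\<lambda>n. norm_L2 M (CE (- int n) g)) \<longlonglongrightarrow> 0"
proof -
  define Y where "Y n = CE (- int n) g" for n :: nat
  \<comment> \<open>The projections are nested, so these squared norms decrease and converge. By
    \<open>dist\<close> their differences are the squared distances between the Y n, which are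
    therefore Cauchy in L^2.\<close>
  define a where "a n = (norm_L2 M (Y n))\<^sup>2" for n
  have Ysq: "sqint M (Y n)" for n unfolding Y_def by (rule CE_sqint[OF g])
  have [measurable]: "Y n \<in> borel_measurable M" for n using Ysq by (simp add: sqint_def)
  have YF: "Y m \<in> borel_measurable (F (- int n))" if "n \<le> m" for n m
    using that measurable_F_mono[OF CE_measurable, of "- int m" "- int n" g] by (simp add: Y_def)
  have inner: "(\<integral>\<omega>. Y m \<omega> * Y n \<omega> \<partial>M) = a m" if "n \<le> m" for n m
    using CE_inner[OF g Ysq YF[OF that]] CE_inner[OF g Ysq YF[of m m]]
    unfolding a_def norm_L2_sq by (simp add: Y_def power2_eq_square)
  have dist: "(\<integral>\<omega>. (Y n \<omega> - Y m \<omega>)\<^sup>2 \<partial>M) = a n - a m" if "n \<le> m" for n m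
  proof -
    have "(\<integral>\<omega>. (Y n \<omega> - Y m \<omega>)\<^sup>2 \<partial>M) = (\<integral>\<omega>. (Y n \<omega>)\<^sup>2 + (Y m \<omega>)\<^sup>2 - 2 * (Y m \<omega> * Y n \<omega>) \<partial>M)"
      by (simp add: power2_diff algebra_simps)
    also have "\<dots> = a n + a m - 2 * a m"
      using Ysq sqint_mult_integrable[OF Ysq Ysq, of m n] inner[OF that] by (simp add: sqint_def a_def norm_L2_sq)
    finally show ?thesis by simp
  qed
  have dec: "a m \<le> a n" if "n \<le> m" for n m
    using dist[OF that] Bochner_Integration.integral_nonneg[of M "\<lambda>\<omega>. (Y n \<omega> - Y m \<omega>)\<^sup>2"] by simp
  have "decseq a" using dec by (simp add: decseq_def)
  moreover have "0 \<le> a n" for n by (simp add: a_def)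
  ultimately obtain L where "a \<longlonglongrightarrow> L" using decseq_convergent[of a 0] by blast
  then have "Cauchy a" by (rule LIMSEQ_imp_Cauchy)
  then have cau: "\<exists>N. \<forall>i\<ge>N. \<forall>j\<ge>N. (\<integral>\<omega>. (Y i \<omega> - Y j \<omega>)\<^sup>2 \<partial>M) < e" if "e > 0" for e
  proof -
    from \<open>Cauchy a\<close> that obtain N where N: "\<forall>i\<ge>N. \<forall>j\<ge>N. \<bar>a i - a j\<bar> < e"
      unfolding Cauchy_def dist_real_def by blast
    have "(\<integral>\<omega>. (Y i \<omega> - Y j \<omega>)\<^sup>2 \<partial>M) < e" if "i \<ge> N" "j \<ge> N" for i j
    proof -
      have "(\<integral>\<omega>. (Y i \<omega> - Y j \<omega>)\<^sup>2 \<partial>M) = \<bar>a i - a j\<bar>"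
        using dist[of i j] dist[of j i] dec[of i j] dec[of j i] by (cases "i \<le> j") (simp_all add: power2_commute)
      also have "\<dots> < e" using N that by blast
      finally show ?thesis .
    qed
    then show ?thesis by blast
  qed
  obtain r where r: "strict_mono r" and rC: "AE \<omega> in M. Cauchy (\<lambda>k. Y (r k) \<omega>)"
  proof (rule cauchy_L1_AE_cauchy_subseq)
    show "integrable M (Y n)" for n by (rule sqint_integrable[OF Ysq])
    fix e :: real assume "e > 0"
    then obtain N where N: "\<forall>i\<ge>N. \<forall>j\<ge>N. (\<integral>\<omega>. (Y i \<omega> - Y j \<omega>)\<^sup>2 \<partial>M) < e\<^sup>2" using cau[of "e\<^sup>2"] by auto
    have "(LINT x|M. norm (Y i x - Y j x)) < e" if "i \<ge> N" "j \<ge> N" for i j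
    proof -
      have "(LINT x|M. norm (Y i x - Y j x)) \<le> norm_L2 M (\<lambda>x. Y i x - Y j x)"
        using integral_abs_le_norm_L2[OF sqint_diff[OF Ysq Ysq]] by simp
      also have "\<dots> < sqrt (e\<^sup>2)" unfolding norm_L2_def using N that by (intro real_sqrt_less_mono) blast
      finally show ?thesis using \<open>e > 0\<close> by simp
    qed
    then show "\<exists>N. \<forall>i\<ge>N. \<forall>j\<ge>N. (LINT x|M. norm (Y i x - Y j x)) < e" by blast
  qed
  define Z where "Z \<omega> = lim (\<lambda>k. Y (r k) \<omega>)" for \<omega>
  have ZF: "Z \<in> borel_measurable (F (- int N))" for N
  proof -
    \<comment> \<open>\<open>lim\<close> depends only on the tail of a sequence, even where there is
      no limit. Without its first N terms the subsequence consists of functions known at time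
      -N.\<close>
    have "Z = (\<lambda>\<omega>. lim (\<lambda>k. Y (r (k + N)) \<omega>))"
    proof
      fix \<omega>
      have "((\<lambda>k. Y (r k) \<omega>) \<longlonglongrightarrow> l) = ((\<lambda>k. Y (r (k + N)) \<omega>) \<longlonglongrightarrow> l)" for l
        using LIMSEQ_ignore_initial_segment[of "\<lambda>k. Y (r k) \<omega>" l N] LIMSEQ_offset[of "\<lambda>k. Y (r k) \<omega>" N l] by blast
      then show "Z \<omega> = lim (\<lambda>k. Y (r (k + N)) \<omega>)" unfolding Z_def lim_def by simp
    qed
    moreover have "Y (r (k + N)) \<in> borel_measurable (F (- int N))" for k
      by (rule YF) (use seq_suble[OF r, of "k + N"] in simp)
    ultimately show ?thesis by simp
  qed
  have Zm[measurable]: "Z \<in> borel_measurable M" by (rule measurable_F_M[OF ZF[of 0]])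
  have Zlim: "AE \<omega> in M. (\<lambda>k. Y (r k) \<omega>) \<longlonglongrightarrow> Z \<omega>"
    using rC by eventually_elim (auto simp: Z_def Cauchy_convergent_iff convergent_LIMSEQ_iff)
  \<comment> \<open>Fatou's lemma along the subsequence. The nonnegative integral is used because
    \<open>Z\<close> is not yet known to be square integrable; that is deduced from this
    bound.\<close>
  have close: "\<exists>N. \<forall>n\<ge>N. (\<integral>\<^sup>+\<omega>. ennreal ((Y n \<omega> - Z \<omega>)\<^sup>2) \<partial>M) \<le> ennreal e" if "e > 0" for e
  proof -
    from cau[OF that] obtain N where N: "\<forall>i\<ge>N. \<forall>j\<ge>N. (\<integral>\<omega>. (Y i \<omega> - Y j \<omega>)\<^sup>2 \<partial>M) < e" by blast
    have "(\<integral>\<^sup>+\<omega>. ennreal ((Y n \<omega> - Z \<omega>)\<^sup>2) \<partial>M) \<le> ennreal e" if "n \<ge> N" for n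
    proof -
      have "(\<integral>\<^sup>+\<omega>. ennreal ((Y n \<omega> - Z \<omega>)\<^sup>2) \<partial>M) = (\<integral>\<^sup>+\<omega>. liminf (\<lambda>k. ennreal ((Y n \<omega> - Y (r k) \<omega>)\<^sup>2)) \<partial>M)"
      proof (rule nn_integral_cong_AE)
        show "AE \<omega> in M. ennreal ((Y n \<omega> - Z \<omega>)\<^sup>2) = liminf (\<lambda>k. ennreal ((Y n \<omega> - Y (r k) \<omega>)\<^sup>2))"
          using Zlim
        proof eventually_elim
          case (elim \<omega>)
          have "(\<lambda>k. ennreal ((Y n \<omega> - Y (r k) \<omega>)\<^sup>2)) \<longlonglongrightarrow> ennreal ((Y n \<omega> - Z \<omega>)\<^sup>2)"
            by (intro tendsto_ennrealI tendsto_power tendsto_diff tendsto_const elim)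
          then show ?case by (intro lim_imp_Liminf[symmetric]) auto
        qed
      qed
      also have "\<dots> \<le> liminf (\<lambda>k. \<integral>\<^sup>+\<omega>. ennreal ((Y n \<omega> - Y (r k) \<omega>)\<^sup>2) \<partial>M)"
        by (rule nn_integral_liminf) measurable
      also have "\<dots> \<le> ennreal e"
      proof (rule Liminf_le)
        show "\<forall>\<^sub>F k in sequentially. (\<integral>\<^sup>+\<omega>. ennreal ((Y n \<omega> - Y (r k) \<omega>)\<^sup>2) \<partial>M) \<le> ennreal e"
          using eventually_ge_at_top[of N]
        proof eventually_elim
          case (elim k)
          then have "r k \<ge> N" using seq_suble[OF r, of k] by simp
          then show ?case using N \<open>n \<ge> N\<close> sqint_diff[OF Ysq Ysq, of n "r k"]
            by (subst nn_integral_eq_integral) (simp_all add: sqint_def ennreal_leI less_imp_le)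
        qed
      qed simp
      finally show ?thesis .
    qed
    then show ?thesis by blast
  qed
  have sq: "sqint M (\<lambda>\<omega>. Y n \<omega> - Z \<omega>)" and le: "norm_L2 M (\<lambda>\<omega>. Y n \<omega> - Z \<omega>) \<le> sqrt e"
    if "e > 0" "(\<integral>\<^sup>+\<omega>. ennreal ((Y n \<omega> - Z \<omega>)\<^sup>2) \<partial>M) \<le> ennreal e" for n e
  proof -
    have "integrable M (\<lambda>\<omega>. (Y n \<omega> - Z \<omega>)\<^sup>2)"
      by (rule integrableI_nonneg) (use that in \<open>auto intro: le_less_trans\<close>)
    then show "sqint M (\<lambda>\<omega>. Y n \<omega> - Z \<omega>)" by (simp add: sqint_def)
    have "ennreal (\<integral>\<omega>. (Y n \<omega> - Z \<omega>)\<^sup>2 \<partial>M) \<le> ennreal e"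
      using that(2) \<open>integrable M (\<lambda>\<omega>. (Y n \<omega> - Z \<omega>)\<^sup>2)\<close> by (subst nn_integral_eq_integral[symmetric]) auto
    then show "norm_L2 M (\<lambda>\<omega>. Y n \<omega> - Z \<omega>) \<le> sqrt e"
      unfolding norm_L2_def using \<open>e > 0\<close> by (intro real_sqrt_le_mono) simp
  qed
  obtain n1 where "(\<integral>\<^sup>+\<omega>. ennreal ((Y n1 \<omega> - Z \<omega>)\<^sup>2) \<partial>M) \<le> ennreal 1" using close[of 1] by auto
  from sqint_diff[OF Ysq[of n1] sq[OF _ this]] have Zsq: "sqint M Z" by simp
  interpret C: sigma_finite_subalgebra M "F i" for i by (rule sigma_finite_F)
  have EY: "(\<integral>\<omega>. Y n \<omega> \<partial>M) = 0" for n
    using C.real_cond_exp_int(2)[OF sqint_integrable[OF g]] g0 by (simp add: Y_def)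
  have EZ: "(\<integral>\<omega>. Z \<omega> \<partial>M) = 0"
  proof (rule ccontr)
    assume "(\<integral>\<omega>. Z \<omega> \<partial>M) \<noteq> 0"
    define e where "e = ((\<integral>\<omega>. Z \<omega> \<partial>M) / 2)\<^sup>2"
    have "e > 0" using \<open>_ \<noteq> 0\<close> by (simp add: e_def)
    obtain n where n: "(\<integral>\<^sup>+\<omega>. ennreal ((Y n \<omega> - Z \<omega>)\<^sup>2) \<partial>M) \<le> ennreal e" using close[OF \<open>e > 0\<close>] by auto
    have "\<bar>\<integral>\<omega>. Z \<omega> \<partial>M\<bar> = \<bar>\<integral>\<omega>. Y n \<omega> - Z \<omega> \<partial>M\<bar>"
      using sqint_integrable[OF Zsq] sqint_integrable[OF Ysq[of n]] EY[of n] by simp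
    also have "\<dots> \<le> (\<integral>\<omega>. \<bar>Y n \<omega> - Z \<omega>\<bar> \<partial>M)" by (rule integral_abs_bound)
    also have "\<dots> \<le> norm_L2 M (\<lambda>\<omega>. Y n \<omega> - Z \<omega>)" by (rule integral_abs_le_norm_L2[OF sqint_diff[OF Ysq Zsq]])
    also have "\<dots> \<le> \<bar>(\<integral>\<omega>. Z \<omega> \<partial>M) / 2\<bar>" using le[OF \<open>e > 0\<close> n] by (simp add: e_def)
    finally show False using \<open>_ \<noteq> 0\<close> by simp
  qed
  have zo: "prob {\<omega> \<in> space M. Z \<omega> \<in> B} = 0 \<or> prob {\<omega> \<in> space M. Z \<omega> \<in> B} = 1" if [measurable]: "B \<in> sets borel" for B
  proof (rule past_trivial)
    have "{\<omega> \<in> space M. Z \<omega> \<in> B} \<in> sets (F i)" for i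
    proof -
      define N where "N = nat (- i)"
      have "Z -` B \<inter> space (F (- int N)) \<in> sets (F (- int N))" using ZF that by (rule measurable_sets)
      then have "{\<omega> \<in> space M. Z \<omega> \<in> B} \<in> sets (F (- int N))" by (simp add: vimage_def Int_def conj_commute)
      moreover have "- int N \<le> i" by (simp add: N_def)
      ultimately show ?thesis using F_mono by blast
    qed
    then show "{\<omega> \<in> space M. Z \<omega> \<in> B} \<in> filtr_past M T F0" by (simp add: filtr_past_def)
  qed
  \<comment> \<open>A function of mean zero cannot be positive almost surely, so the zero-one
    alternative leaves only probability 0.\<close>
  have neg0: "prob {\<omega> \<in> space M. W \<omega> \<in> {0<..}} = 0"
    if W: "sqint M W" "(\<integral>\<omega>. W \<omega> \<partial>M) = 0"
      and "prob {\<omega> \<in> space M. W \<omega> \<in> {0<..}} = 0 \<or> prob {\<omega> \<in> space M. W \<omega> \<in> {0<..}} = 1" for W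
  proof (rule ccontr)
    have [measurable]: "W \<in> borel_measurable M" using W by (simp add: sqint_def)
    assume "prob {\<omega> \<in> space M. W \<omega> \<in> {0<..}} \<noteq> 0"
    with that have "prob {\<omega> \<in> space M. W \<omega> \<in> {0<..}} = 1" by simp
    then have pos: "AE \<omega> in M. 0 < W \<omega>" by (subst (asm) prob_Collect_eq_1) auto
    have nn: "AE \<omega> in M. 0 \<le> W \<omega>" using pos by eventually_elim simp
    have "AE \<omega> in M. W \<omega> = 0"
      using integral_nonneg_eq_0_iff_AE[OF sqint_integrable[OF W(1)] nn] W(2) by simp
    with pos have "AE \<omega> in M. False" by eventually_elim simp
    then show False by simp
  qed
  have p: "prob {\<omega> \<in> space M. Z \<omega> \<in> {0<..}} = 0" by (rule neg0[OF Zsq EZ zo]) simp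
  have n: "prob {\<omega> \<in> space M. - Z \<omega> \<in> {0<..}} = 0"
    by (rule neg0) (use sqint_cmult[OF Zsq, of "-1"] EZ zo[of "{..<0}"] in simp_all)
  have "{\<omega> \<in> space M. Z \<omega> \<in> {0<..}} \<in> events" by measurable
  from prob_Collect_eq_0[OF this] p have 1: "AE \<omega> in M. \<not> Z \<omega> \<in> {0<..}" by blast
  have "{\<omega> \<in> space M. - Z \<omega> \<in> {0<..}} \<in> events" by measurable
  from prob_Collect_eq_0[OF this] n have 2: "AE \<omega> in M. \<not> - Z \<omega> \<in> {0<..}" by blast
  from 1 2 have "AE \<omega> in M. Z \<omega> = 0" by eventually_elim simp
  then have nY: "norm_L2 M (\<lambda>\<omega>. Y n \<omega> - Z \<omega>) = norm_L2 M (Y n)" for n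
    by (intro norm_L2_AE_cong) auto
  show ?thesis
  proof (rule LIMSEQ_I)
    fix e :: real assume "e > 0"
    then have e: "(e / 2)\<^sup>2 > 0" by simp
    obtain N where N: "\<forall>n\<ge>N. (\<integral>\<^sup>+\<omega>. ennreal ((Y n \<omega> - Z \<omega>)\<^sup>2) \<partial>M) \<le> ennreal ((e / 2)\<^sup>2)" using close[OF e] by blast
    have "norm_L2 M (CE (- int n) g) < e" if "n \<ge> N" for n
      using le[OF e, of n] N that \<open>e > 0\<close> nY by (simp add: Y_def)
    then show "\<exists>N. \<forall>n\<ge>N. norm (norm_L2 M (CE (- int n) g) - 0) < e" by auto
  qed
qed


text \<open>Membership in the L^2 closure of the functions known at some finite time. The closure
  properties below extend it to everything measurable for \<open>filtr_all\<close>, which amounts to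
  upward martingale convergence in L^2.\<close>

definition future_approx :: "('a \<Rightarrow> real) \<Rightarrow> bool" where
  "future_approx f \<longleftrightarrow> sqint M f \<and>
     (\<forall>\<delta>>0. \<exists>n Y. Y \<in> borel_measurable (F (int n)) \<and> sqint M Y \<and> norm_L2 M (\<lambda>\<omega>. f \<omega> - Y \<omega>) < \<delta>)"

lemma future_approxD:
  assumes "future_approx f" "\<delta> > 0"
  obtains n Y where "Y \<in> borel_measurable (F (int n))" "sqint M Y" "norm_L2 M (\<lambda>\<omega>. f \<omega> - Y \<omega>) < \<delta>"
  using assms unfolding future_approx_def by blast

lemma future_approx_closed:
  assumes f: "sqint M f"
    and "\<And>\<delta>. \<delta> > 0 \<Longrightarrow> \<exists>f'. future_approx f' \<and> norm_L2 M (\<lambda>\<omega>. f \<omega> - f' \<omega>) < \<delta>"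
  shows "future_approx f"
  unfolding future_approx_def
proof (intro conjI f allI impI)
  fix \<delta> :: real assume "\<delta> > 0"
  then obtain f' where f': "future_approx f'" "norm_L2 M (\<lambda>\<omega>. f \<omega> - f' \<omega>) < \<delta> / 2" using assms(2)[of "\<delta> / 2"] by auto
  obtain n Y where Y: "Y \<in> borel_measurable (F (int n))" "sqint M Y" "norm_L2 M (\<lambda>\<omega>. f' \<omega> - Y \<omega>) < \<delta> / 2"
    by (rule future_approxD[OF f'(1), of "\<delta> / 2"]) (use \<open>\<delta> > 0\<close> in auto)
  have "sqint M f'" using f'(1) by (simp add: future_approx_def)
  from norm_L2_dist_triangle[OF f this Y(2)] have "norm_L2 M (\<lambda>\<omega>. f \<omega> - Y \<omega>) < \<delta>" using f'(2) Y(3) by linarith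
  with Y show "\<exists>n Y. Y \<in> borel_measurable (F (int n)) \<and> sqint M Y \<and> norm_L2 M (\<lambda>\<omega>. f \<omega> - Y \<omega>) < \<delta>" by blast
qed

lemma future_approx_add:
  assumes "future_approx f" "future_approx g" shows "future_approx (\<lambda>\<omega>. f \<omega> + g \<omega>)"
  unfolding future_approx_def
proof (intro conjI allI impI)
  have f: "sqint M f" and g: "sqint M g" using assms by (simp_all add: future_approx_def)
  then show "sqint M (\<lambda>\<omega>. f \<omega> + g \<omega>)" by (rule sqint_add)
  fix \<delta> :: real assume "\<delta> > 0"
  then have d: "\<delta> / 2 > 0" by simp
  obtain n Y where Y: "Y \<in> borel_measurable (F (int n))" "sqint M Y" "norm_L2 M (\<lambda>\<omega>. f \<omega> - Y \<omega>) < \<delta> / 2"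
    by (rule future_approxD[OF assms(1) d])
  obtain m Z where Z: "Z \<in> borel_measurable (F (int m))" "sqint M Z" "norm_L2 M (\<lambda>\<omega>. g \<omega> - Z \<omega>) < \<delta> / 2"
    by (rule future_approxD[OF assms(2) d])
  have "(\<lambda>\<omega>. Y \<omega> + Z \<omega>) \<in> borel_measurable (F (int (max n m)))"
    using measurable_F_mono[OF Y(1), of "int (max n m)"] measurable_F_mono[OF Z(1), of "int (max n m)"] by simp
  moreover have "norm_L2 M (\<lambda>\<omega>. (f \<omega> + g \<omega>) - (Y \<omega> + Z \<omega>)) < \<delta>"
    using norm_L2_triangle[OF sqint_diff[OF f Y(2)] sqint_diff[OF g Z(2)]] Y(3) Z(3) by (simp add: algebra_simps)
  ultimately show "\<exists>n W. W \<in> borel_measurable (F (int n)) \<and> sqint M W \<and> norm_L2 M (\<lambda>\<omega>. (f \<omega> + g \<omega>) - W \<omega>) < \<delta>"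
    using sqint_add[OF Y(2) Z(2)] by blast
qed

lemma future_approx_measurable: "Y \<in> borel_measurable (F (int n)) \<Longrightarrow> sqint M Y \<Longrightarrow> future_approx Y"
  unfolding future_approx_def by (auto simp: norm_L2_def intro!: exI[of _ n] exI[of _ Y])

lemma future_approx_cmult:
  assumes "future_approx f" shows "future_approx (\<lambda>\<omega>. c * f \<omega>)"
  unfolding future_approx_def
proof (intro conjI allI impI)
  have f: "sqint M f" using assms by (simp add: future_approx_def)
  then show "sqint M (\<lambda>\<omega>. c * f \<omega>)" by (rule sqint_cmult)
  fix \<delta> :: real assume "\<delta> > 0"
  \<comment> \<open>The added 1 keeps the quotient meaningful for c = 0.\<close>
  then have d: "\<delta> / (\<bar>c\<bar> + 1) > 0" by simp
  obtain n Y where Y: "Y \<in> borel_measurable (F (int n))" "sqint M Y" "norm_L2 M (\<lambda>\<omega>. f \<omega> - Y \<omega>) < \<delta> / (\<bar>c\<bar> + 1)"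
    by (rule future_approxD[OF assms(1) d])
  have "norm_L2 M (\<lambda>\<omega>. c * f \<omega> - c * Y \<omega>) = \<bar>c\<bar> * norm_L2 M (\<lambda>\<omega>. f \<omega> - Y \<omega>)"
    using norm_L2_cmult[of M c "\<lambda>\<omega>. f \<omega> - Y \<omega>"] by (simp add: right_diff_distrib)
  also have "\<dots> \<le> (\<bar>c\<bar> + 1) * norm_L2 M (\<lambda>\<omega>. f \<omega> - Y \<omega>)" by (intro mult_right_mono) auto
  also have "\<dots> < \<delta>" using Y(3) by (simp add: field_simps)
  finally have "norm_L2 M (\<lambda>\<omega>. c * f \<omega> - c * Y \<omega>) < \<delta>" .
  moreover have "(\<lambda>\<omega>. c * Y \<omega>) \<in> borel_measurable (F (int n))" using Y(1) by simp
  ultimately show "\<exists>n W. W \<in> borel_measurable (F (int n)) \<and> sqint M W \<and> norm_L2 M (\<lambda>\<omega>. c * f \<omega> - W \<omega>) < \<delta>"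
    using sqint_cmult[OF Y(2)] by blast
qed

lemma future_approx_const: "future_approx (\<lambda>_. c)"
  by (rule future_approx_measurable[of _ 0]) simp_all

lemma future_approx_sum: "(\<And>i. i \<in> I \<Longrightarrow> future_approx (f i)) \<Longrightarrow> future_approx (\<lambda>\<omega>. \<Sum>i\<in>I. f i \<omega>)"
proof (induction I rule: infinite_finite_induct)
  case (insert x J)
  then show ?case using future_approx_add[of "f x" "\<lambda>\<omega>. \<Sum>i\<in>J. f i \<omega>"] by simp
qed (simp_all add: future_approx_const)

lemma sets_filtr_all: "sets (filtr_all M T F0) = sigma_sets (space M) (\<Union>i. sets (F i))"
proof -
  have "(\<Union>i. sets (F i)) \<subseteq> Pow (space M)" using sets.sets_into_space[of _ "F _"] by fastforce
  then show ?thesis by (simp add: filtr_all_def)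
qed

text \<open>Dynkin's argument: the sets known at some finite time form a generator stable under
  intersection, and approximability of the indicator passes to complements and to countable disjoint
  unions, in the latter case by dominated convergence of the partial sums.\<close>

lemma future_approx_indicator:
  assumes "A \<in> sets (filtr_all M T F0)"
  shows "A \<in> sets M \<and> future_approx (indicator A)"
proof -
  have sub: "(\<Union>i. sets (F i)) \<subseteq> Pow (space M)" using sets.sets_into_space[of _ "F _"] by fastforce
  have "Int_stable (\<Union>i. sets (F i))"
  proof (rule Int_stableI)
    fix A B assume "A \<in> (\<Union>i. sets (F i))" "B \<in> (\<Union>i. sets (F i))"
    then obtain i k where "A \<in> sets (F i)" "B \<in> sets (F k)" by blast
    then have "A \<inter> B \<in> sets (F (max i k))" using F_mono[of i "max i k"] F_mono[of k "max i k"] by auto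
    then show "A \<inter> B \<in> (\<Union>i. sets (F i))" by blast
  qed
  from this sub assms[unfolded sets_filtr_all] show ?thesis
  proof (induction A rule: sigma_sets_induct_disjoint)
    case (basic A)
    then obtain i where A: "A \<in> sets (F i)" by blast
    \<comment> \<open>\<open>future_approx\<close> offers nonnegative times only, so a negative i is
      raised to 0.\<close>
    then have "A \<in> sets (F (int (nat i)))" using F_mono[of i "int (nat i)"] by auto
    moreover have "A \<in> sets M" using A subalg_F by (auto simp: subalgebra_def)
    ultimately show ?case
      by (auto intro!: future_approx_measurable[of _ "nat i"] sqint_bounded[where B=1] simp: indicator_def)
  next
    case empty
    then show ?case using future_approx_const[of 0] by simp
  next
    case (compl A)
    have "future_approx (\<lambda>\<omega>. 1 + (-1) * indicator A \<omega>)"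
      using compl by (intro future_approx_add future_approx_const future_approx_cmult) auto
    moreover have "sqint M (indicator (space M - A) :: 'a \<Rightarrow> real)"
      using compl by (auto intro!: sqint_bounded[where B=1] simp: indicator_def)
    ultimately have "future_approx (indicator (space M - A))"
    proof (intro future_approx_closed)
      fix \<delta> :: real assume "\<delta> > 0"
      \<comment> \<open>The two functions agree on \<open>space M\<close> but not outside it, hence
        the comparison under the integral and the detour through
        \<open>future_approx_closed\<close>.\<close>
      have "norm_L2 M (\<lambda>\<omega>. indicator (space M - A) \<omega> - (1 + - 1 * indicator A \<omega>)) = norm_L2 M (\<lambda>_. 0)"
        unfolding norm_L2_def by (intro arg_cong[where f=sqrt] Bochner_Integration.integral_cong) (auto simp: indicator_def)
      then show "\<exists>f'. future_approx f' \<and> norm_L2 M (\<lambda>\<omega>. indicator (space M - A) \<omega> - f' \<omega>) < \<delta>"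
        using \<open>future_approx (\<lambda>\<omega>. 1 + (-1) * indicator A \<omega>)\<close> \<open>\<delta> > 0\<close>
        by (intro exI[of _ "\<lambda>\<omega>. 1 + (-1) * indicator A \<omega>"]) (simp add: norm_L2_def)
    qed
    then show ?case using compl by auto
  next
    case (union A)
    have AM: "A i \<in> sets M" for i using union by blast
    then have UM: "(\<Union>i. A i) \<in> sets M" by blast
    have "future_approx (indicator (\<Union>i. A i))"
    proof (rule future_approx_closed)
      show "sqint M (indicator (\<Union>i. A i) :: 'a \<Rightarrow> real)"
        using UM by (auto intro!: sqint_bounded[where B=1] simp: indicator_def)
      fix \<delta> :: real assume "\<delta> > 0"
      let ?S = "\<lambda>n \<omega>. \<Sum>i<n. indicator (A i) \<omega> :: real"
      have S: "?S n \<omega> = indicator (\<Union>i<n. A i) \<omega>" for n \<omega>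
        using union(1) by (subst indicator_UN_disjoint) (auto simp: disjoint_family_on_def)
      have "(\<lambda>n. \<integral>\<omega>. (indicator (\<Union>i. A i) \<omega> - ?S n \<omega>)\<^sup>2 \<partial>M) \<longlonglongrightarrow> (\<integral>\<omega>. 0 \<partial>M)"
      proof (rule integral_dominated_convergence[where w="\<lambda>_. 1"])
        have "(\<lambda>n. ?S n \<omega>) \<longlonglongrightarrow> indicator (\<Union>i. A i) \<omega>" for \<omega>
          unfolding S by (rule LIMSEQ_indicator_UN)
        then have "(\<lambda>n. (indicator (\<Union>i. A i) \<omega> - ?S n \<omega>)\<^sup>2) \<longlonglongrightarrow> (indicator (\<Union>i. A i) \<omega> - indicator (\<Union>i. A i) \<omega>)\<^sup>2" for \<omega>
          by (intro tendsto_intros)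
        then show "AE \<omega> in M. (\<lambda>n. (indicator (\<Union>i. A i) \<omega> - ?S n \<omega>)\<^sup>2) \<longlonglongrightarrow> 0" by simp
        show "AE \<omega> in M. norm ((indicator (\<Union>i. A i) \<omega> - ?S n \<omega>)\<^sup>2) \<le> 1" for n
          unfolding S by (auto simp: indicator_def)
      qed (use AM UM in auto)
      then have "(\<lambda>n. norm_L2 M (\<lambda>\<omega>. indicator (\<Union>i. A i) \<omega> - ?S n \<omega>)) \<longlonglongrightarrow> 0"
        unfolding norm_L2_def using tendsto_real_sqrt by fastforce
      then have "\<forall>\<^sub>F n in sequentially. norm_L2 M (\<lambda>\<omega>. indicator (\<Union>i. A i) \<omega> - ?S n \<omega>) < \<delta>"
        using \<open>\<delta> > 0\<close> by (rule order_tendstoD)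
      then obtain n where "norm_L2 M (\<lambda>\<omega>. indicator (\<Union>i. A i) \<omega> - ?S n \<omega>) < \<delta>" by (auto simp: eventually_sequentially)
      moreover have "future_approx (?S n)" by (rule future_approx_sum) (use union in auto)
      ultimately show "\<exists>f'. future_approx f' \<and> norm_L2 M (\<lambda>\<omega>. indicator (\<Union>i. A i) \<omega> - f' \<omega>) < \<delta>" by blast
    qed
    with UM show ?case by blast
  qed
qed

text \<open>A bounded function is the uniform limit of the step functions \<open>\<lfloor>mf\<rfloor>/m\<close>.\<close>

lemma future_approx_filtr_all:
  assumes f: "sqint M f" and fm: "f \<in> borel_measurable (filtr_all M T F0)"
  shows "future_approx f"
proof (rule future_approx_closed[OF f])
  fix \<delta> :: real assume "\<delta> > 0"
  then obtain A where A: "A \<ge> 0" "norm_L2 M (\<lambda>x. f x - (if \<bar>f x\<bar> \<le> A then f x else 0)) < \<delta> / 2"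
    using sqint_truncation[OF f, of "\<delta> / 2"] by auto
  define g where "g x = (if \<bar>f x\<bar> \<le> A then f x else 0)" for x
  have [measurable]: "f \<in> borel_measurable M" using f by (simp add: sqint_def)
  have gM[measurable]: "g \<in> borel_measurable M" unfolding g_def by measurable
  have sp: "space (filtr_all M T F0) = space M" by (simp add: filtr_all_def space_measure_of_conv)
  have gm: "g \<in> borel_measurable (filtr_all M T F0)" unfolding g_def using fm by measurable
  obtain m :: nat where m: "m > 0" "1 / real m < \<delta> / 2"
    using real_arch_inverse[of "\<delta> / 2"] \<open>\<delta> > 0\<close> by (auto simp: inverse_eq_divide)
  define L where "L = \<lceil>A * m\<rceil> + 1"
  define B where "B k = {\<omega> \<in> space M. \<lfloor>g \<omega> * m\<rfloor> = k}" for k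
  define s where "s \<omega> = (\<Sum>k\<in>{-L..L}. (of_int k / m) * indicator (B k) \<omega>)" for \<omega>
  have "B k \<in> sets (filtr_all M T F0)" for k
  proof -
    have "{\<omega> \<in> space (filtr_all M T F0). \<lfloor>g \<omega> * m\<rfloor> = k} \<in> sets (filtr_all M T F0)" using gm by measurable
    then show ?thesis by (simp add: B_def sp)
  qed
  then have fs: "future_approx s" unfolding s_def
    using future_approx_indicator by (intro future_approx_sum future_approx_cmult) auto
  have sv: "s \<omega> = of_int \<lfloor>g \<omega> * m\<rfloor> / m" if "\<omega> \<in> space M" for \<omega>
  proof -
    have "\<bar>g \<omega> * m\<bar> \<le> A * m" using A(1) by (auto simp: g_def abs_mult intro!: mult_right_mono)
    then have "- L \<le> \<lfloor>g \<omega> * m\<rfloor>" "\<lfloor>g \<omega> * m\<rfloor> \<le> L" unfolding L_def by linarith+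
    then have "s \<omega> = (\<Sum>k\<in>{\<lfloor>g \<omega> * m\<rfloor>}. (of_int k / m) * indicator (B k) \<omega>)" unfolding s_def
      by (intro sum.mono_neutral_right) (auto simp: B_def indicator_def)
    then show ?thesis using that by (simp add: B_def)
  qed
  have cl: "\<bar>g \<omega> - s \<omega>\<bar> \<le> 1 / m" if "\<omega> \<in> space M" for \<omega>
  proof -
    have "g \<omega> - s \<omega> = (g \<omega> * m - of_int \<lfloor>g \<omega> * m\<rfloor>) / m" using m by (simp add: sv[OF that] field_simps)
    moreover have "\<bar>g \<omega> * m - of_int \<lfloor>g \<omega> * m\<rfloor>\<bar> \<le> 1" by linarith
    ultimately show ?thesis using m by (simp add: abs_divide divide_right_mono)
  qed
  have ssq: "sqint M s" using fs by (simp add: future_approx_def)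
  have gsq: "sqint M g" by (rule sqint_bounded[where B=A]) (use A in \<open>auto simp: g_def\<close>)
  have "(\<integral>\<omega>. (g \<omega> - s \<omega>)\<^sup>2 \<partial>M) \<le> (\<integral>\<omega>. (1 / m)\<^sup>2 \<partial>M)"
  proof (rule integral_mono)
    show "integrable M (\<lambda>\<omega>. (g \<omega> - s \<omega>)\<^sup>2)" using sqint_diff[OF gsq ssq] by (simp add: sqint_def)
    show "(g \<omega> - s \<omega>)\<^sup>2 \<le> (1 / m)\<^sup>2" if "\<omega> \<in> space M" for \<omega>
      using power_mono[OF cl[OF that], of 2] by simp
  qed simp
  then have "norm_L2 M (\<lambda>\<omega>. g \<omega> - s \<omega>) \<le> sqrt ((1 / m)\<^sup>2)"
    unfolding norm_L2_def by (intro real_sqrt_le_mono) (simp add: prob_space)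
  then have "norm_L2 M (\<lambda>\<omega>. g \<omega> - s \<omega>) < \<delta> / 2" using m by simp
  then have "norm_L2 M (\<lambda>\<omega>. f \<omega> - s \<omega>) < \<delta>"
    using norm_L2_dist_triangle[OF f gsq ssq] A(2) unfolding g_def[symmetric] by linarith
  with fs show "\<exists>f'. future_approx f' \<and> norm_L2 M (\<lambda>\<omega>. f \<omega> - f' \<omega>) < \<delta>" by blast
qed

text \<open>At every time from n on, the conditional expectation is at least as close to f as any
  given approximant known at time n.\<close>

lemma CE_future_tendsto:
  assumes f: "sqint M f" and fm: "f \<in> borel_measurable (filtr_all M T F0)"
  shows "(\<lambda>n. norm_L2 M (\<lambda>\<omega>. f \<omega> - CE (int n) f \<omega>)) \<longlonglongrightarrow> 0"
proof (rule LIMSEQ_I)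
  fix e :: real assume "e > 0"
  obtain n Y where Y: "Y \<in> borel_measurable (F (int n))" "sqint M Y" "norm_L2 M (\<lambda>\<omega>. f \<omega> - Y \<omega>) < e"
    using future_approxD[OF future_approx_filtr_all[OF f fm] \<open>e > 0\<close>] .
  have "norm_L2 M (\<lambda>\<omega>. f \<omega> - CE (int k) f \<omega>) < e" if "k \<ge> n" for k
    using CE_best_approx[OF f Y(2) measurable_F_mono[OF Y(1)], of "int k"] Y(3) that by simp
  then show "\<exists>N. \<forall>n\<ge>N. norm (norm_L2 M (\<lambda>\<omega>. f \<omega> - CE (int n) f \<omega>) - 0) < e" by auto
qed

end

section \<open>Innovations and Hannan's condition\<close>

lemma integral_sum_sq_orthogonal:
  fixes f :: "'i \<Rightarrow> 'a \<Rightarrow> real"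
  assumes "finite I" "\<And>i. i \<in> I \<Longrightarrow> sqint M (f i)"
    and "\<And>i j. i \<in> I \<Longrightarrow> j \<in> I \<Longrightarrow> i \<noteq> j \<Longrightarrow> (\<integral>x. f i x * f j x \<partial>M) = 0"
  shows "(\<integral>x. (\<Sum>i\<in>I. f i x)\<^sup>2 \<partial>M) = (\<Sum>i\<in>I. \<integral>x. (f i x)\<^sup>2 \<partial>M)"
  using assms
proof (induction I rule: finite_induct)
  case (insert i J)
  let ?S = "\<lambda>x. \<Sum>j\<in>J. f j x"
  have S: "sqint M ?S" using insert by (intro sqint_sum) auto
  have fi: "sqint M (f i)" using insert by auto
  have "(\<integral>x. f i x * ?S x \<partial>M) = (\<Sum>j\<in>J. \<integral>x. f i x * f j x \<partial>M)"
    unfolding sum_distrib_left using insert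
    by (intro Bochner_Integration.integral_sum sqint_mult_integrable) auto
  also have "\<dots> = 0" using insert by (intro sum.neutral) auto
  finally have 0: "(\<integral>x. f i x * ?S x \<partial>M) = 0" .
  have "(\<integral>x. (\<Sum>j\<in>insert i J. f j x)\<^sup>2 \<partial>M) = (\<integral>x. (f i x)\<^sup>2 + (?S x)\<^sup>2 + 2 * (f i x * ?S x) \<partial>M)"
    using insert by (simp add: power2_sum mult.assoc)
  also have "\<dots> = (\<integral>x. (f i x)\<^sup>2 \<partial>M) + (\<integral>x. (?S x)\<^sup>2 \<partial>M)"
    using fi S 0 sqint_mult_integrable[OF fi S] by (simp add: sqint_def)
  finally show ?case using insert by simp
qed simp

section \<open>Innovations and their linear combinations\<close>

context stationary_filtration
begin

text \<open>A martingale difference at time 0, expressed by orthogonality to the square integrable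
  past instead of a vanishing conditional expectation. No choice of an almost sure version is
  involved, and differences inherit the property at once.\<close>

definition innovation :: "('a \<Rightarrow> real) \<Rightarrow> bool" where
  "innovation \<mu> \<longleftrightarrow> sqint M \<mu> \<and> \<mu> \<in> borel_measurable (F 0) \<and>
     (\<forall>Y. sqint M Y \<longrightarrow> Y \<in> borel_measurable (F (-1)) \<longrightarrow> (\<integral>\<omega>. \<mu> \<omega> * Y \<omega> \<partial>M) = 0)"

lemma innovation_sqint: "innovation \<mu> \<Longrightarrow> sqint M \<mu>"
  by (simp add: innovation_def)

lemma innovation_measurable: "innovation \<mu> \<Longrightarrow> (\<lambda>\<omega>. \<mu> (It i \<omega>)) \<in> borel_measurable (F i)"
  using measurable_F_it[of \<mu> 0 i] by (simp add: innovation_def)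

lemma innovation_orthogonal:
  assumes mu: "innovation \<mu>" and Y: "sqint M Y" "Y \<in> borel_measurable (F (i - 1))"
  shows "(\<integral>\<omega>. \<mu> (It i \<omega>) * Y \<omega> \<partial>M) = 0"
proof -
  have Y': "(\<lambda>\<omega>. Y (It (- i) \<omega>)) \<in> borel_measurable (F (-1))"
    using measurable_F_it[OF Y(2), of "- i"] by simp
  have m: "(\<lambda>\<omega>. \<mu> \<omega> * Y (It (- i) \<omega>)) \<in> borel_measurable M"
    using innovation_sqint[OF mu] sqint_it[OF Y(1), of "- i"]
    by (intro borel_measurable_times) (simp_all add: sqint_def)
  have "(\<integral>\<omega>. \<mu> (It i \<omega>) * Y \<omega> \<partial>M) = (\<integral>\<omega>. \<mu> (It i \<omega>) * Y (It (- i) (It i \<omega>)) \<partial>M)"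
    by (rule Bochner_Integration.integral_cong) (auto simp: it_add)
  also have "\<dots> = (\<integral>\<omega>. \<mu> \<omega> * Y (It (- i) \<omega>) \<partial>M)" by (rule integral_it[OF m])
  also have "\<dots> = 0" using mu sqint_it[OF Y(1)] Y' by (simp add: innovation_def)
  finally show ?thesis .
qed

lemma innovation_pairwise:
  assumes "innovation \<mu>" "innovation \<nu>" "i \<noteq> j"
  shows "(\<integral>\<omega>. \<mu> (It i \<omega>) * \<nu> (It j \<omega>) \<partial>M) = 0"
proof (cases "j < i")
  case True
  then have "(\<lambda>\<omega>. \<nu> (It j \<omega>)) \<in> borel_measurable (F (i - 1))"
    using measurable_F_mono[OF innovation_measurable[OF assms(2), of j], of "i - 1"] by simp
  then show ?thesis by (rule innovation_orthogonal[OF assms(1) sqint_it[OF innovation_sqint[OF assms(2)]]])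
next
  case False
  then have "(\<lambda>\<omega>. \<mu> (It i \<omega>)) \<in> borel_measurable (F (j - 1))"
    using assms(3) measurable_F_mono[OF innovation_measurable[OF assms(1), of i], of "j - 1"] by simp
  then show ?thesis
    using innovation_orthogonal[OF assms(2) sqint_it[OF innovation_sqint[OF assms(1)]]] by (simp add: mult.commute)
qed

text \<open>Distinct shifts of one innovation are orthogonal and have the same norm, so forming
  linear combinations is an isometry of coefficient space up to the factor
  \<open>norm_L2 M \<mu>\<close>.\<close>

lemma innovation_lincomb_norm:
  assumes mu: "innovation \<mu>" and "finite I"
  shows "norm_L2 M (\<lambda>\<omega>. \<Sum>i\<in>I. a i * \<mu> (It (i - k) \<omega>)) = norm_L2 M \<mu> * sqrt (\<Sum>i\<in>I. (a i)\<^sup>2)"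
proof -
  have "(\<integral>\<omega>. (\<Sum>i\<in>I. a i * \<mu> (It (i - k) \<omega>))\<^sup>2 \<partial>M) = (\<Sum>i\<in>I. \<integral>\<omega>. (a i * \<mu> (It (i - k) \<omega>))\<^sup>2 \<partial>M)"
  proof (rule integral_sum_sq_orthogonal[OF \<open>finite I\<close>])
    show "sqint M (\<lambda>\<omega>. a i * \<mu> (It (i - k) \<omega>))" for i
      by (intro sqint_cmult sqint_it innovation_sqint mu)
    fix i j assume "i \<noteq> (j :: int)"
    then have "(\<integral>\<omega>. \<mu> (It (i - k) \<omega>) * \<mu> (It (j - k) \<omega>) \<partial>M) = 0" by (intro innovation_pairwise mu) simp
    moreover have "(\<integral>\<omega>. (a i * \<mu> (It (i - k) \<omega>)) * (a j * \<mu> (It (j - k) \<omega>)) \<partial>M)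
        = (\<integral>\<omega>. (a i * a j) * (\<mu> (It (i - k) \<omega>) * \<mu> (It (j - k) \<omega>)) \<partial>M)"
      by (simp add: algebra_simps)
    ultimately show "(\<integral>\<omega>. (a i * \<mu> (It (i - k) \<omega>)) * (a j * \<mu> (It (j - k) \<omega>)) \<partial>M) = 0" by simp
  qed
  also have "\<dots> = (\<Sum>i\<in>I. (a i)\<^sup>2 * (norm_L2 M \<mu>)\<^sup>2)"
  proof (rule sum.cong[OF refl])
    fix i
    have "norm_L2 M (\<lambda>\<omega>. \<mu> (It (i - k) \<omega>)) = norm_L2 M \<mu>"
      by (rule norm_L2_it) (use innovation_sqint[OF mu] in \<open>simp add: sqint_def\<close>)
    then show "(\<integral>\<omega>. (a i * \<mu> (It (i - k) \<omega>))\<^sup>2 \<partial>M) = (a i)\<^sup>2 * (norm_L2 M \<mu>)\<^sup>2"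
      unfolding norm_L2_sq[symmetric] norm_L2_cmult by (simp add: power_mult_distrib)
  qed
  finally show ?thesis unfolding norm_L2_def[of M "\<lambda>\<omega>. \<Sum>i\<in>I. a i * \<mu> (It (i - k) \<omega>)"]
    by (simp add: sum_distrib_right[symmetric] real_sqrt_mult)
qed

text \<open>This is the source of Hannan's bound. Exchanging the sums groups the terms by lag; each
  group is handled isometrically, and the triangle inequality over the lags adds up the norms of the
  innovations.\<close>

lemma innovation_array_norm:
  assumes mu: "\<And>k. k \<in> K \<Longrightarrow> innovation (\<mu> k)" and "finite I" "finite K"
  shows "norm_L2 M (\<lambda>\<omega>. \<Sum>i\<in>I. a i * (\<Sum>k\<in>K. \<mu> k (It (i - k) \<omega>))) \<le> (\<Sum>k\<in>K. norm_L2 M (\<mu> k)) * sqrt (\<Sum>i\<in>I. (a i)\<^sup>2)"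
proof -
  have "(\<lambda>\<omega>. \<Sum>i\<in>I. a i * (\<Sum>k\<in>K. \<mu> k (It (i - k) \<omega>))) = (\<lambda>\<omega>. \<Sum>k\<in>K. \<Sum>i\<in>I. a i * \<mu> k (It (i - k) \<omega>))"
    unfolding sum_distrib_left by (rule ext) (rule sum.swap)
  then have "norm_L2 M (\<lambda>\<omega>. \<Sum>i\<in>I. a i * (\<Sum>k\<in>K. \<mu> k (It (i - k) \<omega>))) \<le> (\<Sum>k\<in>K. norm_L2 M (\<lambda>\<omega>. \<Sum>i\<in>I. a i * \<mu> k (It (i - k) \<omega>)))"
    by (simp only:) (intro norm_L2_sum sqint_sum sqint_cmult sqint_it innovation_sqint mu)
  also have "\<dots> = (\<Sum>k\<in>K. norm_L2 M (\<mu> k)) * sqrt (\<Sum>i\<in>I. (a i)\<^sup>2)"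
    unfolding sum_distrib_right using mu \<open>finite I\<close> by (intro sum.cong innovation_lincomb_norm) auto
  finally show ?thesis .
qed

lemma innovation_diff:
  assumes "innovation \<mu>" "innovation \<nu>" shows "innovation (\<lambda>\<omega>. \<mu> \<omega> - \<nu> \<omega>)"
  unfolding innovation_def
proof (intro conjI allI impI)
  have m: "sqint M \<mu>" "sqint M \<nu>" using assms by (simp_all add: innovation_def)
  then show "sqint M (\<lambda>\<omega>. \<mu> \<omega> - \<nu> \<omega>)" by (rule sqint_diff)
  show "(\<lambda>\<omega>. \<mu> \<omega> - \<nu> \<omega>) \<in> borel_measurable (F 0)"
    using assms by (intro borel_measurable_diff) (simp_all add: innovation_def)
  fix Y assume Y: "sqint M Y" "Y \<in> borel_measurable (F (-1))"
  then have "(\<integral>\<omega>. \<mu> \<omega> * Y \<omega> \<partial>M) = 0" "(\<integral>\<omega>. \<nu> \<omega> * Y \<omega> \<partial>M) = 0" using assms by (simp_all add: innovation_def)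
  then show "(\<integral>\<omega>. (\<mu> \<omega> - \<nu> \<omega>) * Y \<omega> \<partial>M) = 0"
    using sqint_mult_integrable[OF m(1) Y(1)] sqint_mult_integrable[OF m(2) Y(1)] by (simp add: left_diff_distrib)
qed

text \<open>Truncate at level \<open>A\<close> and recentre; clipping the conditional expectation to \<open>[-A, A]\<close>, where
  it lies almost surely, makes the bound hold everywhere.\<close>

lemma innovation_truncation:
  assumes mu: "innovation \<mu>" and "\<delta> > 0"
  obtains \<mu>' B where "innovation \<mu>'" "\<And>\<omega>. \<bar>\<mu>' \<omega>\<bar> \<le> B" "norm_L2 M (\<lambda>\<omega>. \<mu> \<omega> - \<mu>' \<omega>) < \<delta>"
proof -
  note ms = innovation_sqint[OF mu]
  obtain A where A: "A \<ge> 0" "norm_L2 M (\<lambda>x. \<mu> x - (if \<bar>\<mu> x\<bar> \<le> A then \<mu> x else 0)) < \<delta> / 2"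
    using sqint_truncation[OF ms, of "\<delta> / 2"] \<open>\<delta> > 0\<close> by auto
  define \<tau> where "\<tau> x = (if \<bar>\<mu> x\<bar> \<le> A then \<mu> x else 0)" for x
  have "\<mu> \<in> borel_measurable (F 0)" using mu by (simp add: innovation_def)
  then have tF: "\<tau> \<in> borel_measurable (F 0)" unfolding \<tau>_def by measurable
  have tb: "\<bar>\<tau> x\<bar> \<le> A" for x using A(1) by (simp add: \<tau>_def)
  have ts: "sqint M \<tau>" by (rule sqint_bounded[OF measurable_F_M[OF tF] tb])
  define c where "c = CE (-1) \<tau>"
  define c' where "c' x = max (- A) (min A (c x))" for x
  have cF: "c \<in> borel_measurable (F (-1))" by (simp add: c_def)
  have c'F: "c' \<in> borel_measurable (F (-1))" unfolding c'_def using cF by measurable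
  have cs: "sqint M c" unfolding c_def by (rule CE_sqint[OF ts])
  interpret C: sigma_finite_subalgebra M "F (-1)" by (rule sigma_finite_F)
  have "AE x in M. c x \<le> A" unfolding c_def
    by (rule C.real_cond_exp_le_c) (use sqint_integrable[OF ts] tb in \<open>auto simp: abs_le_iff\<close>)
  moreover have "AE x in M. c x \<ge> - A" unfolding c_def
    by (rule C.real_cond_exp_ge_c) (use sqint_integrable[OF ts] tb in \<open>auto simp: abs_le_iff minus_le_iff\<close>)
  ultimately have AEc: "AE x in M. c x = c' x" by eventually_elim (auto simp: c'_def)
  have c'M: "c' \<in> borel_measurable M" by (rule measurable_F_M[OF c'F])
  have c's: "sqint M c'" by (rule sqint_AE_cong[OF cs AEc c'M])
  define \<mu>' where "\<mu>' x = \<tau> x - c' x" for x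
  have inn: "innovation \<mu>'" unfolding innovation_def
  proof (intro conjI allI impI)
    show "sqint M \<mu>'" unfolding \<mu>'_def by (rule sqint_diff[OF ts c's])
    show "\<mu>' \<in> borel_measurable (F 0)"
      unfolding \<mu>'_def using tF measurable_F_mono[OF c'F, of 0] by simp
    fix Y assume Y: "sqint M Y" "Y \<in> borel_measurable (F (-1))"
    have "(\<integral>\<omega>. Y \<omega> * c' \<omega> \<partial>M) = (\<integral>\<omega>. Y \<omega> * c \<omega> \<partial>M)"
      by (rule integral_cong_AE) (use AEc c's cs Y in \<open>auto simp: sqint_def\<close>)
    also have "\<dots> = (\<integral>\<omega>. Y \<omega> * \<tau> \<omega> \<partial>M)" unfolding c_def by (rule CE_inner[OF ts Y])
    finally show "(\<integral>\<omega>. \<mu>' \<omega> * Y \<omega> \<partial>M) = 0"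
      using sqint_mult_integrable[OF Y(1) ts] sqint_mult_integrable[OF Y(1) c's]
      by (simp add: \<mu>'_def right_diff_distrib mult.commute[of _ "Y _"])
  qed
  have bd: "\<bar>\<mu>' x\<bar> \<le> 2 * A" for x
    using tb[of x] A(1) by (auto simp: \<mu>'_def c'_def)
  \<comment> \<open>Since \<mu> is orthogonal to the past, c is also the projection of \<tau> -
    \<mu>. Recentring therefore costs no more than the truncation itself.\<close>
  have "(norm_L2 M c)\<^sup>2 = (\<integral>\<omega>. c \<omega> * \<tau> \<omega> \<partial>M)"
    using CE_inner[OF ts cs cF] by (simp add: norm_L2_sq c_def power2_eq_square[of "CE _ _ _"])
  also have "\<dots> = (\<integral>\<omega>. c \<omega> * (\<tau> \<omega> - \<mu> \<omega>) \<partial>M)"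
    using mu cs cF sqint_mult_integrable[OF cs ts] sqint_mult_integrable[OF cs ms]
    by (simp add: innovation_def right_diff_distrib mult.commute[of "\<mu> _"])
  also have "\<dots> \<le> norm_L2 M c * norm_L2 M (\<lambda>\<omega>. \<tau> \<omega> - \<mu> \<omega>)"
    using integral_mult_le_norm_L2[OF cs sqint_diff[OF ts ms]] by linarith
  finally have *: "norm_L2 M c * norm_L2 M c \<le> norm_L2 M c * norm_L2 M (\<lambda>\<omega>. \<tau> \<omega> - \<mu> \<omega>)"
    unfolding power2_eq_square[of "norm_L2 M c"] .
  have cn: "norm_L2 M c \<le> norm_L2 M (\<lambda>\<omega>. \<tau> \<omega> - \<mu> \<omega>)"
  proof (cases "norm_L2 M c = 0")
    case False
    then have "0 < norm_L2 M c" by (simp add: less_le)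
    then show ?thesis using * by (rule mult_left_le_imp_le[rotated])
  qed simp
  have mt: "norm_L2 M (\<lambda>\<omega>. \<mu> \<omega> - \<tau> \<omega>) < \<delta> / 2" using A(2) by (simp add: \<tau>_def)
  have "norm_L2 M c' = norm_L2 M c"
    by (rule norm_L2_AE_cong) (use AEc c's cs in \<open>auto simp: sqint_def\<close>)
  then have cn': "norm_L2 M c' < \<delta> / 2" using cn mt by (simp add: norm_L2_minus_commute[of M \<tau>])
  have "(\<lambda>\<omega>. \<mu> \<omega> - \<mu>' \<omega>) = (\<lambda>\<omega>. (\<mu> \<omega> - \<tau> \<omega>) + c' \<omega>)" by (auto simp: \<mu>'_def)
  then have "norm_L2 M (\<lambda>\<omega>. \<mu> \<omega> - \<mu>' \<omega>) < \<delta>"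
    using norm_L2_triangle[OF sqint_diff[OF ms ts] c's] mt cn' by simp
  with inn bd show ?thesis using that by blast
qed

end

section \<open>The projective decomposition of the noise\<close>

locale hannan_process = stationary_filtration M T F0 for M :: "'a measure" and T F0 +
  fixes \<epsilon> :: "int \<Rightarrow> 'a \<Rightarrow> real"
  assumes eps_stat: "\<omega> \<in> space M \<Longrightarrow> \<epsilon> i \<omega> = \<epsilon> 0 (int_iterate M T i \<omega>)"
    and eps_square_integrable: "integrable M (\<lambda>\<omega>. (\<epsilon> 0 \<omega>)\<^sup>2)"
    and eps_mean: "(\<integral>\<omega>. \<epsilon> 0 \<omega> \<partial>M) = 0"
    and eps_future_measurable: "\<epsilon> 0 \<in> borel_measurable (filtr_all M T F0)"
    and hannan: "(\<lambda>i. norm_L2 M (proj_incr M T F0 0 (\<epsilon> i))) summable_on UNIV"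
begin

lemma eps0_sqint: "sqint M (\<epsilon> 0)"
proof -
  have "sets (filtr_all M T F0) \<subseteq> sets M"
    unfolding sets_filtr_all by (rule sets.sigma_sets_subset) (use subalg_F in \<open>auto simp: subalgebra_def\<close>)
  moreover have "space (filtr_all M T F0) = space M" by (simp add: filtr_all_def space_measure_of_conv)
  ultimately have "\<epsilon> 0 \<in> borel_measurable M"
    using eps_future_measurable by (auto simp: measurable_def)
  then show ?thesis using eps_square_integrable by (simp add: sqint_def)
qed

lemma eps_sqint: "sqint M (\<epsilon> i)"
proof -
  have "\<epsilon> i \<in> borel_measurable M \<longleftrightarrow> (\<lambda>\<omega>. \<epsilon> 0 (It i \<omega>)) \<in> borel_measurable M"
    by (rule measurable_cong) (rule eps_stat)
  then have m: "\<epsilon> i \<in> borel_measurable M" using sqint_it[OF eps0_sqint, of i] by (simp add: sqint_def)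
  show ?thesis by (rule sqint_AE_cong[OF sqint_it[OF eps0_sqint, of i] _ m]) (auto simp: eps_stat[of _ i])
qed

definition innov :: "int \<Rightarrow> 'a \<Rightarrow> real" where
  "innov k = proj_incr M T F0 0 (\<epsilon> k)"

definition hannan_sum :: real where
  "hannan_sum = (\<Sum>\<^sub>\<infinity>k\<in>UNIV. norm_L2 M (innov k))"

text \<open>The summand k is a version of the projection increment of \<epsilon> i at time i - k,
  written as a shift of the increment at time 0. In this form every lag contributes one stationary
  sequence of innovations.\<close>

definition partial_proc :: "nat \<Rightarrow> int \<Rightarrow> 'a \<Rightarrow> real" where
  "partial_proc N i \<omega> = (\<Sum>k\<in>{- int N..int N}. innov k (It (i - k) \<omega>))"

lemma innov_eq: "innov k = (\<lambda>\<omega>. CE 0 (\<epsilon> k) \<omega> - CE (-1) (\<epsilon> k) \<omega>)"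
  by (simp add: innov_def proj_incr_def fun_eq_iff)

lemma innovation_innov: "innovation (innov k)"
  unfolding innovation_def
proof (intro conjI allI impI)
  show "sqint M (innov k)" unfolding innov_eq by (intro sqint_diff CE_sqint eps_sqint)
  have "CE (-1) (\<epsilon> k) \<in> borel_measurable (F 0)" using measurable_F_mono[OF CE_measurable, of "-1" 0] by simp
  then show "innov k \<in> borel_measurable (F 0)" unfolding innov_eq by simp
  fix Y assume Y: "sqint M Y" "Y \<in> borel_measurable (F (-1))"
  have Y0: "Y \<in> borel_measurable (F 0)" by (rule measurable_F_mono[OF Y(2)]) simp
  have "(\<integral>\<omega>. Y \<omega> * CE 0 (\<epsilon> k) \<omega> \<partial>M) = (\<integral>\<omega>. Y \<omega> * CE (-1) (\<epsilon> k) \<omega> \<partial>M)"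
    using CE_inner[OF eps_sqint Y(1) Y0] CE_inner[OF eps_sqint Y] by simp
  then show "(\<integral>\<omega>. innov k \<omega> * Y \<omega> \<partial>M) = 0"
    using sqint_mult_integrable[OF Y(1) CE_sqint[OF eps_sqint]]
    by (simp add: innov_eq right_diff_distrib mult.commute[of _ "Y _"])
qed

lemma summable_innov: "(\<lambda>k. norm_L2 M (innov k)) summable_on UNIV"
  using hannan by (simp add: innov_def)

lemma sum_innov_le: "finite K \<Longrightarrow> (\<Sum>k\<in>K. norm_L2 M (innov k)) \<le> hannan_sum"
  unfolding hannan_sum_def by (rule finite_sum_le_infsum[OF summable_innov]) auto

lemma hannan_sum_nonneg: "0 \<le> hannan_sum"
  using sum_innov_le[of "{}"] by simp

lemma partial_proc_sqint: "sqint M (partial_proc N i)"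
  unfolding partial_proc_def[abs_def] by (intro sqint_sum sqint_it innovation_sqint innovation_innov)

text \<open>Stationarity exchanges the roles of the index of the noise and the time of the
  projection: all increments now concern the single variable \<epsilon> 0 at varying times, so that
  their sum telescopes.\<close>

lemma innov_shift_AE: "AE \<omega> in M. innov k (It (- k) \<omega>) = CE (- k) (\<epsilon> 0) \<omega> - CE (- k - 1) (\<epsilon> 0) \<omega>"
proof -
  have *: "AE \<omega> in M. CE (b - k) (\<epsilon> 0) \<omega> = CE b (\<epsilon> k) (It (- k) \<omega>)" for b
  proof -
    interpret C: sigma_finite_subalgebra M "F (b - k)" by (rule sigma_finite_F)
    have m: "(\<lambda>\<omega>. \<epsilon> k (It (- k) \<omega>)) \<in> borel_measurable M" "\<epsilon> 0 \<in> borel_measurable M"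
      using sqint_it[OF eps_sqint, of k "- k"] eps0_sqint by (simp_all add: sqint_def)
    have "AE \<omega> in M. \<epsilon> k (It (- k) \<omega>) = \<epsilon> 0 \<omega>"
      by (rule AE_I2) (simp add: eps_stat[of _ k] it_space it_add)
    then have "AE \<omega> in M. CE (b - k) (\<lambda>\<omega>. \<epsilon> k (It (- k) \<omega>)) \<omega> = CE (b - k) (\<epsilon> 0) \<omega>"
      by (rule C.real_cond_exp_cong) fact+
    moreover have "AE \<omega> in M. CE (b - k) (\<lambda>\<omega>. \<epsilon> k (It (- k) \<omega>)) \<omega> = CE b (\<epsilon> k) (It (- k) \<omega>)"
      using CE_shift[OF sqint_integrable[OF eps_sqint[of k]], of b "- k"] by simp
    ultimately show ?thesis by eventually_elim simp
  qed
  have e: "- 1 - k = - k - 1" by simp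
  from *[of 0] *[of "-1", unfolded e] show ?thesis by eventually_elim (simp add: innov_eq)
qed

text \<open>Increments at the times -N to N telescope. An increment at time t subtracts the
  expectation at t - 1, so the lower remainder sits at -(N + 1).\<close>

lemma partial_proc_0_AE:
  "AE \<omega> in M. partial_proc N 0 \<omega> = CE (int N) (\<epsilon> 0) \<omega> - CE (- int (Suc N)) (\<epsilon> 0) \<omega>"
proof -
  have tele: "(\<Sum>k\<in>{- int N..int N}. c (- k) - c (- k - 1)) = c (int N) - c (- int (Suc N))" for c :: "int \<Rightarrow> real"
  proof (induction N)
    case (Suc N)
    have "{- int (Suc N)..int (Suc N)} = insert (- int (Suc N)) (insert (int (Suc N)) {- int N..int N})" by auto
    then show ?case using Suc by (simp add: algebra_simps)
  qed simp
  have "AE \<omega> in M. \<forall>k. innov k (It (- k) \<omega>) = CE (- k) (\<epsilon> 0) \<omega> - CE (- k - 1) (\<epsilon> 0) \<omega>"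
    unfolding AE_all_countable using innov_shift_AE by blast
  then show ?thesis
  proof eventually_elim
    case (elim \<omega>)
    then show ?case using tele[of "\<lambda>i. CE i (\<epsilon> 0) \<omega>"] by (simp add: partial_proc_def)
  qed
qed

text \<open>The error consists of the two ends of the telescoping sum. The upper one vanishes
  because \<epsilon> 0 is measurable for \<open>filtr_all\<close>, the lower one because the remote
  past is trivial and the mean is zero.\<close>

lemma partial_proc_tendsto: "(\<lambda>N. norm_L2 M (\<lambda>\<omega>. \<epsilon> i \<omega> - partial_proc N i \<omega>)) \<longlonglongrightarrow> 0"
proof -
  have le: "norm_L2 M (\<lambda>\<omega>. \<epsilon> i \<omega> - partial_proc N i \<omega>) \<le>
      norm_L2 M (\<lambda>\<omega>. \<epsilon> 0 \<omega> - CE (int N) (\<epsilon> 0) \<omega>) + norm_L2 M (CE (- int (Suc N)) (\<epsilon> 0))" for N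
  proof -
    let ?d = "\<lambda>\<omega>. \<epsilon> 0 \<omega> - partial_proc N 0 \<omega>"
    have d: "sqint M ?d" by (rule sqint_diff[OF eps0_sqint partial_proc_sqint])
    have "norm_L2 M (\<lambda>\<omega>. \<epsilon> i \<omega> - partial_proc N i \<omega>) = norm_L2 M (\<lambda>\<omega>. ?d (It i \<omega>))"
    proof (rule norm_L2_AE_cong)
      show "AE \<omega> in M. \<epsilon> i \<omega> - partial_proc N i \<omega> = ?d (It i \<omega>)"
        by (rule AE_I2) (simp add: eps_stat[of _ i] partial_proc_def it_add algebra_simps)
    qed (use sqint_diff[OF eps_sqint partial_proc_sqint] sqint_it[OF d, of i] in \<open>simp_all add: sqint_def\<close>)
    also have "\<dots> = norm_L2 M ?d" by (rule norm_L2_it) (use d in \<open>simp add: sqint_def\<close>)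
    also have "\<dots> = norm_L2 M (\<lambda>\<omega>. (\<epsilon> 0 \<omega> - CE (int N) (\<epsilon> 0) \<omega>) + CE (- int (Suc N)) (\<epsilon> 0) \<omega>)"
    proof (rule norm_L2_AE_cong)
      show "AE \<omega> in M. ?d \<omega> = (\<epsilon> 0 \<omega> - CE (int N) (\<epsilon> 0) \<omega>) + CE (- int (Suc N)) (\<epsilon> 0) \<omega>"
        using partial_proc_0_AE[of N] by eventually_elim simp
    qed (use d sqint_add[OF sqint_diff[OF eps0_sqint CE_sqint[OF eps0_sqint]] CE_sqint[OF eps0_sqint]] in \<open>simp_all add: sqint_def\<close>)
    also have "\<dots> \<le> norm_L2 M (\<lambda>\<omega>. \<epsilon> 0 \<omega> - CE (int N) (\<epsilon> 0) \<omega>) + norm_L2 M (CE (- int (Suc N)) (\<epsilon> 0))"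
      by (intro norm_L2_triangle sqint_diff CE_sqint eps0_sqint)
    finally show ?thesis .
  qed
  have lim: "(\<lambda>N. norm_L2 M (\<lambda>\<omega>. \<epsilon> 0 \<omega> - CE (int N) (\<epsilon> 0) \<omega>) + norm_L2 M (CE (- int (Suc N)) (\<epsilon> 0))) \<longlonglongrightarrow> 0 + 0"
    by (intro tendsto_add CE_future_tendsto eps0_sqint eps_future_measurable
        LIMSEQ_Suc[OF CE_past_tendsto_0[OF eps0_sqint eps_mean]])
  show ?thesis
    by (rule tendsto_sandwich[OF always_eventually[OF allI[OF norm_L2_nonneg]] always_eventually[OF allI[OF le]] tendsto_const lim[unfolded add_0]])
qed

lemma partial_proc_lincomb_tendsto:
  "(\<lambda>N. norm_L2 M (\<lambda>\<omega>. \<Sum>i\<in>I. a i * (\<epsilon> i \<omega> - partial_proc N i \<omega>))) \<longlonglongrightarrow> 0"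
proof (rule tendsto_sandwich[of "\<lambda>_. 0" _ _ "\<lambda>N. \<Sum>i\<in>I. \<bar>a i\<bar> * norm_L2 M (\<lambda>\<omega>. \<epsilon> i \<omega> - partial_proc N i \<omega>)"])
  show "\<forall>\<^sub>F N in sequentially. norm_L2 M (\<lambda>\<omega>. \<Sum>i\<in>I. a i * (\<epsilon> i \<omega> - partial_proc N i \<omega>))
      \<le> (\<Sum>i\<in>I. \<bar>a i\<bar> * norm_L2 M (\<lambda>\<omega>. \<epsilon> i \<omega> - partial_proc N i \<omega>))"
  proof (intro always_eventually allI)
    fix N
    have "norm_L2 M (\<lambda>\<omega>. \<Sum>i\<in>I. a i * (\<epsilon> i \<omega> - partial_proc N i \<omega>)) \<le> (\<Sum>i\<in>I. norm_L2 M (\<lambda>\<omega>. a i * (\<epsilon> i \<omega> - partial_proc N i \<omega>)))"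
      by (intro norm_L2_sum sqint_cmult sqint_diff eps_sqint partial_proc_sqint)
    then show "norm_L2 M (\<lambda>\<omega>. \<Sum>i\<in>I. a i * (\<epsilon> i \<omega> - partial_proc N i \<omega>))
      \<le> (\<Sum>i\<in>I. \<bar>a i\<bar> * norm_L2 M (\<lambda>\<omega>. \<epsilon> i \<omega> - partial_proc N i \<omega>))" by (simp add: norm_L2_cmult)
  qed
  have "(\<lambda>N. \<Sum>i\<in>I. \<bar>a i\<bar> * norm_L2 M (\<lambda>\<omega>. \<epsilon> i \<omega> - partial_proc N i \<omega>)) \<longlonglongrightarrow> (\<Sum>i\<in>I. \<bar>a i\<bar> * 0)"
    by (intro tendsto_sum tendsto_mult tendsto_const partial_proc_tendsto)
  then show "(\<lambda>N. \<Sum>i\<in>I. \<bar>a i\<bar> * norm_L2 M (\<lambda>\<omega>. \<epsilon> i \<omega> - partial_proc N i \<omega>)) \<longlonglongrightarrow> 0" by simp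
qed auto

text \<open>A longer cut-off N' is interposed. For fixed I the error beyond N' tends to zero, while
  the lags between N and N' cost at most the tail of Hannan's series times the norm of the
  coefficients. The resulting bound is uniform in I and a.\<close>

lemma partial_proc_diff_lincomb:
  assumes "finite I"
  shows "norm_L2 M (\<lambda>\<omega>. \<Sum>i\<in>I. a i * (\<epsilon> i \<omega> - (\<Sum>k\<in>{- int N..int N}. innov k (It (i - k) \<omega>))))
    \<le> (hannan_sum - (\<Sum>k\<in>{- int N..int N}. norm_L2 M (innov k))) * sqrt (\<Sum>i\<in>I. (a i)\<^sup>2)" (is "?L \<le> ?R")
proof (rule LIMSEQ_le_const)
  show "(\<lambda>N'. norm_L2 M (\<lambda>\<omega>. \<Sum>i\<in>I. a i * (\<epsilon> i \<omega> - partial_proc N' i \<omega>)) + ?R) \<longlonglongrightarrow> ?R"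
    using tendsto_add[OF partial_proc_lincomb_tendsto[where I=I and a=a] tendsto_const[of ?R]] by simp
  show "\<exists>m. \<forall>N'\<ge>m. ?L \<le> norm_L2 M (\<lambda>\<omega>. \<Sum>i\<in>I. a i * (\<epsilon> i \<omega> - partial_proc N' i \<omega>)) + ?R"
  proof (intro exI allI impI)
    fix N' assume N': "N \<le> N'"
    let ?K = "{- int N'..int N'} - {- int N..int N}"
    have eq: "partial_proc N' i \<omega> = (\<Sum>k\<in>{- int N..int N}. innov k (It (i - k) \<omega>)) + (\<Sum>k\<in>?K. innov k (It (i - k) \<omega>))" for i \<omega>
      unfolding partial_proc_def using N' by (subst sum.subset_diff[of "{- int N..int N}"]) auto
    have "(\<lambda>\<omega>. \<Sum>i\<in>I. a i * (\<epsilon> i \<omega> - (\<Sum>k\<in>{- int N..int N}. innov k (It (i - k) \<omega>)))) =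
       (\<lambda>\<omega>. (\<Sum>i\<in>I. a i * (\<epsilon> i \<omega> - partial_proc N' i \<omega>)) + (\<Sum>i\<in>I. a i * (\<Sum>k\<in>?K. innov k (It (i - k) \<omega>))))"
      by (simp add: eq sum.distrib[symmetric] algebra_simps)
    then have "?L \<le> norm_L2 M (\<lambda>\<omega>. \<Sum>i\<in>I. a i * (\<epsilon> i \<omega> - partial_proc N' i \<omega>)) +
        norm_L2 M (\<lambda>\<omega>. \<Sum>i\<in>I. a i * (\<Sum>k\<in>?K. innov k (It (i - k) \<omega>)))"
      by (simp only:) (intro norm_L2_triangle sqint_sum sqint_cmult sqint_diff eps_sqint partial_proc_sqint sqint_it innovation_sqint innovation_innov)
    also have "norm_L2 M (\<lambda>\<omega>. \<Sum>i\<in>I. a i * (\<Sum>k\<in>?K. innov k (It (i - k) \<omega>))) \<le> (\<Sum>k\<in>?K. norm_L2 M (innov k)) * sqrt (\<Sum>i\<in>I. (a i)\<^sup>2)"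
      by (intro innovation_array_norm innovation_innov assms) auto
    also have "(\<Sum>k\<in>?K. norm_L2 M (innov k)) = (\<Sum>k\<in>{- int N'..int N'}. norm_L2 M (innov k)) - (\<Sum>k\<in>{- int N..int N}. norm_L2 M (innov k))"
      using N' by (intro sum_diff) auto
    also have "\<dots> * sqrt (\<Sum>i\<in>I. (a i)\<^sup>2) \<le> ?R"
      using sum_innov_le[of "{- int N'..int N'}"] by (intro mult_right_mono) (auto intro: sum_nonneg)
    finally show "?L \<le> norm_L2 M (\<lambda>\<omega>. \<Sum>i\<in>I. a i * (\<epsilon> i \<omega> - partial_proc N' i \<omega>)) + ?R" by simp
  qed
qed

text \<open>The case N = 0 of the tail bound together with the array bound for the one remaining
  lag; the two constants add up to the whole series.\<close>

theorem eps_lincomb_norm: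
  assumes "finite I"
  shows "norm_L2 M (\<lambda>\<omega>. \<Sum>i\<in>I. a i * \<epsilon> i \<omega>) \<le> hannan_sum * sqrt (\<Sum>i\<in>I. (a i)\<^sup>2)"
proof -
  let ?K = "{- int 0..int 0}"
  have "(\<lambda>\<omega>. \<Sum>i\<in>I. a i * \<epsilon> i \<omega>) = (\<lambda>\<omega>. (\<Sum>i\<in>I. a i * (\<epsilon> i \<omega> - (\<Sum>k\<in>?K. innov k (It (i - k) \<omega>)))) + (\<Sum>i\<in>I. a i * (\<Sum>k\<in>?K. innov k (It (i - k) \<omega>))))"
    by (simp add: sum.distrib[symmetric] algebra_simps)
  then have "norm_L2 M (\<lambda>\<omega>. \<Sum>i\<in>I. a i * \<epsilon> i \<omega>) \<le> norm_L2 M (\<lambda>\<omega>. \<Sum>i\<in>I. a i * (\<epsilon> i \<omega> - (\<Sum>k\<in>?K. innov k (It (i - k) \<omega>)))) +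
       norm_L2 M (\<lambda>\<omega>. \<Sum>i\<in>I. a i * (\<Sum>k\<in>?K. innov k (It (i - k) \<omega>)))"
    by (simp only:) (intro norm_L2_triangle sqint_sum sqint_cmult sqint_diff eps_sqint sqint_it innovation_sqint innovation_innov)
  also have "\<dots> \<le> (hannan_sum - (\<Sum>k\<in>?K. norm_L2 M (innov k))) * sqrt (\<Sum>i\<in>I. (a i)\<^sup>2) + (\<Sum>k\<in>?K. norm_L2 M (innov k)) * sqrt (\<Sum>i\<in>I. (a i)\<^sup>2)"
    by (intro add_mono partial_proc_diff_lincomb innovation_array_norm innovation_innov assms) auto
  finally show ?thesis by (simp add: algebra_simps)
qed

text \<open>Half of \<delta> pays for the tail of Hannan's series, which fixes N, and the other half
  for truncating the finitely many innovations that remain.\<close>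

theorem bounded_innovation_approx:
  assumes "\<delta> > 0"
  obtains N :: nat and \<mu> B where "\<And>k. innovation (\<mu> k)" "\<And>k \<omega>. \<bar>\<mu> k \<omega>\<bar> \<le> B"
    "\<And>I a. finite I \<Longrightarrow> norm_L2 M (\<lambda>\<omega>. \<Sum>i\<in>I. a i * (\<epsilon> i \<omega> - (\<Sum>k\<in>{- int N..int N}. \<mu> k (It (i - k) \<omega>))))
       \<le> \<delta> * sqrt (\<Sum>i\<in>I. (a i)\<^sup>2)"
proof -
  have "((\<lambda>K. \<Sum>k\<in>K. norm_L2 M (innov k)) \<longlongrightarrow> hannan_sum) (finite_subsets_at_top UNIV)"
    unfolding hannan_sum_def using infsum_tendsto[OF summable_innov] .
  then have "\<forall>\<^sub>F K in finite_subsets_at_top UNIV. (\<Sum>k\<in>K. norm_L2 M (innov k)) > hannan_sum - \<delta> / 2"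
    by (rule order_tendstoD) (use assms in simp)
  then obtain K where K: "finite K" "\<And>L. finite L \<Longrightarrow> K \<subseteq> L \<Longrightarrow> (\<Sum>k\<in>L. norm_L2 M (innov k)) > hannan_sum - \<delta> / 2"
    unfolding eventually_finite_subsets_at_top by auto
  obtain N :: nat where N: "K \<subseteq> {- int N..int N}"
  proof -
    have "\<bar>k\<bar> \<le> (\<Sum>k\<in>K. \<bar>k\<bar>)" if "k \<in> K" for k
      by (rule member_le_sum) (use K(1) that in auto)
    then have "K \<subseteq> {- int (nat (\<Sum>k\<in>K. \<bar>k\<bar>))..int (nat (\<Sum>k\<in>K. \<bar>k\<bar>))}" by (fastforce simp: abs_le_iff)
    then show ?thesis by (rule that)
  qed
  let ?K = "{- int N..int N}"
  \<comment> \<open>The share of one lag: the 2N + 1 lags together use \<delta> / 2.\<close>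
  define d where "d = \<delta> / (2 * (2 * real N + 1))"
  have d: "d > 0" using assms by (simp add: d_def)
  have "\<exists>\<mu>' B. innovation \<mu>' \<and> (\<forall>\<omega>. \<bar>\<mu>' \<omega>\<bar> \<le> B) \<and> norm_L2 M (\<lambda>\<omega>. innov k \<omega> - \<mu>' \<omega>) < d" for k
    using innovation_truncation[OF innovation_innov d, of k] by metis
  then obtain \<mu>0 B where mb: "\<And>k. innovation (\<mu>0 k)" "\<And>k \<omega>. \<bar>\<mu>0 k \<omega>\<bar> \<le> B k" "\<And>k. norm_L2 M (\<lambda>\<omega>. innov k \<omega> - \<mu>0 k \<omega>) < d"
    by metis
  define \<mu> where "\<mu> k = (if k \<in> ?K then \<mu>0 k else (\<lambda>_. 0))" for k
  have Z: "innovation (\<lambda>_. 0)" by (simp add: innovation_def)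
  have 1: "innovation (\<mu> k)" for k using mb(1) Z by (simp add: \<mu>_def)
  have B0: "0 \<le> B k" for k using mb(2)[of k undefined] by linarith
  have 2: "\<bar>\<mu> k \<omega>\<bar> \<le> (\<Sum>k\<in>?K. B k)" for k \<omega>
  proof (cases "k \<in> ?K")
    case True
    then show ?thesis using mb(2)[of k \<omega>] member_le_sum[of k ?K B] B0 by (simp add: \<mu>_def)
  next
    case False
    then have "\<mu> k \<omega> = 0" unfolding \<mu>_def by auto
    then show ?thesis using B0 by (simp add: sum_nonneg)
  qed
  have 3: "norm_L2 M (\<lambda>\<omega>. \<Sum>i\<in>I. a i * (\<epsilon> i \<omega> - (\<Sum>k\<in>?K. \<mu> k (It (i - k) \<omega>)))) \<le> \<delta> * sqrt (\<Sum>i\<in>I. (a i)\<^sup>2)"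
    if I: "finite I" for I a
  proof -
    have "(\<lambda>\<omega>. \<Sum>i\<in>I. a i * (\<epsilon> i \<omega> - (\<Sum>k\<in>?K. \<mu> k (It (i - k) \<omega>)))) =
      (\<lambda>\<omega>. (\<Sum>i\<in>I. a i * (\<epsilon> i \<omega> - (\<Sum>k\<in>?K. innov k (It (i - k) \<omega>)))) + (\<Sum>i\<in>I. a i * (\<Sum>k\<in>?K. (\<lambda>\<omega>. innov k \<omega> - \<mu> k \<omega>) (It (i - k) \<omega>))))"
      by (rule ext) (simp add: sum_subtractf right_diff_distrib)
    then have "norm_L2 M (\<lambda>\<omega>. \<Sum>i\<in>I. a i * (\<epsilon> i \<omega> - (\<Sum>k\<in>?K. \<mu> k (It (i - k) \<omega>)))) \<le>
       norm_L2 M (\<lambda>\<omega>. \<Sum>i\<in>I. a i * (\<epsilon> i \<omega> - (\<Sum>k\<in>?K. innov k (It (i - k) \<omega>)))) +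
       norm_L2 M (\<lambda>\<omega>. \<Sum>i\<in>I. a i * (\<Sum>k\<in>?K. (\<lambda>\<omega>. innov k \<omega> - \<mu> k \<omega>) (It (i - k) \<omega>)))"
      by (simp only:) (intro norm_L2_triangle sqint_sum sqint_cmult sqint_diff eps_sqint sqint_it innovation_sqint innovation_innov 1)
    also have "\<dots> \<le> (hannan_sum - (\<Sum>k\<in>?K. norm_L2 M (innov k))) * sqrt (\<Sum>i\<in>I. (a i)\<^sup>2) +
       (\<Sum>k\<in>?K. norm_L2 M (\<lambda>\<omega>. innov k \<omega> - \<mu> k \<omega>)) * sqrt (\<Sum>i\<in>I. (a i)\<^sup>2)"
      by (intro add_mono partial_proc_diff_lincomb innovation_array_norm innovation_diff innovation_innov 1 I) auto
    also have "\<dots> \<le> \<delta> / 2 * sqrt (\<Sum>i\<in>I. (a i)\<^sup>2) + \<delta> / 2 * sqrt (\<Sum>i\<in>I. (a i)\<^sup>2)"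
    proof (intro add_mono mult_right_mono)
      show "hannan_sum - (\<Sum>k\<in>?K. norm_L2 M (innov k)) \<le> \<delta> / 2" using K(2)[of ?K] N by simp
      have "(\<Sum>k\<in>?K. norm_L2 M (\<lambda>\<omega>. innov k \<omega> - \<mu> k \<omega>)) \<le> (\<Sum>k\<in>?K. d)"
        using mb(3) by (intro sum_mono) (simp add: \<mu>_def less_imp_le)
      also have "\<dots> = \<delta> / 2" by (simp add: d_def field_simps)
      finally show "(\<Sum>k\<in>?K. norm_L2 M (\<lambda>\<omega>. innov k \<omega> - \<mu> k \<omega>)) \<le> \<delta> / 2" .
    qed (auto intro: sum_nonneg)
    finally show ?thesis by (simp add: algebra_simps)
  qed
  show ?thesis by (rule that[OF 1 2 3])
qed

end

section \<open>Bounded martingale differences\<close>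

text \<open>The upper estimate follows from exp y >= 1 + y + y^2/2, because (1 + y + y^2/2)(1 - y +
  y^2/2) = 1 + y^4/4 >= 1.\<close>

lemma exp_minus_quadratic: "0 \<le> y \<Longrightarrow> \<bar>exp (- y) - (1 - y)\<bar> \<le> y\<^sup>2 / 2" for y :: real
proof -
  assume y: "0 \<le> y"
  have "1 \<le> (1 + y + y\<^sup>2 / 2) * (1 - y + y\<^sup>2 / 2)"
    using y by (simp add: power2_eq_square algebra_simps)
  also have "\<dots> \<le> exp y * (1 - y + y\<^sup>2 / 2)"
  proof (rule mult_right_mono)
    show "1 + y + y\<^sup>2 / 2 \<le> exp y" using exp_lower_Taylor_quadratic[OF y] by simp
    have "0 \<le> (1 - y)\<^sup>2 + 1" by simp
    then show "0 \<le> 1 - y + y\<^sup>2 / 2" by (simp add: power2_eq_square algebra_simps)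
  qed
  finally have "exp (- y) * 1 \<le> exp (- y) * (exp y * (1 - y + y\<^sup>2 / 2))" by (intro mult_left_mono) auto
  then have "exp (- y) \<le> 1 - y + y\<^sup>2 / 2" by (simp add: mult.assoc[symmetric] exp_minus_inverse mult_exp_exp)
  moreover have "1 - y \<le> exp (- y)" using exp_ge_add_one_self[of "- y"] by simp
  ultimately show ?thesis by linarith
qed

text \<open>With y = x^2/2 three errors are added: the Taylor remainder of order |x|^3/6, the defect
  |x|^3/2 of replacing 1 + ix - y by (1 + ix)(1 - y), and x^4/4 from replacing 1 - y by exp(-y). The
  constants 1/6, 1/2 and 1/4 sum to less than 1.\<close>

lemma iexp_factor_bound:
  fixes x :: real
  assumes "\<bar>x\<bar> \<le> 1"
  shows "cmod (iexp x - (1 + \<i> * x) * of_real (exp (- x\<^sup>2 / 2))) \<le> \<bar>x\<bar> ^ 3"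
proof -
  define y where "y = x\<^sup>2 / 2"
  have x4: "x ^ 4 \<le> \<bar>x\<bar> ^ 3"
  proof -
    have "x ^ 4 = \<bar>x\<bar> ^ 3 * \<bar>x\<bar>" by (simp add: power_even_abs[of 4 x, symmetric] power_Suc2[symmetric] del: power_even_abs power_Suc power_even_abs_numeral)
    also have "\<dots> \<le> \<bar>x\<bar> ^ 3 * 1" using assms by (intro mult_left_mono) auto
    finally show ?thesis by simp
  qed
  have 1: "cmod (iexp x - (1 + \<i> * x - y)) \<le> \<bar>x\<bar> ^ 3 / 6"
  proof -
    have "(\<Sum>k\<le>2. (\<i> * x) ^ k / fact k) = 1 + \<i> * x - (y :: complex)"
      by (simp add: numeral_2_eq_2 y_def power2_eq_square algebra_simps)
    then show ?thesis using iexp_approx1[of x 2] by (simp add: fact_numeral)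
  qed
  have 2: "cmod ((1 + \<i> * x - y) - (1 + \<i> * x) * (1 - of_real y)) = \<bar>x\<bar> ^ 3 / 2"
  proof -
    have "(1 + \<i> * x - y) - (1 + \<i> * x) * (1 - of_real y) = \<i> * of_real (x * y)" by (simp add: algebra_simps)
    then have "cmod ((1 + \<i> * x - y) - (1 + \<i> * x) * (1 - of_real y)) = \<bar>x * y\<bar>" by (simp add: norm_mult del: of_real_mult)
    then show ?thesis by (simp add: y_def abs_mult power3_eq_cube power2_eq_square)
  qed
  have 3: "cmod ((1 + \<i> * x) * (1 - of_real y) - (1 + \<i> * x) * of_real (exp (- y))) \<le> x ^ 4 / 4"
  proof -
    have "(1 + \<i> * x) * (1 - of_real y) - (1 + \<i> * x) * of_real (exp (- y)) = (1 + \<i> * x) * of_real ((1 - y) - exp (- y))"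
      by (simp add: algebra_simps)
    then have "cmod ((1 + \<i> * x) * (1 - of_real y) - (1 + \<i> * x) * of_real (exp (- y))) = cmod (1 + \<i> * x) * \<bar>(1 - y) - exp (- y)\<bar>"
      by (simp only: norm_mult norm_of_real)
    also have "\<dots> \<le> 2 * (y\<^sup>2 / 2)"
    proof (rule mult_mono)
      show "cmod (1 + \<i> * x) \<le> 2" using norm_triangle_ineq[of 1 "\<i> * x"] assms by (simp add: norm_mult)
      show "\<bar>(1 - y) - exp (- y)\<bar> \<le> y\<^sup>2 / 2" using exp_minus_quadratic[of y] by (simp add: y_def abs_minus_commute)
    qed auto
    also have "\<dots> = x ^ 4 / 4" by (simp add: y_def power2_eq_square power4_eq_xxxx)
    finally show ?thesis .
  qed
  have "iexp x - (1 + \<i> * x) * of_real (exp (- y)) = (iexp x - (1 + \<i> * x - y)) + ((1 + \<i> * x - y) - (1 + \<i> * x) * (1 - of_real y))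
     + ((1 + \<i> * x) * (1 - of_real y) - (1 + \<i> * x) * of_real (exp (- y)))" by simp
  then have "cmod (iexp x - (1 + \<i> * x) * of_real (exp (- y))) \<le> cmod (iexp x - (1 + \<i> * x - y)) + cmod ((1 + \<i> * x - y) - (1 + \<i> * x) * (1 - of_real y))
     + cmod ((1 + \<i> * x) * (1 - of_real y) - (1 + \<i> * x) * of_real (exp (- y)))"
    by (simp only:) (rule norm_triangle_mono[OF norm_triangle_ineq order_refl])
  also have "\<dots> \<le> \<bar>x\<bar> ^ 3 / 6 + \<bar>x\<bar> ^ 3 / 2 + x ^ 4 / 4" using 1 2 3 by linarith
  also have "\<dots> \<le> \<bar>x\<bar> ^ 3 / 6 + \<bar>x\<bar> ^ 3 / 2 + \<bar>x\<bar> ^ 3 / 4" using x4 by linarith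
  also have "\<dots> \<le> \<bar>x\<bar> ^ 3" using zero_le_power[of "\<bar>x\<bar>" 3] by linarith
  finally show ?thesis by (simp add: y_def)
qed

text \<open>It makes every factor (1 + ix) exp(-x^2/2) of McLeish's product a contraction, and
  bounds the product of the 1 + ix through the sum of squares.\<close>

lemma cmod_one_plus_ix: "cmod (1 + \<i> * of_real x) \<le> exp (x\<^sup>2 / 2)"
proof (rule power2_le_imp_le)
  have "(cmod (1 + \<i> * of_real x))\<^sup>2 = 1 + x\<^sup>2" by (simp add: cmod_power2)
  also have "\<dots> \<le> exp (x\<^sup>2)" by (rule exp_ge_add_one_self)
  also have "\<dots> = (exp (x\<^sup>2 / 2))\<^sup>2" by (simp add: exp_double[symmetric])
  finally show "(cmod (1 + \<i> * of_real x))\<^sup>2 \<le> (exp (x\<^sup>2 / 2))\<^sup>2" .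
qed simp

lemma exp_neg_lipschitz:
  fixes a b :: real
  assumes "0 \<le> a" "0 \<le> b" shows "\<bar>exp (- a) - exp (- b)\<bar> \<le> \<bar>a - b\<bar>"
proof -
  have *: "exp (- a) - exp (- b) \<le> b - a" if "a \<le> b" "0 \<le> a" for a b :: real
  proof -
    have "exp (- a) - exp (- b) = exp (- a) * (1 - exp (- (b - a)))" by (simp add: algebra_simps mult_exp_exp)
    also have "\<dots> \<le> 1 * (b - a)"
    proof (intro mult_mono)
      show "1 - exp (- (b - a)) \<le> b - a" using exp_ge_add_one_self[of "- (b - a)"] by linarith
    qed (use that in auto)
    finally show ?thesis by simp
  qed
  show ?thesis using *[of a b] *[of b a] assms by (cases "a \<le> b") (auto simp: abs_if)
qed

section \<open>Martingale difference arrays and McLeish's comparison\<close>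

context stationary_filtration
begin

text \<open>The bound may depend on the time, and the tests are restricted to bounded functions of
  the past; this is what makes the notion stable under multiplication by bounded predictable
  factors. Bounds hold at every point, so no exceptional sets have to be carried along.\<close>

definition mds :: "(int \<Rightarrow> 'a \<Rightarrow> real) \<Rightarrow> bool" where
  "mds D \<longleftrightarrow> (\<forall>l. D l \<in> borel_measurable (F l)) \<and> (\<forall>l. \<exists>B. \<forall>\<omega>. \<bar>D l \<omega>\<bar> \<le> B) \<and>
     (\<forall>l Y. Y \<in> borel_measurable (F (l - 1)) \<longrightarrow> (\<exists>B. \<forall>\<omega>. \<bar>Y \<omega>\<bar> \<le> B) \<longrightarrow> (\<integral>\<omega>. D l \<omega> * Y \<omega> \<partial>M) = 0)"

lemma mds_measurable: "mds D \<Longrightarrow> D l \<in> borel_measurable (F l)"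
  by (simp add: mds_def)

lemma mds_measurable_M: "mds D \<Longrightarrow> D l \<in> borel_measurable M"
  using measurable_F_M[OF mds_measurable] .

lemma mds_bounded: assumes "mds D" obtains B where "\<And>\<omega>. \<bar>D l \<omega>\<bar> \<le> B"
  using assms unfolding mds_def by blast

lemma mds_integral: "mds D \<Longrightarrow> Y \<in> borel_measurable (F (l - 1)) \<Longrightarrow> (\<And>\<omega>. \<bar>Y \<omega>\<bar> \<le> B) \<Longrightarrow> (\<integral>\<omega>. D l \<omega> * Y \<omega> \<partial>M) = 0"
  unfolding mds_def by blast

lemma mds_sqint: "mds D \<Longrightarrow> sqint M (D l)"
  by (rule mds_bounded[of D l], assumption) (rule sqint_bounded, auto simp: mds_measurable_M)

lemma mds_innovation:
  assumes "innovation \<mu>" "\<And>\<omega>. \<bar>\<mu> \<omega>\<bar> \<le> B" shows "mds (\<lambda>l \<omega>. \<mu> (It l \<omega>))"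
  unfolding mds_def
proof (intro conjI allI impI)
  show "(\<lambda>\<omega>. \<mu> (It l \<omega>)) \<in> borel_measurable (F l)" for l by (rule innovation_measurable[OF assms(1)])
  show "\<exists>B. \<forall>\<omega>. \<bar>\<mu> (It l \<omega>)\<bar> \<le> B" for l using assms(2) by blast
  fix l and Y :: "'a \<Rightarrow> real" assume Y: "Y \<in> borel_measurable (F (l - 1))" "\<exists>B. \<forall>\<omega>. \<bar>Y \<omega>\<bar> \<le> B"
  then obtain C where "\<And>\<omega>. \<bar>Y \<omega>\<bar> \<le> C" by blast
  then have "sqint M Y" by (intro sqint_bounded[OF measurable_F_M[OF Y(1)]])
  then show "(\<integral>\<omega>. \<mu> (It l \<omega>) * Y \<omega> \<partial>M) = 0" by (rule innovation_orthogonal[OF assms(1) _ Y(1)])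
qed

text \<open>A bounded predictable factor can be absorbed into the test function.\<close>

lemma mds_mult:
  assumes D: "mds D" and W: "\<And>l. W l \<in> borel_measurable (F (l - 1))" "\<And>l. \<exists>B. \<forall>\<omega>. \<bar>W l \<omega>\<bar> \<le> B"
  shows "mds (\<lambda>l \<omega>. D l \<omega> * W l \<omega>)"
  unfolding mds_def
proof (intro conjI allI impI)
  fix l
  have Wl: "W l \<in> borel_measurable (F l)" by (rule measurable_F_mono[OF W(1)]) simp
  show "(\<lambda>\<omega>. D l \<omega> * W l \<omega>) \<in> borel_measurable (F l)"
    by (rule borel_measurable_times[OF mds_measurable[OF D] Wl])
  obtain B where B: "\<And>\<omega>. \<bar>D l \<omega>\<bar> \<le> B" using mds_bounded[OF D, of l] by blast
  obtain C where C: "\<And>\<omega>. \<bar>W l \<omega>\<bar> \<le> C" using W(2)[of l] by blast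
  have "\<bar>D l \<omega> * W l \<omega>\<bar> \<le> B * C" for \<omega>
    unfolding abs_mult using B[of \<omega>] C[of \<omega>] by (intro mult_mono) auto
  then show "\<exists>B. \<forall>\<omega>. \<bar>D l \<omega> * W l \<omega>\<bar> \<le> B" by blast
  fix Y :: "'a \<Rightarrow> real" assume Y: "Y \<in> borel_measurable (F (l - 1))" "\<exists>B. \<forall>\<omega>. \<bar>Y \<omega>\<bar> \<le> B"
  then obtain E where E: "\<And>\<omega>. \<bar>Y \<omega>\<bar> \<le> E" by blast
  have "\<bar>W l \<omega> * Y \<omega>\<bar> \<le> C * E" for \<omega>
    unfolding abs_mult using C[of \<omega>] E[of \<omega>] by (intro mult_mono) auto
  then have "(\<integral>\<omega>. D l \<omega> * (W l \<omega> * Y \<omega>) \<partial>M) = 0"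
    by (rule mds_integral[OF D borel_measurable_times[OF W(1) Y(1)]])
  then show "(\<integral>\<omega>. D l \<omega> * W l \<omega> * Y \<omega> \<partial>M) = 0" by (simp add: mult.assoc)
qed

lemma mds_cmult: assumes "mds D" shows "mds (\<lambda>l \<omega>. D l \<omega> * c l)"
  by (rule mds_mult[OF assms]) auto

lemma mds_sum:
  assumes D: "\<And>k. k \<in> K \<Longrightarrow> mds (D k)"
  shows "mds (\<lambda>l \<omega>. \<Sum>k\<in>K. D k l \<omega>)"
  unfolding mds_def
proof (intro conjI allI impI)
  fix l
  show "(\<lambda>\<omega>. \<Sum>k\<in>K. D k l \<omega>) \<in> borel_measurable (F l)"
    using D by (intro borel_measurable_sum) (auto simp: mds_measurable)
  have "\<forall>k\<in>K. \<exists>B. \<forall>\<omega>. \<bar>D k l \<omega>\<bar> \<le> B" using D by (auto simp: mds_def)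
  then obtain B where B: "\<And>k \<omega>. k \<in> K \<Longrightarrow> \<bar>D k l \<omega>\<bar> \<le> B k" by metis
  have "\<bar>\<Sum>k\<in>K. D k l \<omega>\<bar> \<le> (\<Sum>k\<in>K. B k)" for \<omega>
    by (rule order_trans[OF sum_abs sum_mono]) (rule B)
  then show "\<exists>B. \<forall>\<omega>. \<bar>\<Sum>k\<in>K. D k l \<omega>\<bar> \<le> B" by blast
  fix Y :: "'a \<Rightarrow> real" assume Y: "Y \<in> borel_measurable (F (l - 1))" "\<exists>B. \<forall>\<omega>. \<bar>Y \<omega>\<bar> \<le> B"
  then obtain E where E: "\<And>\<omega>. \<bar>Y \<omega>\<bar> \<le> E" by blast
  have Ys: "sqint M Y" using E by (intro sqint_bounded[OF measurable_F_M[OF Y(1)]])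
  have "(\<integral>\<omega>. (\<Sum>k\<in>K. D k l \<omega>) * Y \<omega> \<partial>M) = (\<Sum>k\<in>K. \<integral>\<omega>. D k l \<omega> * Y \<omega> \<partial>M)"
    unfolding sum_distrib_right using D
    by (intro Bochner_Integration.integral_sum sqint_mult_integrable mds_sqint Ys)
  also have "\<dots> = 0" using D by (intro sum.neutral ballI mds_integral[OF _ Y(1) E])
  finally show "(\<integral>\<omega>. (\<Sum>k\<in>K. D k l \<omega>) * Y \<omega> \<partial>M) = 0" .
qed

lemma mds_orthogonal:
  assumes "mds D" "i \<noteq> j" shows "(\<integral>\<omega>. D i \<omega> * D j \<omega> \<partial>M) = 0"
proof -
  have *: "(\<integral>\<omega>. D i \<omega> * D j \<omega> \<partial>M) = 0" if "j < i" for i j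
  proof -
    obtain B where B: "\<And>\<omega>. \<bar>D j \<omega>\<bar> \<le> B" using mds_bounded[OF assms(1), of j] by blast
    show ?thesis
      by (rule mds_integral[OF assms(1) measurable_F_mono[OF mds_measurable[OF assms(1)]] B]) (use that in simp)
  qed
  show ?thesis using *[of j i] *[of i j] assms(2) by (cases "j < i") (simp_all add: mult.commute)
qed

lemma mds_sum_sq:
  assumes "mds D" "finite L"
  shows "(\<integral>\<omega>. (\<Sum>l\<in>L. D l \<omega>)\<^sup>2 \<partial>M) = (\<Sum>l\<in>L. \<integral>\<omega>. (D l \<omega>)\<^sup>2 \<partial>M)"
  using assms by (intro integral_sum_sq_orthogonal mds_sqint mds_orthogonal) auto

text \<open>Induction on the last factor: the product of the earlier ones is bounded and known
  before it, so the last difference contributes nothing. The product is complex, hence the separate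
  tests against its real and imaginary part.\<close>

lemma mds_prod_integral:
  assumes D: "mds D"
  shows "(\<integral>\<omega>. (\<Prod>j<m. 1 + \<i> * of_real (D (lo + int j) \<omega>)) \<partial>M) = 1"
proof (induction m)
  case 0
  then show ?case by (simp add: prob_space)
next
  case (Suc m)
  let ?P = "\<lambda>\<omega>. \<Prod>j<m. 1 + \<i> * of_real (D (lo + int j) \<omega>)"
  let ?d = "D (lo + int m)"
  have PF: "?P \<in> borel_measurable (F (lo + int m - 1))"
  proof (rule borel_measurable_prod)
    fix j assume "j \<in> {..<m}"
    then have [measurable]: "D (lo + int j) \<in> borel_measurable (F (lo + int m - 1))"
      by (intro measurable_F_mono[OF mds_measurable[OF D]]) auto
    show "(\<lambda>\<omega>. 1 + \<i> * of_real (D (lo + int j) \<omega>)) \<in> borel_measurable (F (lo + int m - 1))"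
      by measurable
  qed
  have PM: "?P \<in> borel_measurable M" using measurable_from_subalg[OF subalg_F PF] .
  have "\<forall>j. \<exists>B. \<forall>\<omega>. \<bar>D (lo + int j) \<omega>\<bar> \<le> B" using D by (auto simp: mds_def)
  then obtain B where B: "\<And>j \<omega>. \<bar>D (lo + int j) \<omega>\<bar> \<le> B j" by metis
  have Pb: "cmod (?P \<omega>) \<le> (\<Prod>j<m. 1 + B j)" for \<omega>
    unfolding prod_norm[symmetric]
  proof (intro prod_mono conjI)
    fix j
    show "cmod (1 + \<i> * of_real (D (lo + int j) \<omega>)) \<le> 1 + B j"
      using norm_triangle_ineq[of 1 "\<i> * of_real (D (lo + int j) \<omega>)"] B[of j \<omega>] by (simp add: norm_mult)
  qed simp
  have Re: "(\<integral>\<omega>. ?d \<omega> * Re (?P \<omega>) \<partial>M) = 0"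
    by (rule mds_integral[OF D _ order_trans[OF abs_Re_le_cmod Pb]]) (use PF in measurable)
  have Im: "(\<integral>\<omega>. ?d \<omega> * Im (?P \<omega>) \<partial>M) = 0"
    by (rule mds_integral[OF D _ order_trans[OF abs_Im_le_cmod Pb]]) (use PF in measurable)
  have int_P: "integrable M ?P"
    by (rule integrable_const_bound[OF AE_I2[OF Pb] PM])
  have dM [measurable]: "?d \<in> borel_measurable M" by (rule mds_measurable_M[OF D])
  have int_dP: "integrable M (\<lambda>\<omega>. of_real (?d \<omega>) * ?P \<omega>)"
  proof (rule integrable_const_bound)
    show "AE \<omega> in M. cmod (of_real (?d \<omega>) * ?P \<omega>) \<le> B m * (\<Prod>j<m. 1 + B j)"
      unfolding norm_mult norm_of_real using Pb B order_trans[OF abs_ge_zero B]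
      by (intro AE_I2 mult_mono) auto
    show "(\<lambda>\<omega>. of_real (?d \<omega>) * ?P \<omega>) \<in> borel_measurable M"
      by (rule borel_measurable_times[OF _ PM]) measurable
  qed
  have "(\<integral>\<omega>. of_real (?d \<omega>) * ?P \<omega> \<partial>M) = 0"
  proof (rule complex_eqI)
    show "Re (\<integral>\<omega>. of_real (?d \<omega>) * ?P \<omega> \<partial>M) = Re 0"
      using Re by (subst integral_Re[OF int_dP, symmetric]) simp
    show "Im (\<integral>\<omega>. of_real (?d \<omega>) * ?P \<omega> \<partial>M) = Im 0"
      using Im by (subst integral_Im[OF int_dP, symmetric]) simp
  qed
  moreover have "(\<Prod>j<Suc m. 1 + \<i> * of_real (D (lo + int j) \<omega>)) = ?P \<omega> + \<i> * (of_real (?d \<omega>) * ?P \<omega>)" for \<omega>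
    by (simp add: algebra_simps)
  ultimately show ?case using int_P int_dP Suc by simp
qed

text \<open>McLeish: \<open>exp (\<i> S)\<close> is compared with \<open>exp (- Q / 2) \<Prod> (1 + \<i> \<xi>\<^sub>j)\<close>, where \<open>Q\<close> is the sum of squares,
  and the product has mean one.\<close>

lemma mcleish_bound:
  fixes D lo m
  defines "S \<equiv> \<lambda>\<omega>. \<Sum>j<m. D (lo + int j) \<omega>" and "Q \<equiv> \<lambda>\<omega>. \<Sum>j<m. (D (lo + int j) \<omega>)\<^sup>2"
  assumes D: "mds D" and b: "\<And>j \<omega>. \<bar>D (lo + int j) \<omega>\<bar> \<le> b" "b \<le> 1" and C: "\<And>\<omega>. Q \<omega> \<le> C" and v: "0 \<le> v"
  shows "cmod ((\<integral>\<omega>. iexp (S \<omega>) \<partial>M) - of_real (exp (- v / 2))) \<le> b * C + exp (C / 2) / 2 * (\<integral>\<omega>. \<bar>Q \<omega> - v\<bar> \<partial>M)"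
proof -
  let ?P = "\<lambda>\<omega>. \<Prod>j<m. 1 + \<i> * of_real (D (lo + int j) \<omega>)"
  have [measurable]: "D l \<in> borel_measurable M" for l by (rule mds_measurable_M[OF D])
  have SM[measurable]: "S \<in> borel_measurable M" and QM[measurable]: "Q \<in> borel_measurable M" unfolding S_def Q_def by measurable
  have PM[measurable]: "?P \<in> borel_measurable M" by measurable
  have Q0: "0 \<le> Q \<omega>" for \<omega> unfolding Q_def by (intro sum_nonneg) auto
  have Pb: "cmod (?P \<omega>) \<le> exp (C / 2)" for \<omega>
  proof -
    have "cmod (?P \<omega>) \<le> (\<Prod>j<m. exp ((D (lo + int j) \<omega>)\<^sup>2 / 2))"
      unfolding prod_norm[symmetric] using cmod_one_plus_ix by (intro prod_mono) auto
    also have "\<dots> = exp (Q \<omega> / 2)" by (simp add: exp_sum[symmetric] Q_def sum_divide_distrib)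
    also have "\<dots> \<le> exp (C / 2)" using C by simp
    finally show ?thesis .
  qed
  have b0: "0 \<le> b" using b(1)[of 0 undefined] by linarith
  have main: "cmod (iexp (S \<omega>) - ?P \<omega> * of_real (exp (- Q \<omega> / 2))) \<le> b * C" for \<omega>
  proof -
    let ?x = "\<lambda>j. D (lo + int j) \<omega>"
    have e1: "iexp (S \<omega>) = (\<Prod>j<m. iexp (?x j))"
      by (simp add: S_def exp_sum[symmetric] sum_distrib_left)
    have e2: "?P \<omega> * of_real (exp (- Q \<omega> / 2)) = (\<Prod>j<m. (1 + \<i> * of_real (?x j)) * of_real (exp (- (?x j)\<^sup>2 / 2)))"
    proof -
      have "exp (- Q \<omega> / 2) = (\<Prod>j<m. exp (- (?x j)\<^sup>2 / 2))"
        by (simp add: Q_def exp_sum[symmetric] sum_negf sum_divide_distrib)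
      then show ?thesis by (simp only: prod.distrib of_real_prod)
    qed
    have "cmod (iexp (S \<omega>) - ?P \<omega> * of_real (exp (- Q \<omega> / 2))) \<le> (\<Sum>j<m. cmod (iexp (?x j) - (1 + \<i> * of_real (?x j)) * of_real (exp (- (?x j)\<^sup>2 / 2))))"
      unfolding e1 e2
    \<comment> \<open>All factors of both products have modulus at most 1, so the difference of the
      products is at most the sum of the differences of the factors.\<close>
    proof (rule norm_prod_diff)
      show "cmod ((1 + \<i> * of_real (?x j)) * of_real (exp (- (?x j)\<^sup>2 / 2))) \<le> 1" for j
      proof -
        have "cmod ((1 + \<i> * of_real (?x j)) * of_real (exp (- (?x j)\<^sup>2 / 2))) \<le> exp ((?x j)\<^sup>2 / 2) * exp (- (?x j)\<^sup>2 / 2)"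
          unfolding norm_mult norm_of_real using cmod_one_plus_ix[of "?x j"] by (intro mult_mono) auto
        then show ?thesis by (simp add: mult_exp_exp)
      qed
    qed simp
    also have "\<dots> \<le> (\<Sum>j<m. b * (?x j)\<^sup>2)"
    proof (rule sum_mono)
      fix j
      have "cmod (iexp (?x j) - (1 + \<i> * of_real (?x j)) * of_real (exp (- (?x j)\<^sup>2 / 2))) \<le> \<bar>?x j\<bar> ^ 3"
        by (rule iexp_factor_bound) (use b(1)[of j \<omega>] b(2) in linarith)
      also have "\<dots> = \<bar>?x j\<bar> * (?x j)\<^sup>2" by (simp add: power3_eq_cube power2_eq_square)
      also have "\<dots> \<le> b * (?x j)\<^sup>2" using b(1) by (intro mult_right_mono) auto
      finally show "cmod (iexp (?x j) - (1 + \<i> * of_real (?x j)) * of_real (exp (- (?x j)\<^sup>2 / 2))) \<le> b * (?x j)\<^sup>2" .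
    qed
    also have "\<dots> = b * Q \<omega>" by (simp add: Q_def sum_distrib_left)
    also have "\<dots> \<le> b * C" using C b0 by (intro mult_left_mono) auto
    finally show ?thesis .
  qed
  have pt: "cmod (iexp (S \<omega>) - ?P \<omega> * of_real (exp (- v / 2))) \<le> b * C + exp (C / 2) / 2 * \<bar>Q \<omega> - v\<bar>" for \<omega>
  proof -
    have "cmod (iexp (S \<omega>) - ?P \<omega> * of_real (exp (- v / 2))) \<le>
       cmod (iexp (S \<omega>) - ?P \<omega> * of_real (exp (- Q \<omega> / 2))) + cmod (?P \<omega> * of_real (exp (- Q \<omega> / 2) - exp (- v / 2)))"
      using norm_triangle_ineq[of "iexp (S \<omega>) - ?P \<omega> * of_real (exp (- Q \<omega> / 2))" "?P \<omega> * of_real (exp (- Q \<omega> / 2) - exp (- v / 2))"]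
      by (simp add: algebra_simps)
    also have "cmod (?P \<omega> * of_real (exp (- Q \<omega> / 2) - exp (- v / 2))) \<le> exp (C / 2) * \<bar>Q \<omega> / 2 - v / 2\<bar>"
      unfolding norm_mult norm_of_real
      using Pb exp_neg_lipschitz[of "Q \<omega> / 2" "v / 2"] Q0 v by (intro mult_mono) auto
    also have "exp (C / 2) * \<bar>Q \<omega> / 2 - v / 2\<bar> = exp (C / 2) / 2 * \<bar>Q \<omega> - v\<bar>" by (simp add: diff_divide_distrib[symmetric])
    finally show ?thesis using main[of \<omega>] by linarith
  qed
  have iP: "integrable M ?P" by (rule integrable_const_bound[OF AE_I2[OF Pb] PM])
  have iS: "integrable M (\<lambda>\<omega>. iexp (S \<omega>))" by (rule integrable_const_bound[where B=1]) auto
  have iQ: "integrable M (\<lambda>\<omega>. \<bar>Q \<omega> - v\<bar>)"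
    by (intro integrable_abs Bochner_Integration.integrable_diff integrable_const_bound[where B=C and f=Q] AE_I2) (use Q0 C in auto)
  have "(\<integral>\<omega>. iexp (S \<omega>) \<partial>M) - of_real (exp (- v / 2)) = (\<integral>\<omega>. iexp (S \<omega>) - ?P \<omega> * of_real (exp (- v / 2)) \<partial>M)"
    using iP iS mds_prod_integral[OF D, where m=m and lo=lo] by simp
  also have "cmod \<dots> \<le> (\<integral>\<omega>. cmod (iexp (S \<omega>) - ?P \<omega> * of_real (exp (- v / 2))) \<partial>M)"
    by (rule integral_norm_bound)
  also have "\<dots> \<le> (\<integral>\<omega>. b * C + exp (C / 2) / 2 * \<bar>Q \<omega> - v\<bar> \<partial>M)"
    by (rule integral_mono) (use pt iP iS iQ in auto)
  also have "\<dots> = b * C + exp (C / 2) / 2 * (\<integral>\<omega>. \<bar>Q \<omega> - v\<bar> \<partial>M)" using iQ by (simp add: prob_space)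
  finally show ?thesis .
qed

end

section \<open>The central limit theorem for weighted sums\<close>

lemma sum_shift_support:
  fixes z f :: "int \<Rightarrow> real"
  assumes "\<And>i. i \<notin> A \<Longrightarrow> z i = 0" "finite A" "finite L" "\<And>i. i \<in> A \<Longrightarrow> i - k \<in> L"
  shows "(\<Sum>i\<in>A. z i * f (i - k)) = (\<Sum>l\<in>L. z (l + k) * f l)"
proof -
  have "(\<Sum>i\<in>A. z i * f (i - k)) = (\<Sum>l\<in>(\<lambda>i. i - k) ` A. z (l + k) * f l)"
    by (subst sum.reindex) (auto simp: inj_on_def)
  also have "\<dots> = (\<Sum>l\<in>L. z (l + k) * f l)"
  proof (rule sum.mono_neutral_left)
    show "\<forall>l\<in>L - (\<lambda>i. i - k) ` A. z (l + k) * f l = 0"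
    proof
      fix l assume "l \<in> L - (\<lambda>i. i - k) ` A"
      then have "l + k \<notin> A" by (metis DiffD2 add_diff_cancel_right' image_eqI)
      then show "z (l + k) * f l = 0" using assms(1) by simp
    qed
  qed (use assms in auto)
  finally show ?thesis .
qed

lemma sum_shift_le:
  fixes f :: "int \<Rightarrow> real"
  assumes "\<And>i. i \<notin> A \<Longrightarrow> f i = 0" "\<And>i. 0 \<le> f i" "finite A" "finite L"
  shows "(\<Sum>l\<in>L. f (l + k)) \<le> (\<Sum>i\<in>A. f i)"
proof -
  have "(\<Sum>l\<in>L. f (l + k)) = (\<Sum>i\<in>(\<lambda>l. l + k) ` L. f i)"
    by (subst sum.reindex) (auto simp: inj_on_def)
  also have "\<dots> = (\<Sum>i\<in>(\<lambda>l. l + k) ` L \<inter> A. f i)"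
    using assms by (intro sum.mono_neutral_right) auto
  also have "\<dots> \<le> (\<Sum>i\<in>A. f i)" using assms by (intro sum_mono2) auto
  finally show ?thesis .
qed

lemma sum_int_interval: "(\<Sum>l\<in>{lo..<lo + int m}. f l) = (\<Sum>j<m. f (lo + int j))"
proof -
  have "{lo..<lo + int m} = (\<lambda>j. lo + int j) ` {..<m}"
    by (auto simp: image_iff intro!: bexI[of _ "nat (_ - lo)"])
  then show ?thesis by (simp only:) (subst sum.reindex, auto simp: inj_on_def)
qed

lemma cmod_diff_triangle3:
  "cmod (x - of_real u) \<le> cmod (x - y) + cmod (y - of_real v) + \<bar>v - u\<bar>"
proof -
  have "x - of_real u = ((x - y) + (y - of_real v)) + of_real (v - u)" by simp
  then have "cmod (x - of_real u) \<le> cmod ((x - y) + (y - of_real v)) + cmod (of_real (v - u))"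
    by (metis norm_triangle_ineq)
  then show ?thesis using norm_triangle_ineq[of "x - y" "y - of_real v"] unfolding norm_of_real by linarith
qed

section \<open>A weighted law of large numbers\<close>

context stationary_filtration
begin

text \<open>After a shift one factor sits at time 0 and the other at time -|i - j|. Projecting the
  former on the past at that time does not change the inner product, and Cauchy-Schwarz
  finishes.\<close>

lemma covariance_decay:
  assumes g: "sqint M g" "g \<in> borel_measurable (F 0)"
  shows "\<bar>\<integral>\<omega>. g (It i \<omega>) * g (It j \<omega>) \<partial>M\<bar> \<le> norm_L2 M (CE (- int (nat \<bar>i - j\<bar>)) g) * norm_L2 M g"
proof -
  have *: "\<bar>\<integral>\<omega>. g (It i \<omega>) * g (It j \<omega>) \<partial>M\<bar> \<le> norm_L2 M (CE (- int (nat \<bar>i - j\<bar>)) g) * norm_L2 M g"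
    if "j \<le> i" for i j
  proof -
    let ?d = "j - i"
    have d: "- int (nat \<bar>i - j\<bar>) = ?d" using that by simp
    have gs: "sqint M (\<lambda>\<omega>. g (It ?d \<omega>))" by (rule sqint_it[OF g(1)])
    have gm: "(\<lambda>\<omega>. g (It ?d \<omega>)) \<in> borel_measurable (F ?d)" using measurable_F_it[OF g(2), of ?d] by simp
    have "(\<integral>\<omega>. g (It i \<omega>) * g (It j \<omega>) \<partial>M) = (\<integral>\<omega>. g (It i \<omega>) * g (It ?d (It i \<omega>)) \<partial>M)"
      by (rule Bochner_Integration.integral_cong) (auto simp: it_add)
    also have "\<dots> = (\<integral>\<omega>. g \<omega> * g (It ?d \<omega>) \<partial>M)"
      by (rule integral_it[where f="\<lambda>\<omega>. g \<omega> * g (It ?d \<omega>)"])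
        (intro borel_measurable_times sqint_measurable g gs)
    also have "\<dots> = (\<integral>\<omega>. g (It ?d \<omega>) * CE ?d g \<omega> \<partial>M)" using CE_inner[OF g(1) gs gm] by (simp add: mult.commute)
    also have "\<bar>\<dots>\<bar> \<le> norm_L2 M (\<lambda>\<omega>. g (It ?d \<omega>)) * norm_L2 M (CE ?d g)"
      by (rule integral_mult_le_norm_L2[OF gs CE_sqint[OF g(1)]])
    also have "norm_L2 M (\<lambda>\<omega>. g (It ?d \<omega>)) = norm_L2 M g" by (rule norm_L2_it[OF sqint_measurable[OF g(1)]])
    finally show ?thesis unfolding d by (simp add: mult.commute)
  qed
  show ?thesis using *[of i j] *[of j i] by (cases "j \<le> i") (simp_all add: mult.commute abs_minus_commute)
qed

text \<open>The double sum of covariances is split at distance D. Distant pairs are controlled by e;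
  of the near ones there are at most 2D + 1 for each i, and each carries a weight bounded by
  m.\<close>

lemma weighted_lln_bound:
  assumes g: "sqint M g" "g \<in> borel_measurable (F 0)"
    and I: "finite I" "(\<Sum>i\<in>I. \<bar>w i\<bar>) \<le> C" "\<And>i. i \<in> I \<Longrightarrow> \<bar>w i\<bar> \<le> m" "0 \<le> m"
    and e: "\<And>d. d \<ge> D \<Longrightarrow> norm_L2 M (CE (- int d) g) * norm_L2 M g \<le> e" "0 \<le> e"
  shows "(norm_L2 M (\<lambda>\<omega>. \<Sum>i\<in>I. w i * g (It i \<omega>)))\<^sup>2 \<le> C * (C * e + (2 * real D + 1) * m * (norm_L2 M g)\<^sup>2)"
proof -
  let ?G = "(norm_L2 M g)\<^sup>2"
  define \<phi> where "\<phi> i j = norm_L2 M (CE (- int (nat \<bar>i - j\<bar>)) g) * norm_L2 M g" for i j :: int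
  have C0: "0 \<le> C" by (rule order_trans[OF sum_nonneg I(2)]) simp
  have phi0: "0 \<le> \<phi> i j" for i j by (simp add: \<phi>_def)
  have phiG: "\<phi> i j \<le> ?G" for i j
    unfolding \<phi>_def power2_eq_square by (intro mult_right_mono CE_norm_le g) simp
  have inner: "(\<Sum>j\<in>I. \<bar>w j\<bar> * \<phi> i j) \<le> C * e + (2 * real D + 1) * m * ?G" for i
  proof -
    have "(\<Sum>j\<in>I. \<bar>w j\<bar> * \<phi> i j) \<le> (\<Sum>j\<in>I. \<bar>w j\<bar> * e + (if j \<in> {i - int D..i + int D} then m * ?G else 0))"
    proof (rule sum_mono)
      fix j assume j: "j \<in> I"
      show "\<bar>w j\<bar> * \<phi> i j \<le> \<bar>w j\<bar> * e + (if j \<in> {i - int D..i + int D} then m * ?G else 0)"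
      proof (cases "j \<in> {i - int D..i + int D}")
        case True
        have "\<bar>w j\<bar> * \<phi> i j \<le> m * ?G" using I(3)[OF j] phiG phi0 I(4) by (intro mult_mono) auto
        then show ?thesis using True e(2) by (simp add: add_increasing)
      next
        case False
        then have "D \<le> nat \<bar>i - j\<bar>" by auto
        then have "\<phi> i j \<le> e" unfolding \<phi>_def by (rule e(1))
        then show ?thesis unfolding if_not_P[OF False] by (simp add: mult_left_mono)
      qed
    qed
    also have "\<dots> = (\<Sum>j\<in>I. \<bar>w j\<bar>) * e + (\<Sum>j\<in>I \<inter> {i - int D..i + int D}. m * ?G)"
      by (simp only: sum.distrib sum_distrib_right sum.inter_restrict[OF I(1)])
    also have "(\<Sum>j\<in>I \<inter> {i - int D..i + int D}. m * ?G) \<le> (\<Sum>j\<in>{i - int D..i + int D}. m * ?G)"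
      using I(4) by (intro sum_mono2) auto
    also have "\<dots> = (2 * real D + 1) * m * ?G" by (simp add: mult.assoc)
    also have "(\<Sum>j\<in>I. \<bar>w j\<bar>) * e \<le> C * e" using I(2) e(2) by (rule mult_right_mono)
    finally show ?thesis by simp
  qed
  have gs: "sqint M (\<lambda>\<omega>. g (It i \<omega>))" for i by (rule sqint_it[OF g(1)])
  have "(norm_L2 M (\<lambda>\<omega>. \<Sum>i\<in>I. w i * g (It i \<omega>)))\<^sup>2 = (\<integral>\<omega>. (\<Sum>i\<in>I. \<Sum>j\<in>I. (w i * w j) * (g (It i \<omega>) * g (It j \<omega>))) \<partial>M)"
    unfolding norm_L2_sq by (simp add: power2_eq_square sum_product algebra_simps)
  also have "\<dots> = (\<Sum>i\<in>I. \<Sum>j\<in>I. (w i * w j) * (\<integral>\<omega>. g (It i \<omega>) * g (It j \<omega>) \<partial>M))"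
    by (simp add: Bochner_Integration.integral_sum sqint_mult_integrable[OF gs gs])
  also have "\<dots> \<le> (\<Sum>i\<in>I. \<Sum>j\<in>I. \<bar>w i\<bar> * (\<bar>w j\<bar> * \<phi> i j))"
  proof (intro sum_mono)
    fix i j
    have "(w i * w j) * (\<integral>\<omega>. g (It i \<omega>) * g (It j \<omega>) \<partial>M) \<le> \<bar>w i * w j\<bar> * \<bar>\<integral>\<omega>. g (It i \<omega>) * g (It j \<omega>) \<partial>M\<bar>"
      by (metis abs_ge_self abs_mult)
    also have "\<dots> \<le> \<bar>w i * w j\<bar> * \<phi> i j" unfolding \<phi>_def by (intro mult_left_mono covariance_decay g) simp
    finally show "(w i * w j) * (\<integral>\<omega>. g (It i \<omega>) * g (It j \<omega>) \<partial>M) \<le> \<bar>w i\<bar> * (\<bar>w j\<bar> * \<phi> i j)" by (simp add: abs_mult mult.assoc)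
  qed
  also have "\<dots> = (\<Sum>i\<in>I. \<bar>w i\<bar> * (\<Sum>j\<in>I. \<bar>w j\<bar> * \<phi> i j))" by (simp add: sum_distrib_left)
  also have "\<dots> \<le> (\<Sum>i\<in>I. \<bar>w i\<bar> * (C * e + (2 * real D + 1) * m * ?G))"
    using inner by (intro sum_mono mult_left_mono) auto
  also have "\<dots> = (\<Sum>i\<in>I. \<bar>w i\<bar>) * (C * e + (2 * real D + 1) * m * ?G)" by (simp add: sum_distrib_right)
  also have "\<dots> \<le> C * (C * e + (2 * real D + 1) * m * ?G)"
    using I(2,4) e(2) C0 by (intro mult_right_mono) auto
  finally show ?thesis .
qed

text \<open>No rate of mixing is available, only the decay of conditional expectations on the remote
  past. Hence D is fixed through this decay, and n is then taken so large that the maximal weight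
  makes the near pairs negligible.\<close>

theorem weighted_lln:
  fixes w :: "nat \<Rightarrow> int \<Rightarrow> real" and m :: "nat \<Rightarrow> real"
  assumes g: "sqint M g" "g \<in> borel_measurable (F 0)" "(\<integral>\<omega>. g \<omega> \<partial>M) = 0"
    and I: "\<And>n. finite (I n)" "\<And>n. (\<Sum>i\<in>I n. \<bar>w n i\<bar>) \<le> C" "\<And>n i. i \<in> I n \<Longrightarrow> \<bar>w n i\<bar> \<le> m n" "\<And>n. 0 \<le> m n"
    and m: "m \<longlonglongrightarrow> 0"
  shows "(\<lambda>n. norm_L2 M (\<lambda>\<omega>. \<Sum>i\<in>I n. w n i * g (It i \<omega>))) \<longlonglongrightarrow> 0"
proof -
  let ?S = "\<lambda>n. (norm_L2 M (\<lambda>\<omega>. \<Sum>i\<in>I n. w n i * g (It i \<omega>)))\<^sup>2"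
  have C0: "0 \<le> C" by (rule order_trans[OF sum_nonneg I(2)[of 0]]) simp
  have "?S \<longlonglongrightarrow> 0"
  proof (rule LIMSEQ_I)
    fix r :: real assume r: "r > 0"
    \<comment> \<open>Chosen so that the distant pairs contribute \<open>C * C * e\<close>, at most
      r / 2; the added 1 covers C = 0.\<close>
    define e where "e = r / (2 * (C * C + 1))"
    have cancel: "K \<noteq> 0 \<Longrightarrow> K * (r / (2 * K)) = r / 2" for K :: real by (simp add: field_simps)
    have e: "e > 0" using r C0 by (auto simp: e_def intro!: divide_pos_pos add_nonneg_pos)
    have "(\<lambda>d. norm_L2 M (CE (- int d) g) * norm_L2 M g) \<longlonglongrightarrow> 0 * norm_L2 M g"
      by (intro tendsto_mult CE_past_tendsto_0 g tendsto_const)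
    then have "(\<lambda>d. norm_L2 M (CE (- int d) g) * norm_L2 M g) \<longlonglongrightarrow> 0" by simp
    then have "\<forall>\<^sub>F d in sequentially. norm_L2 M (CE (- int d) g) * norm_L2 M g < e"
      by (rule order_tendstoD) (rule e)
    then obtain D where D: "\<And>d. d \<ge> D \<Longrightarrow> norm_L2 M (CE (- int d) g) * norm_L2 M g < e"
      by (auto simp: eventually_sequentially)
    have "(\<lambda>n. C * ((2 * real D + 1) * m n * (norm_L2 M g)\<^sup>2)) \<longlonglongrightarrow> C * ((2 * real D + 1) * 0 * (norm_L2 M g)\<^sup>2)"
      by (intro tendsto_mult tendsto_const m)
    then have "(\<lambda>n. C * ((2 * real D + 1) * m n * (norm_L2 M g)\<^sup>2)) \<longlonglongrightarrow> 0" by simp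
    then have "\<forall>\<^sub>F n in sequentially. C * ((2 * real D + 1) * m n * (norm_L2 M g)\<^sup>2) < r / 2"
      by (rule order_tendstoD) (use r in simp)
    then obtain n0 where n0: "\<And>n. n \<ge> n0 \<Longrightarrow> C * ((2 * real D + 1) * m n * (norm_L2 M g)\<^sup>2) < r / 2"
      by (auto simp: eventually_sequentially)
    have "?S n < r" if "n \<ge> n0" for n
    proof -
      have "?S n \<le> C * (C * e + (2 * real D + 1) * m n * (norm_L2 M g)\<^sup>2)"
        by (rule weighted_lln_bound[OF g(1,2) I]) (use D e in \<open>auto intro: less_imp_le\<close>)
      also have "\<dots> = C * C * e + C * ((2 * real D + 1) * m n * (norm_L2 M g)\<^sup>2)" by (simp add: algebra_simps)
      also have "C * C * e \<le> (C * C + 1) * e" using e by simp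
      also have "\<dots> = r / 2"
      proof -
        have "C * C + 1 \<noteq> 0" using C0 by (metis add_nonneg_pos less_irrefl mult_nonneg_nonneg zero_less_one)
        then show ?thesis unfolding e_def by (rule cancel)
      qed
      finally show ?thesis using n0[OF that] by simp
    qed
    then show "\<exists>no. \<forall>n\<ge>no. norm (?S n - 0) < r" by auto
  qed
  from tendsto_real_sqrt[OF this] show ?thesis by simp
qed

end

section \<open>Bounded finite moving averages\<close>

locale bounded_ma = stationary_filtration M T F0 for M :: "'a measure" and T F0 +
  fixes N :: nat and \<mu> :: "int \<Rightarrow> 'a \<Rightarrow> real" and B :: real
  assumes mu_innovation: "innovation (\<mu> k)" and mu_bound: "\<bar>\<mu> k \<omega>\<bar> \<le> B"
begin

abbreviation "KN \<equiv> {- int N..int N}"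

definition ma :: "int \<Rightarrow> 'a \<Rightarrow> real" where
  "ma i \<omega> = (\<Sum>k\<in>KN. \<mu> k (It (i - k) \<omega>))"

lemma B_nonneg: "0 \<le> B"
  using mu_bound[of 0 undefined] by linarith

lemma mu_sqint: "sqint M (\<lambda>\<omega>. \<mu> k (It i \<omega>))"
  by (intro sqint_it innovation_sqint mu_innovation)

lemma mu_measurable: "\<mu> k \<in> borel_measurable M"
  using innovation_sqint[OF mu_innovation, of k] by (simp add: sqint_def)

lemma ma_sqint: "sqint M (ma i)"
  unfolding ma_def[abs_def] by (intro sqint_sum mu_sqint)

text \<open>Products of two innovations at the same time have, after centring, mean zero, but they
  need not be martingale differences. This is why a law of large numbers for general centred
  variables is required.\<close>

definition prod_dev :: "int \<Rightarrow> int \<Rightarrow> 'a \<Rightarrow> real" where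
  "prod_dev k k' \<omega> = \<mu> k \<omega> * \<mu> k' \<omega> - (\<integral>\<omega>. \<mu> k \<omega> * \<mu> k' \<omega> \<partial>M)"

lemma mu_mult_sqint: "sqint M (\<lambda>\<omega>. \<mu> k \<omega> * \<mu> k' \<omega>)"
  by (rule sqint_mult_bounded[OF innovation_sqint[OF mu_innovation] mu_measurable mu_bound])

lemma prod_dev_props:
  shows prod_dev_sqint: "sqint M (prod_dev k k')" and prod_dev_measurable: "prod_dev k k' \<in> borel_measurable (F 0)"
    and prod_dev_mean: "(\<integral>\<omega>. prod_dev k k' \<omega> \<partial>M) = 0"
proof -
  show "sqint M (prod_dev k k')" unfolding prod_dev_def[abs_def] by (intro sqint_diff mu_mult_sqint sqint_const)
  show "prod_dev k k' \<in> borel_measurable (F 0)" unfolding prod_dev_def[abs_def]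
    using mu_innovation by (intro borel_measurable_diff borel_measurable_times borel_measurable_const) (auto simp: innovation_def)
  show "(\<integral>\<omega>. prod_dev k k' \<omega> \<partial>M) = 0"
    unfolding prod_dev_def[abs_def] using sqint_integrable[OF mu_mult_sqint, of k k'] by (simp add: prob_space)
qed

text \<open>Regrouped by the time l = i - k of the innovation, the weighted sum becomes a sum of
  martingale differences of size O(b n). Their sum of squares is bounded, and
  \<open>weighted_lln\<close> makes it concentrate at its mean, which is the variance of the sum;
  McLeish's bound then applies.\<close>

lemma ma_clt:
  fixes z :: "nat \<Rightarrow> int \<Rightarrow> real" and b :: "nat \<Rightarrow> real"
  assumes z0: "\<And>n i. i \<notin> {1..int n} \<Longrightarrow> z n i = 0"
    and zC: "\<And>n. (\<Sum>i\<in>{1..int n}. (z n i)\<^sup>2) \<le> C"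
    and zb: "\<And>n i. \<bar>z n i\<bar> \<le> b n" and b: "b \<longlonglongrightarrow> 0"
  defines "S \<equiv> \<lambda>n \<omega>. \<Sum>i\<in>{1..int n}. z n i * ma i \<omega>"
  shows "(\<lambda>n. (\<integral>\<omega>. iexp (S n \<omega>) \<partial>M) - of_real (exp (- (norm_L2 M (S n))\<^sup>2 / 2))) \<longlonglongrightarrow> 0"
proof -
  define \<xi> where "\<xi> n l \<omega> = (\<Sum>k\<in>KN. \<mu> k (It l \<omega>) * z n (l + k))" for n l \<omega>
  \<comment> \<open>For i in 1..n and |k| <= N the times i - k fill the range from 1 - N to n + N,
    which has n + 2N elements.\<close>
  define lo where "lo = 1 - int N"
  define m where "m n = n + 2 * N" for n
  define L where "L n = {lo..<lo + int (m n)}" for n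
  define Q where "Q n \<omega> = (\<Sum>l\<in>L n. (\<xi> n l \<omega>)\<^sup>2)" for n \<omega>
  define v where "v n = (norm_L2 M (S n))\<^sup>2" for n
  have finL: "finite (L n)" for n by (simp add: L_def)
  have SL: "S n \<omega> = (\<Sum>l\<in>L n. \<xi> n l \<omega>)" for n \<omega>
  proof -
    have "S n \<omega> = (\<Sum>k\<in>KN. \<Sum>i\<in>{1..int n}. z n i * \<mu> k (It (i - k) \<omega>))"
      unfolding S_def ma_def sum_distrib_left by (rule sum.swap)
    also have "\<dots> = (\<Sum>k\<in>KN. \<Sum>l\<in>L n. z n (l + k) * \<mu> k (It l \<omega>))"
      by (intro sum.cong refl sum_shift_support[where f="\<lambda>l. \<mu> _ (It l \<omega>)"])
         (auto simp: z0 L_def lo_def m_def)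
    also have "\<dots> = (\<Sum>l\<in>L n. \<xi> n l \<omega>)" unfolding \<xi>_def by (subst sum.swap) (simp add: mult.commute)
    finally show ?thesis .
  qed
  have mds: "mds (\<xi> n)" for n
    unfolding \<xi>_def[abs_def] by (intro mds_sum mds_cmult[where D="\<lambda>l \<omega>. \<mu> _ (It l \<omega>)"] mds_innovation[OF mu_innovation mu_bound])
  have b0: "0 \<le> b n" for n using zb[of n 0] by linarith
  define c where "c = (2 * real N + 1)"
  have xib: "\<bar>\<xi> n l \<omega>\<bar> \<le> c * (B * b n)" for n l \<omega>
  proof -
    have "\<bar>\<xi> n l \<omega>\<bar> \<le> (\<Sum>k\<in>KN. \<bar>\<mu> k (It l \<omega>) * z n (l + k)\<bar>)" unfolding \<xi>_def by (rule sum_abs)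
    also have "\<dots> \<le> (\<Sum>k\<in>KN. B * b n)"
      unfolding abs_mult using mu_bound zb b0 B_nonneg by (intro sum_mono mult_mono) auto
    finally show ?thesis by (simp add: c_def)
  qed
  \<comment> \<open>One factor c comes from Cauchy-Schwarz over the 2N + 1 lags, the other from
    summing over the lags.\<close>
  define C' where "C' = c * (c * (B\<^sup>2 * C))"
  have c0: "0 \<le> c" by (simp add: c_def)
  have QC: "Q n \<omega> \<le> C'" for n \<omega>
  proof -
    have "Q n \<omega> \<le> (\<Sum>l\<in>L n. c * (\<Sum>k\<in>KN. B\<^sup>2 * (z n (l + k))\<^sup>2))" unfolding Q_def
    proof (rule sum_mono)
      fix l
      have "(\<xi> n l \<omega>)\<^sup>2 \<le> (\<Sum>k\<in>KN. (\<mu> k (It l \<omega>) * z n (l + k))\<^sup>2) * real (card KN)"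
        unfolding \<xi>_def by (rule sum_squared_le_sum_of_squares)
      also have "real (card KN) = c" by (simp add: c_def)
      also have "(\<Sum>k\<in>KN. (\<mu> k (It l \<omega>) * z n (l + k))\<^sup>2) * c \<le> (\<Sum>k\<in>KN. B\<^sup>2 * (z n (l + k))\<^sup>2) * c"
      proof (intro mult_right_mono sum_mono c0)
        fix k
        have "(\<mu> k (It l \<omega>))\<^sup>2 \<le> B\<^sup>2" using power_mono[OF mu_bound[of k "It l \<omega>"], of 2] by simp
        then show "(\<mu> k (It l \<omega>) * z n (l + k))\<^sup>2 \<le> B\<^sup>2 * (z n (l + k))\<^sup>2" unfolding power_mult_distrib by (rule mult_right_mono) simp
      qed
      finally show "(\<xi> n l \<omega>)\<^sup>2 \<le> c * (\<Sum>k\<in>KN. B\<^sup>2 * (z n (l + k))\<^sup>2)" by (simp only: mult.commute)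
    qed
    also have "\<dots> = c * (\<Sum>k\<in>KN. B\<^sup>2 * (\<Sum>l\<in>L n. (z n (l + k))\<^sup>2))"
      unfolding sum_distrib_left by (rule sum.swap)
    also have "\<dots> \<le> c * (\<Sum>k\<in>KN. B\<^sup>2 * C)"
    proof (intro mult_left_mono sum_mono c0)
      fix k
      have "(\<Sum>l\<in>L n. (z n (l + k))\<^sup>2) \<le> (\<Sum>i\<in>{1..int n}. (z n i)\<^sup>2)"
        by (rule sum_shift_le) (auto simp: z0 finL)
      then show "(\<Sum>l\<in>L n. (z n (l + k))\<^sup>2) \<le> C" using zC[of n] by linarith
    qed simp
    also have "\<dots> = C'" by (simp add: C'_def c_def)
    finally show ?thesis .
  qed
  have QM: "Q n \<in> borel_measurable M" for n
    unfolding Q_def[abs_def] using mds_measurable_M[OF mds] by measurable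
  have Qs: "sqint M (Q n)" for n
    by (rule sqint_bounded[OF QM]) (use QC in \<open>auto simp: Q_def sum_nonneg\<close>)
  have vQ: "v n = (\<integral>\<omega>. Q n \<omega> \<partial>M)" for n
  proof -
    have "v n = (\<integral>\<omega>. (\<Sum>l\<in>L n. \<xi> n l \<omega>)\<^sup>2 \<partial>M)" by (simp add: v_def norm_L2_sq SL)
    also have "\<dots> = (\<Sum>l\<in>L n. \<integral>\<omega>. (\<xi> n l \<omega>)\<^sup>2 \<partial>M)" by (rule mds_sum_sq[OF mds finL])
    also have "\<dots> = (\<integral>\<omega>. Q n \<omega> \<partial>M)" unfolding Q_def using mds_sqint[OF mds]
      by (intro Bochner_Integration.integral_sum[symmetric]) (simp add: sqint_def)
    finally show ?thesis .
  qed
  define W where "W n k k' l = z n (l + k) * z n (l + k')" for n k k' l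
  \<comment> \<open>By orthogonality \<open>v n\<close> is exactly the mean of Q. The deviation is
    therefore, for each pair of lags, a weighted sum of centred products.\<close>
  have Qdev: "Q n \<omega> - v n = (\<Sum>k\<in>KN. \<Sum>k'\<in>KN. \<Sum>l\<in>L n. W n k k' l * prod_dev k k' (It l \<omega>))" for n \<omega>
  proof -
    let ?E = "\<lambda>k k'. \<integral>\<omega>. \<mu> k \<omega> * \<mu> k' \<omega> \<partial>M"
    have Qe: "Q n \<omega> = (\<Sum>k\<in>KN. \<Sum>k'\<in>KN. \<Sum>l\<in>L n. W n k k' l * (\<mu> k (It l \<omega>) * \<mu> k' (It l \<omega>)))" for \<omega>
    proof -
      have "Q n \<omega> = (\<Sum>l\<in>L n. \<Sum>k\<in>KN. \<Sum>k'\<in>KN. W n k k' l * (\<mu> k (It l \<omega>) * \<mu> k' (It l \<omega>)))"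
        unfolding Q_def \<xi>_def power2_eq_square sum_product W_def by (simp add: algebra_simps)
      also have "\<dots> = (\<Sum>k\<in>KN. \<Sum>l\<in>L n. \<Sum>k'\<in>KN. W n k k' l * (\<mu> k (It l \<omega>) * \<mu> k' (It l \<omega>)))"
        by (rule sum.swap)
      also have "\<dots> = (\<Sum>k\<in>KN. \<Sum>k'\<in>KN. \<Sum>l\<in>L n. W n k k' l * (\<mu> k (It l \<omega>) * \<mu> k' (It l \<omega>)))"
        by (intro sum.cong refl sum.swap)
      finally show ?thesis .
    qed
    have int1: "integrable M (\<lambda>\<omega>. W n k k' l * (\<mu> k (It l \<omega>) * \<mu> k' (It l \<omega>)))" for k k' l
      by (intro integrable_mult_right sqint_mult_integrable mu_sqint)
    have eq1: "(\<integral>\<omega>. \<mu> k (It l \<omega>) * \<mu> k' (It l \<omega>) \<partial>M) = ?E k k'" for k k' l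
      by (rule integral_it[where f="\<lambda>\<omega>. \<mu> k \<omega> * \<mu> k' \<omega>"]) (rule sqint_measurable[OF mu_mult_sqint])
    have "v n = (\<Sum>k\<in>KN. \<Sum>k'\<in>KN. \<Sum>l\<in>L n. W n k k' l * ?E k k')"
      unfolding vQ Qe using int1 by (simp add: Bochner_Integration.integral_sum eq1)
    then show ?thesis unfolding Qe prod_dev_def by (simp add: right_diff_distrib sum_subtractf)
  qed
  have ex: "(\<lambda>n. \<integral>\<omega>. \<bar>Q n \<omega> - v n\<bar> \<partial>M) \<longlonglongrightarrow> 0"
  proof -
    have wl: "(\<lambda>n. norm_L2 M (\<lambda>\<omega>. \<Sum>l\<in>L n. W n k k' l * prod_dev k k' (It l \<omega>))) \<longlonglongrightarrow> 0" for k k'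
    proof (rule weighted_lln[where C=C and m="\<lambda>n. b n * b n"])
      show "(\<Sum>l\<in>L n. \<bar>W n k k' l\<bar>) \<le> C" for n
      proof -
        have "(\<Sum>l\<in>L n. \<bar>W n k k' l\<bar>) \<le> (\<Sum>l\<in>L n. (z n (l + k))\<^sup>2 / 2 + (z n (l + k'))\<^sup>2 / 2)"
        proof (rule sum_mono)
          fix l
          show "\<bar>W n k k' l\<bar> \<le> (z n (l + k))\<^sup>2 / 2 + (z n (l + k'))\<^sup>2 / 2"
            using sum_squares_bound[of "\<bar>z n (l + k)\<bar>" "\<bar>z n (l + k')\<bar>"] by (simp add: W_def abs_mult)
        qed
        also have "\<dots> = (\<Sum>l\<in>L n. (z n (l + k))\<^sup>2) / 2 + (\<Sum>l\<in>L n. (z n (l + k'))\<^sup>2) / 2"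
          by (simp add: sum.distrib sum_divide_distrib)
        also have "\<dots> \<le> (\<Sum>i\<in>{1..int n}. (z n i)\<^sup>2) / 2 + (\<Sum>i\<in>{1..int n}. (z n i)\<^sup>2) / 2"
          by (intro add_mono divide_right_mono sum_shift_le) (auto simp: z0 finL)
        finally show ?thesis using zC[of n] by simp
      qed
      show "\<bar>W n k k' l\<bar> \<le> b n * b n" for n l unfolding W_def abs_mult using zb b0 by (intro mult_mono) auto
      show "(\<lambda>n. b n * b n) \<longlonglongrightarrow> 0" using tendsto_mult[OF b b] by simp
    qed (simp_all add: prod_dev_props finL b0)
    have le: "(\<integral>\<omega>. \<bar>Q n \<omega> - v n\<bar> \<partial>M) \<le> (\<Sum>k\<in>KN. \<Sum>k'\<in>KN. norm_L2 M (\<lambda>\<omega>. \<Sum>l\<in>L n. W n k k' l * prod_dev k k' (It l \<omega>)))" for n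
    proof -
      have "(\<integral>\<omega>. \<bar>Q n \<omega> - v n\<bar> \<partial>M) \<le> norm_L2 M (\<lambda>\<omega>. Q n \<omega> - v n)"
        by (intro integral_abs_le_norm_L2 sqint_diff Qs sqint_const)
      also have "\<dots> \<le> (\<Sum>k\<in>KN. norm_L2 M (\<lambda>\<omega>. \<Sum>k'\<in>KN. \<Sum>l\<in>L n. W n k k' l * prod_dev k k' (It l \<omega>)))"
        unfolding Qdev by (intro norm_L2_sum sqint_sum sqint_cmult sqint_it prod_dev_sqint)
      also have "\<dots> \<le> (\<Sum>k\<in>KN. \<Sum>k'\<in>KN. norm_L2 M (\<lambda>\<omega>. \<Sum>l\<in>L n. W n k k' l * prod_dev k k' (It l \<omega>)))"
        by (intro sum_mono norm_L2_sum sqint_sum sqint_cmult sqint_it prod_dev_sqint)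
      finally show ?thesis .
    qed
    have lim: "(\<lambda>n. \<Sum>k\<in>KN. \<Sum>k'\<in>KN. norm_L2 M (\<lambda>\<omega>. \<Sum>l\<in>L n. W n k k' l * prod_dev k k' (It l \<omega>))) \<longlonglongrightarrow> (\<Sum>k\<in>KN. \<Sum>k'\<in>KN. 0)"
      by (intro tendsto_sum wl)
    show ?thesis
      by (rule tendsto_sandwich[OF always_eventually[OF allI] always_eventually[OF allI[OF le]] tendsto_const lim[unfolded sum.neutral_const]]) simp
  qed
  have ub: "(\<lambda>n. c * (B * b n)) \<longlonglongrightarrow> 0" using tendsto_mult[OF tendsto_const[of "c * B"] b] by (simp add: mult.assoc)
  then have ev: "\<forall>\<^sub>F n in sequentially. c * (B * b n) < 1" by (rule order_tendstoD) simp
  show ?thesis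
  proof (rule Lim_null_comparison)
    show "\<forall>\<^sub>F n in sequentially. cmod ((\<integral>\<omega>. iexp (S n \<omega>) \<partial>M) - of_real (exp (- (norm_L2 M (S n))\<^sup>2 / 2)))
       \<le> c * (B * b n) * C' + exp (C' / 2) / 2 * (\<integral>\<omega>. \<bar>Q n \<omega> - v n\<bar> \<partial>M)"
      using ev
    proof eventually_elim
      case (elim n)
      have Qe: "Q n \<omega> = (\<Sum>j<m n. (\<xi> n (lo + int j) \<omega>)\<^sup>2)" for \<omega> unfolding Q_def L_def by (rule sum_int_interval)
      have Se: "S n \<omega> = (\<Sum>j<m n. \<xi> n (lo + int j) \<omega>)" for \<omega> unfolding SL L_def by (rule sum_int_interval)
      show ?case unfolding v_def[symmetric] unfolding Se Qe
        by (rule mcleish_bound[OF mds xib]) (use elim QC[of n, unfolded Qe] in \<open>auto simp: v_def\<close>)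
    qed
    have "(\<lambda>n. c * (B * b n) * C' + exp (C' / 2) / 2 * (\<integral>\<omega>. \<bar>Q n \<omega> - v n\<bar> \<partial>M)) \<longlonglongrightarrow> 0 * C' + exp (C' / 2) / 2 * 0"
      by (intro tendsto_add tendsto_mult ub ex tendsto_const)
    then show "(\<lambda>n. c * (B * b n) * C' + exp (C' / 2) / 2 * (\<integral>\<omega>. \<bar>Q n \<omega> - v n\<bar> \<partial>M)) \<longlonglongrightarrow> 0" by simp
  qed
qed

end

section \<open>The central limit theorem for the noise\<close>

context hannan_process
begin

lemma bounded_ma_approx:
  assumes "\<delta> > 0"
  obtains N :: nat and \<mu> B where "bounded_ma M T F0 \<mu> B"
    "\<And>I a. finite I \<Longrightarrow> norm_L2 M (\<lambda>\<omega>. \<Sum>i\<in>I. a i * (\<epsilon> i \<omega> - bounded_ma.ma M T N \<mu> i \<omega>)) \<le> \<delta> * sqrt (\<Sum>i\<in>I. (a i)\<^sup>2)"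
proof -
  obtain N \<mu> B where *: "\<And>k. innovation (\<mu> k)" "\<And>k \<omega>. \<bar>\<mu> k \<omega>\<bar> \<le> B"
    "\<And>I a. finite I \<Longrightarrow> norm_L2 M (\<lambda>\<omega>. \<Sum>i\<in>I. a i * (\<epsilon> i \<omega> - (\<Sum>k\<in>{- int N..int N}. \<mu> k (It (i - k) \<omega>)))) \<le> \<delta> * sqrt (\<Sum>i\<in>I. (a i)\<^sup>2)"
    by (rule bounded_innovation_approx[OF assms]) (rule that)
  interpret bounded_ma M T F0 N \<mu> B by unfold_locales (rule *)+
  show ?thesis
  proof (rule that)
    show "bounded_ma M T F0 \<mu> B" by (rule bounded_ma_axioms)
    show "norm_L2 M (\<lambda>\<omega>. \<Sum>i\<in>I. a i * (\<epsilon> i \<omega> - bounded_ma.ma M T N \<mu> i \<omega>)) \<le> \<delta> * sqrt (\<Sum>i\<in>I. (a i)\<^sup>2)"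
      if "finite I" for I a using *(3)[OF that] by (simp add: ma_def)
  qed
qed

text \<open>The comparison is with the Gaussian law of the same variance for each n, leaving the
  convergence of the variances to a later step. Both characteristic functions move by O(\<delta>),
  uniformly in n, when the noise is replaced by a bounded moving average.\<close>

theorem hannan_clt:
  fixes z :: "nat \<Rightarrow> int \<Rightarrow> real" and b :: "nat \<Rightarrow> real"
  assumes z0: "\<And>n i. i \<notin> {1..int n} \<Longrightarrow> z n i = 0"
    and zC: "\<And>n. (\<Sum>i\<in>{1..int n}. (z n i)\<^sup>2) \<le> C"
    and zb: "\<And>n i. \<bar>z n i\<bar> \<le> b n" and b: "b \<longlonglongrightarrow> 0"
  defines "S \<equiv> \<lambda>n \<omega>. \<Sum>i\<in>{1..int n}. z n i * \<epsilon> i \<omega>"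
  shows "(\<lambda>n. (\<integral>\<omega>. iexp (S n \<omega>) \<partial>M) - of_real (exp (- (norm_L2 M (S n))\<^sup>2 / 2))) \<longlonglongrightarrow> 0"
proof (rule LIMSEQ_I)
  fix r :: real assume r: "r > 0"
  let ?H = hannan_sum
  have C0: "0 \<le> C" using zC[of 0] by simp
  \<comment> \<open>The summand \<open>sqrt C\<close> pays for the characteristic function of the
    sum, the next one for the Gaussian factor; the final 1 makes A positive.\<close>
  define A where "A = sqrt C + (2 * ?H + 1) * C / 2 + 1"
  have A: "A > 0" using C0 hannan_sum_nonneg by (auto simp: A_def intro!: add_nonneg_pos add_nonneg_nonneg)
  define \<delta> where "\<delta> = min 1 (r / (2 * A))"
  have d: "\<delta> > 0" "\<delta> \<le> 1" "\<delta> * A \<le> r / 2"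
  proof -
    show "\<delta> > 0" "\<delta> \<le> 1" using r A by (auto simp: \<delta>_def)
    have "\<delta> * A \<le> r / (2 * A) * A" using A by (intro mult_right_mono) (auto simp: \<delta>_def)
    then show "\<delta> * A \<le> r / 2" using A by simp
  qed
  obtain N \<mu> B where ma: "bounded_ma M T F0 \<mu> B" and
    close: "\<And>I a. finite I \<Longrightarrow> norm_L2 M (\<lambda>\<omega>. \<Sum>i\<in>I. a i * (\<epsilon> i \<omega> - bounded_ma.ma M T N \<mu> i \<omega>)) \<le> \<delta> * sqrt (\<Sum>i\<in>I. (a i)\<^sup>2)"
    by (rule bounded_ma_approx[OF d(1)]) (rule that)
  interpret bounded_ma M T F0 N \<mu> B by (rule ma)
  define S' where "S' n \<omega> = (\<Sum>i\<in>{1..int n}. z n i * ma i \<omega>)" for n \<omega>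
  have S: "sqint M (S n)" for n unfolding S_def by (intro sqint_sum sqint_cmult eps_sqint)
  have S': "sqint M (S' n)" for n unfolding S'_def[abs_def] by (intro sqint_sum sqint_cmult ma_sqint)
  have sq: "sqrt (\<Sum>i\<in>{1..int n}. (z n i)\<^sup>2) \<le> sqrt C" for n using zC[of n] by simp
  have df: "norm_L2 M (\<lambda>\<omega>. S n \<omega> - S' n \<omega>) \<le> \<delta> * sqrt C" for n
  proof -
    have "(\<lambda>\<omega>. S n \<omega> - S' n \<omega>) = (\<lambda>\<omega>. \<Sum>i\<in>{1..int n}. z n i * (\<epsilon> i \<omega> - ma i \<omega>))"
      by (simp add: S_def S'_def sum_subtractf right_diff_distrib)
    then have "norm_L2 M (\<lambda>\<omega>. S n \<omega> - S' n \<omega>) \<le> \<delta> * sqrt (\<Sum>i\<in>{1..int n}. (z n i)\<^sup>2)"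
      by (simp only:) (rule close, simp)
    also have "\<dots> \<le> \<delta> * sqrt C" using d sq by (intro mult_left_mono) auto
    finally show ?thesis .
  qed
  have nS: "norm_L2 M (S n) \<le> ?H * sqrt C" for n
    unfolding S_def using eps_lincomb_norm[of "{1..int n}" "z n"] mult_left_mono[OF sq hannan_sum_nonneg, of n] by simp
  have bound1: "cmod ((\<integral>\<omega>. iexp (S n \<omega>) \<partial>M) - (\<integral>\<omega>. iexp (S' n \<omega>) \<partial>M)) \<le> \<delta> * sqrt C" for n
  proof -
    have [measurable]: "S n \<in> borel_measurable M" "S' n \<in> borel_measurable M" using S S' by (simp_all add: sqint_def)
    have i: "integrable M (\<lambda>\<omega>. iexp (S n \<omega>))" "integrable M (\<lambda>\<omega>. iexp (S' n \<omega>))"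
      by (rule integrable_const_bound[where B=1]; simp)+
    have "cmod ((\<integral>\<omega>. iexp (S n \<omega>) \<partial>M) - (\<integral>\<omega>. iexp (S' n \<omega>) \<partial>M)) = cmod (\<integral>\<omega>. iexp (S n \<omega>) - iexp (S' n \<omega>) \<partial>M)"
      using i by simp
    also have "\<dots> \<le> (\<integral>\<omega>. cmod (iexp (S n \<omega>) - iexp (S' n \<omega>)) \<partial>M)" by (rule integral_norm_bound)
    also have "\<dots> \<le> (\<integral>\<omega>. \<bar>S n \<omega> - S' n \<omega>\<bar> \<partial>M)"
    proof (rule integral_mono)
      show "integrable M (\<lambda>\<omega>. cmod (iexp (S n \<omega>) - iexp (S' n \<omega>)))" using i by simp
      show "integrable M (\<lambda>\<omega>. \<bar>S n \<omega> - S' n \<omega>\<bar>)" using sqint_integrable[OF sqint_diff[OF S S']] by simp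
      fix \<omega>
      have "cmod (iexp (S n \<omega>) - iexp (S' n \<omega>)) = cmod (iexp (S' n \<omega>) * (iexp (S n \<omega> - S' n \<omega>) - 1))"
        by (simp add: right_diff_distrib exp_add[symmetric] algebra_simps)
      also have "\<dots> = cmod (iexp (S n \<omega> - S' n \<omega>) - 1)" by (simp add: norm_mult del: of_real_diff)
      also have "\<dots> \<le> \<bar>S n \<omega> - S' n \<omega>\<bar>" using iexp_approx1[of "S n \<omega> - S' n \<omega>" 0] by simp
      finally show "cmod (iexp (S n \<omega>) - iexp (S' n \<omega>)) \<le> \<bar>S n \<omega> - S' n \<omega>\<bar>" .
    qed
    also have "\<dots> \<le> norm_L2 M (\<lambda>\<omega>. S n \<omega> - S' n \<omega>)" by (intro integral_abs_le_norm_L2 sqint_diff S S')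
    also have "\<dots> \<le> \<delta> * sqrt C" by (rule df)
    finally show ?thesis .
  qed
  have bound2: "\<bar>exp (- (norm_L2 M (S n))\<^sup>2 / 2) - exp (- (norm_L2 M (S' n))\<^sup>2 / 2)\<bar> \<le> \<delta> * ((2 * ?H + 1) * C / 2)" for n
  proof -
    let ?a = "norm_L2 M (S n)" and ?b = "norm_L2 M (S' n)" and ?d = "norm_L2 M (\<lambda>\<omega>. S n \<omega> - S' n \<omega>)"
    have ab: "\<bar>?a - ?b\<bar> \<le> ?d"
      using norm_L2_triangle_sub[OF S S', of n n] norm_L2_triangle_sub[OF S' S, of n n]
      by (simp add: norm_L2_minus_commute[of M "S' n"] abs_le_iff)
    have "\<bar>exp (- (?a\<^sup>2 / 2)) - exp (- (?b\<^sup>2 / 2))\<bar> \<le> \<bar>?a\<^sup>2 / 2 - ?b\<^sup>2 / 2\<bar>" by (rule exp_neg_lipschitz) auto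
    also have "\<dots> = \<bar>?a - ?b\<bar> * (?a + ?b) / 2"
    proof -
      have "?a\<^sup>2 / 2 - ?b\<^sup>2 / 2 = (?a - ?b) * (?a + ?b) / 2" by (simp add: power2_eq_square algebra_simps)
      moreover have "\<bar>?a + ?b\<bar> = ?a + ?b" using norm_L2_nonneg[of M "S n"] norm_L2_nonneg[of M "S' n"] by (simp only: abs_of_nonneg add_nonneg_nonneg)
      ultimately show ?thesis by (simp only: abs_mult abs_divide abs_numeral)
    qed
    also have "\<dots> \<le> (\<delta> * sqrt C) * ((2 * ?H + 1) * sqrt C) / 2"
    proof (intro divide_right_mono mult_mono)
      show "\<bar>?a - ?b\<bar> \<le> \<delta> * sqrt C" using ab df[of n] by simp
      have "?b \<le> ?a + \<delta> * sqrt C" using ab df[of n] by simp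
      moreover have "\<delta> * sqrt C \<le> 1 * sqrt C" using d C0 by (intro mult_right_mono) auto
      ultimately show "?a + ?b \<le> (2 * ?H + 1) * sqrt C" using nS[of n] by (simp add: algebra_simps)
    qed (use d C0 in auto)
    also have "\<dots> = \<delta> * ((2 * ?H + 1) * C / 2)"
    proof -
      have "sqrt C * sqrt C = C" using C0 by simp
      then have "(\<delta> * sqrt C) * ((2 * ?H + 1) * sqrt C) = \<delta> * (2 * ?H + 1) * C"
        by (metis (no_types, opaque_lifting) mult.assoc mult.commute)
      then show ?thesis by simp
    qed
    finally show ?thesis by simp
  qed
  have "(\<lambda>n. (\<integral>\<omega>. iexp (S' n \<omega>) \<partial>M) - of_real (exp (- (norm_L2 M (S' n))\<^sup>2 / 2))) \<longlonglongrightarrow> 0"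
    unfolding S'_def[abs_def] by (rule ma_clt[OF z0 zC zb b])
  from LIMSEQ_D[OF this, of "r / 2"] r obtain n0 where
    n0: "\<And>n. n \<ge> n0 \<Longrightarrow> cmod ((\<integral>\<omega>. iexp (S' n \<omega>) \<partial>M) - of_real (exp (- (norm_L2 M (S' n))\<^sup>2 / 2))) < r / 2"
    by auto
  have "cmod ((\<integral>\<omega>. iexp (S n \<omega>) \<partial>M) - of_real (exp (- (norm_L2 M (S n))\<^sup>2 / 2)) - 0) < r" if "n \<ge> n0" for n
  proof -
    let ?x = "(\<integral>\<omega>. iexp (S n \<omega>) \<partial>M)" and ?y = "(\<integral>\<omega>. iexp (S' n \<omega>) \<partial>M)"
    let ?u = "exp (- (norm_L2 M (S n))\<^sup>2 / 2)" and ?v = "exp (- (norm_L2 M (S' n))\<^sup>2 / 2)"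
    have "cmod (?x - of_real ?u) \<le> cmod (?x - ?y) + cmod (?y - of_real ?v) + \<bar>?v - ?u\<bar>"
      by (rule cmod_diff_triangle3)
    also have "\<dots> < \<delta> * sqrt C + r / 2 + \<delta> * ((2 * ?H + 1) * C / 2)"
      using bound1[of n] bound2[of n] n0[OF that] by (simp add: abs_minus_commute)
    also have "\<dots> \<le> \<delta> * A + r / 2" using d(1) by (simp add: A_def algebra_simps)
    also have "\<dots> \<le> r" using d(3) by simp
    finally show ?thesis by simp
  qed
  then show "\<exists>no. \<forall>n\<ge>no. cmod ((\<integral>\<omega>. iexp (S n \<omega>) \<partial>M) - of_real (exp (- (norm_L2 M (S n))\<^sup>2 / 2)) - 0) < r" by blast
qed

end

section \<open>Quadratic forms\<close>

text \<open>A Toeplitz form with two separate arguments, so that differences of quadratic forms can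
  be expanded bilinearly. The factor 1/n is the one of the empirical autocovariances.\<close>

definition quad :: "nat \<Rightarrow> (int \<Rightarrow> real) \<Rightarrow> (int \<Rightarrow> real) \<Rightarrow> (int \<Rightarrow> real) \<Rightarrow> real" where
  "quad n A e f = (1 / real n) * (\<Sum>i\<in>{1..int n}. \<Sum>j\<in>{1..int n}. A (i - j) * (e i * f j))"

lemma sum_banded_le:
  fixes g :: "int \<Rightarrow> real"
  assumes "finite I" "\<And>k. g k \<le> a" "\<And>k. real_of_int \<bar>k\<bar> > w \<Longrightarrow> g k = 0" "0 \<le> w" "0 \<le> a"
  shows "(\<Sum>j\<in>I. g (i - j)) \<le> a * (2 * w + 1)"
proof -
  let ?J = "{i - \<lfloor>w\<rfloor>..i + \<lfloor>w\<rfloor>}"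
  have "(\<Sum>j\<in>I. g (i - j)) = (\<Sum>j\<in>I \<inter> ?J. g (i - j))"
  proof (rule sum.mono_neutral_right)
    show "\<forall>j\<in>I - I \<inter> ?J. g (i - j) = 0"
    proof
      fix j assume "j \<in> I - I \<inter> ?J"
      then have "\<bar>i - j\<bar> > \<lfloor>w\<rfloor>" by auto
      then have "real_of_int \<bar>i - j\<bar> > w" by (simp only: floor_less_iff)
      then show "g (i - j) = 0" by (rule assms(3))
    qed
  qed (use assms in auto)
  also have "\<dots> \<le> (\<Sum>j\<in>I \<inter> ?J. a)" using assms by (intro sum_mono) auto
  also have "\<dots> \<le> (\<Sum>j\<in>?J. a)" using assms by (intro sum_mono2) auto
  also have "\<dots> = a * (2 * of_int \<lfloor>w\<rfloor> + 1)" using assms(4) by simp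
  also have "\<dots> \<le> a * (2 * w + 1)" using assms by (intro mult_left_mono) auto
  finally show ?thesis .
qed

context stationary_filtration
begin

text \<open>The terms whose second innovation is strictly earlier form a martingale difference
  sequence: at time l = i - k the first innovation multiplies a predictable sum \<open>W l\<close>.
  Only 2w + 1 coefficients can enter \<open>W l\<close>, so the variance is of order n(2w +
  1).\<close>

lemma off_diagonal_norm:
  assumes mu: "innovation \<mu>" "\<And>\<omega>. \<bar>\<mu> \<omega>\<bar> \<le> B" and nu: "innovation \<nu>" "\<And>\<omega>. \<bar>\<nu> \<omega>\<bar> \<le> B"
    and A: "\<And>k. \<bar>A k\<bar> \<le> a" "\<And>k. real_of_int \<bar>k\<bar> > w \<Longrightarrow> A k = 0" "0 \<le> w"
  shows "norm_L2 M (\<lambda>\<omega>. \<Sum>i\<in>{1..int n}. \<Sum>j\<in>{j\<in>{1..int n}. j - k' < i - k}. A (i - j) * (\<mu> (It (i - k) \<omega>) * \<nu> (It (j - k') \<omega>)))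
    \<le> B\<^sup>2 * a * sqrt (real n * (2 * w + 1))"
proof -
  let ?I = "{1..int n}"
  define W where "W l \<omega> = (\<Sum>j\<in>{j\<in>?I. j - k' < l}. A (l + k - j) * \<nu> (It (j - k') \<omega>))" for l \<omega>
  define D where "D l \<omega> = \<mu> (It l \<omega>) * W l \<omega>" for l \<omega>
  have B0: "0 \<le> B" using mu(2)[of undefined] by linarith
  have a0: "0 \<le> a" using A(1)[of 0] by linarith
  have WF: "W l \<in> borel_measurable (F (l - 1))" for l
    unfolding W_def[abs_def]
  proof (intro borel_measurable_sum borel_measurable_times borel_measurable_const)
    fix j assume "j \<in> {j\<in>?I. j - k' < l}"
    then show "(\<lambda>\<omega>. \<nu> (It (j - k') \<omega>)) \<in> borel_measurable (F (l - 1))"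
      by (intro measurable_F_mono[OF innovation_measurable[OF nu(1)]]) auto
  qed
  have Wb: "\<exists>C. \<forall>\<omega>. \<bar>W l \<omega>\<bar> \<le> C" for l
  proof (intro exI allI)
    fix \<omega>
    have "\<bar>W l \<omega>\<bar> \<le> (\<Sum>j\<in>{j\<in>?I. j - k' < l}. \<bar>A (l + k - j) * \<nu> (It (j - k') \<omega>)\<bar>)" unfolding W_def by (rule sum_abs)
    also have "\<dots> \<le> (\<Sum>j\<in>{j\<in>?I. j - k' < l}. a * B)"
      unfolding abs_mult using A(1) nu(2) a0 B0 by (intro sum_mono mult_mono) auto
    finally show "\<bar>W l \<omega>\<bar> \<le> (\<Sum>j\<in>{j\<in>?I. j - k' < l}. a * B)" .
  qed
  have mds: "mds D" unfolding D_def[abs_def] by (rule mds_mult[OF mds_innovation[OF mu] WF Wb])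
  have Ws: "sqint M (W l)" for l unfolding W_def[abs_def] by (intro sqint_sum sqint_cmult sqint_it innovation_sqint nu)
  have nn: "(norm_L2 M \<nu>)\<^sup>2 \<le> B\<^sup>2"
  proof -
    have "(\<integral>\<omega>. (\<nu> \<omega>)\<^sup>2 \<partial>M) \<le> (\<integral>\<omega>. B\<^sup>2 \<partial>M)"
    proof (rule integral_mono)
      show "(\<nu> \<omega>)\<^sup>2 \<le> B\<^sup>2" for \<omega> using power_mono[OF nu(2)[of \<omega>], of 2] by simp
    qed (use innovation_sqint[OF nu(1)] in \<open>simp_all add: sqint_def\<close>)
    then show ?thesis by (simp add: norm_L2_sq prob_space)
  qed
  have Wn: "(\<integral>\<omega>. (W l \<omega>)\<^sup>2 \<partial>M) \<le> B\<^sup>2 * (a\<^sup>2 * (2 * w + 1))" for l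
  proof -
    have "(\<integral>\<omega>. (W l \<omega>)\<^sup>2 \<partial>M) = (norm_L2 M (W l))\<^sup>2" by (simp add: norm_L2_sq)
    also have "norm_L2 M (W l) = norm_L2 M \<nu> * sqrt (\<Sum>j\<in>{j\<in>?I. j - k' < l}. (A (l + k - j))\<^sup>2)"
      unfolding W_def by (rule innovation_lincomb_norm[OF nu(1)], rule finite_subset[of _ ?I]) auto
    also have "\<dots>\<^sup>2 = (norm_L2 M \<nu>)\<^sup>2 * (\<Sum>j\<in>{j\<in>?I. j - k' < l}. (A (l + k - j))\<^sup>2)"
      by (simp add: power_mult_distrib sum_nonneg)
    also have "\<dots> \<le> B\<^sup>2 * (a\<^sup>2 * (2 * w + 1))"
    proof (rule mult_mono[OF nn])
      show "(\<Sum>j\<in>{j\<in>?I. j - k' < l}. (A (l + k - j))\<^sup>2) \<le> a\<^sup>2 * (2 * w + 1)"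
      proof (rule sum_banded_le[where g="\<lambda>k. (A k)\<^sup>2"])
        show "finite {j\<in>?I. j - k' < l}" by (rule finite_subset[of _ ?I]) auto
        show "(A k)\<^sup>2 \<le> a\<^sup>2" for k using power_mono[OF A(1)[of k], of 2] by simp
      qed (use A in auto)
    qed (auto intro: sum_nonneg)
    finally show ?thesis .
  qed
  let ?X = "\<lambda>\<omega>. \<Sum>i\<in>?I. \<Sum>j\<in>{j\<in>?I. j - k' < i - k}. A (i - j) * (\<mu> (It (i - k) \<omega>) * \<nu> (It (j - k') \<omega>))"
  have X: "?X \<omega> = (\<Sum>l\<in>(\<lambda>i. i - k) ` ?I. D l \<omega>)" for \<omega>
    by (subst sum.reindex) (auto simp: inj_on_def D_def W_def sum_distrib_left algebra_simps intro!: sum.cong)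
  have "(\<integral>\<omega>. (?X \<omega>)\<^sup>2 \<partial>M) = (\<Sum>l\<in>(\<lambda>i. i - k) ` ?I. \<integral>\<omega>. (D l \<omega>)\<^sup>2 \<partial>M)"
    unfolding X by (rule mds_sum_sq[OF mds]) simp
  also have "\<dots> \<le> (\<Sum>l\<in>(\<lambda>i. i - k) ` ?I. B\<^sup>2 * (B\<^sup>2 * (a\<^sup>2 * (2 * w + 1))))"
  proof (rule sum_mono)
    fix l
    have "(\<integral>\<omega>. (D l \<omega>)\<^sup>2 \<partial>M) \<le> (\<integral>\<omega>. B\<^sup>2 * (W l \<omega>)\<^sup>2 \<partial>M)"
    proof (rule integral_mono)
      show "integrable M (\<lambda>\<omega>. (D l \<omega>)\<^sup>2)" using mds_sqint[OF mds] by (simp add: sqint_def)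
      show "integrable M (\<lambda>\<omega>. B\<^sup>2 * (W l \<omega>)\<^sup>2)" using Ws by (simp add: sqint_def)
      fix \<omega>
      have "(\<mu> (It l \<omega>))\<^sup>2 \<le> B\<^sup>2" using power_mono[OF mu(2)[of "It l \<omega>"], of 2] by simp
      then show "(D l \<omega>)\<^sup>2 \<le> B\<^sup>2 * (W l \<omega>)\<^sup>2" unfolding D_def power_mult_distrib by (rule mult_right_mono) simp
    qed
    also have "\<dots> \<le> B\<^sup>2 * (B\<^sup>2 * (a\<^sup>2 * (2 * w + 1)))" 
      unfolding integral_mult_right_zero by (rule mult_left_mono[OF Wn]) simp
    finally show "(\<integral>\<omega>. (D l \<omega>)\<^sup>2 \<partial>M) \<le> B\<^sup>2 * (B\<^sup>2 * (a\<^sup>2 * (2 * w + 1)))" .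
  qed
  also have "\<dots> = real n * (B\<^sup>2 * (B\<^sup>2 * (a\<^sup>2 * (2 * w + 1))))"
    by (simp add: card_image inj_on_def)
  also have "\<dots> = (B\<^sup>2 * a)\<^sup>2 * (real n * (2 * w + 1))" by (simp add: power2_eq_square algebra_simps)
  finally have "norm_L2 M ?X \<le> sqrt ((B\<^sup>2 * a)\<^sup>2 * (real n * (2 * w + 1)))"
    unfolding norm_L2_def by (rule real_sqrt_le_mono)
  also have "\<dots> = B\<^sup>2 * a * sqrt (real n * (2 * w + 1))"
    using a0 by (simp add: real_sqrt_mult)
  finally show ?thesis .
qed

end

section \<open>Concentration of forms in bounded moving averages\<close>

context bounded_ma
begin

text \<open>The pairs are split by the order of their innovation times i - k and j - k'. Divided by
  n, the two strict parts have norm of order sqrt(w/n). On the diagonal the coefficient is the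
  constant \<open>A n (k - k')\<close>, and the law of large numbers applies; the centring c comes
  from this part alone.\<close>

lemma mu_quad_concentration:
  fixes A :: "nat \<Rightarrow> int \<Rightarrow> real" and w :: "nat \<Rightarrow> real"
  assumes A: "\<And>n k. \<bar>A n k\<bar> \<le> a" "\<And>n k. real_of_int \<bar>k\<bar> > w n \<Longrightarrow> A n k = 0" "\<And>n. 0 \<le> w n"
    and w: "(\<lambda>n. w n / real n) \<longlonglongrightarrow> 0"
  shows "\<exists>c. (\<lambda>n. norm_L2 M (\<lambda>\<omega>. quad n (A n) (\<lambda>i. \<mu> k (It (i - k) \<omega>)) (\<lambda>i. \<mu> k' (It (i - k') \<omega>)) - c n)) \<longlonglongrightarrow> 0"
proof -
  let ?E = "\<integral>\<omega>. \<mu> k \<omega> * \<mu> k' \<omega> \<partial>M"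
  have a0: "0 \<le> a" using A(1)[of 0 0] by linarith
  define I where "I n = {1..int n}" for n
  have finI: "finite (I n)" for n by (simp add: I_def)
  define T1 where "T1 n \<omega> = (\<Sum>i\<in>I n. \<Sum>j\<in>{j\<in>I n. j - k' < i - k}. A n (i - j) * (\<mu> k (It (i - k) \<omega>) * \<mu> k' (It (j - k') \<omega>)))" for n \<omega>
  \<comment> \<open>The reflected strict part with the two lags exchanged, so that
    \<open>off_diagonal_norm\<close> applies to \<open>\<lambda>k. A n (- k)\<close>.\<close>
  define T2 where "T2 n \<omega> = (\<Sum>j\<in>I n. \<Sum>i\<in>{i\<in>I n. i - k < j - k'}. A n (- (j - i)) * (\<mu> k' (It (j - k') \<omega>) * \<mu> k (It (i - k) \<omega>)))" for n \<omega>
  \<comment> \<open>The indices i whose partner j = i - k + k', which has the same innovation time,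
    still lies in the window.\<close>
  define I' where "I' n = {i\<in>I n. i - k + k' \<in> I n}" for n
  define L' where "L' n = (\<lambda>i. i - k) ` I' n" for n
  define T3 where "T3 n \<omega> = (\<Sum>i\<in>I' n. A n (k - k') * (\<mu> k (It (i - k) \<omega>) * \<mu> k' (It (i - k) \<omega>)))" for n \<omega>
  define c where "c n = (1 / real n) * (\<Sum>i\<in>I' n. A n (k - k') * ?E)" for n
  let ?q = "\<lambda>n \<omega>. quad n (A n) (\<lambda>i. \<mu> k (It (i - k) \<omega>)) (\<lambda>i. \<mu> k' (It (i - k') \<omega>))"
  have split: "?q n \<omega> = (1 / real n) * (T1 n \<omega> + T2 n \<omega> + T3 n \<omega>)" for n \<omega>
  proof -
    let ?t = "\<lambda>i j. A n (i - j) * (\<mu> k (It (i - k) \<omega>) * \<mu> k' (It (j - k') \<omega>))"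
    have "(\<Sum>i\<in>I n. \<Sum>j\<in>I n. ?t i j) = (\<Sum>i\<in>I n. \<Sum>j\<in>I n. (if j - k' < i - k then ?t i j else 0) + (if i - k < j - k' then ?t i j else 0) + (if j = i - k + k' then ?t i j else 0))"
      by (intro sum.cong refl) auto
    also have "\<dots> = (\<Sum>i\<in>I n. \<Sum>j\<in>I n. (if j - k' < i - k then ?t i j else 0)) + (\<Sum>i\<in>I n. \<Sum>j\<in>I n. (if i - k < j - k' then ?t i j else 0))
         + (\<Sum>i\<in>I n. \<Sum>j\<in>I n. (if j = i - k + k' then ?t i j else 0))"
      by (simp only: sum.distrib)
    also have "(\<Sum>i\<in>I n. \<Sum>j\<in>I n. (if j - k' < i - k then ?t i j else 0)) = T1 n \<omega>"
      unfolding T1_def by (intro sum.cong refl sum.inter_filter[symmetric] finI)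
    also have "(\<Sum>i\<in>I n. \<Sum>j\<in>I n. (if i - k < j - k' then ?t i j else 0)) = (\<Sum>j\<in>I n. \<Sum>i\<in>I n. (if i - k < j - k' then ?t i j else 0))"
      by (rule sum.swap)
    also have "\<dots> = (\<Sum>j\<in>I n. \<Sum>i\<in>{i\<in>I n. i - k < j - k'}. ?t i j)"
      by (intro sum.cong refl sum.inter_filter[symmetric] finI)
    also have "\<dots> = T2 n \<omega>" unfolding T2_def by (intro sum.cong refl) (simp add: mult.commute)
    also have "(\<Sum>i\<in>I n. \<Sum>j\<in>I n. (if j = i - k + k' then ?t i j else 0)) = (\<Sum>i\<in>I n. if i - k + k' \<in> I n then ?t i (i - k + k') else 0)"
      by (intro sum.cong refl) (simp add: sum.delta[OF finI])
    also have "\<dots> = (\<Sum>i\<in>I' n. ?t i (i - k + k'))" unfolding I'_def by (rule sum.inter_filter[symmetric, OF finI])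
    also have "\<dots> = T3 n \<omega>" unfolding T3_def by (intro sum.cong refl) simp
    finally show ?thesis unfolding quad_def I_def by simp
  qed
  have T1s: "sqint M (T1 n)" for n unfolding T1_def[abs_def]
    by (intro sqint_sum sqint_cmult sqint_mult_bounded[OF mu_sqint _ mu_bound] sqint_measurable mu_sqint)
  have T2s: "sqint M (T2 n)" for n unfolding T2_def[abs_def]
    by (intro sqint_sum sqint_cmult sqint_mult_bounded[OF mu_sqint _ mu_bound] sqint_measurable mu_sqint)
  have n1: "norm_L2 M (T1 n) \<le> B\<^sup>2 * a * sqrt (real n * (2 * w n + 1))" for n
    unfolding T1_def[abs_def] I_def by (rule off_diagonal_norm[OF mu_innovation mu_bound mu_innovation mu_bound A])
  have n2: "norm_L2 M (T2 n) \<le> B\<^sup>2 * a * sqrt (real n * (2 * w n + 1))" for n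
    unfolding T2_def[abs_def] I_def
    by (rule off_diagonal_norm[OF mu_innovation mu_bound mu_innovation mu_bound, where A="\<lambda>k. A n (- k)"]) (use A in auto)
  have T3c: "(1 / real n) * T3 n \<omega> - c n = A n (k - k') * (\<Sum>l\<in>L' n. (1 / real n) * prod_dev k k' (It l \<omega>))" for n \<omega>
  proof -
    have eq: "(\<Sum>l\<in>L' n. (1 / real n) * prod_dev k k' (It l \<omega>)) = (\<Sum>i\<in>I' n. (1 / real n) * prod_dev k k' (It (i - k) \<omega>))"
      unfolding L'_def by (subst sum.reindex) (auto simp: inj_on_def)
    show ?thesis unfolding eq
      by (simp add: T3_def c_def prod_dev_def sum_distrib_left right_diff_distrib sum_subtractf algebra_simps)
  qed
  have finI': "finite (I' n)" for n by (simp add: I'_def finI)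
  have cardL: "card (L' n) \<le> n" for n
  proof -
    have "card (L' n) \<le> card (I' n)" unfolding L'_def by (rule card_image_le[OF finI'])
    also have "\<dots> \<le> card (I n)" unfolding I'_def using finI by (intro card_mono) auto
    finally show ?thesis by (simp add: I_def)
  qed
  have lln: "(\<lambda>n. norm_L2 M (\<lambda>\<omega>. \<Sum>l\<in>L' n. (1 / real n) * prod_dev k k' (It l \<omega>))) \<longlonglongrightarrow> 0"
  proof (rule weighted_lln[where C=1 and m="\<lambda>n. 1 / real n"])
    show "(\<Sum>l\<in>L' n. \<bar>1 / real n\<bar>) \<le> 1" for n using cardL[of n] by (cases "n = 0") (auto simp: field_simps)
    show "(\<lambda>n. 1 / real n) \<longlonglongrightarrow> 0" by (rule lim_1_over_n)
  qed (simp_all add: prod_dev_props L'_def finI')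
  have bound: "norm_L2 M (\<lambda>\<omega>. ?q n \<omega> - c n) \<le> 2 * (B\<^sup>2 * a) * sqrt (2 * (w n / real n) + 1 / real n)
      + a * norm_L2 M (\<lambda>\<omega>. \<Sum>l\<in>L' n. (1 / real n) * prod_dev k k' (It l \<omega>))" for n
  proof -
    let ?D = "\<lambda>\<omega>. \<Sum>l\<in>L' n. (1 / real n) * prod_dev k k' (It l \<omega>)"
    have Ds: "sqint M ?D" by (intro sqint_sum sqint_cmult sqint_it prod_dev_sqint)
    have "(\<lambda>\<omega>. ?q n \<omega> - c n) = (\<lambda>\<omega>. ((1 / real n) * T1 n \<omega> + (1 / real n) * T2 n \<omega>) + A n (k - k') * ?D \<omega>)"
      unfolding split T3c[symmetric] by (simp add: algebra_simps)
    then have "norm_L2 M (\<lambda>\<omega>. ?q n \<omega> - c n) \<le> norm_L2 M (\<lambda>\<omega>. (1 / real n) * T1 n \<omega> + (1 / real n) * T2 n \<omega>) + norm_L2 M (\<lambda>\<omega>. A n (k - k') * ?D \<omega>)"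
      by (simp only:) (intro norm_L2_triangle sqint_add sqint_cmult T1s T2s Ds)
    also have "norm_L2 M (\<lambda>\<omega>. (1 / real n) * T1 n \<omega> + (1 / real n) * T2 n \<omega>) \<le> norm_L2 M (\<lambda>\<omega>. (1 / real n) * T1 n \<omega>) + norm_L2 M (\<lambda>\<omega>. (1 / real n) * T2 n \<omega>)"
      by (intro norm_L2_triangle sqint_cmult T1s T2s)
    also have "\<dots> = (1 / real n) * norm_L2 M (T1 n) + (1 / real n) * norm_L2 M (T2 n)" unfolding norm_L2_cmult by simp
    also have "\<dots> \<le> (1 / real n) * (B\<^sup>2 * a * sqrt (real n * (2 * w n + 1))) + (1 / real n) * (B\<^sup>2 * a * sqrt (real n * (2 * w n + 1)))"
      by (intro add_mono mult_left_mono n1 n2) auto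
    also have "\<dots> = 2 * (B\<^sup>2 * a) * ((1 / real n) * sqrt (real n * (2 * w n + 1)))" by simp
    also have "(1 / real n) * sqrt (real n * (2 * w n + 1)) = sqrt ((1 / real n)\<^sup>2 * (real n * (2 * w n + 1)))"
      by (simp only: real_sqrt_mult real_sqrt_abs) simp
    also have "(1 / real n)\<^sup>2 * (real n * (2 * w n + 1)) = 2 * (w n / real n) + 1 / real n"
      by (cases "n = 0") (simp_all add: power2_eq_square field_simps)
    also have "norm_L2 M (\<lambda>\<omega>. A n (k - k') * ?D \<omega>) \<le> a * norm_L2 M ?D"
      unfolding norm_L2_cmult by (intro mult_right_mono A) simp
    finally show ?thesis by simp
  qed
  have "(\<lambda>n. 2 * (B\<^sup>2 * a) * sqrt (2 * (w n / real n) + 1 / real n) + a * norm_L2 M (\<lambda>\<omega>. \<Sum>l\<in>L' n. (1 / real n) * prod_dev k k' (It l \<omega>)))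
     \<longlonglongrightarrow> 2 * (B\<^sup>2 * a) * sqrt (2 * 0 + 0) + a * 0"
    by (intro tendsto_add tendsto_mult tendsto_const tendsto_real_sqrt w lln lim_1_over_n)
  then have lim: "(\<lambda>n. 2 * (B\<^sup>2 * a) * sqrt (2 * (w n / real n) + 1 / real n) + a * norm_L2 M (\<lambda>\<omega>. \<Sum>l\<in>L' n. (1 / real n) * prod_dev k k' (It l \<omega>))) \<longlonglongrightarrow> 0"
    by simp
  show ?thesis
    by (rule exI[of _ c], rule tendsto_sandwich[OF always_eventually[OF allI[OF norm_L2_nonneg]] always_eventually[OF allI[OF bound]] tendsto_const lim])
qed

lemma ma_quad_eq:
  "quad n A (\<lambda>i. ma i \<omega>) (\<lambda>i. ma i \<omega>) = (\<Sum>k\<in>KN. \<Sum>k'\<in>KN. quad n A (\<lambda>i. \<mu> k (It (i - k) \<omega>)) (\<lambda>i. \<mu> k' (It (i - k') \<omega>)))"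
proof -
  let ?t = "\<lambda>i j k k'. A (i - j) * (\<mu> k (It (i - k) \<omega>) * \<mu> k' (It (j - k') \<omega>))"
  have "(\<Sum>i\<in>{1..int n}. \<Sum>j\<in>{1..int n}. A (i - j) * (ma i \<omega> * ma j \<omega>)) = (\<Sum>i\<in>{1..int n}. \<Sum>j\<in>{1..int n}. \<Sum>k\<in>KN. \<Sum>k'\<in>KN. ?t i j k k')"
    unfolding ma_def by (intro sum.cong refl) (subst sum_product, simp only: sum_distrib_left)
  also have "\<dots> = (\<Sum>i\<in>{1..int n}. \<Sum>k\<in>KN. \<Sum>j\<in>{1..int n}. \<Sum>k'\<in>KN. ?t i j k k')"
    by (intro sum.cong refl sum.swap)
  also have "\<dots> = (\<Sum>k\<in>KN. \<Sum>i\<in>{1..int n}. \<Sum>j\<in>{1..int n}. \<Sum>k'\<in>KN. ?t i j k k')" by (rule sum.swap)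
  also have "\<dots> = (\<Sum>k\<in>KN. \<Sum>i\<in>{1..int n}. \<Sum>k'\<in>KN. \<Sum>j\<in>{1..int n}. ?t i j k k')"
    by (intro sum.cong refl sum.swap)
  also have "\<dots> = (\<Sum>k\<in>KN. \<Sum>k'\<in>KN. \<Sum>i\<in>{1..int n}. \<Sum>j\<in>{1..int n}. ?t i j k k')"
    by (intro sum.cong refl sum.swap)
  finally show ?thesis unfolding quad_def by (simp add: sum_distrib_left)
qed

lemma mu_quad_sqint: "sqint M (\<lambda>\<omega>. quad n A (\<lambda>i. \<mu> k (It (i - k) \<omega>)) (\<lambda>i. \<mu> k' (It (i - k') \<omega>)))"
  unfolding quad_def
  by (intro sqint_cmult sqint_sum sqint_mult_bounded[OF mu_sqint _ mu_bound] sqint_measurable mu_sqint)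

theorem ma_quad_concentration:
  fixes A :: "nat \<Rightarrow> int \<Rightarrow> real" and w :: "nat \<Rightarrow> real"
  assumes A: "\<And>n k. \<bar>A n k\<bar> \<le> a" "\<And>n k. real_of_int \<bar>k\<bar> > w n \<Longrightarrow> A n k = 0" "\<And>n. 0 \<le> w n"
    and w: "(\<lambda>n. w n / real n) \<longlonglongrightarrow> 0"
  obtains c where "\<And>n. sqint M (\<lambda>\<omega>. quad n (A n) (\<lambda>i. ma i \<omega>) (\<lambda>i. ma i \<omega>) - c n)"
    "(\<lambda>n. norm_L2 M (\<lambda>\<omega>. quad n (A n) (\<lambda>i. ma i \<omega>) (\<lambda>i. ma i \<omega>) - c n)) \<longlonglongrightarrow> 0"
proof -
  let ?q = "\<lambda>n k k' \<omega>. quad n (A n) (\<lambda>i. \<mu> k (It (i - k) \<omega>)) (\<lambda>i. \<mu> k' (It (i - k') \<omega>))"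
  define c where "c k k' = (SOME c. (\<lambda>n. norm_L2 M (\<lambda>\<omega>. ?q n k k' \<omega> - c n)) \<longlonglongrightarrow> 0)" for k k'
  have c: "(\<lambda>n. norm_L2 M (\<lambda>\<omega>. ?q n k k' \<omega> - c k k' n)) \<longlonglongrightarrow> 0" for k k'
    unfolding c_def by (rule someI_ex[OF mu_quad_concentration[of A a w, OF A w]])
  define C where "C n = (\<Sum>k\<in>KN. \<Sum>k'\<in>KN. c k k' n)" for n
  have eq: "quad n (A n) (\<lambda>i. ma i \<omega>) (\<lambda>i. ma i \<omega>) - C n = (\<Sum>k\<in>KN. \<Sum>k'\<in>KN. ?q n k k' \<omega> - c k k' n)" for n \<omega>
    by (simp add: ma_quad_eq C_def sum_subtractf)
  have sq: "sqint M (\<lambda>\<omega>. ?q n k k' \<omega> - c k k' n)" for n k k'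
    by (intro sqint_diff mu_quad_sqint sqint_const)
  have le: "norm_L2 M (\<lambda>\<omega>. quad n (A n) (\<lambda>i. ma i \<omega>) (\<lambda>i. ma i \<omega>) - C n) \<le> (\<Sum>k\<in>KN. \<Sum>k'\<in>KN. norm_L2 M (\<lambda>\<omega>. ?q n k k' \<omega> - c k k' n))" for n
    unfolding eq by (intro order_trans[OF norm_L2_sum sum_mono[OF norm_L2_sum]] sqint_sum sq)
  have lim: "(\<lambda>n. \<Sum>k\<in>KN. \<Sum>k'\<in>KN. norm_L2 M (\<lambda>\<omega>. ?q n k k' \<omega> - c k k' n)) \<longlonglongrightarrow> (\<Sum>k\<in>KN. \<Sum>k'\<in>KN. 0)"
    by (intro tendsto_sum c)
  show ?thesis
  proof (rule that)
    show "sqint M (\<lambda>\<omega>. quad n (A n) (\<lambda>i. ma i \<omega>) (\<lambda>i. ma i \<omega>) - C n)" for n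
      unfolding eq by (intro sqint_sum sq)
    show "(\<lambda>n. norm_L2 M (\<lambda>\<omega>. quad n (A n) (\<lambda>i. ma i \<omega>) (\<lambda>i. ma i \<omega>) - C n)) \<longlonglongrightarrow> 0"
      by (rule tendsto_sandwich[OF always_eventually[OF allI[OF norm_L2_nonneg]] always_eventually[OF allI[OF le]] tendsto_const lim[unfolded sum.neutral_const]])
  qed
qed

end

section \<open>The L^1 bound for tapered forms\<close>

context prob_space
begin

text \<open>With \<open>\<sigma>\<close> the sign of the form, \<open>E|quad|\<close> becomes an integral over \<open>t\<close> of \<open>\<kappa> t\<close> times a deterministic
  bilinear form, which \<open>\<rho>(i - j) = \<Sum>\<^sub>s z\<^sub>s\<^sub>+\<^sub>i z\<^sub>s\<^sub>+\<^sub>j\<close> splits into rank-one pieces.\<close>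

lemma quad_L1_bound:
  fixes e f :: "int \<Rightarrow> 'a \<Rightarrow> real" and K \<kappa> :: "real \<Rightarrow> real" and z :: "int \<Rightarrow> real"
  defines "\<rho> \<equiv> \<lambda>n k. \<Sum>s\<in>{1..int n}. z s * z (s + k)"
  assumes e: "\<And>i. sqint M (e i)" "\<And>I a. finite I \<Longrightarrow> norm_L2 M (\<lambda>\<omega>. \<Sum>i\<in>I. a i * e i \<omega>) \<le> He * sqrt (\<Sum>i\<in>I. (a i)\<^sup>2)" "0 \<le> He"
    and f: "\<And>i. sqint M (f i)" "\<And>I a. finite I \<Longrightarrow> norm_L2 M (\<lambda>\<omega>. \<Sum>i\<in>I. a i * f i \<omega>) \<le> Hf * sqrt (\<Sum>i\<in>I. (a i)\<^sup>2)" "0 \<le> Hf"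
    and \<kappa>: "integrable lborel \<kappa>" and K: "\<And>u. K u = (\<integral>t. \<kappa> t * cos (u * t) \<partial>lborel)"
    and z: "\<And>i. i \<notin> {1..int n} \<Longrightarrow> z i = 0" "(\<Sum>i\<in>{1..int n}. (z i)\<^sup>2) \<le> C"
  shows "(\<integral>\<omega>. \<bar>quad n (\<lambda>k. K (real_of_int k / h) * \<rho> n k) (\<lambda>i. e i \<omega>) (\<lambda>i. f i \<omega>)\<bar> \<partial>M) \<le> 2 * (\<integral>t. \<bar>\<kappa> t\<bar> \<partial>lborel) * (He * Hf * C)"
proof -
  let ?I = "{1..int n}"
  let ?S = "{- int n..int n}"
  have C0: "0 \<le> C" by (rule order_trans[OF sum_nonneg z(2)]) simp
  define q where "q \<omega> = quad n (\<lambda>k. K (real_of_int k / h) * \<rho> n k) (\<lambda>i. e i \<omega>) (\<lambda>i. f i \<omega>)" for \<omega>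
  define \<sigma> where "\<sigma> \<omega> = sgn (q \<omega>)" for \<omega>
  have [measurable]: "e i \<in> borel_measurable M" "f i \<in> borel_measurable M" for i using e(1) f(1) by (simp_all add: sqint_def)
  have qM [measurable]: "q \<in> borel_measurable M" unfolding q_def[abs_def] quad_def by measurable
  have sM [measurable]: "\<sigma> \<in> borel_measurable M" unfolding \<sigma>_def[abs_def] by measurable
  have sb: "\<bar>\<sigma> \<omega>\<bar> \<le> 1" for \<omega> by (simp add: \<sigma>_def sgn_if)
  have se: "sqint M (\<lambda>\<omega>. e i \<omega> * \<sigma> \<omega>)" for i by (rule sqint_mult_bounded[OF e(1) sM sb])
  define m where "m i j = (\<integral>\<omega>. (e i \<omega> * \<sigma> \<omega>) * f j \<omega> \<partial>M)" for i j
  have int_m: "integrable M (\<lambda>\<omega>. (e i \<omega> * \<sigma> \<omega>) * f j \<omega>)" for i j by (rule sqint_mult_integrable[OF se f(1)])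
  \<comment> \<open>Substituting s - j for s makes the expression symmetric in i and j. As z
    vanishes off the window, the range of s can be taken independent of i and j.\<close>
  have rho: "\<rho> n (i - j) = (\<Sum>s\<in>?S. z (s + i) * z (s + j))" if "i \<in> ?I" "j \<in> ?I" for i j
  proof -
    have "\<rho> n (i - j) = (\<Sum>s\<in>?I. z s * (\<lambda>l. z (l + i)) (s - j))"
      unfolding \<rho>_def by (intro sum.cong refl) (simp add: algebra_simps)
    also have "\<dots> = (\<Sum>s\<in>?S. z (s + j) * z (s + i))"
      by (rule sum_shift_support[OF z(1)]) (use that in auto)
    finally show ?thesis by (simp add: mult.commute)
  qed
  define \<Phi> where "\<Phi> t = (\<Sum>i\<in>?I. \<Sum>j\<in>?I. cos (real_of_int (i - j) / h * t) * (\<rho> n (i - j) * m i j))" for t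
  \<comment> \<open>\<open>m i j\<close> contains the sign \<sigma>, so the double sum is one
    integral of \<sigma> times a product of two linear combinations. Since |\<sigma>| <= 1,
    Cauchy-Schwarz reduces it to the linear bounds assumed for e and f.\<close>
  have form: "\<bar>\<Sum>i\<in>?I. \<Sum>j\<in>?I. g i * g j * (z (s + i) * z (s + j) * m i j)\<bar> \<le> He * Hf * (\<Sum>i\<in>?I. (z (s + i))\<^sup>2)"
    if g: "\<And>i. \<bar>g i\<bar> \<le> 1" for g :: "int \<Rightarrow> real" and s
  proof -
    let ?E = "\<lambda>\<omega>. \<Sum>i\<in>?I. (g i * z (s + i)) * e i \<omega>" and ?F = "\<lambda>\<omega>. \<Sum>i\<in>?I. (g i * z (s + i)) * f i \<omega>"
    have Es: "sqint M ?E" and Fs: "sqint M ?F" by (intro sqint_sum sqint_cmult e f)+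
    have "(\<Sum>i\<in>?I. \<Sum>j\<in>?I. g i * g j * (z (s + i) * z (s + j) * m i j)) = (\<Sum>i\<in>?I. \<Sum>j\<in>?I. \<integral>\<omega>. (g i * z (s + i)) * (g j * z (s + j)) * ((e i \<omega> * \<sigma> \<omega>) * f j \<omega>) \<partial>M)"
      by (simp only: m_def integral_mult_right_zero) (simp only: mult_ac)
    also have "\<dots> = (\<integral>\<omega>. (\<Sum>i\<in>?I. \<Sum>j\<in>?I. (g i * z (s + i)) * (g j * z (s + j)) * ((e i \<omega> * \<sigma> \<omega>) * f j \<omega>)) \<partial>M)"
      using int_m by (simp add: Bochner_Integration.integral_sum)
    also have "\<dots> = (\<integral>\<omega>. (?E \<omega> * \<sigma> \<omega>) * ?F \<omega> \<partial>M)"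
      by (simp add: sum_product sum_distrib_right sum_distrib_left algebra_simps)
    finally have "\<bar>\<Sum>i\<in>?I. \<Sum>j\<in>?I. g i * g j * (z (s + i) * z (s + j) * m i j)\<bar> = \<bar>\<integral>\<omega>. (?E \<omega> * \<sigma> \<omega>) * ?F \<omega> \<partial>M\<bar>" by simp
    also have "\<dots> \<le> (\<integral>\<omega>. \<bar>(?E \<omega> * \<sigma> \<omega>) * ?F \<omega>\<bar> \<partial>M)" by (rule integral_abs_bound)
    also have "\<dots> \<le> (\<integral>\<omega>. \<bar>?E \<omega> * ?F \<omega>\<bar> \<partial>M)"
    proof (rule integral_mono)
      show "integrable M (\<lambda>\<omega>. \<bar>(?E \<omega> * \<sigma> \<omega>) * ?F \<omega>\<bar>)"
        by (intro integrable_abs sqint_mult_integrable sqint_mult_bounded[OF Es sM sb] Fs)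
      show "integrable M (\<lambda>\<omega>. \<bar>?E \<omega> * ?F \<omega>\<bar>)" by (intro integrable_abs sqint_mult_integrable Es Fs)
      fix \<omega>
      have "\<bar>?E \<omega>\<bar> * \<bar>\<sigma> \<omega>\<bar> * \<bar>?F \<omega>\<bar> \<le> \<bar>?E \<omega>\<bar> * 1 * \<bar>?F \<omega>\<bar>"
        using sb by (intro mult_right_mono mult_left_mono) auto
      then show "\<bar>(?E \<omega> * \<sigma> \<omega>) * ?F \<omega>\<bar> \<le> \<bar>?E \<omega> * ?F \<omega>\<bar>" by (simp add: abs_mult)
    qed
    also have "\<dots> \<le> norm_L2 M ?E * norm_L2 M ?F" by (rule integral_abs_mult_le_norm_L2[OF Es Fs])
    also have "\<dots> \<le> (He * sqrt (\<Sum>i\<in>?I. (z (s + i))\<^sup>2)) * (Hf * sqrt (\<Sum>i\<in>?I. (z (s + i))\<^sup>2))"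
    proof (rule mult_mono)
      have "(\<Sum>i\<in>?I. (g i * z (s + i))\<^sup>2) \<le> (\<Sum>i\<in>?I. (z (s + i))\<^sup>2)"
      proof (rule sum_mono)
        fix i
        have "(g i)\<^sup>2 \<le> 1" using power_mono[OF g[of i], of 2] by simp
        then have "(g i)\<^sup>2 * (z (s + i))\<^sup>2 \<le> 1 * (z (s + i))\<^sup>2" by (rule mult_right_mono) simp
        then show "(g i * z (s + i))\<^sup>2 \<le> (z (s + i))\<^sup>2" by (simp add: power_mult_distrib)
      qed
      then have sq: "sqrt (\<Sum>i\<in>?I. (g i * z (s + i))\<^sup>2) \<le> sqrt (\<Sum>i\<in>?I. (z (s + i))\<^sup>2)" by (rule real_sqrt_le_mono)
      show "norm_L2 M ?E \<le> He * sqrt (\<Sum>i\<in>?I. (z (s + i))\<^sup>2)"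
        by (rule order_trans[OF e(2) mult_left_mono[OF sq e(3)]]) simp
      show "norm_L2 M ?F \<le> Hf * sqrt (\<Sum>i\<in>?I. (z (s + i))\<^sup>2)"
        by (rule order_trans[OF f(2) mult_left_mono[OF sq f(3)]]) simp
    qed (use e(3) in \<open>auto intro!: mult_nonneg_nonneg sum_nonneg\<close>)
    also have "\<dots> = He * Hf * (\<Sum>i\<in>?I. (z (s + i))\<^sup>2)"
    proof -
      have "sqrt x * sqrt x = x" if "0 \<le> x" for x :: real using that by simp
      from this[OF sum_nonneg, of ?I "\<lambda>i. (z (s + i))\<^sup>2"] show ?thesis by (simp add: mult.assoc mult.left_commute)
    qed
    finally show ?thesis .
  qed
  have Phi: "\<bar>\<Phi> t\<bar> \<le> 2 * (He * Hf * (real n * C))" for t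
  proof -
    let ?c = "\<lambda>i. cos (real_of_int i / h * t)" and ?s = "\<lambda>i. sin (real_of_int i / h * t)"
    have "\<Phi> t = (\<Sum>i\<in>?I. \<Sum>j\<in>?I. \<Sum>s\<in>?S. ?c i * ?c j * (z (s + i) * z (s + j) * m i j) + ?s i * ?s j * (z (s + i) * z (s + j) * m i j))"
      unfolding \<Phi>_def
    proof (intro sum.cong refl)
      fix i j assume ij: "i \<in> ?I" "j \<in> ?I"
      \<comment> \<open>The addition theorem separates i from j at the price of two forms, which is
        the origin of the factor 2 in the bound.\<close>
      have "cos (real_of_int (i - j) / h * t) = ?c i * ?c j + ?s i * ?s j"
        by (simp add: cos_diff diff_divide_distrib left_diff_distrib)
      then show "cos (real_of_int (i - j) / h * t) * (\<rho> n (i - j) * m i j) =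
        (\<Sum>s\<in>?S. ?c i * ?c j * (z (s + i) * z (s + j) * m i j) + ?s i * ?s j * (z (s + i) * z (s + j) * m i j))"
        by (simp only: rho[OF ij] sum_distrib_right sum_distrib_left) (simp only: distrib_right)
    qed
    also have "\<dots> = (\<Sum>i\<in>?I. \<Sum>s\<in>?S. \<Sum>j\<in>?I. ?c i * ?c j * (z (s + i) * z (s + j) * m i j) + ?s i * ?s j * (z (s + i) * z (s + j) * m i j))"
      by (intro sum.cong refl sum.swap)
    also have "\<dots> = (\<Sum>s\<in>?S. \<Sum>i\<in>?I. \<Sum>j\<in>?I. ?c i * ?c j * (z (s + i) * z (s + j) * m i j) + ?s i * ?s j * (z (s + i) * z (s + j) * m i j))"
      by (rule sum.swap)
    finally have Pe: "\<Phi> t = (\<Sum>s\<in>?S. \<Sum>i\<in>?I. \<Sum>j\<in>?I. ?c i * ?c j * (z (s + i) * z (s + j) * m i j) + ?s i * ?s j * (z (s + i) * z (s + j) * m i j))" .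
    have "\<bar>\<Phi> t\<bar> \<le> (\<Sum>s\<in>?S. \<bar>\<Sum>i\<in>?I. \<Sum>j\<in>?I. ?c i * ?c j * (z (s + i) * z (s + j) * m i j) + ?s i * ?s j * (z (s + i) * z (s + j) * m i j)\<bar>)"
      unfolding Pe by (rule sum_abs)
    also have "\<dots> \<le> (\<Sum>s\<in>?S. 2 * (He * Hf * (\<Sum>i\<in>?I. (z (s + i))\<^sup>2)))"
    proof (rule sum_mono)
      fix s
      show "\<bar>\<Sum>i\<in>?I. \<Sum>j\<in>?I. ?c i * ?c j * (z (s + i) * z (s + j) * m i j) + ?s i * ?s j * (z (s + i) * z (s + j) * m i j)\<bar> \<le> 2 * (He * Hf * (\<Sum>i\<in>?I. (z (s + i))\<^sup>2))"
        using form[of ?c s, OF abs_cos_le_one] form[of ?s s, OF abs_sin_le_one] unfolding sum.distrib by linarith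
    qed
    also have "\<dots> = 2 * (He * Hf * (\<Sum>i\<in>?I. \<Sum>s\<in>?S. (z (s + i))\<^sup>2))"
      unfolding sum_distrib_left[symmetric] by (subst sum.swap) simp
    also have "\<dots> \<le> 2 * (He * Hf * (\<Sum>i\<in>?I. C))"
    proof (intro mult_left_mono sum_mono)
      fix i
      have "(\<Sum>s\<in>?S. (z (s + i))\<^sup>2) \<le> (\<Sum>s\<in>?I. (z s)\<^sup>2)" by (rule sum_shift_le) (auto simp: z)
      then show "(\<Sum>s\<in>?S. (z (s + i))\<^sup>2) \<le> C" using z(2) by linarith
    qed (use e(3) f(3) in auto)
    finally show ?thesis by simp
  qed
  have int_kc: "integrable lborel (\<lambda>t. \<kappa> t * cos (u * t))" for u
    by (rule Bochner_Integration.integrable_bound[OF \<kappa>]) (use \<kappa> in \<open>auto simp: abs_mult intro!: AE_I2 mult_left_le\<close>)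
  have int_kc2: "integrable lborel (\<lambda>t. (\<rho> n (i - j) * m i j) * (\<kappa> t * cos (real_of_int (i - j) / h * t)))" for i j
    by (intro integrable_mult_right int_kc)
  have "(\<integral>\<omega>. \<bar>q \<omega>\<bar> \<partial>M) = (\<integral>\<omega>. (1 / real n) * (\<Sum>i\<in>?I. \<Sum>j\<in>?I. (K (real_of_int (i - j) / h) * \<rho> n (i - j)) * ((e i \<omega> * \<sigma> \<omega>) * f j \<omega>)) \<partial>M)"
  proof (rule Bochner_Integration.integral_cong[OF refl])
    fix \<omega>
    have "\<bar>q \<omega>\<bar> = \<sigma> \<omega> * q \<omega>" by (simp add: \<sigma>_def sgn_if)
    then show "\<bar>q \<omega>\<bar> = (1 / real n) * (\<Sum>i\<in>?I. \<Sum>j\<in>?I. (K (real_of_int (i - j) / h) * \<rho> n (i - j)) * ((e i \<omega> * \<sigma> \<omega>) * f j \<omega>))"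
      by (simp add: q_def quad_def sum_distrib_left algebra_simps)
  qed
  also have "\<dots> = (1 / real n) * (\<Sum>i\<in>?I. \<Sum>j\<in>?I. (K (real_of_int (i - j) / h) * \<rho> n (i - j)) * m i j)"
    using int_m by (simp add: Bochner_Integration.integral_sum m_def)
  also have "(\<Sum>i\<in>?I. \<Sum>j\<in>?I. (K (real_of_int (i - j) / h) * \<rho> n (i - j)) * m i j) = (\<Sum>i\<in>?I. \<Sum>j\<in>?I. \<integral>t. (\<rho> n (i - j) * m i j) * (\<kappa> t * cos (real_of_int (i - j) / h * t)) \<partial>lborel)"
    by (simp only: integral_mult_right_zero K) (simp only: mult_ac)
  also have "\<dots> = (\<integral>t. (\<Sum>i\<in>?I. \<Sum>j\<in>?I. (\<rho> n (i - j) * m i j) * (\<kappa> t * cos (real_of_int (i - j) / h * t))) \<partial>lborel)"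
    by (simp only: Bochner_Integration.integral_sum Bochner_Integration.integrable_sum int_kc2)
  also have "\<dots> = (\<integral>t. \<kappa> t * \<Phi> t \<partial>lborel)"
    by (rule Bochner_Integration.integral_cong[OF refl]) (simp add: \<Phi>_def sum_distrib_left mult_ac)
  also have "(1 / real n) * \<dots> \<le> (1 / real n) * (\<integral>t. \<bar>\<kappa> t\<bar> * (2 * (He * Hf * (real n * C))) \<partial>lborel)"
  proof (intro mult_left_mono integral_mono)
    show "integrable lborel (\<lambda>t. \<kappa> t * \<Phi> t)"
    proof (rule Bochner_Integration.integrable_bound)
      show "integrable lborel (\<lambda>t. (2 * (He * Hf * (real n * C))) * \<kappa> t)" using \<kappa> by simp
      show "(\<lambda>t. \<kappa> t * \<Phi> t) \<in> borel_measurable lborel"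
        using \<kappa> unfolding \<Phi>_def by measurable
      show "AE t in lborel. norm (\<kappa> t * \<Phi> t) \<le> norm ((2 * (He * Hf * (real n * C))) * \<kappa> t)"
      proof (rule AE_I2)
        fix t
        have "\<bar>\<kappa> t\<bar> * \<bar>\<Phi> t\<bar> \<le> \<bar>\<kappa> t\<bar> * \<bar>2 * (He * Hf * (real n * C))\<bar>"
          using Phi[of t] by (intro mult_left_mono) auto
        then show "norm (\<kappa> t * \<Phi> t) \<le> norm ((2 * (He * Hf * (real n * C))) * \<kappa> t)"
          by (simp add: abs_mult mult_ac)
      qed
    qed
    show "integrable lborel (\<lambda>t. \<bar>\<kappa> t\<bar> * (2 * (He * Hf * (real n * C))))" using \<kappa> by simp
    fix t
    have "\<kappa> t * \<Phi> t \<le> \<bar>\<kappa> t\<bar> * \<bar>\<Phi> t\<bar>" by (metis abs_ge_self abs_mult)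
    also have "\<dots> \<le> \<bar>\<kappa> t\<bar> * (2 * (He * Hf * (real n * C)))" by (intro mult_left_mono Phi) simp
    finally show "\<kappa> t * \<Phi> t \<le> \<bar>\<kappa> t\<bar> * (2 * (He * Hf * (real n * C)))" .
  qed simp
  \<comment> \<open>The quotient is 1, or 0 by convention when n = 0; an inequality covers both
    cases.\<close>
  also have "\<dots> = (real n / real n) * (2 * (\<integral>t. \<bar>\<kappa> t\<bar> \<partial>lborel) * (He * Hf * C))" by simp
  also have "\<dots> \<le> 1 * (2 * (\<integral>t. \<bar>\<kappa> t\<bar> \<partial>lborel) * (He * Hf * C))"
    using e(3) f(3) C0 by (intro mult_right_mono) auto
  finally show ?thesis by (simp add: q_def)
qed

end

section \<open>Tapered Toeplitz forms\<close>

text \<open>Dominated convergence for the counting measure. The limits inherit the bound g, so all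
  the infinite sums are integrals.\<close>

lemma tannery_infsum:
  fixes f :: "nat \<Rightarrow> 'k \<Rightarrow> real"
  assumes "\<And>n k. \<bar>f n k\<bar> \<le> g k" "g summable_on UNIV" "\<And>k. (\<lambda>n. f n k) \<longlonglongrightarrow> l k"
  shows "(\<lambda>n. \<Sum>\<^sub>\<infinity>k\<in>UNIV. f n k) \<longlonglongrightarrow> (\<Sum>\<^sub>\<infinity>k\<in>UNIV. l k)"
proof -
  have g0: "0 \<le> g k" for k using assms(1)[of 0 k] by linarith
  have lg: "\<bar>l k\<bar> \<le> g k" for k
    using tendsto_rabs[OF assms(3)] by (rule LIMSEQ_le_const2) (use assms(1) in blast)
  have ig: "integrable (count_space UNIV) g"
    using assms(2) g0 abs_summable_equivalent[of g UNIV] by (simp add: Infinite_Set_Sum.abs_summable_on_def)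
  have i: "integrable (count_space UNIV) u" if "\<And>k. \<bar>u k\<bar> \<le> g k" for u :: "'k \<Rightarrow> real"
    by (rule Bochner_Integration.integrable_bound[OF ig]) (use that g0 in auto)
  have e: "(\<Sum>\<^sub>\<infinity>k\<in>UNIV. u k) = integral\<^sup>L (count_space UNIV) u" if "\<And>k. \<bar>u k\<bar> \<le> g k" for u :: "'k \<Rightarrow> real"
    using i[OF that] by (simp add: infsetsum_infsum[symmetric] Infinite_Set_Sum.abs_summable_on_def infsetsum_def)
  have "(\<lambda>n. integral\<^sup>L (count_space UNIV) (f n)) \<longlonglongrightarrow> integral\<^sup>L (count_space UNIV) l"
    by (rule integral_dominated_convergence[where w=g]) (use ig assms in auto)
  then show ?thesis using e[OF lg] e[of "f _", OF assms(1)] by simp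
qed

lemma infsum_eq_sum_support:
  assumes "finite A" "\<And>k. k \<notin> A \<Longrightarrow> f k = (0::real)"
  shows "(\<Sum>\<^sub>\<infinity>k\<in>UNIV. f k) = (\<Sum>k\<in>A. f k)"
proof -
  have "(\<Sum>\<^sub>\<infinity>k\<in>UNIV. f k) = (\<Sum>\<^sub>\<infinity>k\<in>A. f k)"
    by (rule infsum_cong_neutral) (use assms(2) in auto)
  then show ?thesis using assms(1) by simp
qed

text \<open>The argument s + k may leave the window; for sequences extended by zero this truncates
  the sum as in an empirical autocovariance.\<close>

definition acorr :: "(int \<Rightarrow> real) \<Rightarrow> nat \<Rightarrow> int \<Rightarrow> real" where
  "acorr z n k = (\<Sum>s\<in>{1..int n}. z s * z (s + k))"

text \<open>Terms are collected along the diagonals i - j = k. Read from right to left it also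
  exchanges the symbol of a Toeplitz form with the autocorrelation of its argument.\<close>

lemma toeplitz_sum:
  fixes z :: "int \<Rightarrow> real"
  assumes "\<And>i. i \<notin> {1..int n} \<Longrightarrow> z i = 0"
  shows "(\<Sum>i\<in>{1..int n}. \<Sum>j\<in>{1..int n}. z i * z j * \<phi> (i - j)) = (\<Sum>k\<in>{- int n..int n}. \<phi> k * acorr z n k)"
proof -
  have "(\<Sum>i\<in>{1..int n}. \<Sum>j\<in>{1..int n}. z i * z j * \<phi> (i - j)) = (\<Sum>j\<in>{1..int n}. \<Sum>i\<in>{1..int n}. z i * z j * \<phi> (i - j))"
    by (rule sum.swap)
  also have "\<dots> = (\<Sum>j\<in>{1..int n}. z j * (\<Sum>i\<in>{1..int n}. z i * \<phi> (i - j)))"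
    by (simp add: sum_distrib_left mult_ac)
  also have "\<dots> = (\<Sum>j\<in>{1..int n}. z j * (\<Sum>k\<in>{- int n..int n}. z (k + j) * \<phi> k))"
    by (intro sum.cong refl arg_cong2[where f="(*)"] sum_shift_support assms) auto
  also have "\<dots> = (\<Sum>j\<in>{1..int n}. \<Sum>k\<in>{- int n..int n}. \<phi> k * (z j * z (j + k)))"
    by (simp add: sum_distrib_left mult_ac add.commute)
  also have "\<dots> = (\<Sum>k\<in>{- int n..int n}. \<Sum>j\<in>{1..int n}. \<phi> k * (z j * z (j + k)))" by (rule sum.swap)
  finally show ?thesis by (simp add: acorr_def sum_distrib_left)
qed

lemma acorr_minus:
  assumes "\<And>i. i \<notin> {1..int n} \<Longrightarrow> z i = 0" shows "acorr z n (- k) = acorr z n k"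
proof -
  let ?I = "{1..int n}"
  let ?L = "?I \<union> (\<lambda>i. i - k) ` ?I"
  have "acorr z n (- k) = (\<Sum>s\<in>?I. z s * z (s - k))" by (simp add: acorr_def)
  also have "\<dots> = (\<Sum>l\<in>?L. z (l + k) * z l)" by (rule sum_shift_support[OF assms]) auto
  also have "\<dots> = (\<Sum>l\<in>?I. z (l + k) * z l)" by (rule sum.mono_neutral_right) (use assms in auto)
  finally show ?thesis by (simp add: acorr_def mult.commute)
qed

lemma acorr_abs: "(\<And>i. i \<notin> {1..int n} \<Longrightarrow> z i = 0) \<Longrightarrow> acorr z n (int (nat \<bar>k\<bar>)) = acorr z n k"
  using acorr_minus[of n z k] by (cases "0 \<le> k") simp_all

lemma acorr_bound:
  assumes z: "\<And>i. i \<notin> {1..int n} \<Longrightarrow> z i = 0"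
  shows "\<bar>acorr z n k\<bar> \<le> (\<Sum>i\<in>{1..int n}. (z i)\<^sup>2)"
proof -
  let ?I = "{1..int n}"
  have "\<bar>acorr z n k\<bar> \<le> (\<Sum>s\<in>?I. \<bar>z s * z (s + k)\<bar>)" unfolding acorr_def by (rule sum_abs)
  also have "\<dots> \<le> (\<Sum>s\<in>?I. (z s)\<^sup>2 / 2 + (z (s + k))\<^sup>2 / 2)"
  proof (rule sum_mono)
    fix s show "\<bar>z s * z (s + k)\<bar> \<le> (z s)\<^sup>2 / 2 + (z (s + k))\<^sup>2 / 2"
      using sum_squares_bound[of "\<bar>z s\<bar>" "\<bar>z (s + k)\<bar>"] by (simp add: abs_mult)
  qed
  also have "\<dots> = (\<Sum>s\<in>?I. (z s)\<^sup>2) / 2 + (\<Sum>s\<in>?I. (z (s + k))\<^sup>2) / 2" by (simp add: sum.distrib sum_divide_distrib)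
  also have "(\<Sum>s\<in>?I. (z (s + k))\<^sup>2) \<le> (\<Sum>s\<in>?I. (z s)\<^sup>2)" by (rule sum_shift_le) (auto simp: z)
  finally show ?thesis by simp
qed

section \<open>Absolute summability of the autocovariances\<close>

context hannan_process
begin

abbreviation "\<gamma> \<equiv> autocov M \<epsilon>"

lemma eps_cov: "(\<integral>\<omega>. \<epsilon> i \<omega> * \<epsilon> j \<omega> \<partial>M) = \<gamma> (i - j)"
proof -
  have "(\<integral>\<omega>. \<epsilon> i \<omega> * \<epsilon> j \<omega> \<partial>M) = (\<integral>\<omega>. \<epsilon> 0 (It j \<omega>) * \<epsilon> (i - j) (It j \<omega>) \<partial>M)"
    by (rule Bochner_Integration.integral_cong)
       (auto simp: eps_stat[of _ i] eps_stat[of _ j] eps_stat[of _ "i - j"] it_space it_add)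
  also have "\<dots> = (\<integral>\<omega>. \<epsilon> 0 \<omega> * \<epsilon> (i - j) \<omega> \<partial>M)"
    by (rule integral_it[where f="\<lambda>\<omega>. \<epsilon> 0 \<omega> * \<epsilon> (i - j) \<omega>"]) (intro borel_measurable_times sqint_measurable eps_sqint)
  finally show ?thesis by (simp add: autocov_def)
qed

lemma partial_cov_tendsto:
  "(\<lambda>N. \<integral>\<omega>. partial_proc N 0 \<omega> * partial_proc N k \<omega> \<partial>M) \<longlonglongrightarrow> \<gamma> k"
proof -
  let ?d = "\<lambda>i N. norm_L2 M (\<lambda>\<omega>. \<epsilon> i \<omega> - partial_proc N i \<omega>)"
  have le: "\<bar>(\<integral>\<omega>. partial_proc N 0 \<omega> * partial_proc N k \<omega> \<partial>M) - \<gamma> k\<bar> \<le> ?d 0 N * norm_L2 M (\<epsilon> k) + (norm_L2 M (\<epsilon> 0) + ?d 0 N) * ?d k N" for N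
  proof -
    have s: "sqint M (\<lambda>\<omega>. \<epsilon> i \<omega> - partial_proc N i \<omega>)" for i by (intro sqint_diff eps_sqint partial_proc_sqint)
    have "\<gamma> k - (\<integral>\<omega>. partial_proc N 0 \<omega> * partial_proc N k \<omega> \<partial>M)
       = (\<integral>\<omega>. (\<epsilon> 0 \<omega> - partial_proc N 0 \<omega>) * \<epsilon> k \<omega> \<partial>M) + (\<integral>\<omega>. partial_proc N 0 \<omega> * (\<epsilon> k \<omega> - partial_proc N k \<omega>) \<partial>M)"
      unfolding autocov_def using sqint_mult_integrable[OF eps_sqint[of 0] eps_sqint[of k]]
        sqint_mult_integrable[OF partial_proc_sqint[of N 0] eps_sqint[of k]]
        sqint_mult_integrable[OF partial_proc_sqint[of N 0] partial_proc_sqint[of N k]]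
      by (simp add: left_diff_distrib right_diff_distrib)
    moreover have "\<bar>\<integral>\<omega>. (\<epsilon> 0 \<omega> - partial_proc N 0 \<omega>) * \<epsilon> k \<omega> \<partial>M\<bar> \<le> ?d 0 N * norm_L2 M (\<epsilon> k)"
      by (rule integral_mult_le_norm_L2[OF s eps_sqint])
    moreover have "\<bar>\<integral>\<omega>. partial_proc N 0 \<omega> * (\<epsilon> k \<omega> - partial_proc N k \<omega>) \<partial>M\<bar> \<le> norm_L2 M (partial_proc N 0) * ?d k N"
      by (rule integral_mult_le_norm_L2[OF partial_proc_sqint s])
    moreover have "norm_L2 M (partial_proc N 0) * ?d k N \<le> (norm_L2 M (\<epsilon> 0) + ?d 0 N) * ?d k N"
      using norm_L2_triangle_sub[OF partial_proc_sqint eps_sqint, of N 0 0]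
      by (intro mult_right_mono) (simp_all add: norm_L2_minus_commute[of M "partial_proc N 0"])
    ultimately show ?thesis by linarith
  qed
  have "(\<lambda>N. ?d 0 N * norm_L2 M (\<epsilon> k) + (norm_L2 M (\<epsilon> 0) + ?d 0 N) * ?d k N) \<longlonglongrightarrow> 0 * norm_L2 M (\<epsilon> k) + (norm_L2 M (\<epsilon> 0) + 0) * 0"
    by (intro tendsto_add tendsto_mult partial_proc_tendsto tendsto_const)
  then have "(\<lambda>N. ?d 0 N * norm_L2 M (\<epsilon> k) + (norm_L2 M (\<epsilon> 0) + ?d 0 N) * ?d k N) \<longlonglongrightarrow> 0" by simp
  then have "(\<lambda>N. (\<integral>\<omega>. partial_proc N 0 \<omega> * partial_proc N k \<omega> \<partial>M) - \<gamma> k) \<longlonglongrightarrow> 0"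
    by (rule Lim_null_comparison[rotated]) (use le in \<open>auto intro!: always_eventually\<close>)
  then show ?thesis by (rule LIM_zero_cancel)
qed

text \<open>For the truncated process, innovations of lags a and b are correlated at distance k only
  if k = b - a. Summed over k, each pair (a, b) thus occurs at most once, which gives the square of
  Hannan's sum. The truncation is removed with J fixed.\<close>

lemma sum_abs_autocov_le:
  assumes "finite J" shows "(\<Sum>k\<in>J. \<bar>\<gamma> k\<bar>) \<le> hannan_sum\<^sup>2"
proof (rule LIMSEQ_le_const2)
  show "(\<lambda>N. \<Sum>k\<in>J. \<bar>\<integral>\<omega>. partial_proc N 0 \<omega> * partial_proc N k \<omega> \<partial>M\<bar>) \<longlonglongrightarrow> (\<Sum>k\<in>J. \<bar>\<gamma> k\<bar>)"
    by (intro tendsto_sum tendsto_rabs partial_cov_tendsto)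
  have "(\<Sum>k\<in>J. \<bar>\<integral>\<omega>. partial_proc N 0 \<omega> * partial_proc N k \<omega> \<partial>M\<bar>) \<le> hannan_sum\<^sup>2" for N
  proof -
    let ?K = "{- int N..int N}"
    let ?p = "\<lambda>k. norm_L2 M (innov k)"
    have sq: "sqint M (\<lambda>\<omega>. innov k (It i \<omega>))" for k i by (intro sqint_it innovation_sqint innovation_innov)
    have "\<bar>\<integral>\<omega>. partial_proc N 0 \<omega> * partial_proc N k \<omega> \<partial>M\<bar> \<le> (\<Sum>a\<in>?K. \<Sum>b\<in>?K. if k = b - a then ?p a * ?p b else 0)" for k
    proof -
      have eq: "(\<integral>\<omega>. partial_proc N 0 \<omega> * partial_proc N k \<omega> \<partial>M) = (\<Sum>a\<in>?K. \<Sum>b\<in>?K. \<integral>\<omega>. innov a (It (0 - a) \<omega>) * innov b (It (k - b) \<omega>) \<partial>M)"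
        unfolding partial_proc_def sum_product
        by (simp only: Bochner_Integration.integral_sum Bochner_Integration.integrable_sum sqint_mult_integrable[OF sq sq])
      have "\<bar>\<integral>\<omega>. partial_proc N 0 \<omega> * partial_proc N k \<omega> \<partial>M\<bar> \<le> (\<Sum>a\<in>?K. \<Sum>b\<in>?K. \<bar>\<integral>\<omega>. innov a (It (0 - a) \<omega>) * innov b (It (k - b) \<omega>) \<partial>M\<bar>)"
        unfolding eq by (rule order_trans[OF sum_abs sum_mono[OF sum_abs]])
      also have "\<dots> \<le> (\<Sum>a\<in>?K. \<Sum>b\<in>?K. if k = b - a then ?p a * ?p b else 0)"
      proof (intro sum_mono)
        fix a b
        show "\<bar>\<integral>\<omega>. innov a (It (0 - a) \<omega>) * innov b (It (k - b) \<omega>) \<partial>M\<bar> \<le> (if k = b - a then ?p a * ?p b else 0)"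
        proof (cases "k = b - a")
          case True
          have "norm_L2 M (\<lambda>\<omega>. innov c (It i \<omega>)) = ?p c" for c i
            by (rule norm_L2_it[OF sqint_measurable[OF innovation_sqint[OF innovation_innov]]])
          then show ?thesis using integral_mult_le_norm_L2[OF sq[of a "0 - a"] sq[of b "k - b"]] True by simp
        next
          case False
          then show ?thesis using innovation_pairwise[OF innovation_innov innovation_innov, of "0 - a" "k - b" a b] by simp
        qed
      qed
      finally show ?thesis .
    qed
    then have "(\<Sum>k\<in>J. \<bar>\<integral>\<omega>. partial_proc N 0 \<omega> * partial_proc N k \<omega> \<partial>M\<bar>) \<le> (\<Sum>k\<in>J. \<Sum>a\<in>?K. \<Sum>b\<in>?K. if k = b - a then ?p a * ?p b else 0)"
      by (rule sum_mono)
    also have "\<dots> = (\<Sum>a\<in>?K. \<Sum>k\<in>J. \<Sum>b\<in>?K. if k = b - a then ?p a * ?p b else 0)"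
      by (rule sum.swap)
    also have "\<dots> = (\<Sum>a\<in>?K. \<Sum>b\<in>?K. \<Sum>k\<in>J. if k = b - a then ?p a * ?p b else 0)"
      by (intro sum.cong refl sum.swap)
    also have "\<dots> \<le> (\<Sum>a\<in>?K. \<Sum>b\<in>?K. ?p a * ?p b)"
      using assms by (intro sum_mono) (simp add: sum.delta)
    also have "\<dots> = (\<Sum>a\<in>?K. ?p a)\<^sup>2" by (simp add: sum_product power2_eq_square)
    also have "\<dots> \<le> hannan_sum\<^sup>2" by (intro power_mono sum_innov_le sum_nonneg) auto
    finally show ?thesis .
  qed
  then show "\<exists>N0. \<forall>N\<ge>N0. (\<Sum>k\<in>J. \<bar>\<integral>\<omega>. partial_proc N 0 \<omega> * partial_proc N k \<omega> \<partial>M\<bar>) \<le> hannan_sum\<^sup>2" by blast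
qed

lemma autocov_abs_summable: "(\<lambda>k. \<bar>\<gamma> k\<bar>) summable_on UNIV"
  by (rule nonneg_bdd_above_summable_on) (auto intro!: bdd_aboveI2[where M="hannan_sum\<^sup>2"] sum_abs_autocov_le)

end

section \<open>Tapered variance estimation with given weights\<close>

locale hannan_taper = hannan_process M T F0 \<epsilon> for M :: "'a measure" and T F0 \<epsilon> +
  fixes K \<kappa> :: "real \<Rightarrow> real" and c0 K1 :: real and h :: "nat \<Rightarrow> real"
  assumes \<kappa>_integrable: "integrable lborel \<kappa>"
    and K_cos: "K u = (\<integral>t. \<kappa> t * cos (u * t) \<partial>lborel)"
    and K_bound: "\<bar>K u\<bar> \<le> K1"
    and K_support: "c0 < \<bar>u\<bar> \<Longrightarrow> K u = 0"
    and K_cont: "isCont K 0" and K_0: "K 0 = 1"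
    and h_pos: "1 \<le> n \<Longrightarrow> 0 < h n"
    and h_top: "filterlim h at_top sequentially"
    and h_small: "(\<lambda>n. h n / real n) \<longlonglongrightarrow> 0"
begin

text \<open>The absolute values keep the width nonnegative whatever the sign of \<open>c0\<close>
  and for n = 0, where \<open>h\<close> is not constrained.\<close>

definition band :: "nat \<Rightarrow> real" where "band n = \<bar>c0\<bar> * \<bar>h n\<bar>"

lemma band_nonneg: "0 \<le> band n"
  by (simp add: band_def)

lemma band_ratio: "(\<lambda>n. band n / real n) \<longlonglongrightarrow> 0"
proof -
  have "(\<lambda>n. \<bar>c0\<bar> * \<bar>h n / real n\<bar>) \<longlonglongrightarrow> \<bar>c0\<bar> * \<bar>0\<bar>"
    by (intro tendsto_mult tendsto_const tendsto_rabs h_small)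
  then show ?thesis by (simp add: band_def abs_divide)
qed

lemma K1_nonneg: "0 \<le> K1"
  using K_bound[of 0] by linarith

text \<open>The variance estimate is a Toeplitz form in the weights with residual autocovariances in
  its symbol. Here the roles are exchanged: the autocorrelation of the weights enters the symbol,
  and the residuals become the arguments.\<close>

definition taper :: "(nat \<Rightarrow> int \<Rightarrow> real) \<Rightarrow> nat \<Rightarrow> int \<Rightarrow> real" where
  "taper z n k = K (real_of_int k / h n) * acorr (z n) n k"

end

locale design_weights = hannan_taper M T F0 \<epsilon> K \<kappa> c0 K1 h
  for M :: "'a measure" and T F0 \<epsilon> and K \<kappa> :: "real \<Rightarrow> real" and c0 K1 :: real and h :: "nat \<Rightarrow> real" +
  fixes z :: "nat \<Rightarrow> int \<Rightarrow> real" and C :: real and b :: "nat \<Rightarrow> real" and r :: "nat \<Rightarrow> real"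
  assumes z0: "i \<notin> {1..int n} \<Longrightarrow> z n i = 0"
    and zC: "(\<Sum>i\<in>{1..int n}. (z n i)\<^sup>2) \<le> C"
    and zb: "\<bar>z n i\<bar> \<le> b n" and b: "b \<longlonglongrightarrow> 0"
    and zr: "(\<lambda>n. acorr (z n) n (int k)) \<longlonglongrightarrow> r k"
begin

text \<open>The limit variance in the time domain. For the weights of the regression it is the
  diagonal entry of F^(-1) G F^(-1).\<close>

definition V :: real where
  "V = (\<Sum>\<^sub>\<infinity>k\<in>UNIV. \<gamma> k * r (nat \<bar>k\<bar>))"

definition S :: "nat \<Rightarrow> 'a \<Rightarrow> real" where
  "S n \<omega> = (\<Sum>i\<in>{1..int n}. z n i * \<epsilon> i \<omega>)"

lemma C_nonneg: "0 \<le> C"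
  by (rule order_trans[OF sum_nonneg zC]) simp

lemma S_sqint: "sqint M (S n)"
  unfolding S_def[abs_def] by (intro sqint_sum sqint_cmult eps_sqint)

lemma S_norm: "norm_L2 M (S n) \<le> hannan_sum * sqrt C"
proof -
  have "sqrt (\<Sum>i\<in>{1..int n}. (z n i)\<^sup>2) \<le> sqrt C" using zC[of n] by simp
  from mult_left_mono[OF this hannan_sum_nonneg] show ?thesis
    unfolding S_def[abs_def] by (rule order_trans[OF eps_lincomb_norm, rotated]) simp
qed

lemma acorr_le_C: "\<bar>acorr (z n) n k\<bar> \<le> C"
  by (rule order_trans[OF acorr_bound[OF z0] zC])

lemma acorr_tendsto: "(\<lambda>n. acorr (z n) n k) \<longlonglongrightarrow> r (nat \<bar>k\<bar>)"
proof -
  have "acorr (z n) n (int (nat \<bar>k\<bar>)) = acorr (z n) n k" for n by (rule acorr_abs[OF z0])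
  then show ?thesis using zr[of "nat \<bar>k\<bar>"] by simp
qed

text \<open>Both the variance of S, with g = 1, and the mean of the tapered form have this shape,
  hence the common limit. Domination is by \<open>\<bar>\<gamma> k\<bar> * (B * C)\<close>.\<close>

lemma V_limit_weighted:
  assumes "\<And>n k. \<bar>g n k\<bar> \<le> B" "\<And>k. (\<lambda>n. g n k) \<longlonglongrightarrow> 1"
  shows "(\<lambda>n. \<Sum>k\<in>{- int n..int n}. \<gamma> k * (g n k * acorr (z n) n k)) \<longlonglongrightarrow> V"
proof -
  have B: "0 \<le> B" using assms(1)[of 0 0] by linarith
  let ?f = "\<lambda>n k. if k \<in> {- int n..int n} then \<gamma> k * (g n k * acorr (z n) n k) else 0"
  have "(\<lambda>n. \<Sum>\<^sub>\<infinity>k\<in>UNIV. ?f n k) \<longlonglongrightarrow> V" unfolding V_def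
  proof (rule tannery_infsum[where g="\<lambda>k. \<bar>\<gamma> k\<bar> * (B * C)"])
    show "\<bar>?f n k\<bar> \<le> \<bar>\<gamma> k\<bar> * (B * C)" for n k
    proof (cases "k \<in> {- int n..int n}")
      case True
      have "\<bar>g n k\<bar> * \<bar>acorr (z n) n k\<bar> \<le> B * C" using assms(1) acorr_le_C B by (intro mult_mono) auto
      then show ?thesis using True by (simp add: abs_mult mult_left_mono)
    next
      case False
      then show ?thesis unfolding if_not_P[OF False] using B C_nonneg by simp
    qed
    show "(\<lambda>k. \<bar>\<gamma> k\<bar> * (B * C)) summable_on UNIV" by (rule summable_on_cmult_left[OF autocov_abs_summable])
    fix k
    have "(\<lambda>n. \<gamma> k * (g n k * acorr (z n) n k)) \<longlonglongrightarrow> \<gamma> k * (1 * r (nat \<bar>k\<bar>))"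
      by (intro tendsto_mult tendsto_const assms acorr_tendsto)
    moreover have "\<forall>\<^sub>F n in sequentially. \<gamma> k * (g n k * acorr (z n) n k) = ?f n k"
      using eventually_ge_at_top[of "nat \<bar>k\<bar>"] by eventually_elim auto
    ultimately show "(\<lambda>n. ?f n k) \<longlonglongrightarrow> \<gamma> k * r (nat \<bar>k\<bar>)"
      using Lim_transform_eventually by simp
  qed
  moreover have "(\<Sum>\<^sub>\<infinity>k\<in>UNIV. ?f n k) = (\<Sum>k\<in>{- int n..int n}. \<gamma> k * (g n k * acorr (z n) n k))" for n
    by (subst infsum_eq_sum_support[of "{- int n..int n}"]) (auto intro: sum.cong)
  ultimately show ?thesis by simp
qed

lemma S_variance_tendsto: "(\<lambda>n. (norm_L2 M (S n))\<^sup>2) \<longlonglongrightarrow> V"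
proof -
  have "(norm_L2 M (S n))\<^sup>2 = (\<Sum>k\<in>{- int n..int n}. \<gamma> k * (1 * acorr (z n) n k))" for n
  proof -
    have "(norm_L2 M (S n))\<^sup>2 = (\<integral>\<omega>. (\<Sum>i\<in>{1..int n}. \<Sum>j\<in>{1..int n}. (z n i * z n j) * (\<epsilon> i \<omega> * \<epsilon> j \<omega>)) \<partial>M)"
      unfolding norm_L2_sq S_def by (simp add: power2_eq_square sum_product mult_ac)
    also have "\<dots> = (\<Sum>i\<in>{1..int n}. \<Sum>j\<in>{1..int n}. (z n i * z n j) * \<gamma> (i - j))"
      by (simp add: Bochner_Integration.integral_sum sqint_mult_integrable[OF eps_sqint eps_sqint] eps_cov)
    also have "\<dots> = (\<Sum>k\<in>{- int n..int n}. \<gamma> k * acorr (z n) n k)" by (rule toeplitz_sum[OF z0])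
    finally show ?thesis by simp
  qed
  then show ?thesis using V_limit_weighted[of "\<lambda>_ _. 1" 1] by simp
qed

text \<open>The factor t is absorbed into the weights, whose energy and maximum remain under
  control, and the central limit theorem is applied at argument 1.\<close>

lemma S_char_tendsto: "(\<lambda>n. \<integral>\<omega>. iexp (t * S n \<omega>) \<partial>M) \<longlonglongrightarrow> of_real (exp (- t\<^sup>2 * V / 2))"
proof -
  let ?z = "\<lambda>n i. t * z n i"
  have tS: "(\<Sum>i\<in>{1..int n}. ?z n i * \<epsilon> i \<omega>) = t * S n \<omega>" for n \<omega>
    by (simp add: S_def sum_distrib_left mult.assoc)
  have bt: "(\<lambda>n. \<bar>t\<bar> * b n) \<longlonglongrightarrow> 0" using tendsto_mult[OF tendsto_const[of "\<bar>t\<bar>"] b] by simp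
  have "(\<lambda>n. (\<integral>\<omega>. iexp (\<Sum>i\<in>{1..int n}. ?z n i * \<epsilon> i \<omega>) \<partial>M) - of_real (exp (- (norm_L2 M (\<lambda>\<omega>. \<Sum>i\<in>{1..int n}. ?z n i * \<epsilon> i \<omega>))\<^sup>2 / 2))) \<longlonglongrightarrow> 0"
  proof (rule hannan_clt[where C="t\<^sup>2 * C" and b="\<lambda>n. \<bar>t\<bar> * b n"])
    show "(\<Sum>i\<in>{1..int n}. (?z n i)\<^sup>2) \<le> t\<^sup>2 * C" for n
      using mult_left_mono[OF zC[of n], of "t\<^sup>2"] by (simp add: power_mult_distrib sum_distrib_left)
    show "\<bar>?z n i\<bar> \<le> \<bar>t\<bar> * b n" for n i using zb by (simp add: abs_mult mult_left_mono)
  qed (simp_all add: z0 bt)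
  then have 1: "(\<lambda>n. (\<integral>\<omega>. iexp (t * S n \<omega>) \<partial>M) - of_real (exp (- (t\<^sup>2 * (norm_L2 M (S n))\<^sup>2) / 2))) \<longlonglongrightarrow> 0"
    unfolding tS norm_L2_cmult by (simp only: power_mult_distrib power2_abs)
  have 2: "(\<lambda>n. of_real (exp (- (t\<^sup>2 * (norm_L2 M (S n))\<^sup>2) / 2)) :: complex) \<longlonglongrightarrow> of_real (exp (- (t\<^sup>2 * V) / 2))"
    by (intro tendsto_intros S_variance_tendsto) simp
  from tendsto_add[OF 1 2] show ?thesis by simp
qed

lemma taper_bound: "\<bar>taper z n k\<bar> \<le> K1 * C"
  unfolding taper_def abs_mult using K_bound acorr_le_C K1_nonneg by (intro mult_mono) auto

lemma taper_support: assumes "real_of_int \<bar>k\<bar> > band n" shows "taper z n k = 0"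
proof (cases "n = 0")
  case True
  then show ?thesis by (simp add: taper_def acorr_def)
next
  case False
  then have h: "0 < h n" by (intro h_pos) simp
  have "c0 * h n \<le> \<bar>c0\<bar> * h n" using h by (intro mult_right_mono) auto
  moreover have "\<bar>c0\<bar> * h n < \<bar>real_of_int k\<bar>" using assms h by (simp add: band_def)
  ultimately have "c0 * h n < \<bar>real_of_int k\<bar>" by linarith
  then have "c0 < \<bar>real_of_int k / h n\<bar>" using h by (simp add: abs_divide field_simps)
  then show ?thesis by (simp add: taper_def K_support)
qed

definition Q :: "nat \<Rightarrow> 'a \<Rightarrow> real" where
  "Q n \<omega> = quad n (taper z n) (\<lambda>i. \<epsilon> i \<omega>) (\<lambda>i. \<epsilon> i \<omega>)"

lemma quad_integrable:
  assumes "\<And>i. sqint M (e i)" "\<And>i. sqint M (f i)"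
  shows "integrable M (\<lambda>\<omega>. quad n A (\<lambda>i. e i \<omega>) (\<lambda>i. f i \<omega>))"
  unfolding quad_def
  by (intro integrable_mult_right Bochner_Integration.integrable_sum sqint_mult_integrable assms)

lemma Q_integrable: "integrable M (Q n)"
  unfolding Q_def[abs_def] by (intro quad_integrable eps_sqint)

text \<open>The mean carries, besides the autocorrelation of the weights, the kernel value at k/h
  and the fraction of index pairs at lag k. Both are bounded, and for fixed k both tend to 1, the
  kernel value because h tends to infinity and K is continuous at 0.\<close>

lemma Q_mean_tendsto: "(\<lambda>n. \<integral>\<omega>. Q n \<omega> \<partial>M) \<longlonglongrightarrow> V"
proof -
  \<comment> \<open>The autocorrelation of the indicator of the window counts the index pairs at lag
    k; divided by n it lies between 1 - |k|/n and 1.\<close>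
  define u where "u n i = (if i \<in> {1..int n} then 1 else 0 :: real)" for n :: nat and i
  define g where "g n k = K (real_of_int k / h n) * ((1 / real n) * acorr (u n) n k)" for n k
  have u0: "u n i = 0" if "i \<notin> {1..int n}" for n i using that unfolding u_def by (rule if_not_P)
  have eq: "(\<integral>\<omega>. Q n \<omega> \<partial>M) = (\<Sum>k\<in>{- int n..int n}. \<gamma> k * (g n k * acorr (z n) n k))" for n
  proof -
    have "(\<integral>\<omega>. Q n \<omega> \<partial>M) = (1 / real n) * (\<Sum>i\<in>{1..int n}. \<Sum>j\<in>{1..int n}. taper z n (i - j) * \<gamma> (i - j))"
      unfolding Q_def quad_def
      by (simp add: Bochner_Integration.integral_sum sqint_mult_integrable[OF eps_sqint eps_sqint] eps_cov)
    also have "(\<Sum>i\<in>{1..int n}. \<Sum>j\<in>{1..int n}. taper z n (i - j) * \<gamma> (i - j)) = (\<Sum>i\<in>{1..int n}. \<Sum>j\<in>{1..int n}. u n i * u n j * (\<lambda>k. taper z n k * \<gamma> k) (i - j))"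
      by (intro sum.cong refl) (simp add: u_def)
    also have "\<dots> = (\<Sum>k\<in>{- int n..int n}. (taper z n k * \<gamma> k) * acorr (u n) n k)" by (rule toeplitz_sum[OF u0])
    also have "(1 / real n) * \<dots> = (\<Sum>k\<in>{- int n..int n}. \<gamma> k * (g n k * acorr (z n) n k))"
      by (simp add: sum_distrib_left g_def taper_def mult_ac)
    finally show ?thesis .
  qed
  have ub: "0 \<le> acorr (u n) n k" "acorr (u n) n k \<le> real n" "real n - \<bar>k\<bar> \<le> acorr (u n) n k" for n k
  proof -
    have e: "acorr (u n) n k = (\<Sum>s\<in>{1..int n}. u n (s + k))" unfolding acorr_def by (intro sum.cong refl) (simp add: u_def)
    show "0 \<le> acorr (u n) n k" unfolding e by (intro sum_nonneg) (simp add: u_def)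
    have "acorr (u n) n k \<le> (\<Sum>s\<in>{1..int n}. 1)" unfolding e by (intro sum_mono) (simp add: u_def)
    then show "acorr (u n) n k \<le> real n" by simp
    have "(\<Sum>s\<in>{1..int n}. 1 - u n (s + k)) = (\<Sum>s\<in>{s\<in>{1..int n}. s + k \<notin> {1..int n}}. 1)"
      unfolding sum.inter_filter[of "{1..int n}", OF finite_atLeastAtMost_int] by (intro sum.cong refl) (auto simp: u_def)
    also have "\<dots> = real (card {s\<in>{1..int n}. s + k \<notin> {1..int n}})" by simp
    also have "\<dots> \<le> real (card ({1..- k} \<union> {int n - k + 1..int n}))"
      by (intro of_nat_mono card_mono) auto
    also have "\<dots> \<le> real (card {1..- k} + card {int n - k + 1..int n})" by (intro of_nat_mono card_Un_le)
    also have "\<dots> = \<bar>k\<bar>" by simp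
    finally have "(\<Sum>s\<in>{1..int n}. 1 - u n (s + k)) \<le> \<bar>k\<bar>" .
    then show "real n - \<bar>k\<bar> \<le> acorr (u n) n k" unfolding e by (simp add: sum_subtractf)
  qed
  show ?thesis unfolding eq
  proof (rule V_limit_weighted[where B=K1])
    fix n k
    have "(1 / real n) * acorr (u n) n k \<le> 1" using ub(2)[of n k] by (cases "n = 0") (auto simp: field_simps)
    then have "\<bar>K (real_of_int k / h n)\<bar> * \<bar>(1 / real n) * acorr (u n) n k\<bar> \<le> K1 * 1"
      using ub(1)[of n k] K_bound K1_nonneg by (intro mult_mono) auto
    then show "\<bar>g n k\<bar> \<le> K1" by (simp add: g_def abs_mult)
  next
    fix k
    have "(\<lambda>n. real_of_int k * inverse (h n)) \<longlonglongrightarrow> real_of_int k * 0"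
      by (intro tendsto_mult tendsto_const tendsto_inverse_0_at_top h_top)
    then have "(\<lambda>n. real_of_int k / h n) \<longlonglongrightarrow> 0" by (simp add: divide_inverse)
    then have kk: "(\<lambda>n. K (real_of_int k / h n)) \<longlonglongrightarrow> 1"
      using isCont_tendsto_compose[OF K_cont, of "\<lambda>n. real_of_int k / h n"] K_0 by simp
    have "(\<lambda>n. (1 / real n) * acorr (u n) n k) \<longlonglongrightarrow> 1"
    proof (rule tendsto_sandwich)
      show "\<forall>\<^sub>F n in sequentially. 1 - real_of_int \<bar>k\<bar> * (1 / real n) \<le> (1 / real n) * acorr (u n) n k"
        using eventually_gt_at_top[of 0]
      proof eventually_elim
        case (elim n)
        then show ?case using mult_left_mono[OF ub(3)[of n k], of "1 / real n"] by (simp add: diff_divide_distrib)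
      qed
      show "\<forall>\<^sub>F n in sequentially. (1 / real n) * acorr (u n) n k \<le> 1"
        using eventually_gt_at_top[of 0]
      proof eventually_elim
        case (elim n)
        then show ?case using ub(2)[of n k] by (simp add: field_simps)
      qed
      have "(\<lambda>n. 1 - real_of_int \<bar>k\<bar> * (1 / real n)) \<longlonglongrightarrow> 1 - real_of_int \<bar>k\<bar> * 0"
        by (intro tendsto_diff tendsto_mult tendsto_const lim_1_over_n)
      then show "(\<lambda>n. 1 - real_of_int \<bar>k\<bar> * (1 / real n)) \<longlonglongrightarrow> 1" by simp
    qed simp
    from tendsto_mult[OF kk this] show "(\<lambda>n. g n k) \<longlonglongrightarrow> 1" by (simp add: g_def)
  qed
qed

text \<open>Replacing the noise by a bounded moving average costs O(\<delta>) in L^1, uniformly in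
  n, by the bilinear expansion and \<open>quad_L1_bound\<close>. The new form concentrates at some
  constants \<open>c n\<close>, which need not be identified: the mean absolute deviation from the
  mean is at most twice that from any constant.\<close>

lemma Q_concentration: "(\<lambda>n. \<integral>\<omega>. \<bar>Q n \<omega> - (\<integral>\<omega>. Q n \<omega> \<partial>M)\<bar> \<partial>M) \<longlonglongrightarrow> 0"
proof (rule LIMSEQ_I)
  fix e :: real assume e: "e > 0"
  let ?H = hannan_sum
  define k1 where "k1 = (\<integral>t. \<bar>\<kappa> t\<bar> \<partial>lborel)"
  have k1: "0 \<le> k1" by (simp add: k1_def)
  \<comment> \<open>The two error forms have Hannan constants \<delta> and H, respectively H +
    \<delta> and \<delta>. Their sum is \<delta> times at most 2H + 1, since \<delta> <= 1; the last
    1 makes A positive.\<close>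
  define A where "A = 2 * k1 * ((2 * ?H + 1) * C) + 1"
  have A: "A > 0" using k1 hannan_sum_nonneg C_nonneg by (auto simp: A_def intro!: add_nonneg_pos mult_nonneg_nonneg)
  define \<delta> where "\<delta> = min 1 (e / (4 * A))"
  have d: "\<delta> > 0" "\<delta> \<le> 1" "\<delta> * A \<le> e / 4"
  proof -
    show "\<delta> > 0" "\<delta> \<le> 1" using e A by (auto simp: \<delta>_def)
    have "\<delta> * A \<le> e / (4 * A) * A" using A by (intro mult_right_mono) (auto simp: \<delta>_def)
    then show "\<delta> * A \<le> e / 4" using A by simp
  qed
  obtain N \<mu> B where ma: "bounded_ma M T F0 \<mu> B" and
    close: "\<And>I a. finite I \<Longrightarrow> norm_L2 M (\<lambda>\<omega>. \<Sum>i\<in>I. a i * (\<epsilon> i \<omega> - bounded_ma.ma M T N \<mu> i \<omega>)) \<le> \<delta> * sqrt (\<Sum>i\<in>I. (a i)\<^sup>2)"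
    by (rule bounded_ma_approx[OF d(1)]) (rule that)
  interpret bounded_ma M T F0 N \<mu> B by (rule ma)
  define Q' where "Q' n \<omega> = quad n (taper z n) (\<lambda>i. ma i \<omega>) (\<lambda>i. ma i \<omega>)" for n \<omega>
  define D where "D i \<omega> = \<epsilon> i \<omega> - ma i \<omega>" for i \<omega>
  have Ds: "sqint M (D i)" for i unfolding D_def[abs_def] by (intro sqint_diff eps_sqint ma_sqint)
  have Dn: "norm_L2 M (\<lambda>\<omega>. \<Sum>i\<in>I. a i * D i \<omega>) \<le> \<delta> * sqrt (\<Sum>i\<in>I. (a i)\<^sup>2)" if "finite I" for I a
    unfolding D_def by (rule close[OF that])
  have man: "norm_L2 M (\<lambda>\<omega>. \<Sum>i\<in>I. a i * ma i \<omega>) \<le> (?H + \<delta>) * sqrt (\<Sum>i\<in>I. (a i)\<^sup>2)" if I: "finite I" for I a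
  proof -
    have "(\<lambda>\<omega>. \<Sum>i\<in>I. a i * ma i \<omega>) = (\<lambda>\<omega>. (\<Sum>i\<in>I. a i * \<epsilon> i \<omega>) - (\<Sum>i\<in>I. a i * D i \<omega>))"
      by (simp add: D_def right_diff_distrib sum_subtractf)
    then have "norm_L2 M (\<lambda>\<omega>. \<Sum>i\<in>I. a i * ma i \<omega>) \<le> norm_L2 M (\<lambda>\<omega>. \<Sum>i\<in>I. a i * \<epsilon> i \<omega>) + norm_L2 M (\<lambda>\<omega>. \<Sum>i\<in>I. a i * D i \<omega>)"
      by (simp only:) (intro norm_L2_triangle_diff sqint_sum sqint_cmult eps_sqint Ds)
    also have "\<dots> \<le> ?H * sqrt (\<Sum>i\<in>I. (a i)\<^sup>2) + \<delta> * sqrt (\<Sum>i\<in>I. (a i)\<^sup>2)"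
      by (intro add_mono eps_lincomb_norm Dn I)
    finally show ?thesis by (simp add: distrib_right)
  qed
  have taper: "taper z n = (\<lambda>k. K (real_of_int k / h n) * (\<Sum>s\<in>{1..int n}. z n s * z n (s + k)))" for n
    by (simp add: taper_def acorr_def fun_eq_iff)
  have H0: "0 \<le> ?H" "0 \<le> ?H + \<delta>" "0 \<le> \<delta>" using hannan_sum_nonneg d by auto
  have approx: "(\<integral>\<omega>. \<bar>Q n \<omega> - Q' n \<omega>\<bar> \<partial>M) \<le> \<delta> * A" for n
  proof -
    let ?q1 = "\<lambda>\<omega>. quad n (taper z n) (\<lambda>i. D i \<omega>) (\<lambda>i. \<epsilon> i \<omega>)" and ?q2 = "\<lambda>\<omega>. quad n (taper z n) (\<lambda>i. ma i \<omega>) (\<lambda>i. D i \<omega>)"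
    have i1: "integrable M ?q1" and i2: "integrable M ?q2" by (intro quad_integrable Ds eps_sqint ma_sqint)+
    have eq: "Q n \<omega> - Q' n \<omega> = ?q1 \<omega> + ?q2 \<omega>" for \<omega>
      unfolding Q_def Q'_def quad_def D_def
      by (simp add: left_diff_distrib right_diff_distrib sum_subtractf)
    have "(\<integral>\<omega>. \<bar>Q n \<omega> - Q' n \<omega>\<bar> \<partial>M) \<le> (\<integral>\<omega>. \<bar>?q1 \<omega>\<bar> + \<bar>?q2 \<omega>\<bar> \<partial>M)"
      unfolding eq by (rule integral_mono) (use i1 i2 in auto)
    also have "\<dots> = (\<integral>\<omega>. \<bar>?q1 \<omega>\<bar> \<partial>M) + (\<integral>\<omega>. \<bar>?q2 \<omega>\<bar> \<partial>M)" using i1 i2 by simp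
    also have "\<dots> \<le> 2 * k1 * (\<delta> * ?H * C) + 2 * k1 * ((?H + \<delta>) * \<delta> * C)"
      unfolding taper k1_def
      by (intro add_mono quad_L1_bound[OF Ds Dn H0(3) eps_sqint eps_lincomb_norm H0(1) \<kappa>_integrable K_cos z0 zC]
           quad_L1_bound[OF ma_sqint man H0(2) Ds Dn H0(3) \<kappa>_integrable K_cos z0 zC])
    also have "\<dots> = \<delta> * (2 * k1 * ((2 * ?H + \<delta>) * C))" by (simp add: algebra_simps)
    also have "\<dots> \<le> \<delta> * A"
    proof (rule mult_left_mono)
      have "2 * k1 * ((2 * ?H + \<delta>) * C) \<le> 2 * k1 * ((2 * ?H + 1) * C)"
        using k1 d C_nonneg by (intro mult_left_mono mult_right_mono) auto
      then show "2 * k1 * ((2 * ?H + \<delta>) * C) \<le> A" by (simp add: A_def)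
    qed (use d in simp)
    finally show ?thesis .
  qed
  obtain c where c0: "\<And>n. sqint M (\<lambda>\<omega>. quad n (taper z n) (\<lambda>i. ma i \<omega>) (\<lambda>i. ma i \<omega>) - c n)"
    "(\<lambda>n. norm_L2 M (\<lambda>\<omega>. quad n (taper z n) (\<lambda>i. ma i \<omega>) (\<lambda>i. ma i \<omega>) - c n)) \<longlonglongrightarrow> 0"
    by (rule ma_quad_concentration[of "taper z" "K1 * C" band, OF taper_bound _ band_nonneg band_ratio], rule taper_support, assumption, rule that)
  note c = c0[folded Q'_def]
  have "\<forall>\<^sub>F n in sequentially. norm_L2 M (\<lambda>\<omega>. Q' n \<omega> - c n) < e / 4" using c(2) by (rule order_tendstoD) (use e in simp)
  then obtain n0 where n0: "\<And>n. n \<ge> n0 \<Longrightarrow> norm_L2 M (\<lambda>\<omega>. Q' n \<omega> - c n) < e / 4" by (auto simp: eventually_sequentially)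
  have Q'i: "integrable M (Q' n)" for n unfolding Q'_def[abs_def] by (intro quad_integrable ma_sqint)
  have "(\<integral>\<omega>. \<bar>Q n \<omega> - (\<integral>\<omega>. Q n \<omega> \<partial>M)\<bar> \<partial>M) < e" if "n \<ge> n0" for n
  proof -
    have i: "integrable M (\<lambda>\<omega>. Q n \<omega> - c n)" using Q_integrable by simp
    have 1: "(\<integral>\<omega>. \<bar>Q n \<omega> - c n\<bar> \<partial>M) < e / 2"
    proof -
      have "(\<integral>\<omega>. \<bar>Q n \<omega> - c n\<bar> \<partial>M) \<le> (\<integral>\<omega>. \<bar>Q n \<omega> - Q' n \<omega>\<bar> + \<bar>Q' n \<omega> - c n\<bar> \<partial>M)"
        by (rule integral_mono) (use Q_integrable[of n] Q'i[of n] in auto)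
      also have "\<dots> = (\<integral>\<omega>. \<bar>Q n \<omega> - Q' n \<omega>\<bar> \<partial>M) + (\<integral>\<omega>. \<bar>Q' n \<omega> - c n\<bar> \<partial>M)"
        using Q_integrable[of n] Q'i[of n] by simp
      also have "\<dots> < e / 4 + e / 4"
        using approx[of n] d(3) n0[OF that] integral_abs_le_norm_L2[OF c(1), of n] by linarith
      finally show ?thesis by simp
    qed
    have 2: "\<bar>(\<integral>\<omega>. Q n \<omega> \<partial>M) - c n\<bar> \<le> (\<integral>\<omega>. \<bar>Q n \<omega> - c n\<bar> \<partial>M)"
      using integral_abs_bound[of M "\<lambda>\<omega>. Q n \<omega> - c n"] Q_integrable[of n] by (simp add: prob_space)
    have "(\<integral>\<omega>. \<bar>Q n \<omega> - (\<integral>\<omega>. Q n \<omega> \<partial>M)\<bar> \<partial>M) \<le> (\<integral>\<omega>. \<bar>Q n \<omega> - c n\<bar> + \<bar>(\<integral>\<omega>. Q n \<omega> \<partial>M) - c n\<bar> \<partial>M)"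
      by (rule integral_mono) (use Q_integrable[of n] in auto)
    also have "\<dots> = (\<integral>\<omega>. \<bar>Q n \<omega> - c n\<bar> \<partial>M) + \<bar>(\<integral>\<omega>. Q n \<omega> \<partial>M) - c n\<bar>"
      using Q_integrable[of n] by (simp add: prob_space)
    finally show ?thesis using 1 2 by linarith
  qed
  then show "\<exists>no. \<forall>n\<ge>no. norm ((\<integral>\<omega>. \<bar>Q n \<omega> - (\<integral>\<omega>. Q n \<omega> \<partial>M)\<bar> \<partial>M) - 0) < e" by auto
qed

lemma Q_tendsto: "(\<lambda>n. \<integral>\<omega>. \<bar>Q n \<omega> - V\<bar> \<partial>M) \<longlonglongrightarrow> 0"
proof -
  have le: "(\<integral>\<omega>. \<bar>Q n \<omega> - V\<bar> \<partial>M) \<le> (\<integral>\<omega>. \<bar>Q n \<omega> - (\<integral>\<omega>. Q n \<omega> \<partial>M)\<bar> \<partial>M) + \<bar>(\<integral>\<omega>. Q n \<omega> \<partial>M) - V\<bar>" for n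
  proof -
    have "(\<integral>\<omega>. \<bar>Q n \<omega> - V\<bar> \<partial>M) \<le> (\<integral>\<omega>. \<bar>Q n \<omega> - (\<integral>\<omega>. Q n \<omega> \<partial>M)\<bar> + \<bar>(\<integral>\<omega>. Q n \<omega> \<partial>M) - V\<bar> \<partial>M)"
      by (rule integral_mono) (use Q_integrable[of n] in auto)
    then show ?thesis using Q_integrable[of n] by (simp add: prob_space)
  qed
  have "(\<lambda>n. (\<integral>\<omega>. \<bar>Q n \<omega> - (\<integral>\<omega>. Q n \<omega> \<partial>M)\<bar> \<partial>M) + \<bar>(\<integral>\<omega>. Q n \<omega> \<partial>M) - V\<bar>) \<longlonglongrightarrow> 0 + \<bar>V - V\<bar>"
    by (intro tendsto_add Q_concentration tendsto_rabs tendsto_diff Q_mean_tendsto tendsto_const)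
  then have lim: "(\<lambda>n. (\<integral>\<omega>. \<bar>Q n \<omega> - (\<integral>\<omega>. Q n \<omega> \<partial>M)\<bar> \<partial>M) + \<bar>(\<integral>\<omega>. Q n \<omega> \<partial>M) - V\<bar>) \<longlonglongrightarrow> 0" by simp
  show ?thesis
    by (rule tendsto_sandwich[OF always_eventually[OF allI] always_eventually[OF allI[OF le]] tendsto_const lim]) simp
qed

text \<open>Replacing the errors by the residuals \<open>\<epsilon> - u\<close>: since \<open>u\<close> has bounded total energy, crude band bounds
  on the taper matrix suffice.\<close>

lemma quad_residual_bound:
  assumes u: "\<And>i. sqint M (u i)" "(\<Sum>i\<in>{1..int n}. \<integral>\<omega>. (u i \<omega>)\<^sup>2 \<partial>M) \<le> U" and n: "n > 0"
  shows "(\<integral>\<omega>. \<bar>quad n (taper z n) (\<lambda>i. \<epsilon> i \<omega> - u i \<omega>) (\<lambda>i. \<epsilon> i \<omega> - u i \<omega>) - Q n \<omega>\<bar> \<partial>M)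
    \<le> K1 * C * U * ((2 * band n + 1) / real n) + 2 * (hannan_sum * (K1 * C) * sqrt U * sqrt ((2 * band n + 1) / real n))"
proof -
  let ?I = "{1..int n}"
  let ?A = "taper z n"
  define a where "a = K1 * C"
  define w where "w = 2 * band n + 1"
  have a0: "0 \<le> a" using K1_nonneg C_nonneg by (simp add: a_def)
  have w0: "0 \<le> w" using band_nonneg[of n] by (simp add: w_def)
  have ab: "(\<Sum>j\<in>?I. \<bar>?A (i - j)\<bar>) \<le> a * w" for i
    unfolding w_def by (rule sum_banded_le[where g="\<lambda>k. \<bar>?A k\<bar>"]) (use taper_bound taper_support band_nonneg a0 in \<open>auto simp: a_def\<close>)
  have ab': "(\<Sum>j\<in>?I. \<bar>?A (j - i)\<bar>) \<le> a * w" for i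
    unfolding w_def using sum_banded_le[of ?I "\<lambda>k. \<bar>?A (- k)\<bar>" a "band n" i] taper_bound taper_support band_nonneg a0
    by (simp add: a_def)
  have sq1: "(\<Sum>j\<in>?I. (?A (i - j))\<^sup>2) \<le> a\<^sup>2 * w" for i
    unfolding w_def
  proof (rule sum_banded_le[where g="\<lambda>k. (?A k)\<^sup>2"])
    show "(?A k)\<^sup>2 \<le> a\<^sup>2" for k using power_mono[OF taper_bound[of n k], of 2] by (simp add: a_def)
  qed (use taper_support band_nonneg in auto)
  have sq2: "(\<Sum>j\<in>?I. (?A (j - i))\<^sup>2) \<le> a\<^sup>2 * w" for i
  proof -
    have "(\<Sum>j\<in>?I. (?A (- (i - j)))\<^sup>2) \<le> a\<^sup>2 * w" unfolding w_def
    proof (rule sum_banded_le[where g="\<lambda>k. (?A (- k))\<^sup>2"])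
      show "(?A (- k))\<^sup>2 \<le> a\<^sup>2" for k using power_mono[OF taper_bound[of n "- k"], of 2] by (simp add: a_def)
    qed (use taper_support band_nonneg in auto)
    then show ?thesis by simp
  qed
  let ?uu = "\<lambda>\<omega>. quad n ?A (\<lambda>i. u i \<omega>) (\<lambda>i. u i \<omega>)"
  let ?ue = "\<lambda>\<omega>. quad n ?A (\<lambda>i. u i \<omega>) (\<lambda>i. \<epsilon> i \<omega>)"
  let ?eu = "\<lambda>\<omega>. quad n ?A (\<lambda>i. \<epsilon> i \<omega>) (\<lambda>i. u i \<omega>)"
  have i: "integrable M ?uu" "integrable M ?ue" "integrable M ?eu" by (intro quad_integrable u eps_sqint)+
  have eq: "quad n ?A (\<lambda>i. \<epsilon> i \<omega> - u i \<omega>) (\<lambda>i. \<epsilon> i \<omega> - u i \<omega>) - Q n \<omega> = ?uu \<omega> - ?ue \<omega> - ?eu \<omega>" for \<omega>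
    unfolding Q_def quad_def by (simp add: left_diff_distrib right_diff_distrib sum_subtractf)
  \<comment> \<open>Schur's test: after the arithmetic-geometric inequality every row and column sum
    of the absolute coefficients is at most \<open>a * w\<close>.\<close>
  have uu: "(\<integral>\<omega>. \<bar>?uu \<omega>\<bar> \<partial>M) \<le> a * U * (w / real n)"
  proof -
    have pt: "\<bar>?uu \<omega>\<bar> \<le> (1 / real n) * (a * w * (\<Sum>i\<in>?I. (u i \<omega>)\<^sup>2))" for \<omega>
    proof -
      have "\<bar>\<Sum>i\<in>?I. \<Sum>j\<in>?I. ?A (i - j) * (u i \<omega> * u j \<omega>)\<bar> \<le> (\<Sum>i\<in>?I. \<Sum>j\<in>?I. \<bar>?A (i - j) * (u i \<omega> * u j \<omega>)\<bar>)"
        by (rule order_trans[OF sum_abs sum_mono[OF sum_abs]])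
      also have "\<dots> \<le> (\<Sum>i\<in>?I. \<Sum>j\<in>?I. \<bar>?A (i - j)\<bar> * ((u i \<omega>)\<^sup>2 / 2) + \<bar>?A (i - j)\<bar> * ((u j \<omega>)\<^sup>2 / 2))"
      proof (intro sum_mono)
        fix i j
        have "\<bar>u i \<omega> * u j \<omega>\<bar> \<le> (u i \<omega>)\<^sup>2 / 2 + (u j \<omega>)\<^sup>2 / 2"
          using sum_squares_bound[of "\<bar>u i \<omega>\<bar>" "\<bar>u j \<omega>\<bar>"] by (simp add: abs_mult)
        then show "\<bar>?A (i - j) * (u i \<omega> * u j \<omega>)\<bar> \<le> \<bar>?A (i - j)\<bar> * ((u i \<omega>)\<^sup>2 / 2) + \<bar>?A (i - j)\<bar> * ((u j \<omega>)\<^sup>2 / 2)"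
          unfolding abs_mult[of "?A (i - j)"] distrib_left[symmetric] by (rule mult_left_mono) simp
      qed
      also have "\<dots> = (\<Sum>i\<in>?I. \<Sum>j\<in>?I. \<bar>?A (i - j)\<bar> * ((u i \<omega>)\<^sup>2 / 2)) + (\<Sum>i\<in>?I. \<Sum>j\<in>?I. \<bar>?A (i - j)\<bar> * ((u j \<omega>)\<^sup>2 / 2))"
        by (simp only: sum.distrib)
      also have "(\<Sum>i\<in>?I. \<Sum>j\<in>?I. \<bar>?A (i - j)\<bar> * ((u j \<omega>)\<^sup>2 / 2)) = (\<Sum>j\<in>?I. \<Sum>i\<in>?I. \<bar>?A (i - j)\<bar> * ((u j \<omega>)\<^sup>2 / 2))"
        by (rule sum.swap)
      also have "(\<Sum>i\<in>?I. \<Sum>j\<in>?I. \<bar>?A (i - j)\<bar> * ((u i \<omega>)\<^sup>2 / 2)) + (\<Sum>j\<in>?I. \<Sum>i\<in>?I. \<bar>?A (i - j)\<bar> * ((u j \<omega>)\<^sup>2 / 2))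
         \<le> (\<Sum>i\<in>?I. a * w * ((u i \<omega>)\<^sup>2 / 2)) + (\<Sum>j\<in>?I. a * w * ((u j \<omega>)\<^sup>2 / 2))"
        unfolding sum_distrib_right[symmetric] by (intro add_mono sum_mono mult_right_mono ab ab') auto
      also have "\<dots> = a * w * (\<Sum>i\<in>?I. (u i \<omega>)\<^sup>2)"
        by (simp add: sum_distrib_left sum.distrib[symmetric] sum_divide_distrib[symmetric])
      finally show ?thesis unfolding quad_def abs_mult by (simp add: divide_right_mono)
    qed
    have ui: "integrable M (\<lambda>\<omega>. (u i \<omega>)\<^sup>2)" for i using u(1) by (simp add: sqint_def)
    have "(\<integral>\<omega>. \<bar>?uu \<omega>\<bar> \<partial>M) \<le> (\<integral>\<omega>. (1 / real n) * (a * w * (\<Sum>i\<in>?I. (u i \<omega>)\<^sup>2)) \<partial>M)"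
      by (rule integral_mono) (use i ui pt in auto)
    also have "\<dots> = (1 / real n) * (a * w * (\<Sum>i\<in>?I. \<integral>\<omega>. (u i \<omega>)\<^sup>2 \<partial>M))"
      using ui by (simp add: Bochner_Integration.integral_sum)
    also have "\<dots> \<le> (1 / real n) * (a * w * U)" using u(2) a0 w0 by (intro mult_left_mono) auto
    finally show ?thesis by (simp add: mult_ac)
  qed
  \<comment> \<open>For each i the combination of the noise has norm at most H a sqrt w by Hannan's
    bound, with H the Hannan sum. Summing the norms of u i by Cauchy-Schwarz costs sqrt n, so that
    sqrt(w/n) remains after division by n.\<close>
  have cross: "(\<integral>\<omega>. \<bar>(1 / real n) * (\<Sum>i\<in>?I. u i \<omega> * (\<Sum>j\<in>?I. A' i j * \<epsilon> j \<omega>))\<bar> \<partial>M) \<le> hannan_sum * a * sqrt U * sqrt (w / real n)"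
    if A': "\<And>i. (\<Sum>j\<in>?I. (A' i j)\<^sup>2) \<le> a\<^sup>2 * w" for A' :: "int \<Rightarrow> int \<Rightarrow> real"
  proof -
    let ?Y = "\<lambda>i \<omega>. \<Sum>j\<in>?I. A' i j * \<epsilon> j \<omega>"
    have Ys: "sqint M (?Y i)" for i by (intro sqint_sum sqint_cmult eps_sqint)
    have Yn: "norm_L2 M (?Y i) \<le> hannan_sum * (a * sqrt w)" for i
    proof -
      have "sqrt (\<Sum>j\<in>?I. (A' i j)\<^sup>2) \<le> sqrt (a\<^sup>2 * w)" using A' by (rule real_sqrt_le_mono)
      also have "\<dots> = a * sqrt w" using a0 by (simp add: real_sqrt_mult)
      finally show ?thesis by (intro order_trans[OF eps_lincomb_norm mult_left_mono[OF _ hannan_sum_nonneg]]) auto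
    qed
    have uY: "integrable M (\<lambda>\<omega>. u i \<omega> * ?Y i \<omega>)" for i by (rule sqint_mult_integrable[OF u(1) Ys])
    have "(\<integral>\<omega>. \<bar>(1 / real n) * (\<Sum>i\<in>?I. u i \<omega> * ?Y i \<omega>)\<bar> \<partial>M) \<le> (\<integral>\<omega>. (1 / real n) * (\<Sum>i\<in>?I. \<bar>u i \<omega> * ?Y i \<omega>\<bar>) \<partial>M)"
    proof (rule integral_mono)
      show "integrable M (\<lambda>\<omega>. \<bar>(1 / real n) * (\<Sum>i\<in>?I. u i \<omega> * ?Y i \<omega>)\<bar>)"
        by (intro integrable_abs integrable_mult_right Bochner_Integration.integrable_sum uY)
      show "integrable M (\<lambda>\<omega>. (1 / real n) * (\<Sum>i\<in>?I. \<bar>u i \<omega> * ?Y i \<omega>\<bar>))"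
        by (intro integrable_abs integrable_mult_right Bochner_Integration.integrable_sum uY)
      show "\<bar>(1 / real n) * (\<Sum>i\<in>?I. u i \<omega> * ?Y i \<omega>)\<bar> \<le> (1 / real n) * (\<Sum>i\<in>?I. \<bar>u i \<omega> * ?Y i \<omega>\<bar>)" for \<omega>
        unfolding abs_mult[of "1 / real n"] by (simp add: divide_right_mono sum_abs)
    qed
    also have "\<dots> = (1 / real n) * (\<Sum>i\<in>?I. \<integral>\<omega>. \<bar>u i \<omega> * ?Y i \<omega>\<bar> \<partial>M)"
      by (simp only: integral_mult_right_zero Bochner_Integration.integral_sum integrable_abs[OF uY])
    also have "\<dots> \<le> (1 / real n) * (\<Sum>i\<in>?I. norm_L2 M (u i) * (hannan_sum * (a * sqrt w)))"
      by (intro mult_left_mono sum_mono order_trans[OF integral_abs_mult_le_norm_L2[OF u(1) Ys] mult_left_mono[OF Yn]]) auto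
    also have "\<dots> = (1 / real n) * ((\<Sum>i\<in>?I. norm_L2 M (u i)) * (hannan_sum * (a * sqrt w)))" by (simp only: sum_distrib_right)
    also have "\<dots> \<le> (1 / real n) * (sqrt (U * real n) * (hannan_sum * (a * sqrt w)))"
    proof (intro mult_left_mono mult_right_mono)
      have "(\<Sum>i\<in>?I. norm_L2 M (u i))\<^sup>2 \<le> (\<Sum>i\<in>?I. (norm_L2 M (u i))\<^sup>2) * real (card ?I)"
        by (rule sum_squared_le_sum_of_squares)
      also have "\<dots> \<le> U * real n" using u(2) by (simp add: norm_L2_sq mult_right_mono)
      finally show "(\<Sum>i\<in>?I. norm_L2 M (u i)) \<le> sqrt (U * real n)" by (rule real_le_rsqrt)
    qed (use a0 w0 hannan_sum_nonneg in auto)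
    also have "\<dots> = hannan_sum * a * sqrt U * sqrt (w / real n)"
      using n by (simp add: real_sqrt_mult real_sqrt_divide field_simps)
    finally show ?thesis .
  qed
  have ue: "(\<integral>\<omega>. \<bar>?ue \<omega>\<bar> \<partial>M) \<le> hannan_sum * a * sqrt U * sqrt (w / real n)"
    using cross[of "\<lambda>i j. ?A (i - j)", OF sq1] by (simp only: quad_def sum_distrib_left mult_ac)
  have eu: "(\<integral>\<omega>. \<bar>?eu \<omega>\<bar> \<partial>M) \<le> hannan_sum * a * sqrt U * sqrt (w / real n)"
  proof -
    have "?eu \<omega> = (1 / real n) * (\<Sum>i\<in>?I. u i \<omega> * (\<Sum>j\<in>?I. ?A (j - i) * \<epsilon> j \<omega>))" for \<omega>
      unfolding quad_def by (subst sum.swap) (simp only: sum_distrib_left mult_ac)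
    then show ?thesis using cross[of "\<lambda>i j. ?A (j - i)", OF sq2] by simp
  qed
  have "(\<integral>\<omega>. \<bar>quad n ?A (\<lambda>i. \<epsilon> i \<omega> - u i \<omega>) (\<lambda>i. \<epsilon> i \<omega> - u i \<omega>) - Q n \<omega>\<bar> \<partial>M) \<le> (\<integral>\<omega>. \<bar>?uu \<omega>\<bar> + \<bar>?ue \<omega>\<bar> + \<bar>?eu \<omega>\<bar> \<partial>M)"
    unfolding eq by (rule integral_mono) (use i in auto)
  also have "\<dots> = (\<integral>\<omega>. \<bar>?uu \<omega>\<bar> \<partial>M) + (\<integral>\<omega>. \<bar>?ue \<omega>\<bar> \<partial>M) + (\<integral>\<omega>. \<bar>?eu \<omega>\<bar> \<partial>M)" using i by simp
  also have "\<dots> \<le> a * U * (w / real n) + 2 * (hannan_sum * a * sqrt U * sqrt (w / real n))"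
    using uu ue eu by linarith
  finally show ?thesis by (simp add: a_def w_def)
qed

text \<open>The energy bound is asked from \<open>n0\<close> on only, because the fitted noise is
  controlled once the design has become regular. Since the band width is o(n), both error terms
  vanish.\<close>

theorem residual_quad_tendsto:
  fixes u :: "nat \<Rightarrow> int \<Rightarrow> 'a \<Rightarrow> real"
  assumes u: "\<And>n i. sqint M (u n i)" "\<And>n. n \<ge> n0 \<Longrightarrow> (\<Sum>i\<in>{1..int n}. \<integral>\<omega>. (u n i \<omega>)\<^sup>2 \<partial>M) \<le> U"
  shows "(\<lambda>n. \<integral>\<omega>. \<bar>quad n (taper z n) (\<lambda>i. \<epsilon> i \<omega> - u n i \<omega>) (\<lambda>i. \<epsilon> i \<omega> - u n i \<omega>) - V\<bar> \<partial>M) \<longlonglongrightarrow> 0"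
proof -
  let ?q = "\<lambda>n \<omega>. quad n (taper z n) (\<lambda>i. \<epsilon> i \<omega> - u n i \<omega>) (\<lambda>i. \<epsilon> i \<omega> - u n i \<omega>)"
  let ?g = "\<lambda>n. K1 * C * U * ((2 * band n + 1) / real n) + 2 * (hannan_sum * (K1 * C) * sqrt U * sqrt ((2 * band n + 1) / real n))"
  have qi: "integrable M (?q n)" for n by (intro quad_integrable sqint_diff eps_sqint u)
  have le: "\<forall>\<^sub>F n in sequentially. (\<integral>\<omega>. \<bar>?q n \<omega> - V\<bar> \<partial>M) \<le> ?g n + (\<integral>\<omega>. \<bar>Q n \<omega> - V\<bar> \<partial>M)"
    using eventually_ge_at_top[of "max 1 n0"]
  proof eventually_elim
    case (elim n)
    have "(\<integral>\<omega>. \<bar>?q n \<omega> - V\<bar> \<partial>M) \<le> (\<integral>\<omega>. \<bar>?q n \<omega> - Q n \<omega>\<bar> + \<bar>Q n \<omega> - V\<bar> \<partial>M)"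
      by (rule integral_mono) (use qi[of n] Q_integrable[of n] in auto)
    also have "\<dots> = (\<integral>\<omega>. \<bar>?q n \<omega> - Q n \<omega>\<bar> \<partial>M) + (\<integral>\<omega>. \<bar>Q n \<omega> - V\<bar> \<partial>M)" using qi[of n] Q_integrable[of n] by simp
    also have "(\<integral>\<omega>. \<bar>?q n \<omega> - Q n \<omega>\<bar> \<partial>M) \<le> ?g n"
      by (rule quad_residual_bound[OF u(1) u(2)]) (use elim in auto)
    finally show ?case by simp
  qed
  have "(\<lambda>n. 2 * (band n / real n) + 1 / real n) \<longlonglongrightarrow> 2 * 0 + 0"
    by (intro tendsto_add tendsto_mult tendsto_const band_ratio lim_1_over_n)
  then have bw: "(\<lambda>n. (2 * band n + 1) / real n) \<longlonglongrightarrow> 0" by (simp add: add_divide_distrib)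
  have "(\<lambda>n. ?g n + (\<integral>\<omega>. \<bar>Q n \<omega> - V\<bar> \<partial>M)) \<longlonglongrightarrow> (K1 * C * U * 0 + 2 * (hannan_sum * (K1 * C) * sqrt U * sqrt 0)) + 0"
    by (intro tendsto_add tendsto_mult tendsto_const tendsto_real_sqrt bw Q_tendsto)
  then have lim: "(\<lambda>n. ?g n + (\<integral>\<omega>. \<bar>Q n \<omega> - V\<bar> \<partial>M)) \<longlonglongrightarrow> 0" by simp
  show ?thesis
    by (rule tendsto_sandwich[OF always_eventually[OF allI] le tendsto_const lim]) simp
qed

end

section \<open>The kernel as a cosine transform\<close>

lemma cmod_iexp_minus_1: "cmod (iexp x - 1) \<le> \<bar>x\<bar>"
  using iexp_approx1[of x 0] by simp

text \<open>The quotient is the kernel of Levy's inversion formula for an interval of length d. The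
  first bound supplies a dominating function, the second the pointwise limit after division by
  d.\<close>

lemma iexp_diff_quotient:
  assumes "t \<noteq> (0::real)"
  shows "cmod ((iexp (- (t * a)) - iexp (- (t * (a + d)))) / (\<i> * t)) \<le> \<bar>d\<bar>"
    and "d \<noteq> 0 \<Longrightarrow> cmod (of_real (1 / d) * ((iexp (- (t * a)) - iexp (- (t * (a + d)))) / (\<i> * t)) - iexp (- (t * a))) \<le> \<bar>t * d\<bar> / 2"
proof -
  define s where "s = - (t * d)"
  have f: "iexp (- (t * a)) - iexp (- (t * (a + d))) = iexp (- (t * a)) * (1 - iexp s)"
    by (simp add: s_def right_diff_distrib exp_add[symmetric] algebra_simps)
  have "cmod ((iexp (- (t * a)) - iexp (- (t * (a + d)))) / (\<i> * t)) = cmod (iexp s - 1) / \<bar>t\<bar>"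
    unfolding f norm_divide norm_mult by (simp add: norm_minus_commute del: of_real_minus of_real_mult)
  also have "\<dots> \<le> \<bar>s\<bar> / \<bar>t\<bar>" using cmod_iexp_minus_1[of s] by (rule divide_right_mono) simp
  also have "\<dots> = \<bar>d\<bar>" using assms by (simp add: s_def abs_mult)
  finally show "cmod ((iexp (- (t * a)) - iexp (- (t * (a + d)))) / (\<i> * t)) \<le> \<bar>d\<bar>" .
  assume d: "d \<noteq> 0"
  have "of_real (1 / d) * ((iexp (- (t * a)) - iexp (- (t * (a + d)))) / (\<i> * t)) - iexp (- (t * a))
      = iexp (- (t * a)) * ((iexp s - (1 + \<i> * s)) / (\<i> * s))"
  proof -
    have "of_real (1 / d) * (iexp (- (t * a)) * (1 - iexp s) / (\<i> * t)) = iexp (- (t * a)) * ((iexp s - 1) / (\<i> * s))"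
      using d assms by (simp add: s_def divide_simps) (simp add: algebra_simps)
    moreover have "(iexp s - (1 + \<i> * s)) / (\<i> * s) = (iexp s - 1) / (\<i> * s) - 1"
      using d assms by (simp add: s_def divide_simps)
    ultimately show ?thesis unfolding f by (simp add: right_diff_distrib)
  qed
  then have "cmod (of_real (1 / d) * ((iexp (- (t * a)) - iexp (- (t * (a + d)))) / (\<i> * t)) - iexp (- (t * a)))
      = cmod (iexp s - (1 + \<i> * s)) / \<bar>s\<bar>"
    by (simp only: norm_mult norm_divide norm_exp_i_times norm_ii norm_of_real mult_1_left)
  also have "\<dots> \<le> (\<bar>s\<bar>\<^sup>2 / 2) / \<bar>s\<bar>"
    using iexp_approx1[of s 1] by (intro divide_right_mono) (simp_all add: numeral_2_eq_2)
  also have "\<dots> = \<bar>t * d\<bar> / 2"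
  proof -
    have "s \<noteq> 0" using d assms by (simp add: s_def)
    then have "(\<bar>s\<bar>\<^sup>2 / 2) / \<bar>s\<bar> = \<bar>s\<bar> / 2" by (cases "0 < s") (simp_all add: power2_eq_square)
    moreover have "\<bar>s\<bar> = \<bar>t * d\<bar>" by (simp add: s_def)
    ultimately show ?thesis by simp
  qed
  finally show "cmod (of_real (1 / d) * ((iexp (- (t * a)) - iexp (- (t * (a + d)))) / (\<i> * t)) - iexp (- (t * a))) \<le> \<bar>t * d\<bar> / 2" .
qed

text \<open>Fourier inversion at every point, from Levy's inversion formula for the law with density \<open>p\<close>: divide
  the mass of \<open>(a, a + d]\<close> by \<open>d\<close> and let \<open>d\<close> tend to 0 on both sides.\<close>

lemma density_fourier_inversion:
  fixes p :: "real \<Rightarrow> real"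
  assumes p: "continuous_on UNIV p" "\<And>x. 0 \<le> p x" "integrable lborel p" "(\<integral>x. p x \<partial>lborel) = 1"
  defines "\<phi> \<equiv> \<lambda>t. \<integral>x. of_real (p x) * iexp (t * x) \<partial>lborel"
  assumes \<phi>: "integrable lborel \<phi>"
  shows "of_real (p a) = of_real (1 / (2 * pi)) * (\<integral>t. iexp (- (t * a)) * \<phi> t \<partial>lborel)"
proof -
  define P where "P = density lborel (\<lambda>x. ennreal (p x))"
  have pm[measurable]: "p \<in> borel_measurable borel" using p(1) by (rule borel_measurable_continuous_onI)
  have em: "emeasure P A = ennreal (\<integral>x. indicator A x * p x \<partial>lborel)" if [measurable]: "A \<in> sets borel" for A
  proof -
    have "emeasure P A = (\<integral>\<^sup>+x. ennreal (indicator A x * p x) \<partial>lborel)"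
      unfolding P_def by (subst emeasure_density) (auto intro!: nn_integral_cong simp: indicator_def)
    also have "\<dots> = ennreal (\<integral>x. indicator A x * p x \<partial>lborel)"
      using p integrable_mult_indicator[OF _ p(3), of A] by (intro nn_integral_eq_integral) auto
    finally show ?thesis .
  qed
  interpret P: real_distribution P
  proof (rule real_distribution.intro)
    show "prob_space P"
    proof
      show "emeasure P (space P) = 1" using em[of UNIV] p(4) by (simp add: P_def)
    qed
    show "real_distribution_axioms P" by unfold_locales (simp_all add: P_def)
  qed
  have ms: "measure P A = (\<integral>x. indicator A x * p x \<partial>lborel)" if "A \<in> sets borel" for A
    using em[OF that] p(2) by (simp add: measure_def)
  have ch: "char P t = \<phi> t" for t
  proof -
    have "char P t = (\<integral>x. p x *\<^sub>R iexp (t * x) \<partial>lborel)"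
      unfolding char_def P_def by (rule integral_density) (use p in auto)
    then show ?thesis by (simp add: \<phi>_def scaleR_conv_of_real)
  qed
  \<comment> \<open>The inversion formula requires endpoints without mass.\<close>
  have atom: "measure P {c} = 0" for c
  proof -
    have "AE x in lborel. indicator {c} x * p x = 0" using AE_lborel_singleton[of c] by eventually_elim auto
    then have "(\<integral>x. indicator {c} x * p x \<partial>lborel) = (\<integral>x. 0 \<partial>(lborel::real measure))" by (intro integral_cong_AE) auto
    then show ?thesis by (simp add: ms)
  qed
  have \<phi>m[measurable]: "\<phi> \<in> borel_measurable borel" using \<phi> by simp
  define g where "g d t = (iexp (- (t * a)) - iexp (- (t * (a + d)))) / (\<i> * t) * \<phi> t" for d t :: real
  have gm[measurable]: "g d \<in> borel_measurable borel" for d unfolding g_def[abs_def] by measurable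
  have gb: "cmod (g d t) \<le> \<bar>d\<bar> * cmod (\<phi> t)" for d t
  proof (cases "t = 0")
    case True then show ?thesis by (simp add: g_def)
  next
    case False
    then show ?thesis unfolding g_def norm_mult by (intro mult_right_mono iexp_diff_quotient(1)) auto
  qed
  have gi: "integrable lborel (g d)" for d
  proof (rule Bochner_Integration.integrable_bound)
    show "integrable lborel (\<lambda>t. \<bar>d\<bar> * cmod (\<phi> t))" using \<phi> by simp
    show "AE t in lborel. norm (g d t) \<le> norm (\<bar>d\<bar> * cmod (\<phi> t))" using gb by (auto simp: abs_mult)
  qed simp
  \<comment> \<open>The integrability of \<phi> turns the limit of truncated integrals in Levy's
    formula into an ordinary integral.\<close>
  have mass: "of_real (measure P {a<..a + d}) = of_real (1 / (2 * pi)) * (\<integral>t. g d t \<partial>lborel)" if "0 \<le> d" for d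
  proof (rule LIMSEQ_unique)
    show "(\<lambda>T::nat. 1 / (2 * pi) * (CLBINT t=-T..T. g d t)) \<longlonglongrightarrow> of_real (measure P {a<..a + d})"
      using P.Levy_Inversion[of a "a + d"] that atom unfolding g_def ch by simp
    have "(\<lambda>T::nat. CLBINT t=-T..T. g d t) \<longlonglongrightarrow> (\<integral>t. g d t \<partial>lborel)"
    proof -
      have eq: "(CLBINT t=-(real T)..real T. g d t) = (\<integral>t. indicator {- real T<..<real T} t *\<^sub>R g d t \<partial>lborel)" for T :: nat
        by (simp add: interval_lebesgue_integral_def einterval_eq set_lebesgue_integral_def)
      have "(\<lambda>T::nat. \<integral>t. indicator {- real T<..<real T} t *\<^sub>R g d t \<partial>lborel) \<longlonglongrightarrow> (\<integral>t. g d t \<partial>lborel)"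
      proof (rule integral_dominated_convergence[where w="\<lambda>t. cmod (g d t)"])
        have "(\<lambda>T::nat. indicator {- real T<..<real T} t *\<^sub>R g d t) \<longlonglongrightarrow> g d t" for t
        proof (rule tendsto_eventually)
          show "\<forall>\<^sub>F T in sequentially. indicator {- real T<..<real T} t *\<^sub>R g d t = g d t"
            using eventually_gt_at_top[of "nat \<lceil>\<bar>t\<bar>\<rceil>"]
          proof eventually_elim
            case (elim T)
            then have "\<bar>t\<bar> < real T" by linarith
            then show ?case by (auto simp: indicator_def)
          qed
        qed
        then show "AE t in lborel. (\<lambda>T::nat. indicator {- real T<..<real T} t *\<^sub>R g d t) \<longlonglongrightarrow> g d t" by simp
        show "integrable lborel (\<lambda>t. cmod (g d t))" using gi by simp
        show "AE t in lborel. norm (indicator {- real T<..<real T} t *\<^sub>R g d t) \<le> cmod (g d t)" for T :: nat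
          by (auto simp: indicator_def)
      qed simp_all
      then show ?thesis by (simp add: eq)
    qed
    from tendsto_mult[OF tendsto_const this, of "of_real (1 / (2 * pi))"]
    show "(\<lambda>T::nat. 1 / (2 * pi) * (CLBINT t=-T..T. g d t)) \<longlonglongrightarrow> of_real (1 / (2 * pi)) * (\<integral>t. g d t \<partial>lborel)"
      by simp
  qed
  define d where "d n = 1 / real (Suc n)" for n
  have d0: "0 < d n" for n by (simp add: d_def)
  have dl: "d \<longlonglongrightarrow> 0" unfolding d_def[abs_def] using LIMSEQ_inverse_real_of_nat by (simp add: inverse_eq_divide)
  have lhs: "(\<lambda>n. measure P {a<..a + d n} / d n) \<longlonglongrightarrow> p a"
  proof (rule LIMSEQ_I)
    fix e :: real assume "e > 0"
    have "isCont p a" using p(1) by (simp add: continuous_on_eq_continuous_at)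
    then obtain \<eta> where \<eta>: "\<eta> > 0" "\<And>x. \<bar>x - a\<bar> < \<eta> \<Longrightarrow> \<bar>p x - p a\<bar> < e / 2"
      using \<open>e > 0\<close> unfolding continuous_at_eps_delta dist_real_def by (metis half_gt_zero)
    obtain N where N: "\<And>n. n \<ge> N \<Longrightarrow> \<bar>d n\<bar> < \<eta>" using LIMSEQ_D[OF dl \<eta>(1)] by auto
    have "\<bar>measure P {a<..a + d n} / d n - p a\<bar> < e" if "n \<ge> N" for n
    proof -
      have i1: "integrable lborel (\<lambda>x. indicator {a<..a + d n} x * p x)"
        using integrable_mult_indicator[OF _ p(3), of "{a<..a + d n}"] by simp
      have i2: "integrable lborel (\<lambda>x. indicator {a<..a + d n} x * c)" for c :: real
        using d0[of n] by (intro integrable_mult_left integrable_real_indicator) auto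
      have ic: "(\<integral>x. indicator {a<..a + d n} x * c \<partial>lborel) = d n * c" for c
        using d0[of n] by (simp add: less_imp_le)
      have mp: "measure P {a<..a + d n} = (\<integral>x. indicator {a<..a + d n} x * p x \<partial>lborel)" by (rule ms) simp
      have e1: "measure P {a<..a + d n} - d n * p a = (\<integral>x. indicator {a<..a + d n} x * p x - indicator {a<..a + d n} x * p a \<partial>lborel)"
        by (simp only: Bochner_Integration.integral_diff[OF i1 i2] ic mp)
      have "\<bar>measure P {a<..a + d n} - d n * p a\<bar> \<le> (\<integral>x. \<bar>indicator {a<..a + d n} x * p x - indicator {a<..a + d n} x * p a\<bar> \<partial>lborel)"
        unfolding e1 by (rule integral_abs_bound)
      also have "\<dots> \<le> (\<integral>x. indicator {a<..a + d n} x * (e / 2) \<partial>lborel)"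
      proof (rule integral_mono)
        fix x
        show "\<bar>indicator {a<..a + d n} x * p x - indicator {a<..a + d n} x * p a\<bar> \<le> indicator {a<..a + d n} x * (e / 2)"
          using \<eta>(2)[of x] N[OF that] by (auto simp: indicator_def)
      qed (use i1 i2 in auto)
      also have "\<dots> = d n * (e / 2)" by (rule ic)
      finally have "\<bar>measure P {a<..a + d n} - d n * p a\<bar> \<le> d n * (e / 2)" .
      moreover have "measure P {a<..a + d n} / d n - p a = (measure P {a<..a + d n} - d n * p a) / d n"
        using d0[of n] by (simp add: diff_divide_distrib)
      ultimately have "\<bar>measure P {a<..a + d n} / d n - p a\<bar> = \<bar>measure P {a<..a + d n} - d n * p a\<bar> / d n"
        using d0[of n] by (simp only: abs_divide abs_of_pos)
      also have "\<dots> \<le> d n * (e / 2) / d n"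
        using \<open>\<bar>measure P {a<..a + d n} - d n * p a\<bar> \<le> d n * (e / 2)\<close> d0[of n] by (intro divide_right_mono) auto
      also have "\<dots> < e" using d0[of n] \<open>e > 0\<close> by simp
      finally show ?thesis .
    qed
    then show "\<exists>no. \<forall>n\<ge>no. norm (measure P {a<..a + d n} / d n - p a) < e" by auto
  qed
  have rhs: "(\<lambda>n. \<integral>t. of_real (1 / d n) * g (d n) t \<partial>lborel) \<longlonglongrightarrow> (\<integral>t. iexp (- (t * a)) * \<phi> t \<partial>lborel)"
  proof (rule integral_dominated_convergence[where w="\<lambda>t. cmod (\<phi> t)"])
    show "integrable lborel (\<lambda>t. cmod (\<phi> t))" using \<phi> by simp
    show "AE t in lborel. norm (of_real (1 / d n) * g (d n) t) \<le> cmod (\<phi> t)" for n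
    proof (rule AE_I2)
      fix t
      have "norm (of_real (1 / d n) * g (d n) t) \<le> (1 / d n) * (d n * cmod (\<phi> t))"
        using gb[of "d n" t] d0[of n] by (simp add: norm_mult norm_divide pos_divide_le_eq mult.commute)
      then show "norm (of_real (1 / d n) * g (d n) t) \<le> cmod (\<phi> t)" using d0[of n] by simp
    qed
    show "AE t in lborel. (\<lambda>n. of_real (1 / d n) * g (d n) t) \<longlonglongrightarrow> iexp (- (t * a)) * \<phi> t"
      using AE_lborel_singleton[of 0]
    proof eventually_elim
      case (elim t)
      have "(\<lambda>n. of_real (1 / d n) * g (d n) t - iexp (- (t * a)) * \<phi> t) \<longlonglongrightarrow> 0"
      proof (rule Lim_null_comparison)
        show "\<forall>\<^sub>F n in sequentially. cmod (of_real (1 / d n) * g (d n) t - iexp (- (t * a)) * \<phi> t) \<le> \<bar>t * d n\<bar> / 2 * cmod (\<phi> t)"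
        proof (intro always_eventually allI)
          fix n
          have "of_real (1 / d n) * g (d n) t - iexp (- (t * a)) * \<phi> t =
            (of_real (1 / d n) * ((iexp (- (t * a)) - iexp (- (t * (a + d n)))) / (\<i> * t)) - iexp (- (t * a))) * \<phi> t"
            by (simp only: g_def left_diff_distrib mult.assoc)
          then show "cmod (of_real (1 / d n) * g (d n) t - iexp (- (t * a)) * \<phi> t) \<le> \<bar>t * d n\<bar> / 2 * cmod (\<phi> t)"
            using iexp_diff_quotient(2)[OF elim, of "d n" a] d0[of n]
            by (simp only: norm_mult) (intro mult_right_mono, auto)
        qed
        have "(\<lambda>n. \<bar>t * d n\<bar> / 2 * cmod (\<phi> t)) \<longlonglongrightarrow> \<bar>t * 0\<bar> / 2 * cmod (\<phi> t)"
          by (intro tendsto_intros dl) simp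
        then show "(\<lambda>n. \<bar>t * d n\<bar> / 2 * cmod (\<phi> t)) \<longlonglongrightarrow> 0" by simp
      qed
      then show ?case by (rule LIM_zero_cancel)
    qed
  qed simp_all
  have "(\<lambda>n. of_real (measure P {a<..a + d n} / d n)) \<longlonglongrightarrow> of_real (1 / (2 * pi)) * (\<integral>t. iexp (- (t * a)) * \<phi> t \<partial>lborel)"
  proof -
    have "of_real (measure P {a<..a + d n} / d n) = of_real (1 / (2 * pi)) * (\<integral>t. of_real (1 / d n) * g (d n) t \<partial>lborel)" for n
      using mass[of "d n"] d0[of n] by (simp add: less_imp_le)
    then show ?thesis by (simp only:) (rule tendsto_mult[OF tendsto_const rhs])
  qed
  then show ?thesis using LIMSEQ_unique[OF tendsto_of_real[OF lhs]] by blast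
qed

section \<open>Admissible kernels\<close>

lemma admissible_kernelD:
  assumes "admissible_kernel K"
  shows "continuous_on UNIV K" "0 \<le> K u" "K (- u) = K u" "K 0 = 1" "compact (closure {u. K u \<noteq> 0})"
    "integrable lborel (fourier_transform K)"
  using assms unfolding admissible_kernel_def by blast+

lemma admissible_kernel_support:
  assumes "admissible_kernel K"
  shows "\<exists>c. \<forall>u. c < \<bar>u\<bar> \<longrightarrow> K u = 0"
proof -
  have "bounded {u. K u \<noteq> 0}"
    by (rule bounded_subset[OF compact_imp_bounded[OF admissible_kernelD(5)[OF assms]] closure_subset])
  then obtain c where "\<And>u. K u \<noteq> 0 \<Longrightarrow> \<bar>u\<bar> \<le> c" unfolding bounded_iff by auto
  then show ?thesis by (metis not_le)
qed

lemma admissible_kernel_bounded: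
  assumes K: "admissible_kernel K"
  shows "\<exists>B. \<forall>u. \<bar>K u\<bar> \<le> B"
proof -
  from admissible_kernel_support[OF K] obtain c where c: "\<And>u. c < \<bar>u\<bar> \<Longrightarrow> K u = 0" by blast
  have "compact (K ` {- c..c})"
    by (intro compact_continuous_image continuous_on_subset[OF admissible_kernelD(1)[OF K]]) auto
  from compact_imp_bounded[OF this] obtain B where "\<forall>y\<in>K ` {- c..c}. norm y \<le> B" unfolding bounded_iff by blast
  then have B: "\<bar>K u\<bar> \<le> B" if "u \<in> {- c..c}" for u using that by auto
  have "\<bar>K u\<bar> \<le> max B 0" for u
    using B[of u] c[of u] by (cases "\<bar>u\<bar> \<le> c") (auto simp: abs_le_iff)
  then show ?thesis by blast
qed

lemma admissible_kernel_integrable: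
  assumes K: "admissible_kernel K" shows "integrable lborel K"
proof -
  from admissible_kernel_support[OF K] obtain c where c: "\<And>u. c < \<bar>u\<bar> \<Longrightarrow> K u = 0" by blast
  have "integrable lborel (\<lambda>x. indicator {- c..c} x *\<^sub>R K x)"
    by (intro borel_integrable_compact continuous_on_subset[OF admissible_kernelD(1)[OF K]]) auto
  moreover have "(\<lambda>x. indicator {- c..c} x *\<^sub>R K x) = K"
  proof
    fix x show "indicator {- c..c} x *\<^sub>R K x = K x" using c[of x] by (cases "\<bar>x\<bar> \<le> c") (auto simp: indicator_def abs_le_iff)
  qed
  ultimately show ?thesis by simp
qed

text \<open>K exceeds 1/2 near 0 by continuity. The positive mass permits normalising K to a
  probability density.\<close>

lemma admissible_kernel_mass:
  assumes K: "admissible_kernel K" shows "0 < (\<integral>x. K x \<partial>lborel)"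
proof -
  have nn: "0 \<le> K x" for x by (rule admissible_kernelD(2)[OF K])
  have "isCont K 0" "K 0 = 1" using admissible_kernelD(1,4)[OF K] by (auto simp: continuous_on_eq_continuous_at)
  then obtain \<eta> where \<eta>: "\<eta> > 0" "\<And>x. \<bar>x\<bar> < \<eta> \<Longrightarrow> \<bar>K x - 1\<bar> < 1 / 2"
    unfolding continuous_at_eps_delta dist_real_def by (metis diff_zero half_gt_zero zero_less_one)
  have "0 < (\<integral>x. indicator {0<..<\<eta>} x * (1 / 2 :: real) \<partial>(lborel::real measure))"
    using \<eta>(1) by (simp add: less_imp_le)
  also have "\<dots> \<le> (\<integral>x. K x \<partial>lborel)"
  proof (rule integral_mono)
    show "integrable lborel (\<lambda>x. indicator {0<..<\<eta>} x * (1 / 2 :: real))"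
      using \<eta>(1) by (intro integrable_mult_left integrable_real_indicator) auto
    show "indicator {0<..<\<eta>} x * (1 / 2) \<le> K x" for x
      using \<eta>(2)[of x] nn[of x] by (cases "x \<in> {0<..<\<eta>}") (auto simp: indicator_def abs_if split: if_splits)
  qed (rule admissible_kernel_integrable[OF K])
  finally show ?thesis .
qed

text \<open>Inversion for the density K/m represents K by its Fourier transform. Averaging over u
  and -u removes the sine part and leaves the real part of the transform, divided by 2 pi, as
  \<kappa>.\<close>

theorem admissible_kernel_cos:
  assumes K: "admissible_kernel K"
  obtains \<kappa> where "integrable lborel \<kappa>" "\<And>u. K u = (\<integral>t. \<kappa> t * cos (u * t) \<partial>lborel)"
proof -
  define m where "m = (\<integral>x. K x \<partial>lborel)"
  have m: "0 < m" unfolding m_def by (rule admissible_kernel_mass[OF K])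
  \<comment> \<open>Characteristic functions use the opposite sign in the exponent from
    \<open>fourier_transform\<close>, hence the reflection.\<close>
  define G where "G t = fourier_transform K (- t)" for t
  have Gi: "integrable lborel G"
  proof -
    have "integrable lborel (fourier_transform K)" by (rule admissible_kernelD(6)[OF K])
    from lborel_integrable_real_affine[OF this, of "-1" 0] show ?thesis by (simp add: G_def[abs_def])
  qed
  let ?p = "\<lambda>x. K x / m"
  have phi: "(\<integral>x. of_real (?p x) * iexp (t * x) \<partial>lborel) = G t / m" for t
  proof -
    have "(\<integral>x. of_real (?p x) * iexp (t * x) \<partial>lborel) = (\<integral>x. (of_real (K x) * iexp (t * x)) / of_real m \<partial>lborel)"
      by simp
    also have "\<dots> = (\<integral>x. of_real (K x) * iexp (t * x) \<partial>lborel) / of_real m" by (rule integral_divide_zero)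
    finally show ?thesis by (simp add: G_def fourier_transform_def)
  qed
  have inv: "of_real (K a) = of_real (1 / (2 * pi)) * (\<integral>t. iexp (- (t * a)) * G t \<partial>lborel)" for a
  proof -
    have "of_real (?p a) = of_real (1 / (2 * pi)) * (\<integral>t. iexp (- (t * a)) * (\<integral>x. of_real (?p x) * iexp (t * x) \<partial>lborel) \<partial>lborel)"
    proof (rule density_fourier_inversion)
      show "continuous_on UNIV ?p" using admissible_kernelD(1)[OF K] m by (auto intro!: continuous_intros)
      show "0 \<le> ?p x" for x using admissible_kernelD(2)[OF K] m by simp
      show "integrable lborel ?p" using admissible_kernel_integrable[OF K] by simp
      show "(\<integral>x. ?p x \<partial>lborel) = 1" using m by (simp add: m_def)
      show "integrable lborel (\<lambda>t. \<integral>x. of_real (?p x) * iexp (t * x) \<partial>lborel)" unfolding phi using Gi by simp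
    qed
    then have "of_real (?p a) = of_real (1 / (2 * pi)) * ((\<integral>t. iexp (- (t * a)) * G t \<partial>lborel) / of_real m)"
      unfolding phi by simp
    then show ?thesis using m by (simp add: field_simps)
  qed
  have int1: "integrable lborel (\<lambda>t. iexp (- (t * a)) * G t)" for a
    by (rule Bochner_Integration.integrable_bound[OF Gi]) (use Gi in \<open>auto simp: norm_mult\<close>)
  have re: "K a = 1 / (2 * pi) * (\<integral>t. cos (a * t) * Re (G t) + sin (a * t) * Im (G t) \<partial>lborel)" for a
  proof -
    have "K a = Re (of_real (1 / (2 * pi)) * (\<integral>t. iexp (- (t * a)) * G t \<partial>lborel))"
      unfolding inv[symmetric] by simp
    also have "\<dots> = 1 / (2 * pi) * Re (\<integral>t. iexp (- (t * a)) * G t \<partial>lborel)" by simp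
    also have "Re (\<integral>t. iexp (- (t * a)) * G t \<partial>lborel) = (\<integral>t. Re (iexp (- (t * a)) * G t) \<partial>lborel)"
      by (rule integral_Re[OF int1, symmetric])
    also have "\<dots> = (\<integral>t. cos (a * t) * Re (G t) + sin (a * t) * Im (G t) \<partial>lborel)"
      by (rule Bochner_Integration.integral_cong[OF refl]) (simp add: Re_exp Im_exp mult.commute)
    finally show ?thesis .
  qed
  have ReG: "integrable lborel (\<lambda>t. Re (G t))" and ImG: "integrable lborel (\<lambda>t. Im (G t))" using Gi by simp_all
  have ci: "integrable lborel (\<lambda>t. cos (a * t) * Re (G t))" for a
    by (rule Bochner_Integration.integrable_bound[OF ReG]) (use ReG in \<open>auto simp: abs_mult intro!: AE_I2 mult_left_le_one_le\<close>)
  have si: "integrable lborel (\<lambda>t. sin (a * t) * Im (G t))" for a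
    by (rule Bochner_Integration.integrable_bound[OF ImG]) (use ImG in \<open>auto simp: abs_mult intro!: AE_I2 mult_left_le_one_le\<close>)
  show ?thesis
  proof (rule that)
    show "integrable lborel (\<lambda>t. 1 / (2 * pi) * Re (G t))" using ReG by simp
    fix u
    have "K u = (K u + K (- u)) / 2" by (simp add: admissible_kernelD(3)[OF K])
    also have "\<dots> = 1 / (2 * pi) * (\<integral>t. cos (u * t) * Re (G t) \<partial>lborel)"
      unfolding re[of u] re[of "- u"] using ci[of u] si[of u] by (simp add: field_simps)
    also have "\<dots> = (\<integral>t. 1 / (2 * pi) * (cos (u * t) * Re (G t)) \<partial>lborel)" by (rule integral_mult_right_zero[symmetric])
    also have "\<dots> = (\<integral>t. 1 / (2 * pi) * Re (G t) * cos (u * t) \<partial>lborel)" by (simp only: mult_ac)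
    finally show "K u = (\<integral>t. 1 / (2 * pi) * Re (G t) * cos (u * t) \<partial>lborel)" .
  qed
qed

section \<open>Studentization\<close>

text \<open>The hypotheses give c >= V/2, which keeps the denominators away from zero; the
  difference of the roots is V - c divided by their sum.\<close>

lemma inverse_sqrt_diff:
  assumes V: "0 < V" and c: "\<bar>c - V\<bar> \<le> \<eta>" "\<eta> \<le> V / 2"
  shows "0 < c" "\<bar>1 / sqrt c - 1 / sqrt V\<bar> \<le> \<eta> / (V * sqrt (V / 2))"
proof -
  have cV: "V / 2 \<le> c" using c by (auto simp: abs_le_iff)
  then show c0: "0 < c" using V by linarith
  have "\<bar>sqrt V - sqrt c\<bar> * sqrt V \<le> \<bar>sqrt V - sqrt c\<bar> * (sqrt V + sqrt c)"
    using c0 by (intro mult_left_mono) auto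
  also have "\<dots> = \<bar>(sqrt V - sqrt c) * (sqrt V + sqrt c)\<bar>"
    using c0 V by (simp add: abs_mult)
  also have "(sqrt V - sqrt c) * (sqrt V + sqrt c) = V - c" using c0 V by (simp add: algebra_simps)
  finally have 1: "\<bar>sqrt V - sqrt c\<bar> * sqrt V \<le> \<eta>" using c(1) by (simp add: abs_minus_commute)
  have "1 / sqrt c - 1 / sqrt V = (sqrt V - sqrt c) / (sqrt c * sqrt V)" using c0 V by (simp add: field_simps)
  also have "\<bar>\<dots>\<bar> = (\<bar>sqrt V - sqrt c\<bar> * sqrt V) / (sqrt c * V)"
    using c0 V by (simp add: abs_mult field_simps)
  also have "\<dots> \<le> \<eta> / (sqrt c * V)" using 1 c0 V by (intro divide_right_mono) auto
  also have "\<dots> \<le> \<eta> / (sqrt (V / 2) * V)"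
  proof (rule divide_left_mono)
    show "sqrt (V / 2) * V \<le> sqrt c * V" using cV V by (intro mult_right_mono) auto
    show "0 \<le> \<eta>" using c(1) by linarith
  qed (use c0 V in auto)
  finally show "\<bar>1 / sqrt c - 1 / sqrt V\<bar> \<le> \<eta> / (V * sqrt (V / 2))" by (simp add: mult.commute)
qed

lemma cmod_iexp_diff: "cmod (iexp x - iexp y) \<le> \<bar>x - y\<bar>"
proof -
  have "iexp x - iexp y = iexp y * (iexp (x - y) - 1)"
    by (simp add: right_diff_distrib exp_add[symmetric] algebra_simps)
  then have "cmod (iexp x - iexp y) = cmod (iexp (x - y) - 1)" by (simp add: norm_mult del: of_real_diff)
  then show ?thesis using cmod_iexp_minus_1[of "x - y"] by simp
qed

context prob_space
begin

text \<open>Markov's inequality, as c <= 0 forces |c - V| >= V.\<close>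

lemma prob_nonpos_le:
  assumes c: "integrable M c" and V: "0 < V"
  shows "prob {\<omega> \<in> space M. c \<omega> \<le> 0} \<le> (\<integral>\<omega>. \<bar>c \<omega> - V\<bar> \<partial>M) / V"
proof -
  have [measurable]: "c \<in> borel_measurable M" using c by simp
  let ?A = "{\<omega> \<in> space M. c \<omega> \<le> 0}"
  have "prob ?A = (\<integral>\<omega>. indicator ?A \<omega> \<partial>M)" by simp
  also have "\<dots> \<le> (\<integral>\<omega>. \<bar>c \<omega> - V\<bar> / V \<partial>M)"
  proof (rule integral_mono)
    show "indicator ?A \<omega> \<le> \<bar>c \<omega> - V\<bar> / V" for \<omega> using V by (auto simp: indicator_def field_simps)
    show "integrable M (indicator ?A :: 'a \<Rightarrow> real)" by (rule integrable_real_indicator) (auto simp: emeasure_eq_measure)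
  qed (use c in auto)
  also have "\<dots> = (\<integral>\<omega>. \<bar>c \<omega> - V\<bar> \<partial>M) / V" by (rule integral_divide_zero)
  finally show ?thesis .
qed

text \<open>Slutsky's argument on characteristic functions. Where |c - V| <= \<eta> the quotient
  changes by O(\<eta>)|S|; elsewhere two unimodular numbers differ by at most 2, which is below
  (2/\<eta>)|c - V|. The convention 0 for nonpositive c falls entirely into the second case.\<close>

theorem studentized_char_tendsto:
  fixes S c :: "nat \<Rightarrow> 'a \<Rightarrow> real"
  assumes S: "\<And>n. sqint M (S n)" "\<And>n. norm_L2 M (S n) \<le> B"
    and c: "\<And>n. integrable M (c n)" "(\<lambda>n. \<integral>\<omega>. \<bar>c n \<omega> - V\<bar> \<partial>M) \<longlonglongrightarrow> 0" and V: "0 < V"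
    and clt: "\<And>t. (\<lambda>n. \<integral>\<omega>. iexp (t * S n \<omega>) \<partial>M) \<longlonglongrightarrow> of_real (exp (- t\<^sup>2 * V / 2))"
  shows "(\<lambda>n. \<integral>\<omega>. iexp (t * (if 0 < c n \<omega> then S n \<omega> / sqrt (c n \<omega>) else 0)) \<partial>M) \<longlonglongrightarrow> of_real (exp (- t\<^sup>2 / 2))"
proof -
  let ?T = "\<lambda>n \<omega>. if 0 < c n \<omega> then S n \<omega> / sqrt (c n \<omega>) else 0"
  let ?U = "\<lambda>n \<omega>. S n \<omega> / sqrt V"
  have [measurable]: "c n \<in> borel_measurable M" "S n \<in> borel_measurable M" for n using c S by (simp_all add: sqint_def)
  have iT: "integrable M (\<lambda>\<omega>. iexp (t * ?T n \<omega>))" "integrable M (\<lambda>\<omega>. iexp (t * ?U n \<omega>))" for n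
    by (rule integrable_const_bound[where B=1]; simp)+
  have B0: "0 \<le> B" using S(2)[of 0] norm_L2_nonneg[of M "S 0"] by linarith
  have U: "(\<lambda>n. \<integral>\<omega>. iexp (t * ?U n \<omega>) \<partial>M) \<longlonglongrightarrow> of_real (exp (- t\<^sup>2 / 2))"
    using clt[of "t / sqrt V"] V by (simp add: power_divide)
  define k where "k = \<bar>t\<bar> / (V * sqrt (V / 2)) * B + 1"
  have k: "0 < k" using V B0 by (auto simp: k_def intro!: add_nonneg_pos)
  have diff: "(\<lambda>n. (\<integral>\<omega>. iexp (t * ?T n \<omega>) \<partial>M) - (\<integral>\<omega>. iexp (t * ?U n \<omega>) \<partial>M)) \<longlonglongrightarrow> 0"
  proof (rule LIMSEQ_I)
    fix e :: real assume e: "e > 0"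
    define \<eta> where "\<eta> = min (V / 2) (e / (2 * k))"
    have eta: "0 < \<eta>" "\<eta> \<le> V / 2" "\<eta> * k \<le> e / 2"
    proof -
      show "0 < \<eta>" "\<eta> \<le> V / 2" using V e k by (auto simp: \<eta>_def)
      have "\<eta> * k \<le> e / (2 * k) * k" using k by (intro mult_right_mono) (auto simp: \<eta>_def)
      then show "\<eta> * k \<le> e / 2" using k by simp
    qed
    have "\<forall>\<^sub>F n in sequentially. (\<integral>\<omega>. \<bar>c n \<omega> - V\<bar> \<partial>M) < e * \<eta> / 4"
      using c(2) by (rule order_tendstoD) (use e eta in simp)
    then obtain n0 where n0: "\<And>n. n \<ge> n0 \<Longrightarrow> (\<integral>\<omega>. \<bar>c n \<omega> - V\<bar> \<partial>M) < e * \<eta> / 4" by (auto simp: eventually_sequentially)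
    have "cmod ((\<integral>\<omega>. iexp (t * ?T n \<omega>) \<partial>M) - (\<integral>\<omega>. iexp (t * ?U n \<omega>) \<partial>M)) < e" if "n \<ge> n0" for n
    proof -
      let ?d = "\<bar>t\<bar> * (\<eta> / (V * sqrt (V / 2)))"
      have pt: "cmod (iexp (t * ?T n \<omega>) - iexp (t * ?U n \<omega>)) \<le> ?d * \<bar>S n \<omega>\<bar> + 2 / \<eta> * \<bar>c n \<omega> - V\<bar>" for \<omega>
      proof (cases "\<bar>c n \<omega> - V\<bar> \<le> \<eta>")
        case True
        note b = inverse_sqrt_diff[OF V True eta(2)]
        have "cmod (iexp (t * ?T n \<omega>) - iexp (t * ?U n \<omega>)) \<le> \<bar>t * ?T n \<omega> - t * ?U n \<omega>\<bar>" by (rule cmod_iexp_diff)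
        also have "t * ?T n \<omega> - t * ?U n \<omega> = t * S n \<omega> * (1 / sqrt (c n \<omega>) - 1 / sqrt V)" using b(1) by (simp add: right_diff_distrib)
        also have "\<bar>\<dots>\<bar> \<le> \<bar>t * S n \<omega>\<bar> * (\<eta> / (V * sqrt (V / 2)))" unfolding abs_mult[of "t * S n \<omega>"] using b(2) by (rule mult_left_mono) simp
        also have "\<dots> = ?d * \<bar>S n \<omega>\<bar>" by (simp add: abs_mult)
        also have "\<dots> \<le> ?d * \<bar>S n \<omega>\<bar> + 2 / \<eta> * \<bar>c n \<omega> - V\<bar>" using eta by simp
        finally show ?thesis .
      next
        case False
        have "cmod (iexp (t * ?T n \<omega>) - iexp (t * ?U n \<omega>)) \<le> cmod (iexp (t * ?T n \<omega>)) + cmod (iexp (t * ?U n \<omega>))" by (rule norm_triangle_ineq4)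
        also have "\<dots> = 2" by (simp only: norm_exp_i_times one_add_one)
        also have "\<dots> \<le> 2 / \<eta> * \<bar>c n \<omega> - V\<bar>" using False eta(1) by (simp add: field_simps)
        also have "\<dots> \<le> ?d * \<bar>S n \<omega>\<bar> + 2 / \<eta> * \<bar>c n \<omega> - V\<bar>" using eta V by simp
        finally show ?thesis .
      qed
      have Si: "integrable M (S n)" by (rule sqint_integrable[OF S(1)])
      have "cmod ((\<integral>\<omega>. iexp (t * ?T n \<omega>) \<partial>M) - (\<integral>\<omega>. iexp (t * ?U n \<omega>) \<partial>M)) = cmod (\<integral>\<omega>. iexp (t * ?T n \<omega>) - iexp (t * ?U n \<omega>) \<partial>M)"
        by (simp only: Bochner_Integration.integral_diff[OF iT])
      also have "\<dots> \<le> (\<integral>\<omega>. cmod (iexp (t * ?T n \<omega>) - iexp (t * ?U n \<omega>)) \<partial>M)" by (rule integral_norm_bound)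
      also have "\<dots> \<le> (\<integral>\<omega>. ?d * \<bar>S n \<omega>\<bar> + 2 / \<eta> * \<bar>c n \<omega> - V\<bar> \<partial>M)"
      proof (rule integral_mono)
        show "integrable M (\<lambda>\<omega>. cmod (iexp (t * ?T n \<omega>) - iexp (t * ?U n \<omega>)))"
          by (intro integrable_norm Bochner_Integration.integrable_diff iT)
        show "integrable M (\<lambda>\<omega>. ?d * \<bar>S n \<omega>\<bar> + 2 / \<eta> * \<bar>c n \<omega> - V\<bar>)" using Si c(1)[of n] by auto
      qed (rule pt)
      also have "\<dots> = ?d * (\<integral>\<omega>. \<bar>S n \<omega>\<bar> \<partial>M) + 2 / \<eta> * (\<integral>\<omega>. \<bar>c n \<omega> - V\<bar> \<partial>M)" using Si c(1)[of n] by simp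
      also have "\<dots> < ?d * B + 2 / \<eta> * (e * \<eta> / 4)"
      proof (rule add_le_less_mono)
        show "?d * (\<integral>\<omega>. \<bar>S n \<omega>\<bar> \<partial>M) \<le> ?d * B"
          using integral_abs_le_norm_L2[OF S(1), of n] S(2)[of n] eta V by (intro mult_left_mono) auto
        show "2 / \<eta> * (\<integral>\<omega>. \<bar>c n \<omega> - V\<bar> \<partial>M) < 2 / \<eta> * (e * \<eta> / 4)"
          using n0[OF that] eta(1) by (intro mult_strict_left_mono) auto
      qed
      also have "\<dots> \<le> \<eta> * k + e / 2" using eta(1) by (simp add: k_def algebra_simps)
      also have "\<dots> \<le> e" using eta(3) by simp
      finally show ?thesis .
    qed
    then show "\<exists>no. \<forall>n\<ge>no. norm ((\<integral>\<omega>. iexp (t * ?T n \<omega>) \<partial>M) - (\<integral>\<omega>. iexp (t * ?U n \<omega>) \<partial>M) - 0) < e" by auto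
  qed
  from tendsto_add[OF diff U] show ?thesis by simp
qed

end

section \<open>Spectral measures\<close>

lemma int_interval_finite_subsets: "filterlim (\<lambda>n. {- int n..int n}) (finite_subsets_at_top UNIV) sequentially"
  unfolding filterlim_iff
proof (intro allI impI)
  fix P :: "int set \<Rightarrow> bool" assume "eventually P (finite_subsets_at_top UNIV)"
  then obtain X where X: "finite X" "\<And>Y. finite Y \<Longrightarrow> X \<subseteq> Y \<Longrightarrow> P Y"
    unfolding eventually_finite_subsets_at_top by auto
  have "P {- int n..int n}" if "n \<ge> nat (\<Sum>k\<in>X. \<bar>k\<bar>)" for n
  proof (rule X(2))
    show "X \<subseteq> {- int n..int n}"
    proof
      fix k assume "k \<in> X"
      then have "\<bar>k\<bar> \<le> (\<Sum>k\<in>X. \<bar>k\<bar>)" by (intro member_le_sum) (use X(1) in auto)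
      also have "\<dots> \<le> int n" using that by simp
      finally show "k \<in> {- int n..int n}" by (auto simp: abs_le_iff)
    qed
  qed simp
  then show "\<forall>\<^sub>F n in sequentially. P {- int n..int n}" by (auto simp: eventually_sequentially)
qed

lemma sum_int_tendsto_infsum:
  fixes f :: "int \<Rightarrow> 'b::{t2_space, comm_monoid_add}"
  assumes "f summable_on UNIV"
  shows "(\<lambda>n. \<Sum>k\<in>{- int n..int n}. f k) \<longlonglongrightarrow> (\<Sum>\<^sub>\<infinity>k\<in>UNIV. f k)"
  by (rule filterlim_compose[OF infsum_tendsto[OF assms] int_interval_finite_subsets])

text \<open>The estimate holds whether or not the supremum is countably additive, because
  \<open>measure_of\<close> assigns the value 0 to every set in the latter case.\<close>

lemma upper_variation_finite:
  assumes "\<And>A. A \<in> sets S \<Longrightarrow> \<nu> A \<le> B"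
  shows "finite_measure (upper_variation S \<nu>)"
proof
  let ?\<mu> = "\<lambda>A. SUP B\<in>{B \<in> sets S. B \<subseteq> A}. ennreal (\<nu> B)"
  have "emeasure (upper_variation S \<nu>) (space S) \<le> ?\<mu> (space S)"
    unfolding upper_variation_def emeasure_measure_of_conv by simp
  also have "\<dots> \<le> ennreal B" using assms by (intro SUP_least ennreal_leI) auto
  also have "\<dots> < \<infinity>" by simp
  finally show "emeasure (upper_variation S \<nu>) (space (upper_variation S \<nu>)) \<noteq> \<infinity>"
    by (simp add: upper_variation_def space_measure_of_conv)
qed

lemma signed_integral_uminus: "signed_integral S (\<lambda>A. - \<nu> A) g = - signed_integral S \<nu> g"
  by (simp add: signed_integral_def)

lemma signed_integral_cnj: "signed_integral S \<nu> (\<lambda>x. cnj (g x)) = cnj (signed_integral S \<nu> g)"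
  by (simp add: signed_integral_def)

lemma complex_integral_cnj:
  "complex_integral S (\<lambda>A. cnj (\<nu> A)) (\<lambda>x. cnj (g x)) = cnj (complex_integral S \<nu> g)"
  by (simp add: complex_integral_def signed_integral_uminus signed_integral_cnj)

text \<open>Dominated convergence on a finite measure, with the constant sum of the |a k| dominating
  all partial sums.\<close>

lemma upper_variation_series_tendsto:
  fixes a :: "int \<Rightarrow> complex" and e :: "int \<Rightarrow> 'x \<Rightarrow> complex"
  assumes \<nu>: "\<And>A. A \<in> sets S \<Longrightarrow> \<nu> A \<le> B"
    and e: "\<And>k. e k \<in> borel_measurable S" "\<And>k x. cmod (e k x) \<le> 1" and a: "(\<lambda>k. cmod (a k)) summable_on UNIV"
  shows "(\<lambda>n. \<Sum>k\<in>{- int n..int n}. a k * integral\<^sup>L (upper_variation S \<nu>) (e k)) \<longlonglongrightarrow> integral\<^sup>L (upper_variation S \<nu>) (\<lambda>x. \<Sum>\<^sub>\<infinity>k\<in>UNIV. a k * e k x)"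
proof -
  let ?U = "upper_variation S \<nu>"
  interpret finite_measure ?U by (rule upper_variation_finite[OF \<nu>])
  have em: "e k \<in> borel_measurable ?U" for k using e(1)[of k] by (simp add: measurable_def upper_variation_def space_measure_of_conv)
  have ei: "integrable ?U (e k)" for k by (rule integrable_const_bound[where B=1]) (use e em in auto)
  have sm: "(\<lambda>k. a k * e k x) summable_on UNIV" for x
  proof (rule abs_summable_summable, rule summable_on_comparison_test[OF a])
    show "norm (a k * e k x) \<le> cmod (a k)" for k using e(2)[of k x] by (simp add: norm_mult mult_left_le)
  qed simp
  have fin: "cmod (\<Sum>k\<in>{- int n..int n}. a k * e k x) \<le> (\<Sum>\<^sub>\<infinity>k\<in>UNIV. cmod (a k))" for n x
  proof -
    have "cmod (\<Sum>k\<in>{- int n..int n}. a k * e k x) \<le> (\<Sum>k\<in>{- int n..int n}. cmod (a k))"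
      using e(2) by (intro order_trans[OF norm_sum sum_mono]) (simp add: norm_mult mult_left_le)
    also have "\<dots> \<le> (\<Sum>\<^sub>\<infinity>k\<in>UNIV. cmod (a k))" by (rule finite_sum_le_infsum[OF a]) auto
    finally show ?thesis .
  qed
  have lim: "(\<lambda>n. \<Sum>k\<in>{- int n..int n}. a k * e k x) \<longlonglongrightarrow> (\<Sum>\<^sub>\<infinity>k\<in>UNIV. a k * e k x)" for x
    by (rule sum_int_tendsto_infsum[OF sm])
  have "(\<lambda>n. integral\<^sup>L ?U (\<lambda>x. \<Sum>k\<in>{- int n..int n}. a k * e k x)) \<longlonglongrightarrow> integral\<^sup>L ?U (\<lambda>x. \<Sum>\<^sub>\<infinity>k\<in>UNIV. a k * e k x)"
  proof (rule integral_dominated_convergence[where w="\<lambda>_. \<Sum>\<^sub>\<infinity>k\<in>UNIV. cmod (a k)"])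
    show "(\<lambda>x. \<Sum>k\<in>{- int n..int n}. a k * e k x) \<in> borel_measurable ?U" for n using em by measurable
    then show "(\<lambda>x. \<Sum>\<^sub>\<infinity>k\<in>UNIV. a k * e k x) \<in> borel_measurable ?U"
      by (rule borel_measurable_LIMSEQ_metric) (rule lim)
  qed (use lim fin in auto)
  moreover have "integral\<^sup>L ?U (\<lambda>x. \<Sum>k\<in>{- int n..int n}. a k * e k x) = (\<Sum>k\<in>{- int n..int n}. a k * integral\<^sup>L ?U (e k))" for n
    using ei by (simp add: Bochner_Integration.integral_sum)
  ultimately show ?thesis by simp
qed

lemma complex_integral_series_tendsto:
  fixes a :: "int \<Rightarrow> complex" and e :: "int \<Rightarrow> 'x \<Rightarrow> complex"
  assumes \<nu>: "\<And>A. A \<in> sets S \<Longrightarrow> cmod (\<nu> A) \<le> B"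
    and e: "\<And>k. e k \<in> borel_measurable S" "\<And>k x. cmod (e k x) \<le> 1" and a: "(\<lambda>k. cmod (a k)) summable_on UNIV"
  shows "(\<lambda>n. \<Sum>k\<in>{- int n..int n}. a k * complex_integral S \<nu> (e k)) \<longlonglongrightarrow> complex_integral S \<nu> (\<lambda>x. \<Sum>\<^sub>\<infinity>k\<in>UNIV. a k * e k x)"
proof -
  have b: "Re (\<nu> A) \<le> B" "- Re (\<nu> A) \<le> B" "Im (\<nu> A) \<le> B" "- Im (\<nu> A) \<le> B" if "A \<in> sets S" for A
    using \<nu>[OF that] abs_Re_le_cmod[of "\<nu> A"] abs_Im_le_cmod[of "\<nu> A"] by linarith+
  note u = upper_variation_series_tendsto[OF _ e a]
  have sg: "(\<lambda>n. \<Sum>k\<in>{- int n..int n}. a k * signed_integral S \<xi> (e k)) \<longlonglongrightarrow> signed_integral S \<xi> (\<lambda>x. \<Sum>\<^sub>\<infinity>k\<in>UNIV. a k * e k x)"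
    if "\<And>A. A \<in> sets S \<Longrightarrow> \<xi> A \<le> B" "\<And>A. A \<in> sets S \<Longrightarrow> - \<xi> A \<le> B" for \<xi>
    unfolding signed_integral_def right_diff_distrib sum_subtractf
    by (intro tendsto_diff u[of _ B] that)
  have "(\<lambda>n. (\<Sum>k\<in>{- int n..int n}. a k * signed_integral S (\<lambda>A. Re (\<nu> A)) (e k)) + \<i> * (\<Sum>k\<in>{- int n..int n}. a k * signed_integral S (\<lambda>A. Im (\<nu> A)) (e k)))
    \<longlonglongrightarrow> complex_integral S \<nu> (\<lambda>x. \<Sum>\<^sub>\<infinity>k\<in>UNIV. a k * e k x)"
    unfolding complex_integral_def by (intro tendsto_add tendsto_mult tendsto_const sg b)
  then show ?thesis
    by (simp add: complex_integral_def distrib_left sum.distrib sum_distrib_left mult_ac)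
qed

section \<open>Hermitian forms and matrix-valued measures\<close>

lemma herm_form_axis: "herm_form A (axis a c) = cnj c * A $ a $ a * c"
proof -
  have "herm_form A (axis a c) = (\<Sum>i\<in>UNIV. \<Sum>j\<in>UNIV. if i = a \<and> j = a then cnj c * A $ a $ a * c else 0)"
    unfolding herm_form_def axis_def by (intro sum.cong refl) auto
  also have "\<dots> = (\<Sum>i\<in>UNIV. if i = a then cnj c * A $ a $ a * c else 0)"
    by (intro sum.cong refl) (simp add: sum.delta)
  finally show ?thesis by simp
qed

lemma herm_form_axis2:
  fixes A :: "complex^'n^'n"
  assumes "a \<noteq> b"
  shows "herm_form A (axis a c + axis b d) = cnj c * A $ a $ a * c + cnj c * A $ a $ b * d + cnj d * A $ b $ a * c + cnj d * A $ b $ b * d"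
proof -
  let ?v = "axis a c + axis b d :: complex^'n"
  have row: "(\<Sum>j\<in>UNIV. x j * ?v $ j) = x a * c + x b * d" for x :: "'n \<Rightarrow> complex"
  proof -
    have "(\<Sum>j\<in>UNIV. x j * ?v $ j) = (\<Sum>j\<in>{a, b}. x j * ?v $ j)" by (rule sum.mono_neutral_right) (auto simp: axis_def)
    then show ?thesis using assms by (simp add: axis_def)
  qed
  have "herm_form A ?v = (\<Sum>i\<in>UNIV. cnj (?v $ i) * (A $ i $ a * c + A $ i $ b * d))"
    unfolding herm_form_def by (simp only: row) (simp add: algebra_simps)
  also have "\<dots> = (\<Sum>i\<in>{a, b}. cnj (?v $ i) * (A $ i $ a * c + A $ i $ b * d))" by (rule sum.mono_neutral_right) (auto simp: axis_def)
  finally show ?thesis using assms by (simp add: axis_def algebra_simps)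
qed

lemma herm_nonneg_def_hermitian: "herm_nonneg_def A \<Longrightarrow> A $ a $ b = cnj (A $ b $ a)"
  unfolding herm_nonneg_def_def hermitian_def by blast

lemma herm_nonneg_def_diag: "herm_nonneg_def A \<Longrightarrow> 0 \<le> Re (A $ a $ a)"
  using herm_form_axis[of A a 1] unfolding herm_nonneg_def_def by (metis complex_cnj_one mult.left_neutral mult.right_neutral)

text \<open>Testing the form at \<open>e\<^sub>a + d e\<^sub>b\<close> with \<open>d\<close> unimodular gives \<open>2|A\<^sub>a\<^sub>b| \<le> A\<^sub>a\<^sub>a + A\<^sub>b\<^sub>b\<close>.\<close>

lemma herm_nonneg_def_entry:
  assumes A: "herm_nonneg_def A"
  shows "cmod (A $ a $ b) \<le> Re (A $ a $ a) + Re (A $ b $ b)"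
proof (cases "a = b")
  case True
  have "Im (A $ a $ a) = 0" using arg_cong[OF herm_nonneg_def_hermitian[OF A, of a a], of Im] by simp
  then have "cmod (A $ a $ a) = \<bar>Re (A $ a $ a)\<bar>" by (simp add: cmod_def)
  then show ?thesis using True herm_nonneg_def_diag[OF A, of a] by simp
next
  case False
  show ?thesis
  proof (cases "A $ a $ b = 0")
    case True
    then show ?thesis using herm_nonneg_def_diag[OF A] by simp
  next
    case nz: False
    let ?z = "A $ a $ b"
    \<comment> \<open>This phase rotates the entry onto the negative real axis.\<close>
    define d where "d = - cnj ?z / of_real (cmod ?z)"
    have zd: "?z * d = - of_real (cmod ?z)"
      using nz complex_norm_square[of ?z] by (simp add: d_def power2_eq_square field_simps)
    have dd: "cnj d * d = 1"
      using nz complex_norm_square[of ?z] by (simp add: d_def power2_eq_square field_simps)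
    have "A $ b $ a = cnj ?z" by (rule herm_nonneg_def_hermitian[OF A])
    then have "cnj d * A $ b $ a = cnj (?z * d)" by (simp add: mult.commute)
    then have ba: "cnj d * A $ b $ a = - of_real (cmod ?z)" by (simp add: zd)
    have bb: "cnj d * A $ b $ b * d = A $ b $ b" using dd by (metis mult.assoc mult.commute mult.right_neutral)
    have "herm_form A (axis a 1 + axis b d) = A $ a $ a + A $ b $ b - 2 * of_real (cmod ?z)"
      unfolding herm_form_axis2[OF False] using zd ba bb by simp
    moreover have "0 \<le> Re (herm_form A (axis a 1 + axis b d))" using A by (auto simp: herm_nonneg_def_def)
    ultimately have "2 * cmod ?z \<le> Re (A $ a $ a) + Re (A $ b $ b)" by simp
    then show ?thesis using norm_ge_zero[of ?z] by linarith
  qed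
qed

text \<open>Additivity is extracted from countable additivity by the sequence A, its complement, and
  empty sets; the empty set has value 0 because a constant series converges only if its terms
  vanish. Diagonal entries are nonnegative, hence increasing in the set.\<close>

lemma herm_matrix_measure_mono_diag:
  assumes F: "herm_matrix_measure S F" and A: "A \<in> sets S"
  shows "Re (F A $ a $ a) \<le> Re (F (space S) $ a $ a)"
proof -
  have F0: "F {} = 0"
  proof -
    have "(\<lambda>i::nat. F {}) sums F (\<Union>i::nat. {})"
      using F[unfolded herm_matrix_measure_def] by (elim conjE allE[of _ "\<lambda>_. {}"]) (simp add: disjoint_family_on_def)
    then have "(\<lambda>_::nat. F {}) \<longlonglongrightarrow> 0" using summable_LIMSEQ_zero[OF sums_summable] by fastforce
    then show ?thesis by (simp add: LIMSEQ_const_iff)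
  qed
  let ?X = "\<lambda>i::nat. if i = 0 then A else if i = 1 then space S - A else {}"
  have "(\<lambda>i. F (?X i)) sums F (\<Union>i. ?X i)"
  proof -
    have "range ?X \<subseteq> sets S" using A by auto
    moreover have "disjoint_family ?X" by (auto simp: disjoint_family_on_def)
    ultimately show ?thesis using F unfolding herm_matrix_measure_def by blast
  qed
  moreover have "(\<lambda>i. F (?X i)) sums (\<Sum>i\<in>{0, 1}. F (?X i))"
    by (rule sums_finite) (auto simp: F0)
  ultimately have "F (\<Union>i. ?X i) = F A + F (space S - A)" using sums_unique2 by fastforce
  moreover have "(\<Union>i. ?X i) = space S"
  proof
    show "(\<Union>i. ?X i) \<subseteq> space S" using sets.sets_into_space[OF A] by auto
    show "space S \<subseteq> (\<Union>i. ?X i)"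
    proof
      fix x assume "x \<in> space S"
      then have "x \<in> ?X 0 \<or> x \<in> ?X 1" by auto
      then show "x \<in> (\<Union>i. ?X i)" by blast
    qed
  qed
  ultimately have "F (space S) = F A + F (space S - A)" by simp
  moreover have "0 \<le> Re (F (space S - A) $ a $ a)"
    by (rule herm_nonneg_def_diag) (use F A in \<open>auto simp: herm_matrix_measure_def\<close>)
  ultimately show ?thesis by simp
qed

text \<open>Off-diagonal entries are complex and not monotone, so they are controlled by the
  diagonal. The uniform bound makes the upper variations of their real and imaginary parts
  finite.\<close>

lemma herm_matrix_measure_bounded:
  assumes F: "herm_matrix_measure S F" and A: "A \<in> sets S"
  shows "cmod (F A $ a $ b) \<le> Re (F (space S) $ a $ a) + Re (F (space S) $ b $ b)"
proof -
  have "herm_nonneg_def (F A)" using F A by (auto simp: herm_matrix_measure_def)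
  then show ?thesis
    using herm_nonneg_def_entry[of "F A" a b] herm_matrix_measure_mono_diag[OF F A, of a] herm_matrix_measure_mono_diag[OF F A, of b]
    by linarith
qed

lemma measurable_iexp_freq: "(\<lambda>l. exp (\<i> * of_int k * complex_of_real l)) \<in> borel_measurable freq"
  by (rule measurable_restrict_space1) measurable

lemma complex_integral_cong_sets:
  assumes "\<And>A. A \<in> sets S \<Longrightarrow> \<nu> A = \<nu>' A" shows "complex_integral S \<nu> g = complex_integral S \<nu>' g"
proof -
  have "upper_variation S \<xi> = upper_variation S \<xi>'" if "\<And>A. A \<in> sets S \<Longrightarrow> \<xi> A = \<xi>' A" for \<xi> \<xi>' :: "'a set \<Rightarrow> real"
    unfolding upper_variation_def by (intro arg_cong2[where f="measure_of (space S)"] refl ext SUP_cong) (auto simp: that)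
  then have "signed_integral S \<xi> g = signed_integral S \<xi>' g" if "\<And>A. A \<in> sets S \<Longrightarrow> \<xi> A = \<xi>' A" for \<xi> \<xi>' :: "'a set \<Rightarrow> real"
    unfolding signed_integral_def using that by (metis (no_types, lifting))
  then show ?thesis unfolding complex_integral_def using assms by (metis (no_types, lifting))
qed

text \<open>The representation is postulated for nonnegative k only. For negative k, Hermitian
  symmetry of the measure makes the moment the conjugate of the opposite moment of the transposed
  entry.\<close>

lemma spectral_moment:
  assumes F: "is_spectral_measure R F"
  shows "complex_integral freq (\<lambda>A. F A $ a $ b) (\<lambda>l. exp (\<i> * of_int k * complex_of_real l))
    = of_real (if 0 \<le> k then R (nat k) $ a $ b else R (nat (- k)) $ b $ a)"
proof -
  have pos: "complex_integral freq (\<lambda>A. F A $ a $ b) (\<lambda>l. exp (\<i> * of_nat k * complex_of_real l)) = of_real (R k $ a $ b)" for k a b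
    using F by (simp add: is_spectral_measure_def matrix_integral_def)
  show ?thesis
  proof (cases "0 \<le> k")
    case True
    then have "(of_int k :: complex) = of_nat (nat k)" by simp
    then show ?thesis using pos[of a b "nat k"] True by simp
  next
    case False
    then have k: "(of_int k :: complex) = - of_nat (nat (- k))" by simp
    have herm: "F A $ a $ b = cnj (F A $ b $ a)" if "A \<in> sets freq" for A
      by (rule herm_nonneg_def_hermitian) (use F that in \<open>auto simp: is_spectral_measure_def herm_matrix_measure_def\<close>)
    have "complex_integral freq (\<lambda>A. F A $ a $ b) (\<lambda>l. exp (\<i> * of_int k * complex_of_real l))
      = complex_integral freq (\<lambda>A. cnj (F A $ b $ a)) (\<lambda>l. cnj (exp (\<i> * of_nat (nat (- k)) * complex_of_real l)))"
      unfolding k by (subst complex_integral_cong_sets[OF herm]) (simp_all add: exp_cnj)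
    also have "\<dots> = of_real (R (nat (- k)) $ b $ a)" unfolding complex_integral_cnj pos by simp
    finally show ?thesis using False by simp
  qed
qed

section \<open>Inverse matrices and positivity of the limit variance\<close>

lemma matrix_inv_eqI:
  fixes A :: "'a::field^'n^'n"
  assumes "A ** B = mat 1" shows "matrix_inv A = B"
proof -
  have BA: "B ** A = mat 1" using assms by (simp add: matrix_left_right_inverse)
  have "A ** matrix_inv A = mat 1 \<and> matrix_inv A ** A = mat 1"
    unfolding matrix_inv_def using assms BA by (intro someI_ex[where P="\<lambda>A'. A ** A' = mat 1 \<and> A' ** A = mat 1"]) blast
  then have "B = B ** (A ** matrix_inv A)" by simp
  then show ?thesis by (simp add: matrix_mul_assoc BA)
qed

text \<open>Cramer's rule exhibits the inverse as a continuous, hence measurable, function of the entries; it is a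
  junk value when the determinant vanishes.\<close>

definition cramer_inv :: "real^'n^'n \<Rightarrow> real^'n^'n" where
  "cramer_inv A = (\<chi> k c. det (\<chi> i j. if j = k then (if i = c then 1 else 0) else A $ i $ j) / det A)"

lemma cramer_inv:
  fixes A :: "real^'n^'n"
  assumes "det A \<noteq> 0" shows "A ** cramer_inv A = mat 1"
proof -
  have "(A ** cramer_inv A) $ i $ c = mat 1 $ i $ c" for i c
  proof -
    let ?b = "\<chi> i. if i = c then 1 else 0 :: real^'n"
    let ?x = "\<chi> k. det (\<chi> i j. if j = k then ?b $ i else A $ i $ j) / det A"
    have "A *v ?x = ?b" using cramer[OF assms, of ?x ?b] by blast
    from arg_cong[OF this, of "\<lambda>v. v $ i"] show ?thesis
      unfolding matrix_vector_mult_def matrix_matrix_mult_def cramer_inv_def mat_def vec_lambda_beta .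
  qed
  then show ?thesis by (simp add: vec_eq_iff)
qed

lemma matrix_inv_eq_cramer_inv: "det A \<noteq> 0 \<Longrightarrow> matrix_inv A = cramer_inv A"
  by (rule matrix_inv_eqI[OF cramer_inv])

lemma tendsto_det:
  fixes A :: "'i \<Rightarrow> real^'n^'n"
  assumes "\<And>i j. ((\<lambda>n. A n $ i $ j) \<longlongrightarrow> L $ i $ j) G" shows "((\<lambda>n. det (A n)) \<longlongrightarrow> det L) G"
  unfolding det_def by (intro tendsto_sum tendsto_mult tendsto_const tendsto_prod assms)

lemma tendsto_cramer_inv:
  fixes A :: "'i \<Rightarrow> real^'n^'n"
  assumes A: "\<And>i j. ((\<lambda>n. A n $ i $ j) \<longlongrightarrow> L $ i $ j) G" and L: "det L \<noteq> 0"
  shows "((\<lambda>n. cramer_inv (A n) $ k $ c) \<longlongrightarrow> cramer_inv L $ k $ c) G"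
  unfolding cramer_inv_def vec_lambda_beta
  by (intro tendsto_divide tendsto_det L) (auto intro: A)

lemma pos_def_invertible:
  fixes A :: "real^'n^'n"
  assumes "pos_def A" shows "det A \<noteq> 0"
proof -
  have "v = 0" if "A *v v = 0" for v using assms that unfolding pos_def_def by (metis inner_zero_right less_irrefl)
  then have "inj ((*v) A)"
    by (intro injI) (metis eq_iff_diff_eq_0 matrix_vector_mult_diff_distrib)
  then obtain B where "B ** A = mat 1" using matrix_left_invertible_injective by blast
  then show ?thesis using invertible_left_inverse invertible_det_nz by blast
qed

lemma matrix_inv_symmetric:
  fixes A :: "real^'n^'n"
  assumes "transpose A = A" "det A \<noteq> 0" shows "matrix_inv A $ a $ b = matrix_inv A $ b $ a"
proof -
  let ?W = "cramer_inv A"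
  have "?W ** A = mat 1" using cramer_inv[OF assms(2)] by (simp add: matrix_left_right_inverse)
  then have "transpose (?W ** A) = mat 1" by (simp add: transpose_mat)
  then have "A ** transpose ?W = mat 1" by (simp add: matrix_transpose_mul assms(1))
  then have "matrix_inv A = transpose ?W" by (rule matrix_inv_eqI)
  then have "?W = transpose ?W" by (simp add: matrix_inv_eq_cramer_inv[OF assms(2)])
  then have "?W $ a $ b = transpose ?W $ a $ b" by simp
  then show ?thesis by (simp add: transpose_def matrix_inv_eq_cramer_inv[OF assms(2)])
qed

lemma cmod_exp_i_real: "cmod (exp (\<i> * of_int k * complex_of_real l)) = 1"
proof -
  have "exp (\<i> * of_int k * complex_of_real l) = exp (\<i> * complex_of_real (of_int k * l))" by (simp add: mult.assoc)
  then show ?thesis by (simp only: norm_exp_i_times)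
qed

text \<open>Here F = R(0)/(2 pi), so each factor F^(-1) contributes 2 pi. These cancel the 1/(2 pi)
  in G and the one in the spectral density, and the entry (j, j) of F^(-1) G F^(-1) is the series in
  \<gamma> and r. Positivity follows by testing the Hermitian form on the j-th axis vector.\<close>

lemma spectral_variance_pos:
  fixes R :: "nat \<Rightarrow> real^'p^'p" and \<gamma> :: "int \<Rightarrow> real" and j :: 'p
  defines "W \<equiv> matrix_inv (R 0)"
  defines "r \<equiv> \<lambda>k. \<Sum>a\<in>UNIV. \<Sum>b\<in>UNIV. W $ a $ j * W $ b $ j * R k $ a $ b"
  assumes F: "is_spectral_measure R F" and R0: "pos_def (R 0)" and \<gamma>: "(\<lambda>k. \<bar>\<gamma> k\<bar>) summable_on UNIV"
    and rC: "\<And>k. \<bar>r k\<bar> \<le> C"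
    and pos: "herm_pos_def (asymp_cov (spectral_density \<gamma>) F)"
  shows "0 < (\<Sum>\<^sub>\<infinity>k\<in>UNIV. \<gamma> k * r (nat \<bar>k\<bar>))"
proof -
  have det: "det (R 0) \<noteq> 0" by (rule pos_def_invertible[OF R0])
  have sym: "W $ a $ b = W $ b $ a" for a b
    unfolding W_def using R0 det by (intro matrix_inv_symmetric) (auto simp: pos_def_def)
  let ?e = "\<lambda>k l. exp (\<i> * of_int k * complex_of_real l)"
  define E where "E a b k = complex_integral freq (\<lambda>A. F A $ a $ b) (?e k)" for a b k
  have hm: "herm_matrix_measure freq F" using F by (simp add: is_spectral_measure_def)
  have sF: "spectral_F F $ a $ b = of_real (R 0 $ a $ b / (2 * pi))" for a b
    using spectral_moment[OF F, of a b 0] unfolding spectral_F_def vector_scaleR_component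
    by (simp add: matrix_integral_def scaleR_conv_of_real)
  have inv: "matrix_inv (spectral_F F) = (\<chi> a b. of_real (2 * pi * W $ a $ b))"
  proof (rule matrix_inv_eqI)
    have "R 0 ** W = mat 1" unfolding W_def matrix_inv_eq_cramer_inv[OF det] by (rule cramer_inv[OF det])
    from arg_cong[OF this, of "\<lambda>A. A $ _ $ _"] have RW: "(\<Sum>k\<in>UNIV. R 0 $ a $ k * W $ k $ b) = (if a = b then 1 else 0)" for a b
      by (simp only: matrix_matrix_mult_def mat_def vec_lambda_beta)
    have "(spectral_F F ** (\<chi> a b. of_real (2 * pi * W $ a $ b))) $ a $ b = of_real (\<Sum>k\<in>UNIV. R 0 $ a $ k * W $ k $ b)" for a b
      by (simp add: matrix_matrix_mult_def sF)
    then show "spectral_F F ** (\<chi> a b. of_real (2 * pi * W $ a $ b)) = mat 1"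
      unfolding RW by (simp add: vec_eq_iff mat_def)
  qed
  have dens: "spectral_density \<gamma> l = (\<Sum>\<^sub>\<infinity>k\<in>UNIV. of_real (\<gamma> k / (2 * pi)) * ?e k l)" for l
    unfolding spectral_density_def infsum_cmult_right'[symmetric] by (simp add: mult_ac)
  have G: "(\<lambda>n. \<Sum>k\<in>{- int n..int n}. of_real (\<gamma> k / (2 * pi)) * E a b k) \<longlonglongrightarrow> complex_integral freq (\<lambda>A. F A $ a $ b) (spectral_density \<gamma>)" for a b
    unfolding dens[abs_def] E_def
  proof (rule complex_integral_series_tendsto)
    show "cmod (F A $ a $ b) \<le> Re (F (space freq) $ a $ a) + Re (F (space freq) $ b $ b)" if "A \<in> sets freq" for A
      by (rule herm_matrix_measure_bounded[OF hm that])
    show "(\<lambda>k. cmod (complex_of_real (\<gamma> k / (2 * pi)))) summable_on UNIV"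
      using summable_on_cmult_left[OF \<gamma>, of "1 / (2 * pi)"] by (simp add: norm_divide)
  qed (simp_all add: measurable_iexp_freq cmod_exp_i_real)
  let ?A = "asymp_cov (spectral_density \<gamma>) F"
  have entry: "?A $ j $ j = (\<Sum>a\<in>UNIV. \<Sum>b\<in>UNIV. of_real (2 * pi * W $ a $ j * W $ b $ j) * complex_integral freq (\<lambda>A. F A $ a $ b) (spectral_density \<gamma>))"
  proof -
    let ?g = "\<lambda>a b. complex_integral freq (\<lambda>A. F A $ a $ b) (spectral_density \<gamma>)"
    have Gc: "spectral_G (spectral_density \<gamma>) F $ a $ b = of_real (1 / (2 * pi)) * ?g a b" for a b
      unfolding spectral_G_def vector_scaleR_component by (simp add: matrix_integral_def scaleR_conv_of_real)
    have "?A $ j $ j = (\<Sum>b\<in>UNIV. (\<Sum>a\<in>UNIV. of_real (2 * pi * W $ j $ a) * (of_real (1 / (2 * pi)) * ?g a b)) * of_real (2 * pi * W $ b $ j))"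
      unfolding asymp_cov_def inv matrix_matrix_mult_def vec_lambda_beta Gc ..
    also have "\<dots> = (\<Sum>b\<in>UNIV. \<Sum>a\<in>UNIV. of_real (2 * pi * W $ a $ j * W $ b $ j) * ?g a b)"
      unfolding sum_distrib_right by (intro sum.cong refl) (simp add: sym[of j])
    also have "\<dots> = (\<Sum>a\<in>UNIV. \<Sum>b\<in>UNIV. of_real (2 * pi * W $ a $ j * W $ b $ j) * ?g a b)" by (rule sum.swap)
    finally show ?thesis .
  qed
  have "(\<lambda>n. \<Sum>a\<in>UNIV. \<Sum>b\<in>UNIV. of_real (2 * pi * W $ a $ j * W $ b $ j) * (\<Sum>k\<in>{- int n..int n}. of_real (\<gamma> k / (2 * pi)) * E a b k)) \<longlonglongrightarrow> ?A $ j $ j"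
    unfolding entry by (intro tendsto_sum tendsto_mult tendsto_const G)
  moreover have "(\<Sum>a\<in>UNIV. \<Sum>b\<in>UNIV. of_real (2 * pi * W $ a $ j * W $ b $ j) * (\<Sum>k\<in>{- int n..int n}. of_real (\<gamma> k / (2 * pi)) * E a b k))
     = of_real (\<Sum>k\<in>{- int n..int n}. \<gamma> k * r (nat \<bar>k\<bar>))" for n
  proof -
    have "(\<Sum>a\<in>UNIV. \<Sum>b\<in>UNIV. of_real (2 * pi * W $ a $ j * W $ b $ j) * (\<Sum>k\<in>{- int n..int n}. of_real (\<gamma> k / (2 * pi)) * E a b k))
      = (\<Sum>a\<in>UNIV. \<Sum>b\<in>UNIV. \<Sum>k\<in>{- int n..int n}. of_real (\<gamma> k) * (of_real (W $ a $ j * W $ b $ j) * E a b k))"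
      unfolding sum_distrib_left by (intro sum.cong refl) simp
    also have "\<dots> = (\<Sum>a\<in>UNIV. \<Sum>k\<in>{- int n..int n}. \<Sum>b\<in>UNIV. of_real (\<gamma> k) * (of_real (W $ a $ j * W $ b $ j) * E a b k))"
      by (intro sum.cong refl sum.swap)
    also have "\<dots> = (\<Sum>k\<in>{- int n..int n}. \<Sum>a\<in>UNIV. \<Sum>b\<in>UNIV. of_real (\<gamma> k) * (of_real (W $ a $ j * W $ b $ j) * E a b k))"
      by (rule sum.swap)
    also have "\<dots> = (\<Sum>k\<in>{- int n..int n}. of_real (\<gamma> k * r (nat \<bar>k\<bar>)))"
    proof (rule sum.cong[OF refl])
      fix k
      have "(\<Sum>a\<in>UNIV. \<Sum>b\<in>UNIV. of_real (W $ a $ j * W $ b $ j) * E a b k) = complex_of_real (r (nat \<bar>k\<bar>))"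
      proof (cases "0 \<le> k")
        case True
        then show ?thesis unfolding E_def spectral_moment[OF F] by (simp add: r_def)
      next
        case False
        then have "(\<Sum>a\<in>UNIV. \<Sum>b\<in>UNIV. of_real (W $ a $ j * W $ b $ j) * E a b k)
          = complex_of_real (\<Sum>a\<in>UNIV. \<Sum>b\<in>UNIV. W $ a $ j * W $ b $ j * R (nat (- k)) $ b $ a)"
          unfolding E_def spectral_moment[OF F] by simp
        \<comment> \<open>Negative lags bring the transposed entry; summing over both indices with
          symmetric coefficients undoes the transposition.\<close>
        also have "(\<Sum>a\<in>UNIV. \<Sum>b\<in>UNIV. W $ a $ j * W $ b $ j * R (nat (- k)) $ b $ a) = (\<Sum>b\<in>UNIV. \<Sum>a\<in>UNIV. W $ a $ j * W $ b $ j * R (nat (- k)) $ b $ a)"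
          by (rule sum.swap)
        also have "\<dots> = r (nat \<bar>k\<bar>)" using False by (simp add: r_def mult_ac)
        finally show ?thesis .
      qed
      then show "(\<Sum>a\<in>UNIV. \<Sum>b\<in>UNIV. of_real (\<gamma> k) * (of_real (W $ a $ j * W $ b $ j) * E a b k)) = complex_of_real (\<gamma> k * r (nat \<bar>k\<bar>))"
        unfolding sum_distrib_left[symmetric] by simp
    qed
    finally show ?thesis by simp
  qed
  ultimately have lim: "(\<lambda>n. complex_of_real (\<Sum>k\<in>{- int n..int n}. \<gamma> k * r (nat \<bar>k\<bar>))) \<longlonglongrightarrow> ?A $ j $ j" by simp
  have "(\<lambda>k. \<gamma> k * r (nat \<bar>k\<bar>)) summable_on UNIV"
  proof (rule abs_summable_summable, rule summable_on_comparison_test[OF summable_on_cmult_left[OF \<gamma>, of C]])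
    show "norm (\<gamma> k * r (nat \<bar>k\<bar>)) \<le> \<bar>\<gamma> k\<bar> * C" for k using rC[of "nat \<bar>k\<bar>"] by (simp add: abs_mult mult_left_mono)
  qed simp
  from tendsto_of_real[OF sum_int_tendsto_infsum[OF this]]
  have "?A $ j $ j = of_real (\<Sum>\<^sub>\<infinity>k\<in>UNIV. \<gamma> k * r (nat \<bar>k\<bar>))" using LIMSEQ_unique[OF lim] by blast
  moreover have "0 < Re (herm_form ?A (axis j 1))" using pos by (auto simp: herm_pos_def_def axis_eq_0_iff)
  ultimately show ?thesis by (simp add: herm_form_axis)
qed

section \<open>Least squares as weighted sums of the noise\<close>

text \<open>\<open>weight x c n\<close> is column \<open>c\<close> of \<open>X(X\<^sup>tX)\<^sup>-\<^sup>1D(n)\<close>, extended by zero to all integers, and \<open>noise_fit\<close> is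
  \<open>X(X\<^sup>tX)\<^sup>-\<^sup>1X\<^sup>te\<close>, the fitted value of the noise. The residuals are \<open>e - noise_fit x n e\<close>.\<close>

definition weight :: "(nat \<Rightarrow> real^'p) \<Rightarrow> 'p \<Rightarrow> nat \<Rightarrow> int \<Rightarrow> real" where
  "weight x c n i = (if i \<in> {1..int n} then (\<Sum>a\<in>UNIV. x (nat i) $ a * cramer_inv (gram x n) $ a $ c) * col_norm x c n else 0)"

definition noise_fit :: "(nat \<Rightarrow> real^'p) \<Rightarrow> nat \<Rightarrow> (int \<Rightarrow> real) \<Rightarrow> int \<Rightarrow> real" where
  "noise_fit x n e i = (\<Sum>c\<in>UNIV. weight x c n i * (\<Sum>m\<in>{1..int n}. (x (nat m) $ c / col_norm x c n) * e m))"

lemma sum_nat_int: "(\<Sum>i=1..n. f (int i)) = (\<Sum>i\<in>{1..int n}. f i)"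
proof -
  have "{1..int n} = int ` {1..n}" by (simp add: image_int_atLeastAtMost)
  then show ?thesis by (simp only:) (subst sum.reindex, auto)
qed

lemma col_norm_sq: "(col_norm x c n)\<^sup>2 = (\<Sum>i=1..n. (x i $ c)\<^sup>2)"
  by (simp add: col_norm_def sum_nonneg)

lemma gram_sym: "gram x n $ a $ b = gram x n $ b $ a"
  by (simp add: gram_def mult.commute)

lemma gram_transpose: "transpose (gram x n) = gram x n"
  using gram_sym[of x n] by (simp add: transpose_def vec_eq_iff)

lemma cramer_inv_gram_sym: "det (gram x n) \<noteq> 0 \<Longrightarrow> cramer_inv (gram x n) $ a $ b = cramer_inv (gram x n) $ b $ a"
  using matrix_inv_symmetric[OF gram_transpose, of x n a b] by (simp add: matrix_inv_eq_cramer_inv)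

lemma lse_response:
  fixes x :: "nat \<Rightarrow> real^'p"
  assumes det: "det (gram x n) \<noteq> 0"
  shows "lse x (response x \<beta> e) n $ c = \<beta> $ c + (\<Sum>a\<in>UNIV. cramer_inv (gram x n) $ c $ a * (\<Sum>i=1..n. x i $ a * e (int i)))"
proof -
  let ?W = "cramer_inv (gram x n)"
  let ?s = "\<chi> a. \<Sum>i=1..n. x i $ a * e (int i)"
  have "(\<Sum>i=1..n. x i $ a * response x \<beta> e i) = (gram x n *v \<beta> + ?s) $ a" for a
  proof -
    have "(\<Sum>i=1..n. x i $ a * (x i \<bullet> \<beta>)) = (\<Sum>i=1..n. \<Sum>b\<in>UNIV. x i $ a * x i $ b * \<beta> $ b)"
      by (simp add: inner_vec_def sum_distrib_left mult.assoc)
    also have "\<dots> = (\<Sum>b\<in>UNIV. \<Sum>i=1..n. x i $ a * x i $ b * \<beta> $ b)" by (rule sum.swap)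
    also have "\<dots> = (gram x n *v \<beta>) $ a" by (simp add: matrix_vector_mult_def gram_def sum_distrib_right)
    finally show ?thesis by (simp add: response_def distrib_left sum.distrib)
  qed
  then have "(\<chi> a. \<Sum>i=1..n. x i $ a * response x \<beta> e i) = gram x n *v \<beta> + ?s" by (simp add: vec_eq_iff)
  then have "lse x (response x \<beta> e) n = ?W *v (gram x n *v \<beta> + ?s)"
    by (simp add: lse_def matrix_inv_eq_cramer_inv[OF det])
  also have "\<dots> = (?W ** gram x n) *v \<beta> + ?W *v ?s" by (simp add: matrix_vector_right_distrib matrix_vector_mul_assoc)
  also have "?W ** gram x n = mat 1" using cramer_inv[OF det] by (simp add: matrix_left_right_inverse)
  finally have e: "lse x (response x \<beta> e) n = mat 1 *v \<beta> + ?W *v ?s" .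
  show ?thesis unfolding e matrix_vector_mul_lid by (simp add: matrix_vector_mult_def)
qed

lemma normalized_lse:
  fixes x :: "nat \<Rightarrow> real^'p"
  assumes det: "det (gram x n) \<noteq> 0" and "\<beta> $ j = 0"
  shows "col_norm x j n * lse x (response x \<beta> e) n $ j = (\<Sum>i\<in>{1..int n}. weight x j n i * e i)"
proof -
  let ?W = "cramer_inv (gram x n)"
  have "col_norm x j n * lse x (response x \<beta> e) n $ j = (\<Sum>a\<in>UNIV. \<Sum>i=1..n. (x i $ a * ?W $ a $ j * col_norm x j n) * e (int i))"
    unfolding lse_response[OF det] assms(2)
    by (simp add: sum_distrib_left cramer_inv_gram_sym[OF det, of j] mult_ac)
  also have "\<dots> = (\<Sum>i=1..n. \<Sum>a\<in>UNIV. (x i $ a * ?W $ a $ j * col_norm x j n) * e (int i))" by (rule sum.swap)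
  also have "\<dots> = (\<Sum>i=1..n. weight x j n (int i) * e (int i))"
    by (intro sum.cong refl) (simp add: weight_def sum_distrib_right)
  also have "\<dots> = (\<Sum>i\<in>{1..int n}. weight x j n i * e i)" by (rule sum_nat_int)
  finally show ?thesis .
qed

lemma residual_eq:
  fixes x :: "nat \<Rightarrow> real^'p"
  assumes det: "det (gram x n) \<noteq> 0" and d: "\<And>c. col_norm x c n \<noteq> 0" and i: "i \<in> {1..n}"
  shows "residual x (response x \<beta> e) n i = e (int i) - noise_fit x n e (int i)"
proof -
  let ?W = "cramer_inv (gram x n)"
  have "x i \<bullet> lse x (response x \<beta> e) n = x i \<bullet> \<beta> + (\<Sum>a\<in>UNIV. \<Sum>c\<in>UNIV. x i $ a * ?W $ a $ c * (\<Sum>m=1..n. x m $ c * e (int m)))"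
    unfolding inner_vec_def lse_response[OF det] by (simp add: distrib_left sum.distrib sum_distrib_left mult_ac)
  also have "(\<Sum>a\<in>UNIV. \<Sum>c\<in>UNIV. x i $ a * ?W $ a $ c * (\<Sum>m=1..n. x m $ c * e (int m))) = (\<Sum>c\<in>UNIV. \<Sum>a\<in>UNIV. x i $ a * ?W $ a $ c * (\<Sum>m=1..n. x m $ c * e (int m)))"
    by (rule sum.swap)
  also have "\<dots> = noise_fit x n e (int i)"
    unfolding noise_fit_def
  proof (intro sum.cong refl)
    fix c
    have s: "(\<Sum>m\<in>{1..int n}. (x (nat m) $ c / col_norm x c n) * e m) = (\<Sum>m=1..n. x m $ c * e (int m)) / col_norm x c n"
      unfolding sum_nat_int[symmetric] by (simp add: sum_divide_distrib)
    show "(\<Sum>a\<in>UNIV. x i $ a * ?W $ a $ c * (\<Sum>m=1..n. x m $ c * e (int m))) = weight x c n (int i) * (\<Sum>m\<in>{1..int n}. (x (nat m) $ c / col_norm x c n) * e m)"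
      unfolding s sum_distrib_right[symmetric] using i d[of c] by (simp add: weight_def)
  qed
  finally show ?thesis by (simp add: residual_def response_def[of x \<beta> e i])
qed

lemma residual_autocov_eq:
  fixes x :: "nat \<Rightarrow> real^'p"
  assumes y: "\<And>i. i \<in> {1..n} \<Longrightarrow> residual x y n i = e (int i)" and e0: "\<And>i. i \<notin> {1..int n} \<Longrightarrow> e i = 0"
  shows "residual_autocov x y n k = (1 / real n) * acorr e n k"
proof -
  let ?k = "nat \<bar>k\<bar>"
  have "acorr e n (int ?k) = (\<Sum>i=1..n. e (int i) * e (int i + int ?k))"
    unfolding acorr_def by (rule sum_nat_int[symmetric])
  also have "\<dots> = (\<Sum>i=1..n - ?k. e (int i) * e (int i + int ?k))"
  proof (rule sum.mono_neutral_right)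
    show "\<forall>i\<in>{1..n} - {1..n - ?k}. e (int i) * e (int i + int ?k) = 0"
    proof
      fix i assume "i \<in> {1..n} - {1..n - ?k}"
      then have "int i + int ?k \<notin> {1..int n}" by (auto simp del: int_nat_eq nat_0_le)
      then show "e (int i) * e (int i + int ?k) = 0" using e0 by simp
    qed
  qed auto
  also have "\<dots> = (\<Sum>i=1..n - ?k. residual x y n i * residual x y n (i + ?k))"
    by (intro sum.cong refl) (auto simp: y)
  finally show ?thesis using acorr_abs[where z=e and n=n and k=k, OF e0] by (simp add: residual_autocov_def)
qed

lemma cov_estimator_eq:
  fixes x :: "nat \<Rightarrow> real^'p"
  assumes det: "det (gram x n) \<noteq> 0" and y: "\<And>i. i \<in> {1..n} \<Longrightarrow> residual x y n i = e (int i)"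
  shows "cov_estimator K h x y n $ j $ j
    = quad n (\<lambda>k. K (real_of_int k / h) * acorr (weight x j n) n k) e e"
proof -
  let ?W = "cramer_inv (gram x n)" and ?d = "col_norm x j n"
  define e' where "e' i = (if i \<in> {1..int n} then e i else 0)" for i
  have e0: "e' i = 0" if "i \<notin> {1..int n}" for i using that unfolding e'_def by (rule if_not_P)
  have w0: "weight x j n i = 0" if "i \<notin> {1..int n}" for i using that unfolding weight_def by (rule if_not_P)
  define t where "t k = K (real_of_int k / h) * ((1 / real n) * acorr e' n k)" for k
  have tap: "tapered_cov K h x y n i m = t (int i - int m)" for i m
    unfolding tapered_cov_def t_def by (subst residual_autocov_eq[where e=e']) (auto simp: y e'_def)
  let ?M = "\<lambda>a b. \<Sum>i=1..n. \<Sum>m=1..n. x i $ a * t (int i - int m) * x m $ b"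
  have diag1: "(col_norm_mat x n ** A) $ j $ b = ?d * A $ j $ b" for A b
    by (simp add: matrix_matrix_mult_def col_norm_mat_def if_distrib[where f="\<lambda>z. z * _"] sum.delta cong: if_cong)
  have diag2: "(A ** col_norm_mat x n) $ j $ j = A $ j $ j * ?d" for A
    by (simp add: matrix_matrix_mult_def col_norm_mat_def if_distrib[where f="\<lambda>z. _ * z"] sum.delta' cong: if_cong)
  have mm: "(A ** B) $ a $ b = (\<Sum>k\<in>UNIV. A $ a $ k * B $ k $ b)" for A B :: "real^'p^'p" and a b
    by (simp add: matrix_matrix_mult_def)
  have e1: "(col_norm_mat x n ** ?W ** (\<chi> a b. ?M a b) ** ?W) $ j $ j = (\<Sum>b\<in>UNIV. (col_norm_mat x n ** ?W ** (\<chi> a b. ?M a b)) $ j $ b * ?W $ b $ j)"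
    by (rule mm)
  have e2: "(col_norm_mat x n ** ?W ** (\<chi> a b. ?M a b)) $ j $ b = (\<Sum>a\<in>UNIV. (col_norm_mat x n ** ?W) $ j $ a * (\<chi> a b. ?M a b) $ a $ b)" for b
    by (rule mm)
  have "cov_estimator K h x y n $ j $ j = (\<Sum>b\<in>UNIV. (\<Sum>a\<in>UNIV. ?d * ?W $ j $ a * ?M a b) * ?W $ b $ j) * ?d"
    unfolding cov_estimator_def tap diag2 matrix_inv_eq_cramer_inv[OF det] e1 e2 diag1 by simp
  also have "\<dots> = (\<Sum>b\<in>UNIV. \<Sum>a\<in>UNIV. \<Sum>i=1..n. \<Sum>m=1..n. (x i $ a * ?W $ a $ j * ?d) * (x m $ b * ?W $ b $ j * ?d) * t (int i - int m))"
    unfolding sum_distrib_right sum_distrib_left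
    by (intro sum.cong refl) (simp only: cramer_inv_gram_sym[OF det, of j] mult_ac)
  also have "\<dots> = (\<Sum>b\<in>UNIV. \<Sum>i=1..n. \<Sum>a\<in>UNIV. \<Sum>m=1..n. (x i $ a * ?W $ a $ j * ?d) * (x m $ b * ?W $ b $ j * ?d) * t (int i - int m))"
    by (intro sum.cong refl sum.swap)
  also have "\<dots> = (\<Sum>i=1..n. \<Sum>b\<in>UNIV. \<Sum>a\<in>UNIV. \<Sum>m=1..n. (x i $ a * ?W $ a $ j * ?d) * (x m $ b * ?W $ b $ j * ?d) * t (int i - int m))"
    by (rule sum.swap)
  also have "\<dots> = (\<Sum>i=1..n. \<Sum>b\<in>UNIV. \<Sum>m=1..n. \<Sum>a\<in>UNIV. (x i $ a * ?W $ a $ j * ?d) * (x m $ b * ?W $ b $ j * ?d) * t (int i - int m))"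
    by (intro sum.cong refl sum.swap)
  also have "\<dots> = (\<Sum>i=1..n. \<Sum>m=1..n. \<Sum>b\<in>UNIV. \<Sum>a\<in>UNIV. (x i $ a * ?W $ a $ j * ?d) * (x m $ b * ?W $ b $ j * ?d) * t (int i - int m))"
    by (intro sum.cong refl sum.swap)
  also have "\<dots> = (\<Sum>i=1..n. \<Sum>m=1..n. weight x j n (int i) * weight x j n (int m) * t (int i - int m))"
  proof (intro sum.cong refl)
    fix i m assume im: "i \<in> {1..n}" "m \<in> {1..n}"
    have "weight x j n (int i) * weight x j n (int m) = (\<Sum>a\<in>UNIV. x i $ a * ?W $ a $ j * ?d) * (\<Sum>b\<in>UNIV. x m $ b * ?W $ b $ j * ?d)"
      using im by (simp add: weight_def sum_distrib_right)
    also have "\<dots> = (\<Sum>a\<in>UNIV. \<Sum>b\<in>UNIV. (x i $ a * ?W $ a $ j * ?d) * (x m $ b * ?W $ b $ j * ?d))" by (rule sum_product)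
    also have "\<dots> = (\<Sum>b\<in>UNIV. \<Sum>a\<in>UNIV. (x i $ a * ?W $ a $ j * ?d) * (x m $ b * ?W $ b $ j * ?d))" by (rule sum.swap)
    finally show "(\<Sum>b\<in>UNIV. \<Sum>a\<in>UNIV. (x i $ a * ?W $ a $ j * ?d) * (x m $ b * ?W $ b $ j * ?d) * t (int i - int m)) = weight x j n (int i) * weight x j n (int m) * t (int i - int m)"
      by (simp only: sum_distrib_right)
  qed
  also have "\<dots> = (\<Sum>i=1..n. \<Sum>m\<in>{1..int n}. weight x j n (int i) * weight x j n m * t (int i - m))"
    by (intro sum.cong refl sum_nat_int[where f="\<lambda>m. weight x j n (int _) * weight x j n m * t (int _ - m)"])
  also have "\<dots> = (\<Sum>i\<in>{1..int n}. \<Sum>m\<in>{1..int n}. weight x j n i * weight x j n m * t (i - m))"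
    by (rule sum_nat_int[where f="\<lambda>i. \<Sum>m\<in>{1..int n}. weight x j n i * weight x j n m * t (i - m)"])
  also have "\<dots> = (\<Sum>k\<in>{- int n..int n}. t k * acorr (weight x j n) n k)" by (rule toeplitz_sum[OF w0])
  also have "\<dots> = (1 / real n) * (\<Sum>k\<in>{- int n..int n}. (K (real_of_int k / h) * acorr (weight x j n) n k) * acorr e' n k)"
    unfolding sum_distrib_left by (intro sum.cong refl) (simp add: t_def mult_ac)
  also have "(\<Sum>k\<in>{- int n..int n}. (K (real_of_int k / h) * acorr (weight x j n) n k) * acorr e' n k)
    = (\<Sum>i\<in>{1..int n}. \<Sum>m\<in>{1..int n}. e' i * e' m * (K (real_of_int (i - m) / h) * acorr (weight x j n) n (i - m)))"
    by (rule toeplitz_sum[OF e0, symmetric])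
  also have "\<dots> = (\<Sum>i\<in>{1..int n}. \<Sum>m\<in>{1..int n}. (K (real_of_int (i - m) / h) * acorr (weight x j n) n (i - m)) * (e i * e m))"
    by (intro sum.cong refl) (simp add: e'_def mult_ac)
  finally show ?thesis by (simp add: quad_def)
qed

section \<open>Deterministic designs\<close>

locale good_design =
  fixes x :: "nat \<Rightarrow> real^'p"
  assumes norm_top: "filterlim (col_norm x a) at_top sequentially"
    and lindeberg: "(\<lambda>n. (SUP i\<in>{1..n}. \<bar>x i $ a\<bar>) / col_norm x a n) \<longlonglongrightarrow> 0"
    and corr_convergent: "convergent (cross_corr x k a b)"
    and limit_pos_def: "pos_def (limit_corr x 0)"
begin

abbreviation "R \<equiv> limit_corr x"

definition Rn :: "nat \<Rightarrow> real^'p^'p" where "Rn n = (\<chi> a b. cross_corr x 0 a b n)"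

definition Wn :: "nat \<Rightarrow> real^'p^'p" where
  "Wn n = (\<chi> a c. col_norm x a n * cramer_inv (gram x n) $ a $ c * col_norm x c n)"

definition regular :: "nat \<Rightarrow> bool" where
  "regular n \<longleftrightarrow> (\<forall>a. 0 < col_norm x a n) \<and> det (Rn n) \<noteq> 0"

lemma corr_tendsto: "(\<lambda>n. cross_corr x k a b n) \<longlonglongrightarrow> R k $ a $ b"
  using corr_convergent[of k a b] by (simp add: limit_corr_def convergent_LIMSEQ_iff)

lemma det_R: "det (R 0) \<noteq> 0"
  by (rule pos_def_invertible[OF limit_pos_def])

lemma eventually_regular: "\<forall>\<^sub>F n in sequentially. regular n"
proof -
  have "\<forall>\<^sub>F n in sequentially. \<forall>a. 0 < col_norm x a n"
    by (rule eventually_all_finite) (use norm_top in \<open>auto simp: filterlim_at_top_dense\<close>)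
  moreover have "(\<lambda>n. det (Rn n)) \<longlonglongrightarrow> det (R 0)"
    by (rule tendsto_det) (simp add: Rn_def corr_tendsto)
  then have "\<forall>\<^sub>F n in sequentially. det (Rn n) \<noteq> 0" using det_R by (rule tendsto_imp_eventually_ne)
  ultimately show ?thesis by eventually_elim (simp add: regular_def)
qed

lemma regular_gram:
  assumes n: "regular n"
  shows "det (gram x n) \<noteq> 0" "Wn n = cramer_inv (Rn n)"
proof -
  let ?d = "\<lambda>a. col_norm x a n"
  let ?V = "cramer_inv (Rn n)"
  have d: "?d a \<noteq> 0" for a using n by (metis regular_def less_irrefl)
  define B where "B = (\<chi> b c. ?V $ b $ c / (?d b * ?d c))"
  have RV: "(\<Sum>b\<in>UNIV. Rn n $ a $ b * ?V $ b $ c) = (if a = c then 1 else 0)" for a c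
  proof -
    have "Rn n ** ?V = mat 1" using n by (intro cramer_inv) (simp add: regular_def)
    from arg_cong[OF this, of "\<lambda>A. A $ a $ c"] show ?thesis unfolding matrix_matrix_mult_def mat_def vec_lambda_beta .
  qed
  have g: "gram x n $ a $ b = ?d a * Rn n $ a $ b * ?d b" for a b
  proof -
    have "Rn n $ a $ b = gram x n $ a $ b / (?d a * ?d b)"
      by (simp add: Rn_def cross_corr_def gram_def sum_divide_distrib)
    then show ?thesis using d by simp
  qed
  have "(gram x n ** B) $ a $ c = mat 1 $ a $ c" for a c
  proof -
    have "(gram x n ** B) $ a $ c = (\<Sum>b\<in>UNIV. (?d a / ?d c) * (Rn n $ a $ b * ?V $ b $ c))"
      unfolding matrix_matrix_mult_def vec_lambda_beta B_def g using d by (intro sum.cong refl) (simp add: field_simps)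
    also have "\<dots> = (?d a / ?d c) * (if a = c then 1 else 0)" unfolding sum_distrib_left[symmetric] RV ..
    also have "\<dots> = mat 1 $ a $ c" using d by (simp add: mat_def)
    finally show ?thesis .
  qed
  then have B: "gram x n ** B = mat 1" by (simp add: vec_eq_iff)
  then show det: "det (gram x n) \<noteq> 0" using invertible_right_inverse invertible_det_nz by blast
  have "cramer_inv (gram x n) = B" using matrix_inv_eqI[OF B] by (simp add: matrix_inv_eq_cramer_inv[OF det])
  then show "Wn n = ?V" using d by (simp add: Wn_def B_def vec_eq_iff)
qed

definition W :: "real^'p^'p" where "W = matrix_inv (R 0)"

lemma Wn_tendsto: "(\<lambda>n. Wn n $ a $ c) \<longlonglongrightarrow> W $ a $ c"
proof -
  have "(\<lambda>n. cramer_inv (Rn n) $ a $ c) \<longlonglongrightarrow> W $ a $ c"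
    unfolding W_def matrix_inv_eq_cramer_inv[OF det_R]
    by (rule tendsto_cramer_inv[OF _ det_R]) (simp add: Rn_def corr_tendsto)
  moreover have "\<forall>\<^sub>F n in sequentially. cramer_inv (Rn n) $ a $ c = Wn n $ a $ c"
    using eventually_regular by eventually_elim (simp add: regular_gram)
  ultimately show ?thesis by (rule Lim_transform_eventually)
qed

lemma weight_outside: "i \<notin> {1..int n} \<Longrightarrow> weight x c n i = 0"
  unfolding weight_def by (rule if_not_P)

lemma weight_regular:
  assumes "regular n" "i \<in> {1..int n}"
  shows "weight x c n i = (\<Sum>a\<in>UNIV. (x (nat i) $ a / col_norm x a n) * Wn n $ a $ c)"
proof -
  have d: "col_norm x a n \<noteq> 0" for a using assms(1) by (metis regular_def less_irrefl)
  have "weight x c n i = (\<Sum>a\<in>UNIV. x (nat i) $ a * cramer_inv (gram x n) $ a $ c * col_norm x c n)"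
    using assms(2) by (simp add: weight_def sum_distrib_right)
  also have "\<dots> = (\<Sum>a\<in>UNIV. (x (nat i) $ a / col_norm x a n) * Wn n $ a $ c)"
    using d by (intro sum.cong refl) (simp add: Wn_def)
  finally show ?thesis .
qed

definition r :: "'p \<Rightarrow> nat \<Rightarrow> real" where
  "r c k = (\<Sum>a\<in>UNIV. \<Sum>b\<in>UNIV. W $ a $ c * W $ b $ c * R k $ a $ b)"

lemma acorr_weight_regular:
  assumes n: "regular n"
  shows "acorr (weight x c n) n (int k) = (\<Sum>a\<in>UNIV. \<Sum>b\<in>UNIV. Wn n $ a $ c * Wn n $ b $ c * cross_corr x k a b n)"
proof -
  let ?t = "\<lambda>m a b. Wn n $ a $ c * Wn n $ b $ c * (x m $ a * x (m + k) $ b / (col_norm x a n * col_norm x b n))"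
  have "acorr (weight x c n) n (int k) = (\<Sum>m=1..n. weight x c n (int m) * weight x c n (int m + int k))"
    unfolding acorr_def by (rule sum_nat_int[symmetric])
  also have "\<dots> = (\<Sum>m=1..n - k. weight x c n (int m) * weight x c n (int m + int k))"
  proof (rule sum.mono_neutral_right)
    show "\<forall>m\<in>{1..n} - {1..n - k}. weight x c n (int m) * weight x c n (int m + int k) = 0"
    proof
      fix m assume "m \<in> {1..n} - {1..n - k}"
      then have "int m + int k \<notin> {1..int n}" by auto
      then show "weight x c n (int m) * weight x c n (int m + int k) = 0" by (simp add: weight_outside)
    qed
  qed auto
  also have "\<dots> = (\<Sum>m=1..n - k. \<Sum>a\<in>UNIV. \<Sum>b\<in>UNIV. ?t m a b)"
  proof (rule sum.cong[OF refl])
    fix m assume "m \<in> {1..n - k}"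
    then have m: "int m \<in> {1..int n}" "int m + int k \<in> {1..int n}" by auto
    have nm: "nat (int m + int k) = m + k" by simp
    show "weight x c n (int m) * weight x c n (int m + int k) = (\<Sum>a\<in>UNIV. \<Sum>b\<in>UNIV. ?t m a b)"
      unfolding weight_regular[OF n m(1)] weight_regular[OF n m(2)] nm sum_product
      by (intro sum.cong refl) simp
  qed
  also have "\<dots> = (\<Sum>a\<in>UNIV. \<Sum>m=1..n - k. \<Sum>b\<in>UNIV. ?t m a b)" by (rule sum.swap)
  also have "\<dots> = (\<Sum>a\<in>UNIV. \<Sum>b\<in>UNIV. \<Sum>m=1..n - k. ?t m a b)" by (intro sum.cong refl sum.swap)
  finally show ?thesis by (simp only: cross_corr_def sum_distrib_left)
qed

lemma acorr_weight_tendsto: "(\<lambda>n. acorr (weight x c n) n (int k)) \<longlonglongrightarrow> r c k"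
proof -
  have "(\<lambda>n. \<Sum>a\<in>UNIV. \<Sum>b\<in>UNIV. Wn n $ a $ c * Wn n $ b $ c * cross_corr x k a b n) \<longlonglongrightarrow> r c k"
    unfolding r_def by (intro tendsto_sum tendsto_mult Wn_tendsto corr_tendsto)
  moreover have "\<forall>\<^sub>F n in sequentially. (\<Sum>a\<in>UNIV. \<Sum>b\<in>UNIV. Wn n $ a $ c * Wn n $ b $ c * cross_corr x k a b n) = acorr (weight x c n) n (int k)"
    using eventually_regular by eventually_elim (simp add: acorr_weight_regular)
  ultimately show ?thesis by (rule Lim_transform_eventually)
qed

lemma weight_energy_bounded: "\<exists>C. \<forall>n. (\<Sum>i\<in>{1..int n}. (weight x c n i)\<^sup>2) \<le> C"
proof -
  have "convergent (\<lambda>n. acorr (weight x c n) n 0)" using acorr_weight_tendsto[of c 0] by (auto simp: convergent_def)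
  then obtain C where "\<And>n. norm (acorr (weight x c n) n 0) \<le> C" using convergent_imp_Bseq BseqE by blast
  then have "(\<Sum>i\<in>{1..int n}. (weight x c n i)\<^sup>2) \<le> C" for n
    using abs_le_D1[of "acorr (weight x c n) n 0" C] by (simp add: acorr_def power2_eq_square)
  then show ?thesis by blast
qed

definition max_weight :: "'p \<Rightarrow> nat \<Rightarrow> real" where
  "max_weight c n = Max ((\<lambda>i. \<bar>weight x c n i\<bar>) ` {0..int n})"

lemma weight_le_max: "\<bar>weight x c n i\<bar> \<le> max_weight c n"
proof (cases "i \<in> {0..int n}")
  case True
  then show ?thesis unfolding max_weight_def by (intro Max_ge) auto
next
  case False
  then have "\<bar>weight x c n i\<bar> = \<bar>weight x c n 0\<bar>" by (simp add: weight_outside)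
  also have "\<dots> \<le> max_weight c n" unfolding max_weight_def by (intro Max_ge) auto
  finally show ?thesis .
qed

lemma max_weight_tendsto: "max_weight c \<longlonglongrightarrow> 0"
proof -
  let ?m = "\<lambda>a n. (SUP i\<in>{1..n}. \<bar>x i $ a\<bar>) / col_norm x a n"
  have "(\<lambda>n. \<Sum>a\<in>UNIV. ?m a n * \<bar>Wn n $ a $ c\<bar>) \<longlonglongrightarrow> (\<Sum>a\<in>UNIV. 0 * \<bar>W $ a $ c\<bar>)"
    by (intro tendsto_sum tendsto_mult lindeberg tendsto_rabs Wn_tendsto)
  then have lim: "(\<lambda>n. \<Sum>a\<in>UNIV. ?m a n * \<bar>Wn n $ a $ c\<bar>) \<longlonglongrightarrow> 0" by simp
  have le: "\<forall>\<^sub>F n in sequentially. max_weight c n \<le> (\<Sum>a\<in>UNIV. ?m a n * \<bar>Wn n $ a $ c\<bar>)"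
    using eventually_regular eventually_ge_at_top[of 1]
  proof eventually_elim
    case (elim n)
    have d: "0 < col_norm x a n" for a using elim(1) by (simp add: regular_def)
    have sup: "\<bar>x i $ a\<bar> \<le> (SUP i\<in>{1..n}. \<bar>x i $ a\<bar>)" if "i \<in> {1..n}" for i a
      using that by (intro cSUP_upper) auto
    have m0: "0 \<le> ?m a n" for a using order_trans[OF abs_ge_zero sup[of 1 a]] elim(2) d[of a] by simp
    have "\<bar>weight x c n i\<bar> \<le> (\<Sum>a\<in>UNIV. ?m a n * \<bar>Wn n $ a $ c\<bar>)" for i
    proof (cases "i \<in> {1..int n}")
      case True
      then have i: "nat i \<in> {1..n}" by auto
      have "\<bar>weight x c n i\<bar> \<le> (\<Sum>a\<in>UNIV. \<bar>(x (nat i) $ a / col_norm x a n) * Wn n $ a $ c\<bar>)"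
        unfolding weight_regular[OF elim(1) True] by (rule sum_abs)
      also have "\<dots> \<le> (\<Sum>a\<in>UNIV. ?m a n * \<bar>Wn n $ a $ c\<bar>)"
        unfolding abs_mult abs_divide
      proof (intro sum_mono mult_right_mono)
        fix a
        show "\<bar>x (nat i) $ a\<bar> / \<bar>col_norm x a n\<bar> \<le> ?m a n"
          using divide_right_mono[OF sup[OF i, of a] less_imp_le[OF d[of a]]] d[of a] by simp
      qed simp
      finally show ?thesis .
    next
      case False
      have "0 \<le> (\<Sum>a\<in>UNIV. ?m a n * \<bar>Wn n $ a $ c\<bar>)" by (intro sum_nonneg mult_nonneg_nonneg m0 abs_ge_zero)
      then show ?thesis unfolding weight_outside[OF False] by simp
    qed
    then show ?case unfolding max_weight_def by (subst Max_le_iff) auto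
  qed
  have nn: "0 \<le> max_weight c n" for n using order_trans[OF abs_ge_zero weight_le_max[of c n 0]] .
  show ?thesis
    by (rule tendsto_sandwich[OF always_eventually[OF allI[OF nn]] le tendsto_const lim])
qed

end

definition stat_num :: "(nat \<Rightarrow> real^'p) \<Rightarrow> 'p \<Rightarrow> nat \<Rightarrow> (int \<Rightarrow> real) \<Rightarrow> real" where
  "stat_num x j n e = (\<Sum>i\<in>{1..int n}. weight x j n i * e i)"

definition stat_var :: "(real \<Rightarrow> real) \<Rightarrow> real \<Rightarrow> (nat \<Rightarrow> real^'p) \<Rightarrow> 'p \<Rightarrow> nat \<Rightarrow> (int \<Rightarrow> real) \<Rightarrow> real" where
  "stat_var K h x j n e = quad n (\<lambda>k. K (real_of_int k / h) * acorr (weight x j n) n k)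
     (\<lambda>i. e i - noise_fit x n e i) (\<lambda>i. e i - noise_fit x n e i)"

definition stat :: "(real \<Rightarrow> real) \<Rightarrow> real \<Rightarrow> (nat \<Rightarrow> real^'p) \<Rightarrow> 'p \<Rightarrow> nat \<Rightarrow> (int \<Rightarrow> real) \<Rightarrow> real" where
  "stat K h x j n e = (if 0 < stat_var K h x j n e then stat_num x j n e / sqrt (stat_var K h x j n e) else 0)"

definition stat_defined :: "(real \<Rightarrow> real) \<Rightarrow> real \<Rightarrow> (nat \<Rightarrow> real^'p) \<Rightarrow> 'p \<Rightarrow> nat \<Rightarrow> (int \<Rightarrow> real) \<Rightarrow> bool" where
  "stat_defined K h x j n e \<longleftrightarrow> det (gram x n) \<noteq> 0 \<and> (\<forall>c. col_norm x c n \<noteq> 0) \<and> 0 < stat_var K h x j n e"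

lemma stat_eq:
  fixes x :: "nat \<Rightarrow> real^'p"
  assumes "stat_defined K h x j n e" and "\<beta> $ j = 0"
  shows "cov_estimator K h x (response x \<beta> e) n $ j $ j = stat_var K h x j n e"
    and "col_norm x j n * lse x (response x \<beta> e) n $ j / sqrt (cov_estimator K h x (response x \<beta> e) n $ j $ j) = stat K h x j n e"
proof -
  have d: "det (gram x n) \<noteq> 0" "\<And>c. col_norm x c n \<noteq> 0" "0 < stat_var K h x j n e"
    using assms(1) by (auto simp: stat_defined_def)
  show 1: "cov_estimator K h x (response x \<beta> e) n $ j $ j = stat_var K h x j n e"
    unfolding stat_var_def by (rule cov_estimator_eq[OF d(1)]) (rule residual_eq[OF d(1,2)])
  show "col_norm x j n * lse x (response x \<beta> e) n $ j / sqrt (cov_estimator K h x (response x \<beta> e) n $ j $ j) = stat K h x j n e"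
    unfolding 1 normalized_lse[OF d(1) assms(2)] using d(3) by (simp add: stat_def stat_num_def)
qed

context hannan_process
begin

lemma noise_fit_sqint: "sqint M (\<lambda>\<omega>. noise_fit x n (\<lambda>i. \<epsilon> i \<omega>) i)"
  unfolding noise_fit_def by (intro sqint_sum sqint_cmult eps_sqint)

lemma noise_fit_energy:
  fixes x :: "nat \<Rightarrow> real^'p"
  assumes C: "\<And>c. (\<Sum>i\<in>{1..int n}. (weight x c n i)\<^sup>2) \<le> C c" and d: "\<And>c. 0 < col_norm x c n"
  shows "(\<Sum>i\<in>{1..int n}. \<integral>\<omega>. (noise_fit x n (\<lambda>i. \<epsilon> i \<omega>) i)\<^sup>2 \<partial>M) \<le> real CARD('p) * (\<Sum>c\<in>UNIV. C c * hannan_sum\<^sup>2)"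
proof -
  define s where "s c \<omega> = (\<Sum>m\<in>{1..int n}. (x (nat m) $ c / col_norm x c n) * \<epsilon> m \<omega>)" for c \<omega>
  have ss: "sqint M (s c)" for c unfolding s_def[abs_def] by (intro sqint_sum sqint_cmult eps_sqint)
  have sb: "(\<integral>\<omega>. (s c \<omega>)\<^sup>2 \<partial>M) \<le> hannan_sum\<^sup>2" for c
  proof -
    have "(\<Sum>m\<in>{1..int n}. (x (nat m) $ c / col_norm x c n)\<^sup>2) = (\<Sum>m=1..n. (x m $ c)\<^sup>2) / (col_norm x c n)\<^sup>2"
      unfolding sum_nat_int[symmetric] by (simp add: power_divide sum_divide_distrib)
    also have "\<dots> = 1" unfolding col_norm_sq[symmetric] using d[of c] by simp
    finally have "norm_L2 M (s c) \<le> hannan_sum * sqrt 1"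
      unfolding s_def[abs_def] using eps_lincomb_norm[of "{1..int n}" "\<lambda>m. x (nat m) $ c / col_norm x c n"] by simp
    then have "(norm_L2 M (s c))\<^sup>2 \<le> hannan_sum\<^sup>2" by (intro power_mono) auto
    then show ?thesis by (simp add: norm_L2_sq)
  qed
  have si: "integrable M (\<lambda>\<omega>. (s c \<omega>)\<^sup>2)" for c using ss by (simp add: sqint_def)
  have "(\<integral>\<omega>. (noise_fit x n (\<lambda>i. \<epsilon> i \<omega>) i)\<^sup>2 \<partial>M) \<le> real CARD('p) * (\<Sum>c\<in>UNIV. (weight x c n i)\<^sup>2 * (\<integral>\<omega>. (s c \<omega>)\<^sup>2 \<partial>M))" for i
  proof -
    have "(\<integral>\<omega>. (noise_fit x n (\<lambda>i. \<epsilon> i \<omega>) i)\<^sup>2 \<partial>M) \<le> (\<integral>\<omega>. real CARD('p) * (\<Sum>c\<in>UNIV. (weight x c n i)\<^sup>2 * (s c \<omega>)\<^sup>2) \<partial>M)"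
    proof (rule integral_mono)
      show "integrable M (\<lambda>\<omega>. (noise_fit x n (\<lambda>i. \<epsilon> i \<omega>) i)\<^sup>2)" by (rule sqint_square_integrable[OF noise_fit_sqint])
      show "integrable M (\<lambda>\<omega>. real CARD('p) * (\<Sum>c\<in>UNIV. (weight x c n i)\<^sup>2 * (s c \<omega>)\<^sup>2))" using si by simp
      fix \<omega>
      have "(noise_fit x n (\<lambda>i. \<epsilon> i \<omega>) i)\<^sup>2 \<le> (\<Sum>c\<in>UNIV. (weight x c n i * s c \<omega>)\<^sup>2) * real CARD('p)"
        unfolding noise_fit_def s_def by (rule sum_squared_le_sum_of_squares)
      then show "(noise_fit x n (\<lambda>i. \<epsilon> i \<omega>) i)\<^sup>2 \<le> real CARD('p) * (\<Sum>c\<in>UNIV. (weight x c n i)\<^sup>2 * (s c \<omega>)\<^sup>2)"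
        by (simp add: power_mult_distrib mult.commute)
    qed
    also have "\<dots> = real CARD('p) * (\<Sum>c\<in>UNIV. (weight x c n i)\<^sup>2 * (\<integral>\<omega>. (s c \<omega>)\<^sup>2 \<partial>M))"
      using si by (simp add: Bochner_Integration.integral_sum)
    finally show ?thesis .
  qed
  then have "(\<Sum>i\<in>{1..int n}. \<integral>\<omega>. (noise_fit x n (\<lambda>i. \<epsilon> i \<omega>) i)\<^sup>2 \<partial>M)
    \<le> (\<Sum>i\<in>{1..int n}. real CARD('p) * (\<Sum>c\<in>UNIV. (weight x c n i)\<^sup>2 * (\<integral>\<omega>. (s c \<omega>)\<^sup>2 \<partial>M)))" by (rule sum_mono)
  also have "\<dots> = real CARD('p) * (\<Sum>c\<in>UNIV. (\<Sum>i\<in>{1..int n}. (weight x c n i)\<^sup>2) * (\<integral>\<omega>. (s c \<omega>)\<^sup>2 \<partial>M))"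
    unfolding sum_distrib_left[symmetric] sum_distrib_right by (subst sum.swap) simp
  also have "\<dots> \<le> real CARD('p) * (\<Sum>c\<in>UNIV. C c * hannan_sum\<^sup>2)"
  proof (intro mult_left_mono sum_mono mult_mono C sb)
    show "0 \<le> C c" for c by (rule order_trans[OF sum_nonneg C]) simp
  qed auto
  finally show ?thesis .
qed

end

context hannan_taper
begin

theorem fixed_design_limit:
  fixes x :: "nat \<Rightarrow> real^'p"
  assumes gd: "good_design x" and FX: "is_spectral_measure (limit_corr x) FX"
    and pos: "herm_pos_def (asymp_cov (spectral_density (autocov M \<epsilon>)) FX)"
  shows "(\<lambda>n. \<integral>\<omega>. iexp (t * stat K (h n) x j n (\<lambda>i. \<epsilon> i \<omega>)) \<partial>M) \<longlonglongrightarrow> of_real (exp (- t\<^sup>2 / 2))"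
    and "(\<lambda>n. prob {\<omega> \<in> space M. \<not> stat_defined K (h n) x j n (\<lambda>i. \<epsilon> i \<omega>)}) \<longlonglongrightarrow> 0"
proof -
  interpret G: good_design x by (rule gd)
  have "\<exists>C. \<forall>c n. (\<Sum>i\<in>{1..int n}. (weight x c n i)\<^sup>2) \<le> C c"
    by (rule choice) (intro allI G.weight_energy_bounded)
  then obtain C where C: "\<And>c n. (\<Sum>i\<in>{1..int n}. (weight x c n i)\<^sup>2) \<le> C c" by blast
  interpret D: design_weights M T F0 \<epsilon> K \<kappa> c0 K1 h "weight x j" "C j" "G.max_weight j" "G.r j"
    by unfold_locales (use G.weight_outside C G.weight_le_max G.max_weight_tendsto G.acorr_weight_tendsto in blast)+
  have V: "0 < D.V"
  proof -
    have "\<bar>G.r j k\<bar> \<le> C j" for k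
      by (rule LIMSEQ_le_const2[OF tendsto_rabs[OF G.acorr_weight_tendsto[of j k]]]) (use D.acorr_le_C in blast)
    then show ?thesis
      unfolding D.V_def G.r_def G.W_def
      by (intro spectral_variance_pos[OF FX G.limit_pos_def autocov_abs_summable _ pos, where C="C j"])
  qed
  have c_eq: "stat_var K (h n) x j n (\<lambda>i. \<epsilon> i \<omega>) = quad n (taper (weight x j) n) (\<lambda>i. \<epsilon> i \<omega> - noise_fit x n (\<lambda>i. \<epsilon> i \<omega>) i) (\<lambda>i. \<epsilon> i \<omega> - noise_fit x n (\<lambda>i. \<epsilon> i \<omega>) i)" for n \<omega>
    by (simp add: stat_var_def taper_def[abs_def])
  have S_eq: "stat_num x j n (\<lambda>i. \<epsilon> i \<omega>) = D.S n \<omega>" for n \<omega>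
    by (simp add: stat_num_def D.S_def)
  obtain n0 where n0: "\<And>n. n \<ge> n0 \<Longrightarrow> G.regular n" using G.eventually_regular by (auto simp: eventually_sequentially)
  have var: "(\<lambda>n. \<integral>\<omega>. \<bar>stat_var K (h n) x j n (\<lambda>i. \<epsilon> i \<omega>) - D.V\<bar> \<partial>M) \<longlonglongrightarrow> 0"
    unfolding c_eq
  proof (rule D.residual_quad_tendsto)
    show "sqint M (\<lambda>\<omega>. noise_fit x n (\<lambda>i. \<epsilon> i \<omega>) i)" for n i by (rule noise_fit_sqint)
    show "(\<Sum>i\<in>{1..int n}. \<integral>\<omega>. (noise_fit x n (\<lambda>i. \<epsilon> i \<omega>) i)\<^sup>2 \<partial>M) \<le> real CARD('p) * (\<Sum>c\<in>UNIV. C c * hannan_sum\<^sup>2)" if "n0 \<le> n" for n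
      by (rule noise_fit_energy[OF C]) (use n0[OF that] in \<open>simp add: G.regular_def\<close>)
  qed
  have ci: "integrable M (\<lambda>\<omega>. stat_var K (h n) x j n (\<lambda>i. \<epsilon> i \<omega>))" for n
    unfolding c_eq by (intro D.quad_integrable sqint_diff eps_sqint noise_fit_sqint)
  show "(\<lambda>n. \<integral>\<omega>. iexp (t * stat K (h n) x j n (\<lambda>i. \<epsilon> i \<omega>)) \<partial>M) \<longlonglongrightarrow> of_real (exp (- t\<^sup>2 / 2))"
    unfolding stat_def S_eq
    by (rule studentized_char_tendsto[OF D.S_sqint D.S_norm ci var V D.S_char_tendsto])
  have le: "\<forall>\<^sub>F n in sequentially. prob {\<omega> \<in> space M. \<not> stat_defined K (h n) x j n (\<lambda>i. \<epsilon> i \<omega>)} \<le> (\<integral>\<omega>. \<bar>stat_var K (h n) x j n (\<lambda>i. \<epsilon> i \<omega>) - D.V\<bar> \<partial>M) / D.V"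
    using eventually_ge_at_top[of n0]
  proof eventually_elim
    case (elim n)
    have "G.regular n" by (rule n0[OF elim])
    then have "col_norm x c n \<noteq> 0" for c by (metis G.regular_def less_irrefl)
    then have "{\<omega> \<in> space M. \<not> stat_defined K (h n) x j n (\<lambda>i. \<epsilon> i \<omega>)} = {\<omega> \<in> space M. stat_var K (h n) x j n (\<lambda>i. \<epsilon> i \<omega>) \<le> 0}"
      using G.regular_gram(1)[OF \<open>G.regular n\<close>] by (auto simp: stat_defined_def)
    then show ?case using prob_nonpos_le[OF ci V] by simp
  qed
  have "(\<lambda>n. (\<integral>\<omega>. \<bar>stat_var K (h n) x j n (\<lambda>i. \<epsilon> i \<omega>) - D.V\<bar> \<partial>M) / D.V) \<longlonglongrightarrow> 0 / D.V"
    by (intro tendsto_divide var tendsto_const) (use V in simp)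
  then have lim: "(\<lambda>n. (\<integral>\<omega>. \<bar>stat_var K (h n) x j n (\<lambda>i. \<epsilon> i \<omega>) - D.V\<bar> \<partial>M) / D.V) \<longlonglongrightarrow> 0" by simp
  show "(\<lambda>n. prob {\<omega> \<in> space M. \<not> stat_defined K (h n) x j n (\<lambda>i. \<epsilon> i \<omega>)}) \<longlonglongrightarrow> 0"
    by (rule tendsto_sandwich[OF always_eventually[OF allI] le tendsto_const lim]) simp
qed

end

section \<open>Random designs\<close>

lemma (in prob_space) indep_distr_pair:
  assumes indep: "indep_set (sets (vimage_algebra (space M) X N1)) (sets (vimage_algebra (space M) Y N2))"
    and X [measurable]: "X \<in> measurable M N1" and Y [measurable]: "Y \<in> measurable M N2"
  shows "distr M N1 X \<Otimes>\<^sub>M distr M N2 Y = distr M (N1 \<Otimes>\<^sub>M N2) (\<lambda>\<omega>. (X \<omega>, Y \<omega>))"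
proof (rule pair_measure_eqI)
  interpret PX: prob_space "distr M N1 X" by (rule prob_space_distr) fact
  interpret PY: prob_space "distr M N2 Y" by (rule prob_space_distr) fact
  show "sigma_finite_measure (distr M N1 X)" "sigma_finite_measure (distr M N2 Y)" by unfold_locales
  fix A B assume "A \<in> sets (distr M N1 X)" "B \<in> sets (distr M N2 Y)"
  then have A: "A \<in> sets N1" and B: "B \<in> sets N2" by simp_all
  have eq: "(\<lambda>\<omega>. (X \<omega>, Y \<omega>)) -` (A \<times> B) \<inter> space M = (X -` A \<inter> space M) \<inter> (Y -` B \<inter> space M)" by auto
  show "emeasure (distr M N1 X) A * emeasure (distr M N2 Y) B = emeasure (distr M (N1 \<Otimes>\<^sub>M N2) (\<lambda>\<omega>. (X \<omega>, Y \<omega>))) (A \<times> B)"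
    using A B indep_setD[OF indep in_vimage_algebra[OF A] in_vimage_algebra[OF B]]
    by (simp add: emeasure_distr eq emeasure_eq_measure ennreal_mult)
qed simp

lemma (in prob_space) indep_integral_iterated:
  fixes \<psi> :: "'b \<times> 'c \<Rightarrow> 'd::{banach, second_countable_topology}"
  assumes indep: "indep_set (sets (vimage_algebra (space M) X N1)) (sets (vimage_algebra (space M) Y N2))"
    and X [measurable]: "X \<in> measurable M N1" and Y [measurable]: "Y \<in> measurable M N2"
    and \<psi> [measurable]: "\<psi> \<in> borel_measurable (N1 \<Otimes>\<^sub>M N2)"
    and B: "\<And>p. norm (\<psi> p) \<le> B"
  shows "(\<integral>\<omega>. \<psi> (X \<omega>, Y \<omega>) \<partial>M) = (\<integral>\<omega>. (\<integral>\<omega>'. \<psi> (X \<omega>, Y \<omega>') \<partial>M) \<partial>M)"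
    and "(\<lambda>\<omega>. \<integral>\<omega>'. \<psi> (X \<omega>, Y \<omega>') \<partial>M) \<in> borel_measurable M"
proof -
  have joint: "distr M N1 X \<Otimes>\<^sub>M distr M N2 Y = distr M (N1 \<Otimes>\<^sub>M N2) (\<lambda>\<omega>. (X \<omega>, Y \<omega>))"
    by (rule indep_distr_pair[OF indep X Y])
  interpret PX: prob_space "distr M N1 X" by (rule prob_space_distr) fact
  interpret PY: prob_space "distr M N2 Y" by (rule prob_space_distr) fact
  interpret P: pair_prob_space "distr M N1 X" "distr M N2 Y" ..
  have m: "\<psi> \<in> borel_measurable (distr M N1 X \<Otimes>\<^sub>M distr M N2 Y)"
    by (subst measurable_cong_sets[OF sets_pair_measure_cong[OF sets_distr sets_distr] refl]) (rule \<psi>)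
  have int: "integrable (distr M N1 X \<Otimes>\<^sub>M distr M N2 Y) \<psi>"
    by (rule P.integrable_const_bound[where B=B]) (use B m in auto)
  have inner: "(\<integral>y. \<psi> (x, y) \<partial>distr M N2 Y) = (\<integral>\<omega>'. \<psi> (x, Y \<omega>') \<partial>M)" if "x \<in> space N1" for x
    by (rule integral_distr[OF Y]) (use that in measurable)
  have meas: "(\<lambda>x. \<integral>\<omega>'. \<psi> (x, Y \<omega>') \<partial>M) \<in> borel_measurable N1"
    by (rule borel_measurable_lebesgue_integral) measurable
  have "(\<integral>\<omega>. \<psi> (X \<omega>, Y \<omega>) \<partial>M) = integral\<^sup>L (distr M (N1 \<Otimes>\<^sub>M N2) (\<lambda>\<omega>. (X \<omega>, Y \<omega>))) \<psi>"
    by (rule integral_distr[symmetric]) measurable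
  also have "\<dots> = (\<integral>x. (\<integral>y. \<psi> (x, y) \<partial>distr M N2 Y) \<partial>distr M N1 X)"
    unfolding joint[symmetric] by (rule P.integral_fst'[OF int, symmetric])
  also have "\<dots> = (\<integral>x. (\<integral>\<omega>'. \<psi> (x, Y \<omega>') \<partial>M) \<partial>distr M N1 X)"
    by (rule Bochner_Integration.integral_cong[OF refl]) (simp add: inner)
  also have "\<dots> = (\<integral>\<omega>. (\<integral>\<omega>'. \<psi> (X \<omega>, Y \<omega>') \<partial>M) \<partial>M)" by (rule integral_distr[OF X meas])
  finally show "(\<integral>\<omega>. \<psi> (X \<omega>, Y \<omega>) \<partial>M) = (\<integral>\<omega>. (\<integral>\<omega>'. \<psi> (X \<omega>, Y \<omega>') \<partial>M) \<partial>M)" .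
  show "(\<lambda>\<omega>. \<integral>\<omega>'. \<psi> (X \<omega>, Y \<omega>') \<partial>M) \<in> borel_measurable M"
    by (rule measurable_compose[OF X meas])
qed

abbreviation (input) design_space :: "(nat \<Rightarrow> real^'p) measure" where
  "design_space \<equiv> \<Pi>\<^sub>M i\<in>{1..}. borel"

abbreviation (input) noise_space :: "(int \<Rightarrow> real) measure" where
  "noise_space \<equiv> \<Pi>\<^sub>M i\<in>UNIV. borel"

context
  fixes N :: "((nat \<Rightarrow> real^'p) \<times> (int \<Rightarrow> real)) measure"
  defines "N \<equiv> design_space \<Otimes>\<^sub>M noise_space"
begin

lemma measurable_design_entry: assumes "1 \<le> i" shows "(\<lambda>q. fst q i $ a) \<in> borel_measurable N"
proof -
  have "(\<lambda>x. x i) \<in> measurable design_space (borel :: (real^'p) measure)"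
    by (rule measurable_component_singleton) (use assms in simp)
  then have "(\<lambda>q. fst q i) \<in> measurable N (borel :: (real^'p) measure)"
    unfolding N_def by (rule measurable_compose[OF measurable_fst])
  moreover have "(\<lambda>v::real^'p. v $ a) \<in> borel_measurable borel"
    by (intro borel_measurable_continuous_onI continuous_intros)
  ultimately show ?thesis by (rule measurable_compose)
qed

lemma measurable_noise_entry: "(\<lambda>q. snd q i) \<in> borel_measurable N"
proof -
  have "(\<lambda>e. e i) \<in> measurable noise_space (borel :: real measure)"
    by (rule measurable_component_singleton) simp
  then show ?thesis unfolding N_def by (rule measurable_compose[OF measurable_snd])
qed

lemma measurable_col_norm: "(\<lambda>q. col_norm (fst q) a n) \<in> borel_measurable N"
  unfolding col_norm_def
  by (intro measurable_compose[OF _ borel_measurable_sqrt] borel_measurable_sum borel_measurable_power measurable_design_entry) simp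

lemma measurable_gram_entry: "(\<lambda>q. gram (fst q) n $ a $ b) \<in> borel_measurable N"
  unfolding gram_def vec_lambda_beta
  by (intro borel_measurable_sum borel_measurable_times measurable_design_entry) simp_all

lemma measurable_det:
  assumes "\<And>i j. (\<lambda>q. A q $ i $ j) \<in> borel_measurable N'" shows "(\<lambda>q. det (A q :: real^'n^'n)) \<in> borel_measurable N'"
  unfolding det_def
  by (intro borel_measurable_sum borel_measurable_times borel_measurable_prod borel_measurable_const assms)

lemma measurable_cramer_inv_gram: "(\<lambda>q. cramer_inv (gram (fst q) n) $ a $ c) \<in> borel_measurable N"
  unfolding cramer_inv_def vec_lambda_beta
proof (intro borel_measurable_divide measurable_det)
  fix i j
  show "(\<lambda>q. (\<chi> i j. if j = a then if i = c then 1 else 0 else gram (fst q) n $ i $ j) $ i $ j) \<in> borel_measurable N"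
    using measurable_gram_entry[of n i j] by (cases "j = a") simp_all
qed (rule measurable_gram_entry)

lemma measurable_weight: "(\<lambda>q. weight (fst q) c n i) \<in> borel_measurable N"
proof (cases "i \<in> {1..int n}")
  case True
  then have "1 \<le> nat i" by auto
  show ?thesis unfolding weight_def if_P[OF True]
    by (intro borel_measurable_times borel_measurable_sum measurable_design_entry measurable_cramer_inv_gram measurable_col_norm) (rule \<open>1 \<le> nat i\<close>)
next
  case False
  show ?thesis unfolding weight_def if_not_P[OF False] by simp
qed

lemma measurable_noise_fit: "(\<lambda>q. noise_fit (fst q) n (snd q) i) \<in> borel_measurable N"
  unfolding noise_fit_def
  by (intro borel_measurable_sum borel_measurable_times borel_measurable_divide measurable_design_entry measurable_weight
      measurable_col_norm measurable_noise_entry) auto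

lemma measurable_stat_var: "(\<lambda>q. stat_var K h (fst q) j n (snd q)) \<in> borel_measurable N"
  unfolding stat_var_def quad_def acorr_def
  by (intro borel_measurable_sum borel_measurable_times borel_measurable_diff borel_measurable_const measurable_weight
      measurable_noise_fit measurable_noise_entry)

lemma measurable_stat_num: "(\<lambda>q. stat_num (fst q) j n (snd q)) \<in> borel_measurable N"
  unfolding stat_num_def
  by (intro borel_measurable_sum borel_measurable_times measurable_weight measurable_noise_entry)

lemma measurable_stat: "(\<lambda>q. stat K h (fst q) j n (snd q)) \<in> borel_measurable N"
proof -
  note [measurable] = measurable_stat_var measurable_stat_num
  show ?thesis unfolding stat_def by measurable
qed

lemma measurable_stat_defined: "Measurable.pred N (\<lambda>q. stat_defined K h (fst q) j n (snd q))"
proof -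
  note [measurable] = measurable_stat_var measurable_col_norm measurable_det[OF measurable_gram_entry]
  show ?thesis unfolding stat_defined_def by measurable
qed

end

lemma restrict_design:
  fixes x :: "nat \<Rightarrow> real^'p"
  defines "x' \<equiv> \<lambda>i\<in>{1..}. x i"
  shows "stat_num x' = stat_num x" "stat_var K h x' = stat_var K h x" "stat K h x' = stat K h x"
    "stat_defined K h x' = stat_defined K h x"
proof -
  have x': "x' i = x i" if "1 \<le> i" for i using that by (simp add: x'_def)
  have g: "gram x' n = gram x n" for n by (simp add: gram_def x')
  have c: "col_norm x' a n = col_norm x a n" for a n by (simp add: col_norm_def x')
  have w: "weight x' c n i = weight x c n i" for c n i
  proof (cases "i \<in> {1..int n}")
    case True
    then have "1 \<le> nat i" by auto
    then show ?thesis unfolding weight_def g c by (simp add: x')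
  next
    case False
    show ?thesis unfolding weight_def if_not_P[OF False] by simp
  qed
  have f: "noise_fit x' n e i = noise_fit x n e i" for n e i
  proof -
    have "(\<Sum>m\<in>{1..int n}. (x' (nat m) $ a / col_norm x a n) * e m) = (\<Sum>m\<in>{1..int n}. (x (nat m) $ a / col_norm x a n) * e m)" for a
      by (intro sum.cong refl arg_cong2[where f="(*)"] arg_cong2[where f="(/)"] arg_cong[where f="\<lambda>v. v $ a"] x') auto
    then show ?thesis unfolding noise_fit_def w c by simp
  qed
  have w': "weight x' = weight x" by (intro ext) (rule w)
  show n: "stat_num x' = stat_num x" by (intro ext) (simp add: stat_num_def w)
  show v: "stat_var K h x' = stat_var K h x" by (intro ext) (simp add: stat_var_def f w')
  show "stat K h x' = stat K h x" by (intro ext) (simp add: stat_def n v)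
  show "stat_defined K h x' = stat_defined K h x" by (intro ext) (simp add: stat_defined_def v g c)
qed

theorem mainTheorem5:
  fixes M :: "'a measure" and T :: "'a \<Rightarrow> 'a" and F0 :: "'a measure"
    and \<epsilon> :: "int \<Rightarrow> 'a \<Rightarrow> real"
    and x :: "'a \<Rightarrow> nat \<Rightarrow> real^'p" and \<beta> :: "real^'p"
    and FX :: "'a \<Rightarrow> real set \<Rightarrow> complex^'p^'p"
    and K :: "real \<Rightarrow> real" and h :: "nat \<Rightarrow> real"
    and j :: 'p and Tstat :: "nat \<Rightarrow> 'a \<Rightarrow> real"
  defines "Y \<equiv> \<lambda>\<omega>. response (x \<omega>) \<beta> (\<lambda>i. \<epsilon> i \<omega>)"
  assumes "prob_space M"
    and "invertible_mpt M T"
    and "\<And>i \<omega>. \<omega> \<in> space M \<Longrightarrow> \<epsilon> i \<omega> = \<epsilon> 0 (int_iterate M T i \<omega>)"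
    and "integrable M (\<lambda>\<omega>. (\<epsilon> 0 \<omega>)\<^sup>2)"
    and "(\<integral>\<omega>. \<epsilon> 0 \<omega> \<partial>M) = 0"
    and "subalgebra M F0"
    and "sets F0 \<subseteq> sets (vimage_algebra (space M) T F0)"
    and past_trivial: "\<And>A. A \<in> filtr_past M T F0 \<Longrightarrow> measure M A = 0 \<or> measure M A = 1"
    and "\<epsilon> 0 \<in> borel_measurable (filtr_all M T F0)"
    and design_indep: "prob_space.indep_set M
          (sets (vimage_algebra (space M) (\<lambda>\<omega>. \<lambda>i\<in>{1..}. x \<omega> i) (\<Pi>\<^sub>M i\<in>{1..}. borel)))
          (sets (vimage_algebra (space M) (\<lambda>\<omega> i. \<epsilon> i \<omega>) (\<Pi>\<^sub>M i\<in>UNIV. borel)))"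
    and hannan: "(\<lambda>i. norm_L2 M (proj_incr M T F0 0 (\<epsilon> i))) summable_on UNIV"
    and design_i: "AE \<omega> in M. \<forall>a. filterlim (col_norm (x \<omega>) a) at_top sequentially"
    and design_ii: "AE \<omega> in M. \<forall>a.
          (\<lambda>n. (SUP i\<in>{1..n}. \<bar>x \<omega> i $ a\<bar>) / col_norm (x \<omega>) a n) \<longlonglongrightarrow> 0"
    and design_iii: "AE \<omega> in M. \<forall>a b k. convergent (cross_corr (x \<omega>) k a b)"
    and design_iv: "AE \<omega> in M. pos_def (limit_corr (x \<omega>) 0)"
    and "AE \<omega> in M. is_spectral_measure (limit_corr (x \<omega>)) (FX \<omega>)"
    and "AE \<omega> in M. herm_pos_def (asymp_cov (spectral_density (autocov M \<epsilon>)) (FX \<omega>))"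
    and "admissible_kernel K"
    and "\<And>n. 1 \<le> n \<Longrightarrow> 0 < h n"
    and "filterlim h at_top sequentially"
    and "(\<lambda>n. h n / real n) \<longlonglongrightarrow> 0"
    and "(\<lambda>n. h n * (\<integral>\<omega>. (\<epsilon> 0 \<omega>)\<^sup>2 * min 1 (h n / real n * (\<epsilon> 0 \<omega>)\<^sup>2) \<partial>M)) \<longlonglongrightarrow> 0"
    and "\<And>n. Tstat n \<in> borel_measurable M"
    and "\<And>n \<omega>. \<omega> \<in> space M \<Longrightarrow> invertible (gram (x \<omega>) n) \<Longrightarrow>
          0 < cov_estimator K (h n) (x \<omega>) (Y \<omega>) n $ j $ j \<Longrightarrow>
          Tstat n \<omega> = col_norm (x \<omega>) j n * lse (x \<omega>) (Y \<omega>) n $ j /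
                        sqrt (cov_estimator K (h n) (x \<omega>) (Y \<omega>) n $ j $ j)"
    and null_hypothesis: "\<beta> $ j = 0"
  shows "weak_conv_m (\<lambda>n. distr M borel (Tstat n)) std_normal_distribution"
proof -
  note kernel = \<open>admissible_kernel K\<close>
  obtain \<kappa> where \<kappa>: "integrable lborel \<kappa>" "\<And>u. K u = (\<integral>t. \<kappa> t * cos (u * t) \<partial>lborel)"
    by (rule admissible_kernel_cos[OF kernel]) (rule that)
  obtain c0 where c0: "\<And>u. c0 < \<bar>u\<bar> \<Longrightarrow> K u = 0" using admissible_kernel_support[OF kernel] by auto
  obtain K1 where K1: "\<And>u. \<bar>K u\<bar> \<le> K1" using admissible_kernel_bounded[OF kernel] by auto
  have Kc: "isCont K 0" using admissible_kernelD(1)[OF kernel] by (simp add: continuous_on_eq_continuous_at)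
  interpret prob_space M by fact
  interpret hannan_taper M T F0 \<epsilon> K \<kappa> c0 K1 h
    by unfold_locales (fact | rule \<kappa> c0 K1 Kc admissible_kernelD(4)[OF kernel] | assumption)+
  let ?N1 = "design_space :: (nat \<Rightarrow> real^'p) measure"
  let ?X = "\<lambda>\<omega>. \<lambda>i\<in>{1..}. x \<omega> i" and ?E = "\<lambda>\<omega> i. \<epsilon> i \<omega>"
  have X: "?X \<in> measurable M ?N1"
  proof (rule measurableI)
    show "?X \<omega> \<in> space ?N1" for \<omega> by (simp add: space_PiM)
    show "?X -` A \<inter> space M \<in> events" if "A \<in> sets ?N1" for A
      using in_vimage_algebra[OF that, of ?X "space M"] indep_setD_ev1[OF design_indep] by blast
  qed
  have E: "?E \<in> measurable M noise_space"
  proof (rule measurableI)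
    show "?E \<omega> \<in> space noise_space" for \<omega> by (simp add: space_PiM)
    show "?E -` A \<inter> space M \<in> events" if "A \<in> sets noise_space" for A
      using in_vimage_algebra[OF that, of ?E "space M"] indep_setD_ev2[OF design_indep] by blast
  qed
  have good: "AE \<omega> in M. good_design (x \<omega>) \<and> is_spectral_measure (limit_corr (x \<omega>)) (FX \<omega>) \<and>
      herm_pos_def (asymp_cov (spectral_density (autocov M \<epsilon>)) (FX \<omega>))"
    using design_i design_ii design_iii design_iv
      \<open>AE \<omega> in M. is_spectral_measure (limit_corr (x \<omega>)) (FX \<omega>)\<close>
      \<open>AE \<omega> in M. herm_pos_def (asymp_cov (spectral_density (autocov M \<epsilon>)) (FX \<omega>))\<close>
    by eventually_elim (simp add: good_design_def)
  define st where "st n \<omega> = stat K (h n) (x \<omega>) j n (?E \<omega>)" for n \<omega>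
  define bad where "bad n \<omega> = (if stat_defined K (h n) (x \<omega>) j n (?E \<omega>) then 0 else 1 :: real)" for n \<omega>
  have pair: "(\<lambda>\<omega>. (?X \<omega>, ?E \<omega>)) \<in> measurable M (?N1 \<Otimes>\<^sub>M noise_space)" using X E by (rule measurable_Pair)
  have st_meas [measurable]: "st n \<in> borel_measurable M" for n
    using measurable_compose[OF pair measurable_stat[of K "h n" j n]] unfolding fst_conv snd_conv restrict_design st_def .
  let ?\<psi> = "\<lambda>t n q. iexp (t * stat K (h n) (fst q) j n (snd q))"
  let ?\<phi> = "\<lambda>n q. if stat_defined K (h n) (fst q) j n (snd q) then 0 else 1 :: real"
  have \<psi>m: "?\<psi> t n \<in> borel_measurable (?N1 \<Otimes>\<^sub>M noise_space)" for t n
  proof -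
    note [measurable] = measurable_stat[of K "h n" j n]
    show ?thesis by measurable
  qed
  have \<phi>m: "?\<phi> n \<in> borel_measurable (?N1 \<Otimes>\<^sub>M noise_space)" for n
  proof -
    note [measurable] = measurable_stat_defined[of K "h n" j n]
    show ?thesis by measurable
  qed
  have bad_meas [measurable]: "bad n \<in> borel_measurable M" for n
    using measurable_compose[OF pair \<phi>m[of n]] unfolding fst_conv snd_conv restrict_design bad_def .
  have char_lim: "(\<lambda>n. \<integral>\<omega>. iexp (t * st n \<omega>) \<partial>M) \<longlonglongrightarrow> of_real (exp (- t\<^sup>2 / 2))" for t
  proof -
    let ?I = "\<lambda>n \<omega>. \<integral>\<omega>'. iexp (t * stat K (h n) (x \<omega>) j n (?E \<omega>')) \<partial>M"
    note it = indep_integral_iterated[OF design_indep X E \<psi>m[of t], where B=1, unfolded fst_conv snd_conv restrict_design]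
    have b1: "cmod (?I n \<omega>) \<le> 1" for n \<omega>
    proof -
      have "cmod (?I n \<omega>) \<le> (\<integral>\<omega>'. cmod (iexp (t * stat K (h n) (x \<omega>) j n (?E \<omega>'))) \<partial>M)" by (rule integral_norm_bound)
      also have "\<dots> = 1" by (simp only: norm_exp_i_times) (simp add: prob_space)
      finally show ?thesis .
    qed
    have "(\<lambda>n. \<integral>\<omega>. ?I n \<omega> \<partial>M) \<longlonglongrightarrow> (\<integral>\<omega>. of_real (exp (- t\<^sup>2 / 2)) \<partial>M)"
    proof (rule integral_dominated_convergence[where w="\<lambda>_. 1"])
      show "?I n \<in> borel_measurable M" for n by (rule it(2)) simp
      show "AE \<omega> in M. (\<lambda>n. ?I n \<omega>) \<longlonglongrightarrow> of_real (exp (- t\<^sup>2 / 2))"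
        using good by eventually_elim (rule fixed_design_limit(1), auto)
    qed (use b1 in auto)
    moreover have "(\<integral>\<omega>. iexp (t * st n \<omega>) \<partial>M) = (\<integral>\<omega>. ?I n \<omega> \<partial>M)" for n
      unfolding st_def by (rule it(1)) simp
    ultimately show ?thesis by (simp add: prob_space)
  qed
  have bad_lim: "(\<lambda>n. \<integral>\<omega>. bad n \<omega> \<partial>M) \<longlonglongrightarrow> 0"
  proof -
    let ?I = "\<lambda>n \<omega>. \<integral>\<omega>'. (if stat_defined K (h n) (x \<omega>) j n (?E \<omega>') then 0 else 1 :: real) \<partial>M"
    note it = indep_integral_iterated[OF design_indep X E \<phi>m, where B=1, unfolded fst_conv snd_conv restrict_design]
    have I: "?I n \<omega> = prob {\<omega>' \<in> space M. \<not> stat_defined K (h n) (x \<omega>) j n (?E \<omega>')}" for n \<omega>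
    proof -
      have "?I n \<omega> = (\<integral>\<omega>'. indicator {\<omega>' \<in> space M. \<not> stat_defined K (h n) (x \<omega>) j n (?E \<omega>')} \<omega>' \<partial>M)"
        by (rule Bochner_Integration.integral_cong[OF refl]) (auto simp: indicator_def)
      also have "\<dots> = prob {\<omega>' \<in> space M. \<not> stat_defined K (h n) (x \<omega>) j n (?E \<omega>')}" by (simp add: Int_absorb2 subset_eq)
      finally show ?thesis .
    qed
    have "(\<lambda>n. \<integral>\<omega>. ?I n \<omega> \<partial>M) \<longlonglongrightarrow> (\<integral>\<omega>. 0 \<partial>M)"
    proof (rule integral_dominated_convergence[where w="\<lambda>_. 1"])
      show "?I n \<in> borel_measurable M" for n by (rule it(2)) simp
      show "AE \<omega> in M. (\<lambda>n. ?I n \<omega>) \<longlonglongrightarrow> 0"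
        unfolding I using good by eventually_elim (rule fixed_design_limit(2), auto)
      show "AE \<omega> in M. norm (?I n \<omega>) \<le> 1" for n unfolding I by simp
    qed auto
    moreover have "(\<integral>\<omega>. bad n \<omega> \<partial>M) = (\<integral>\<omega>. ?I n \<omega> \<partial>M)" for n
      unfolding bad_def by (rule it(1)) simp
    ultimately show ?thesis by simp
  qed
  have T_meas [measurable]: "Tstat n \<in> borel_measurable M" for n by fact
  have T_eq: "Tstat n \<omega> = st n \<omega>" if "\<omega> \<in> space M" "stat_defined K (h n) (x \<omega>) j n (?E \<omega>)" for n \<omega>
  proof -
    note e = stat_eq[OF that(2) null_hypothesis]
    have "invertible (gram (x \<omega>) n)" "0 < stat_var K (h n) (x \<omega>) j n (?E \<omega>)"
      using that(2) by (simp_all add: stat_defined_def invertible_det_nz)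
    then have "Tstat n \<omega> = col_norm (x \<omega>) j n * lse (x \<omega>) (Y \<omega>) n $ j / sqrt (cov_estimator K (h n) (x \<omega>) (Y \<omega>) n $ j $ j)"
      using that(1) e(1) by (intro assms) (simp_all add: Y_def)
    then show ?thesis using e(2) by (simp add: Y_def st_def)
  qed
  have close: "cmod ((\<integral>\<omega>. iexp (t * Tstat n \<omega>) \<partial>M) - (\<integral>\<omega>. iexp (t * st n \<omega>) \<partial>M)) \<le> 2 * (\<integral>\<omega>. bad n \<omega> \<partial>M)" for t n
  proof -
    have i: "integrable M (\<lambda>\<omega>. iexp (t * Tstat n \<omega>))" "integrable M (\<lambda>\<omega>. iexp (t * st n \<omega>))"
      by (rule integrable_const_bound[where B=1]; simp)+
    have ib: "integrable M (bad n)" by (rule integrable_const_bound[where B=1]) (auto simp: bad_def)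
    have "cmod ((\<integral>\<omega>. iexp (t * Tstat n \<omega>) \<partial>M) - (\<integral>\<omega>. iexp (t * st n \<omega>) \<partial>M)) = cmod (\<integral>\<omega>. iexp (t * Tstat n \<omega>) - iexp (t * st n \<omega>) \<partial>M)"
      by (simp only: Bochner_Integration.integral_diff[OF i])
    also have "\<dots> \<le> (\<integral>\<omega>. cmod (iexp (t * Tstat n \<omega>) - iexp (t * st n \<omega>)) \<partial>M)" by (rule integral_norm_bound)
    also have "\<dots> \<le> (\<integral>\<omega>. 2 * bad n \<omega> \<partial>M)"
    proof (rule integral_mono)
      show "integrable M (\<lambda>\<omega>. cmod (iexp (t * Tstat n \<omega>) - iexp (t * st n \<omega>)))"
        by (intro integrable_norm Bochner_Integration.integrable_diff i)
      show "integrable M (\<lambda>\<omega>. 2 * bad n \<omega>)" using ib by simp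
      fix \<omega> assume \<omega>: "\<omega> \<in> space M"
      show "cmod (iexp (t * Tstat n \<omega>) - iexp (t * st n \<omega>)) \<le> 2 * bad n \<omega>"
      proof (cases "stat_defined K (h n) (x \<omega>) j n (?E \<omega>)")
        case True
        then show ?thesis by (simp add: T_eq[OF \<omega> True] bad_def)
      next
        case False
        have "cmod (iexp (t * Tstat n \<omega>) - iexp (t * st n \<omega>)) \<le> cmod (iexp (t * Tstat n \<omega>)) + cmod (iexp (t * st n \<omega>))"
          by (rule norm_triangle_ineq4)
        also have "\<dots> = 2" by (simp only: norm_exp_i_times one_add_one)
        finally show ?thesis using False by (simp add: bad_def)
      qed
    qed
    finally show ?thesis by simp
  qed
  show ?thesis
  proof (rule levy_continuity)
    show "real_distribution (distr M borel (Tstat n))" for n by (rule real_distribution_distr) measurable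
    show "real_distribution std_normal_distribution" by (rule real_dist_normal_dist)
    fix t
    have "(\<lambda>n. (\<integral>\<omega>. iexp (t * Tstat n \<omega>) \<partial>M) - (\<integral>\<omega>. iexp (t * st n \<omega>) \<partial>M)) \<longlonglongrightarrow> 0"
    proof (rule Lim_null_comparison)
      show "\<forall>\<^sub>F n in sequentially. cmod ((\<integral>\<omega>. iexp (t * Tstat n \<omega>) \<partial>M) - (\<integral>\<omega>. iexp (t * st n \<omega>) \<partial>M)) \<le> 2 * (\<integral>\<omega>. bad n \<omega> \<partial>M)"
        using close by (intro always_eventually allI)
      show "(\<lambda>n. 2 * (\<integral>\<omega>. bad n \<omega> \<partial>M)) \<longlonglongrightarrow> 0" using tendsto_mult[OF tendsto_const[of 2] bad_lim] by simp
    qed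
    from tendsto_add[OF this char_lim[of t]]
    have "(\<lambda>n. \<integral>\<omega>. iexp (t * Tstat n \<omega>) \<partial>M) \<longlonglongrightarrow> of_real (exp (- t\<^sup>2 / 2))" by simp
    moreover have "char (distr M borel (Tstat n)) t = (\<integral>\<omega>. iexp (t * Tstat n \<omega>) \<partial>M)" for n
      unfolding char_def by (rule integral_distr) measurable
    ultimately show "(\<lambda>n. char (distr M borel (Tstat n)) t) \<longlonglongrightarrow> char std_normal_distribution t"
      by (simp add: char_std_normal_distribution)
  qed
qed

end
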